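(* Consider the quantum Cayley graph of a free product of universal discrete quantum groups in which all directions have quantum dimension different from $2$. Then there exists a unique path cocycle $c_g:\mathcal{S}\to\mathcal{K}'_g$.
   Context: Free products of universal discrete quantum groups. For $Q\in GL_n(\mathbb{C})$, $\mathcal{A}_u(Q)$ is the unital $*$-algebra generated by $n^2$ elements $u_{ij}$ subject to the relations making $u=(u_{ij})$ and $Q(u_{ij}^* )_{ij}Q^{-1}$ unitary; if $Q\bar Q\in\mathbb{C}I_n$, $\mathcal{A}_o(Q)$ is the quotient of $\mathcal{A}_u(Q)$ by the relations $u=Q(u_{ij}^* )_{ij}Q^{-1}$. Both have the coproduct $\delta(u_{ij})=\sum_k u_{ik}\otimes u_{kj}$. Let $\mathcal{S}$ be a free product of finitely many Hopf $*$-algebras of the form $\mathcal{A}_o(Q)$ or $\mathcal{A}_u(Q)$ (at least one factor, the coproduct extending those of the factors). The set of directions $\mathcal{D}$ is the set of fundamental corepresentations of the factors: one self-dual direction $\gamma=\bar\gamma=u$ for each factor $\mathcal{A}_o(Q)$ and two directions $\gamma=u,\bar\gamma=\bar u$ for each factor $\mathcal{A}_u(Q)$. The quantum dimension of $\gamma$ is $m_\gamma=\mathrm{Tr}(F_\gamma)$, where $F_\gamma\in L(H_\gamma)$ is the unique positive invertible operator with $(\mathrm{id}\otimes\kappa^2)(\gamma)=(F_\gamma\otimes1)\gamma(F_\gamma^{-1}\otimes1)$ and $\mathrm{Tr}(F_\gamma)=\mathrm{Tr}(F_\gamma^{-1})$ ($\gamma\in L(H_\gamma)\otimes\mathcal{S}$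 being taken unitary). General notation. $\mathcal{S}$ has coproduct $\delta$, counit $\epsilon$, antipode $\kappa$, Haar state $h$. Let $\Lambda_h:\mathcal{S}\to H$ be the GNS map of $h$, $\lambda:\mathcal{S}\to B(H)$ the GNS representation (left multiplication), $\mathcal{H}=\Lambda_h(\mathcal{S})$. Let $V\in B(H\otimes H)$ be the unitary $V(\Lambda_h\otimes\Lambda_h)(x\otimes y)=(\Lambda_h\otimes\Lambda_h)(\delta(x)(1\otimes y))$, $\Sigma$ the flip of $H\otimes H$, and $U=J\hat J\in B(H)$ the unitary of the associated Kac system $(H,V,U)$: $J$ is the modular conjugation of $h$ and $\hat J\Lambda_h(x)=\Lambda_h(R(x)^* )$ with $R$ the unitary antipode. For an irreducible finite-dimensional corepresentation $\alpha$, $p_\alpha\in B(H)$ is the orthogonal projection onto the image by $\Lambda_h$ of the span of the coefficients of $\alpha$. Quantum Cayley graph. Put $p_1=\sum_{\gamma\in\mathcal{D}}p_\gamma$, $K=H\otimes p_1H$, on which $\mathcal{S}$ acts by $\lambda\otimes\mathrm{id}$; $\Theta=\Sigma(1\otimes U)V(U\otimes U)\Sigma\in B(K)$ (reversing operator); $E_2:K\to H$ the bounded operator with $E_2(\Lambda_h(x)\otimes\Lambda_h(y))=\Lambda_h(xy)$ (target operator); $K_g=\ker(\Theta+\mathrm{id})$, $p_g\in B(K)$ the orthogonal projection onto $K_g$, $\mathcal{K}=\mathcal{H}\otimes p_1H$ and $\mathcal{K}'_g=p_g(\mathcal{K})$. A path cocycle is a linear map $c_g:\mathcal{S}\to K$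 with $c_g(xy)=x\cdot c_g(y)+c_g(x)\epsilon(y)$ for all $x,y\in\mathcal{S}$, $c_g(\mathcal{S})\subset\mathcal{K}'_g$, and $E_2(c_g(x))=\Lambda_h(x)-\epsilon(x)\Lambda_h(1)$ for all $x\in\mathcal{S}$. *)

theory Defs
  imports
    "HOL-Analysis.Analysis"
    "HOL-Library.Poly_Mapping"
    "HOL-Algebra.QuotRing"
    "HOL-Algebra.Module"
    "Jordan_Normal_Form.Gauss_Jordan_Elimination"
begin

section \<open>Complex Hilbert spaces\<close>

text \<open>Topology, norm and completeness are those of the underlying real Hilbert space.
  The complex inner product is conjugate-linear in the first variable.\<close>

class complex_hilbert_space = real_inner + complete_space +
  fixes scaleC :: "complex \<Rightarrow> 'a \<Rightarrow> 'a" (infixr "*\<^sub>C" 75)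
    and cinner :: "'a \<Rightarrow> 'a \<Rightarrow> complex"
  assumes scaleC_add_right: "a *\<^sub>C (x + y) = a *\<^sub>C x + a *\<^sub>C y"
    and scaleC_add_left: "(a + b) *\<^sub>C x = a *\<^sub>C x + b *\<^sub>C x"
    and scaleC_scaleC: "a *\<^sub>C (b *\<^sub>C x) = (a * b) *\<^sub>C x"
    and scaleC_of_real: "of_real r *\<^sub>C x = r *\<^sub>R x"
    and cinner_commute: "cinner x y = cnj (cinner y x)"
    and cinner_add_right: "cinner x (y + z) = cinner x y + cinner x z"
    and cinner_scaleC_right: "cinner x (a *\<^sub>C y) = a * cinner x y"
    and Re_cinner: "Re (cinner x y) = inner x y"

definition cspan :: "'h::complex_hilbert_space set \<Rightarrow> 'h set" where
  "cspan A = span {c *\<^sub>C x |c x. x \<in> A}"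

definition bounded_clinear ::
    "('h::complex_hilbert_space \<Rightarrow> 'g::complex_hilbert_space) \<Rightarrow> bool" where
  "bounded_clinear T \<longleftrightarrow> bounded_linear T \<and> (\<forall>c x. T (c *\<^sub>C x) = c *\<^sub>C T x)"

definition bounded_antilinear ::
    "('h::complex_hilbert_space \<Rightarrow> 'g::complex_hilbert_space) \<Rightarrow> bool" where
  "bounded_antilinear T \<longleftrightarrow> bounded_linear T \<and> (\<forall>c x. T (c *\<^sub>C x) = cnj c *\<^sub>C T x)"

definition unitary_op :: "('h::complex_hilbert_space \<Rightarrow> 'h) \<Rightarrow> bool" where
  "unitary_op T \<longleftrightarrow> bounded_clinear T \<and> surj T \<and> (\<forall>x y. cinner (T x) (T y) = cinner x y)"

definition antiunitary_op :: "('h::complex_hilbert_space \<Rightarrow> 'h) \<Rightarrow> bool" where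
  "antiunitary_op T \<longleftrightarrow>
     bounded_antilinear T \<and> surj T \<and> (\<forall>x y. cinner (T x) (T y) = cinner y x)"

text \<open>Meaningful for a closed complex subspace \<open>M\<close>.\<close>

definition orth_proj :: "'h::complex_hilbert_space set \<Rightarrow> 'h \<Rightarrow> 'h" where
  "orth_proj M x = (THE y. y \<in> M \<and> (\<forall>z\<in>M. cinner z (x - y) = 0))"

text \<open>A possibly unbounded operator is a pair of its domain and a function, of which only
  the values on the domain matter. The fourth condition says that the graph of the adjoint
  is the graph of the operator.\<close>

definition pos_selfadjoint ::
    "'h::complex_hilbert_space set \<Rightarrow> ('h \<Rightarrow> 'h) \<Rightarrow> bool" where
  "pos_selfadjoint M D \<longleftrightarrow>
     cspan M = M \<and> closure M = UNIV \<and>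
     (\<forall>x\<in>M. \<forall>y\<in>M. \<forall>c. D (x + c *\<^sub>C y) = D x + c *\<^sub>C D y) \<and>
     {(y, z). \<forall>x\<in>M. cinner y (D x) = cinner z x} = {(x, D x) |x. x \<in> M} \<and>
     (\<forall>x\<in>M. cinner x (D x) \<in> \<real>\<^sub>\<ge>\<^sub>0)"

text \<open>\<open>hilbert_tensor t\<close>: the target space of \<open>t\<close>, with elementary tensors \<open>t x y\<close>,
  is a Hilbert space tensor product of \<open>'h\<close> with itself.\<close>

definition hilbert_tensor ::
    "('h::complex_hilbert_space \<Rightarrow> 'h \<Rightarrow> 't::complex_hilbert_space) \<Rightarrow> bool" where
  "hilbert_tensor t \<longleftrightarrow>
     (\<forall>x y z c. t (x + c *\<^sub>C y) z = t x z + c *\<^sub>C t y z \<and>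
                t z (x + c *\<^sub>C y) = t z x + c *\<^sub>C t z y) \<and>
     (\<forall>x y x' y'. cinner (t x y) (t x' y') = cinner x x' * cinner y y') \<and>
     closure (cspan {t x y |x y. True}) = UNIV"

definition tensor_op ::
    "('h::complex_hilbert_space \<Rightarrow> 'h \<Rightarrow> 't::complex_hilbert_space)
      \<Rightarrow> ('h \<Rightarrow> 'h) \<Rightarrow> ('h \<Rightarrow> 'h) \<Rightarrow> 't \<Rightarrow> 't" where
  "tensor_op t A B =
     (THE T. bounded_clinear T \<and> (\<forall>x y. T (t x y) = t (A x) (B y)))"

definition flip_op ::
    "('h::complex_hilbert_space \<Rightarrow> 'h \<Rightarrow> 't::complex_hilbert_space) \<Rightarrow> 't \<Rightarrow> 't" where
  "flip_op t = (THE T. bounded_clinear T \<and> (\<forall>x y. T (t x y) = t y x))"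


section \<open>Unital star-algebras by generators and relations\<close>

text \<open>With concatenation on lists, \<open>'w list \<Rightarrow>\<^sub>0 complex\<close> carries the product of the free
  unital algebra on \<open>'w\<close>. In the free star-algebra the letter \<open>(x, False)\<close> is the
  generator \<open>x\<close> and \<open>(x, True)\<close> its adjoint.\<close>

instantiation list :: (type) monoid_add
begin
definition zero_list :: "'a list" where "zero_list = []"
definition plus_list :: "'a list \<Rightarrow> 'a list \<Rightarrow> 'a list" where "plus_list = append"
instance by standard (simp_all add: zero_list_def plus_list_def)
end

type_synonym 'x free_star = "('x \<times> bool) list \<Rightarrow>\<^sub>0 complex"

definition fgen :: "'x \<Rightarrow> 'x free_star" where
  "fgen x = Poly_Mapping.single [(x, False)] 1"

definition fconst :: "complex \<Rightarrow> 'x free_star" where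
  "fconst c = Poly_Mapping.single [] c"

definition fstar :: "'x free_star \<Rightarrow> 'x free_star" where
  "fstar p = (\<Sum>w\<in>Poly_Mapping.keys p.
     Poly_Mapping.single (rev (map (\<lambda>(x, b). (x, \<not> b)) w)) (cnj (Poly_Mapping.lookup p w)))"

record 'a star_algebra = "(complex, 'a) module" +
  star :: "'a \<Rightarrow> 'a"

definition free_ring :: "'x set \<Rightarrow> 'x free_star ring" where
  "free_ring X =
     \<lparr>carrier = {p. \<forall>w\<in>Poly_Mapping.keys p. fst ` set w \<subseteq> X},
      monoid.mult = (*), one = 1, zero = 0, add = (+)\<rparr>"

text \<open>The relations are \<open>r = 0\<close> for \<open>r \<in> R\<close>.\<close>

definition rel_ideal :: "'x set \<Rightarrow> 'x free_star set \<Rightarrow> 'x free_star set" where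
  "rel_ideal X R = Idl\<^bsub>free_ring X\<^esub> (R \<union> fstar ` R)"

definition presented_class ::
    "'x set \<Rightarrow> 'x free_star set \<Rightarrow> 'x free_star \<Rightarrow> 'x free_star set" where
  "presented_class X R p = rel_ideal X R +>\<^bsub>free_ring X\<^esub> p"

definition presented ::
    "'x set \<Rightarrow> 'x free_star set \<Rightarrow> 'x free_star set star_algebra" where
  "presented X R = (let P = free_ring X Quot rel_ideal X R in
     \<lparr>carrier = carrier P, monoid.mult = monoid.mult P, one = one P, zero = zero P, add = add P,
      smult = (\<lambda>c a. presented_class X R (fconst c) \<otimes>\<^bsub>P\<^esub> a),
      star = (\<lambda>a. fstar ` a)\<rparr>)"

definition star_hom :: "'a star_algebra \<Rightarrow> 'b star_algebra \<Rightarrow> ('a \<Rightarrow> 'b) set" where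
  "star_hom A B = {f \<in> Ring.ring_hom A B. \<forall>a\<in>carrier A.
     f (star A a) = star B (f a) \<and> (\<forall>c. f (c \<odot>\<^bsub>A\<^esub> a) = c \<odot>\<^bsub>B\<^esub> f a)}"

definition linear_endo :: "'a star_algebra \<Rightarrow> ('a \<Rightarrow> 'a) \<Rightarrow> bool" where
  "linear_endo A f \<longleftrightarrow> f \<in> carrier A \<rightarrow> carrier A \<and>
     (\<forall>a\<in>carrier A. \<forall>b\<in>carrier A. f (a \<oplus>\<^bsub>A\<^esub> b) = f a \<oplus>\<^bsub>A\<^esub> f b) \<and>
     (\<forall>a\<in>carrier A. \<forall>c. f (c \<odot>\<^bsub>A\<^esub> a) = c \<odot>\<^bsub>A\<^esub> f a)"

definition linear_form :: "'a star_algebra \<Rightarrow> ('a \<Rightarrow> complex) \<Rightarrow> bool" where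
  "linear_form A f \<longleftrightarrow>
     (\<forall>a\<in>carrier A. \<forall>b\<in>carrier A. f (a \<oplus>\<^bsub>A\<^esub> b) = f a + f b) \<and>
     (\<forall>a\<in>carrier A. \<forall>c. f (c \<odot>\<^bsub>A\<^esub> a) = c * f a)"

definition linear_to_hilbert ::
    "'a star_algebra \<Rightarrow> ('a \<Rightarrow> 'h::complex_hilbert_space) \<Rightarrow> bool" where
  "linear_to_hilbert A f \<longleftrightarrow>
     (\<forall>a\<in>carrier A. \<forall>b\<in>carrier A. f (a \<oplus>\<^bsub>A\<^esub> b) = f a + f b) \<and>
     (\<forall>a\<in>carrier A. \<forall>c. f (c \<odot>\<^bsub>A\<^esub> a) = c *\<^sub>C f a)"

text \<open>Free product of unital star-algebras, i.e. their coproduct: one generator \<open>(p, a)\<close> for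
  each element \<open>a\<close> of the \<open>p\<close>-th algebra, with relations making every
  \<open>a \<mapsto> (p, a)\<close> a unital star-homomorphism.\<close>

definition free_product_gens :: "'a star_algebra list \<Rightarrow> (nat \<times> 'a) set" where
  "free_product_gens As = (SIGMA p:{..<length As}. carrier (As ! p))"

definition free_product_rels :: "'a star_algebra list \<Rightarrow> (nat \<times> 'a) free_star set" where
  "free_product_rels As = (\<Union>p<length As. let A = As ! p; g = (\<lambda>a. fgen (p, a)) in
     {g (a \<oplus>\<^bsub>A\<^esub> b) - (g a + g b) |a b. a \<in> carrier A \<and> b \<in> carrier A} \<union>
     {g (c \<odot>\<^bsub>A\<^esub> a) - fconst c * g a |c a. a \<in> carrier A} \<union>
     {g (a \<otimes>\<^bsub>A\<^esub> b) - g a * g b |a b. a \<in> carrier A \<and> b \<in> carrier A} \<union>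
     {g \<one>\<^bsub>A\<^esub> - 1} \<union>
     {g (star A a) - fstar (g a) |a. a \<in> carrier A})"

definition free_product ::
    "'a star_algebra list \<Rightarrow> (nat \<times> 'a) free_star set star_algebra" where
  "free_product As = presented (free_product_gens As) (free_product_rels As)"

definition free_product_inj ::
    "'a star_algebra list \<Rightarrow> nat \<Rightarrow> 'a \<Rightarrow> (nat \<times> 'a) free_star set" where
  "free_product_inj As p a =
     presented_class (free_product_gens As) (free_product_rels As) (fgen (p, a))"

text \<open>Algebraic tensor square of a unital star-algebra, presented by its elementary tensors.
  By the multiplication rule the elementary tensors span, so this is the usual quotient of the
  free vector space on pairs by the bilinearity relations, with its usual star-algebra
  structure.\<close>

definition tensor_square_rels :: "'a star_algebra \<Rightarrow> ('a \<times> 'a) free_star set" where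
  "tensor_square_rels A = (let g = (\<lambda>a b. fgen (a, b)) in
     {g (a \<oplus>\<^bsub>A\<^esub> a') b - (g a b + g a' b) |a a' b.
        a \<in> carrier A \<and> a' \<in> carrier A \<and> b \<in> carrier A} \<union>
     {g a (b \<oplus>\<^bsub>A\<^esub> b') - (g a b + g a b') |a b b'.
        a \<in> carrier A \<and> b \<in> carrier A \<and> b' \<in> carrier A} \<union>
     {g (c \<odot>\<^bsub>A\<^esub> a) b - fconst c * g a b |c a b. a \<in> carrier A \<and> b \<in> carrier A} \<union>
     {g a (c \<odot>\<^bsub>A\<^esub> b) - fconst c * g a b |c a b. a \<in> carrier A \<and> b \<in> carrier A} \<union>
     {g (a \<otimes>\<^bsub>A\<^esub> a') (b \<otimes>\<^bsub>A\<^esub> b') - g a b * g a' b' |a a' b b'.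
        a \<in> carrier A \<and> a' \<in> carrier A \<and> b \<in> carrier A \<and> b' \<in> carrier A} \<union>
     {g \<one>\<^bsub>A\<^esub> \<one>\<^bsub>A\<^esub> - 1} \<union>
     {g (star A a) (star A b) - fstar (g a b) |a b. a \<in> carrier A \<and> b \<in> carrier A})"

definition tensor_square ::
    "'a star_algebra \<Rightarrow> ('a \<times> 'a) free_star set star_algebra" where
  "tensor_square A = presented (carrier A \<times> carrier A) (tensor_square_rels A)"

definition elem_tensor ::
    "'a star_algebra \<Rightarrow> 'a \<Rightarrow> 'a \<Rightarrow> ('a \<times> 'a) free_star set" where
  "elem_tensor A a b =
     presented_class (carrier A \<times> carrier A) (tensor_square_rels A) (fgen (a, b))"


section \<open>Universal quantum groups and their free products\<close>

definition inv_mat :: "complex mat \<Rightarrow> complex mat" where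
  "inv_mat Q = the (mat_inverse Q)"

definition unitarity_rels :: "nat \<Rightarrow> (nat \<Rightarrow> nat \<Rightarrow> 'x free_star) \<Rightarrow> 'x free_star set" where
  "unitarity_rels n v =
     {(\<Sum>k<n. v i k * fstar (v j k)) - (if i = j then 1 else 0) |i j. i < n \<and> j < n} \<union>
     {(\<Sum>k<n. fstar (v k i) * v k j) - (if i = j then 1 else 0) |i j. i < n \<and> j < n}"

definition free_conj :: "complex mat \<Rightarrow> nat \<Rightarrow> nat \<Rightarrow> (nat \<times> nat) free_star" where
  "free_conj Q i j = (\<Sum>k<dim_row Q. \<Sum>l<dim_row Q.
     fconst (Q $$ (i, k) * inv_mat Q $$ (l, j)) * fstar (fgen (k, l)))"

definition Au_rels :: "complex mat \<Rightarrow> (nat \<times> nat) free_star set" where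
  "Au_rels Q = unitarity_rels (dim_row Q) (\<lambda>i j. fgen (i, j)) \<union>
               unitarity_rels (dim_row Q) (free_conj Q)"

definition Ao_rels :: "complex mat \<Rightarrow> (nat \<times> nat) free_star set" where
  "Ao_rels Q = Au_rels Q \<union>
     {fgen (i, j) - free_conj Q i j |i j. i < dim_row Q \<and> j < dim_row Q}"

datatype factor = Ao "complex mat" | Au "complex mat"

primrec fmat :: "factor \<Rightarrow> complex mat" where
  "fmat (Ao Q) = Q"
| "fmat (Au Q) = Q"

primrec factor_rels :: "factor \<Rightarrow> (nat \<times> nat) free_star set" where
  "factor_rels (Ao Q) = Ao_rels Q"
| "factor_rels (Au Q) = Au_rels Q"

abbreviation fdim :: "factor \<Rightarrow> nat" where
  "fdim F \<equiv> dim_row (fmat F)"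

primrec valid_factor :: "factor \<Rightarrow> bool" where
  "valid_factor (Au Q) \<longleftrightarrow> 0 < dim_row Q \<and> invertible_mat Q"
| "valid_factor (Ao Q) \<longleftrightarrow> 0 < dim_row Q \<and> invertible_mat Q \<and>
     (\<exists>c. Q * map_mat cnj Q = c \<cdot>\<^sub>m 1\<^sub>m (dim_row Q))"

definition factor_gens :: "factor \<Rightarrow> (nat \<times> nat) set" where
  "factor_gens F = {..<fdim F} \<times> {..<fdim F}"

definition factor_alg :: "factor \<Rightarrow> (nat \<times> nat) free_star set star_algebra" where
  "factor_alg F = presented (factor_gens F) (factor_rels F)"

type_synonym fp_elem = "(nat \<times> (nat \<times> nat) free_star set) free_star set"

definition fp_alg :: "factor list \<Rightarrow> fp_elem star_algebra" where
  "fp_alg Fs = free_product (map factor_alg Fs)"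

text \<open>Image in the free product of the generator \<open>u\<^sub>i\<^sub>j\<close> of the \<open>p\<close>-th factor.\<close>

definition fund :: "factor list \<Rightarrow> nat \<Rightarrow> nat \<Rightarrow> nat \<Rightarrow> fp_elem" where
  "fund Fs p i j = free_product_inj (map factor_alg Fs) p
     (presented_class (factor_gens (Fs ! p)) (factor_rels (Fs ! p)) (fgen (i, j)))"

text \<open>Entries of the unitary matrix \<open>Q u\<^sup>* Q\<^sup>-\<^sup>1\<close> (entrywise adjoint), the unitary form of the
  conjugate of \<open>u\<close>.\<close>

definition fund_conj :: "factor list \<Rightarrow> nat \<Rightarrow> nat \<Rightarrow> nat \<Rightarrow> fp_elem" where
  "fund_conj Fs p i j = (let Q = fmat (Fs ! p); S = fp_alg Fs in
     \<Oplus>\<^bsub>S\<^esub>k\<in>{..<dim_row Q}. \<Oplus>\<^bsub>S\<^esub>l\<in>{..<dim_row Q}.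
       (Q $$ (i, k) * inv_mat Q $$ (l, j)) \<odot>\<^bsub>S\<^esub> star S (fund Fs p k l))"

text \<open>The direction \<open>(p, False)\<close> is \<open>u\<close> of the \<open>p\<close>-th factor and \<open>(p, True)\<close>, present only
  for factors of type \<open>Au\<close>, is its conjugate.\<close>

type_synonym direction = "nat \<times> bool"

definition directions :: "factor list \<Rightarrow> direction set" where
  "directions Fs = {(p, b). p < length Fs \<and> (b \<longrightarrow> (\<exists>Q. Fs ! p = Au Q))}"

definition dir_dim :: "factor list \<Rightarrow> direction \<Rightarrow> nat" where
  "dir_dim Fs \<gamma> = fdim (Fs ! fst \<gamma>)"

definition dir_corep :: "factor list \<Rightarrow> direction \<Rightarrow> nat \<Rightarrow> nat \<Rightarrow> fp_elem" where
  "dir_corep Fs \<gamma> = (if snd \<gamma> then fund_conj Fs (fst \<gamma>) else fund Fs (fst \<gamma>))"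


section \<open>Hopf structure, Haar state and quantum dimensions\<close>

type_synonym 'a comult = "'a \<Rightarrow> ('a \<times> 'a) free_star set"

text \<open>A unital star-homomorphism with the prescribed values on the generators of the factors;
  this says that it extends the coproducts of the factors.\<close>

definition fp_coproduct :: "factor list \<Rightarrow> fp_elem comult \<Rightarrow> bool" where
  "fp_coproduct Fs \<delta> \<longleftrightarrow> (let S = fp_alg Fs; SS = tensor_square S in
     \<delta> \<in> star_hom S SS \<and>
     (\<forall>p<length Fs. \<forall>i<fdim (Fs ! p). \<forall>j<fdim (Fs ! p).
        \<delta> (fund Fs p i j) =
          (\<Oplus>\<^bsub>SS\<^esub>k\<in>{..<fdim (Fs ! p)}. elem_tensor S (fund Fs p i k) (fund Fs p k j))))"

definition pair_sum :: "'b star_algebra \<Rightarrow> ('a \<Rightarrow> 'a \<Rightarrow> 'b) \<Rightarrow> ('a \<times> 'a) list \<Rightarrow> 'b" where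
  "pair_sum B f ps = foldr (\<lambda>(a, b) s. f a b \<oplus>\<^bsub>B\<^esub> s) ps \<zero>\<^bsub>B\<^esub>"

text \<open>\<open>sweedler S \<delta> x ps\<close>: \<open>\<delta> x\<close> is the sum of the elementary tensors of the pairs in \<open>ps\<close>.
  Identities in Sweedler notation are required for every such decomposition.\<close>

definition sweedler ::
    "'a star_algebra \<Rightarrow> 'a comult \<Rightarrow> 'a \<Rightarrow> ('a \<times> 'a) list \<Rightarrow> bool" where
  "sweedler S \<delta> x ps \<longleftrightarrow> x \<in> carrier S \<and> set ps \<subseteq> carrier S \<times> carrier S \<and>
     \<delta> x = pair_sum (tensor_square S) (elem_tensor S) ps"

definition counit :: "'a star_algebra \<Rightarrow> 'a comult \<Rightarrow> ('a \<Rightarrow> complex) \<Rightarrow> bool" where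
  "counit S \<delta> \<epsilon> \<longleftrightarrow> linear_form S \<epsilon> \<and>
     (\<forall>x ps. sweedler S \<delta> x ps \<longrightarrow>
        pair_sum S (\<lambda>a b. \<epsilon> a \<odot>\<^bsub>S\<^esub> b) ps = x \<and> pair_sum S (\<lambda>a b. \<epsilon> b \<odot>\<^bsub>S\<^esub> a) ps = x)"

definition antipode ::
    "'a star_algebra \<Rightarrow> 'a comult \<Rightarrow> ('a \<Rightarrow> complex) \<Rightarrow> ('a \<Rightarrow> 'a) \<Rightarrow> bool" where
  "antipode S \<delta> \<epsilon> \<kappa> \<longleftrightarrow> linear_endo S \<kappa> \<and>
     (\<forall>x ps. sweedler S \<delta> x ps \<longrightarrow>
        pair_sum S (\<lambda>a b. \<kappa> a \<otimes>\<^bsub>S\<^esub> b) ps = \<epsilon> x \<odot>\<^bsub>S\<^esub> \<one>\<^bsub>S\<^esub> \<and>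
        pair_sum S (\<lambda>a b. a \<otimes>\<^bsub>S\<^esub> \<kappa> b) ps = \<epsilon> x \<odot>\<^bsub>S\<^esub> \<one>\<^bsub>S\<^esub>)"

definition haar_state :: "'a star_algebra \<Rightarrow> 'a comult \<Rightarrow> ('a \<Rightarrow> complex) \<Rightarrow> bool" where
  "haar_state S \<delta> h \<longleftrightarrow> linear_form S h \<and> h \<one>\<^bsub>S\<^esub> = 1 \<and>
     (\<forall>x\<in>carrier S. h (star S x \<otimes>\<^bsub>S\<^esub> x) \<in> \<real>\<^sub>\<ge>\<^sub>0) \<and>
     (\<forall>x ps. sweedler S \<delta> x ps \<longrightarrow>
        pair_sum S (\<lambda>a b. h a \<odot>\<^bsub>S\<^esub> b) ps = h x \<odot>\<^bsub>S\<^esub> \<one>\<^bsub>S\<^esub> \<and>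
        pair_sum S (\<lambda>a b. h b \<odot>\<^bsub>S\<^esub> a) ps = h x \<odot>\<^bsub>S\<^esub> \<one>\<^bsub>S\<^esub>)"

text \<open>Polar decomposition \<open>\<kappa> = R \<circ> \<tau>\<close> of the antipode: \<open>R\<close> is an involutive
  star-anti-automorphism and \<open>\<tau>\<close> (the value at \<open>-i/2\<close> of the analytically extended scaling
  group) an algebra homomorphism that commutes with \<open>R\<close> and is positive for the inner product
  of \<open>h\<close>. Then \<open>\<tau> \<circ> \<tau> = \<kappa> \<circ> \<kappa>\<close>, and positivity makes \<open>\<tau>\<close>, hence \<open>R\<close>, unique.\<close>

definition unitary_antipode ::
    "'a star_algebra \<Rightarrow> ('a \<Rightarrow> 'a) \<Rightarrow> ('a \<Rightarrow> complex) \<Rightarrow> ('a \<Rightarrow> 'a) \<Rightarrow> bool" where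
  "unitary_antipode S \<kappa> h R \<longleftrightarrow> linear_endo S R \<and>
     (\<forall>x\<in>carrier S. \<forall>y\<in>carrier S. R (x \<otimes>\<^bsub>S\<^esub> y) = R y \<otimes>\<^bsub>S\<^esub> R x) \<and>
     (\<forall>x\<in>carrier S. R (star S x) = star S (R x) \<and> R (R x) = x) \<and>
     (\<exists>\<tau>. linear_endo S \<tau> \<and> \<tau> \<in> Ring.ring_hom S S \<and>
        (\<forall>x\<in>carrier S. \<kappa> x = R (\<tau> x) \<and> R (\<tau> x) = \<tau> (R x) \<and>
           h (star S x \<otimes>\<^bsub>S\<^esub> \<tau> x) \<in> \<real>\<^sub>\<ge>\<^sub>0))"

definition mat_trace :: "complex mat \<Rightarrow> complex" where
  "mat_trace A = (\<Sum>i<dim_row A. A $$ (i, i))"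

definition pos_mat :: "nat \<Rightarrow> complex mat \<Rightarrow> bool" where
  "pos_mat n A \<longleftrightarrow> A \<in> carrier_mat n n \<and>
     (\<forall>v :: nat \<Rightarrow> complex. (\<Sum>i<n. \<Sum>j<n. cnj (v i) * A $$ (i, j) * v j) \<in> \<real>\<^sub>\<ge>\<^sub>0)"

definition F_matrix :: "factor list \<Rightarrow> (fp_elem \<Rightarrow> fp_elem) \<Rightarrow> direction \<Rightarrow> complex mat" where
  "F_matrix Fs \<kappa> \<gamma> = (let n = dir_dim Fs \<gamma>; v = dir_corep Fs \<gamma>; S = fp_alg Fs in
     THE F. pos_mat n F \<and> invertible_mat F \<and>
       (\<forall>i<n. \<forall>j<n. \<kappa> (\<kappa> (v i j)) =
          (\<Oplus>\<^bsub>S\<^esub>k\<in>{..<n}. \<Oplus>\<^bsub>S\<^esub>l\<in>{..<n}. (F $$ (i, k) * inv_mat F $$ (l, j)) \<odot>\<^bsub>S\<^esub> v k l)) \<and>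
       mat_trace F = mat_trace (inv_mat F))"

definition qdim :: "factor list \<Rightarrow> (fp_elem \<Rightarrow> fp_elem) \<Rightarrow> direction \<Rightarrow> complex" where
  "qdim Fs \<kappa> \<gamma> = mat_trace (F_matrix Fs \<kappa> \<gamma>)"


section \<open>GNS space and Kac system\<close>

definition gns_map ::
    "'a star_algebra \<Rightarrow> ('a \<Rightarrow> complex) \<Rightarrow> ('a \<Rightarrow> 'h::complex_hilbert_space) \<Rightarrow> bool" where
  "gns_map S h \<Lambda> \<longleftrightarrow> linear_to_hilbert S \<Lambda> \<and>
     (\<forall>x\<in>carrier S. \<forall>y\<in>carrier S. cinner (\<Lambda> x) (\<Lambda> y) = h (star S x \<otimes>\<^bsub>S\<^esub> y)) \<and>
     closure (\<Lambda> ` carrier S) = UNIV"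

definition gns_rep ::
    "'a star_algebra \<Rightarrow> ('a \<Rightarrow> 'h::complex_hilbert_space) \<Rightarrow> 'a \<Rightarrow> 'h \<Rightarrow> 'h" where
  "gns_rep S \<Lambda> x =
     (THE T. bounded_clinear T \<and> (\<forall>y\<in>carrier S. T (\<Lambda> y) = \<Lambda> (x \<otimes>\<^bsub>S\<^esub> y)))"

definition mult_unitary ::
    "'a star_algebra \<Rightarrow> 'a comult \<Rightarrow> ('a \<Rightarrow> 'h::complex_hilbert_space)
      \<Rightarrow> ('h \<Rightarrow> 'h \<Rightarrow> 't::complex_hilbert_space) \<Rightarrow> 't \<Rightarrow> 't" where
  "mult_unitary S \<delta> \<Lambda> t = (THE V. unitary_op V \<and>
     (\<forall>x ps. sweedler S \<delta> x ps \<longrightarrow> (\<forall>y\<in>carrier S.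
        V (t (\<Lambda> x) (\<Lambda> y)) = (\<Sum>(a, b)\<leftarrow>ps. t (\<Lambda> a) (\<Lambda> (b \<otimes>\<^bsub>S\<^esub> y))))))"

text \<open>Tomita-Takesaki: \<open>J\<close> is the antiunitary part of the polar decomposition \<open>J \<circ> D\<close>
  (\<open>D\<close> the square root of the modular operator) of the closure of
  \<open>\<Lambda> x \<mapsto> \<Lambda> (x\<^sup>*)\<close>; operators are compared through their graphs.\<close>

definition modular_conj ::
    "'a star_algebra \<Rightarrow> ('a \<Rightarrow> 'h::complex_hilbert_space) \<Rightarrow> 'h \<Rightarrow> 'h" where
  "modular_conj S \<Lambda> = (THE J. antiunitary_op J \<and>
     (\<exists>M D. pos_selfadjoint M D \<and>
        closure {(\<Lambda> x, \<Lambda> (star S x)) |x. x \<in> carrier S} = {(\<xi>, J (D \<xi>)) |\<xi>. \<xi> \<in> M}))"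

definition dual_conj ::
    "'a star_algebra \<Rightarrow> ('a \<Rightarrow> 'a) \<Rightarrow> ('a \<Rightarrow> 'h::complex_hilbert_space) \<Rightarrow> 'h \<Rightarrow> 'h" where
  "dual_conj S R \<Lambda> = (THE T. bounded_antilinear T \<and>
     (\<forall>x\<in>carrier S. T (\<Lambda> x) = \<Lambda> (star S (R x))))"

definition kac_U ::
    "'a star_algebra \<Rightarrow> ('a \<Rightarrow> 'a) \<Rightarrow> ('a \<Rightarrow> 'h::complex_hilbert_space) \<Rightarrow> 'h \<Rightarrow> 'h" where
  "kac_U S R \<Lambda> = modular_conj S \<Lambda> \<circ> dual_conj S R \<Lambda>"


section \<open>Quantum Cayley graph and path cocycles\<close>

definition dir_proj ::
    "factor list \<Rightarrow> (fp_elem \<Rightarrow> 'h::complex_hilbert_space) \<Rightarrow> direction \<Rightarrow> 'h \<Rightarrow> 'h" where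
  "dir_proj Fs \<Lambda> \<gamma> = orth_proj
     (cspan {\<Lambda> (dir_corep Fs \<gamma> i j) |i j. i < dir_dim Fs \<gamma> \<and> j < dir_dim Fs \<gamma>})"

definition p1_op ::
    "factor list \<Rightarrow> (fp_elem \<Rightarrow> 'h::complex_hilbert_space) \<Rightarrow> 'h \<Rightarrow> 'h" where
  "p1_op Fs \<Lambda> \<xi> = (\<Sum>\<gamma>\<in>directions Fs. dir_proj Fs \<Lambda> \<gamma> \<xi>)"

text \<open>The edge space \<open>K\<close>, a closed subspace of the tensor square. Operators on \<open>K\<close> are
  represented by operators on the whole tensor square.\<close>

definition edge_space ::
    "factor list \<Rightarrow> (fp_elem \<Rightarrow> 'h::complex_hilbert_space)
      \<Rightarrow> ('h \<Rightarrow> 'h \<Rightarrow> 't::complex_hilbert_space) \<Rightarrow> 't set" where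
  "edge_space Fs \<Lambda> t = closure (cspan {t \<xi> \<eta> |\<xi> \<eta>. \<eta> \<in> range (p1_op Fs \<Lambda>)})"

definition alg_edge_space ::
    "factor list \<Rightarrow> (fp_elem \<Rightarrow> 'h::complex_hilbert_space)
      \<Rightarrow> ('h \<Rightarrow> 'h \<Rightarrow> 't::complex_hilbert_space) \<Rightarrow> 't set" where
  "alg_edge_space Fs \<Lambda> t =
     cspan {t (\<Lambda> x) \<eta> |x \<eta>. x \<in> carrier (fp_alg Fs) \<and> \<eta> \<in> range (p1_op Fs \<Lambda>)}"

definition edge_action ::
    "factor list \<Rightarrow> (fp_elem \<Rightarrow> 'h::complex_hilbert_space)
      \<Rightarrow> ('h \<Rightarrow> 'h \<Rightarrow> 't::complex_hilbert_space) \<Rightarrow> fp_elem \<Rightarrow> 't \<Rightarrow> 't" where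
  "edge_action Fs \<Lambda> t x = tensor_op t (gns_rep (fp_alg Fs) \<Lambda> x) id"

definition reversing_op ::
    "factor list \<Rightarrow> fp_elem comult \<Rightarrow> (fp_elem \<Rightarrow> fp_elem)
      \<Rightarrow> (fp_elem \<Rightarrow> 'h::complex_hilbert_space)
      \<Rightarrow> ('h \<Rightarrow> 'h \<Rightarrow> 't::complex_hilbert_space) \<Rightarrow> 't \<Rightarrow> 't" where
  "reversing_op Fs \<delta> R \<Lambda> t = (let S = fp_alg Fs; U = kac_U S R \<Lambda> in
     flip_op t \<circ> tensor_op t id U \<circ> mult_unitary S \<delta> \<Lambda> t \<circ> tensor_op t U U \<circ> flip_op t)"

definition target_op ::
    "factor list \<Rightarrow> (fp_elem \<Rightarrow> 'h::complex_hilbert_space)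
      \<Rightarrow> ('h \<Rightarrow> 'h \<Rightarrow> 't::complex_hilbert_space) \<Rightarrow> 't \<Rightarrow> 'h" where
  "target_op Fs \<Lambda> t = (let S = fp_alg Fs in
     THE E. bounded_clinear E \<and>
       (\<forall>x\<in>carrier S. \<forall>y\<in>carrier S. \<Lambda> y \<in> range (p1_op Fs \<Lambda>) \<longrightarrow>
          E (t (\<Lambda> x) (\<Lambda> y)) = \<Lambda> (x \<otimes>\<^bsub>S\<^esub> y)) \<and>
       (\<forall>\<zeta>. (\<forall>\<xi>\<in>edge_space Fs \<Lambda> t. cinner \<xi> \<zeta> = 0) \<longrightarrow> E \<zeta> = 0))"

definition geom_edge_space ::
    "factor list \<Rightarrow> fp_elem comult \<Rightarrow> (fp_elem \<Rightarrow> fp_elem)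
      \<Rightarrow> (fp_elem \<Rightarrow> 'h::complex_hilbert_space)
      \<Rightarrow> ('h \<Rightarrow> 'h \<Rightarrow> 't::complex_hilbert_space) \<Rightarrow> 't set" where
  "geom_edge_space Fs \<delta> R \<Lambda> t =
     {\<zeta> \<in> edge_space Fs \<Lambda> t. reversing_op Fs \<delta> R \<Lambda> t \<zeta> + \<zeta> = 0}"

definition geom_edge_core ::
    "factor list \<Rightarrow> fp_elem comult \<Rightarrow> (fp_elem \<Rightarrow> fp_elem)
      \<Rightarrow> (fp_elem \<Rightarrow> 'h::complex_hilbert_space)
      \<Rightarrow> ('h \<Rightarrow> 'h \<Rightarrow> 't::complex_hilbert_space) \<Rightarrow> 't set" where
  "geom_edge_core Fs \<delta> R \<Lambda> t =
     orth_proj (geom_edge_space Fs \<delta> R \<Lambda> t) ` alg_edge_space Fs \<Lambda> t"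

text \<open>The cocycle is an extensional function on the carrier of the algebra, so that
  uniqueness means equality on the algebra.\<close>

definition path_cocycle ::
    "factor list \<Rightarrow> fp_elem comult \<Rightarrow> (fp_elem \<Rightarrow> complex) \<Rightarrow> (fp_elem \<Rightarrow> fp_elem)
      \<Rightarrow> (fp_elem \<Rightarrow> 'h::complex_hilbert_space)
      \<Rightarrow> ('h \<Rightarrow> 'h \<Rightarrow> 't::complex_hilbert_space) \<Rightarrow> (fp_elem \<Rightarrow> 't) \<Rightarrow> bool" where
  "path_cocycle Fs \<delta> \<epsilon> R \<Lambda> t c \<longleftrightarrow> (let S = fp_alg Fs in
     c \<in> carrier S \<rightarrow>\<^sub>E geom_edge_core Fs \<delta> R \<Lambda> t \<and>
     linear_to_hilbert S c \<and>
     (\<forall>x\<in>carrier S. \<forall>y\<in>carrier S.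
        c (x \<otimes>\<^bsub>S\<^esub> y) = edge_action Fs \<Lambda> t x (c y) + \<epsilon> y *\<^sub>C c x) \<and>
     (\<forall>x\<in>carrier S. target_op Fs \<Lambda> t (c x) = \<Lambda> x - \<epsilon> x *\<^sub>C \<Lambda> \<one>\<^bsub>S\<^esub>))"

end

theory Submission
  imports Defs "HOL-Computational_Algebra.Fundamental_Theorem_Algebra"
begin

text \<open>
  The unitary \<open>U\<close> of the Kac system acts on the algebra as an antimultiplicative involution that
  maps \<open>\<gamma>\<^sub>i\<^sub>j\<close> into the span of the \<open>\<gamma>\<^sub>j\<^sub>k\<^sup>*\<close>. This yields
  \<open>\<Theta> (x \<otimes> \<gamma>\<^sub>i\<^sub>j) = \<Sum>\<^sub>l x \<gamma>\<^sub>i\<^sub>l \<otimes> \<gamma>\<^sub>j\<^sub>l\<^sup>*\<close>. With the source operator \<open>E\<^sub>1 = id \<otimes> \<epsilon>\<close> it follows that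
  \<open>E\<^sub>2 \<Theta> = E\<^sub>1\<close> and \<open>E\<^sub>1 \<Theta> = E\<^sub>2\<close>, hence \<open>2 E\<^sub>2 p\<^sub>g = E\<^sub>2 - E\<^sub>1\<close>, because \<open>E\<^sub>2 - E\<^sub>1\<close> vanishes on the range of
  \<open>1 + \<Theta>\<close> and \<open>p\<^sub>g\<close> is the projection onto its complement.

  Existence: the values \<open>c(\<gamma>\<^sub>i\<^sub>j) = 2 p\<^sub>g (1 \<otimes> \<gamma>\<^sub>i\<^sub>j)\<close> extend to a cocycle, since the defining relations,
  the unitarity of the directions, turn into \<open>p\<^sub>g (1 + \<Theta>) = 0\<close>.
  Uniqueness: if \<open>E\<^sub>2 p\<^sub>g\<close> annihilates \<open>\<Sum> x \<otimes> y\<close>, then \<open>\<Sum> x (y - \<epsilon>(y)) = 0\<close> in the algebra by faithfulness of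
  the Haar state, and applying the cocycle to this identity gives \<open>2 p\<^sub>g (\<Sum> x \<otimes> y) = 0\<close>; so \<open>E\<^sub>2\<close> is injective
  on geometric edges.

  The form of \<open>U\<close> rests on the modular automorphism \<open>\<sigma>\<close>, determined by \<open>h(a b) = h(b \<sigma>(a))\<close>. It commutes with
  the square of the antipode, and both are symmetric and locally finite, so the algebra is spanned by common
  eigenvectors. On these the polar decomposition defining the modular conjugation is explicit.
\<close>

section \<open>Free algebras\<close>

text \<open>The obstacle is \<Theta>: it involves \<open>U\<close>, the product of two conjugations
  given by polar decompositions, whereas the cocycle needs \<Theta> on matrix entries. On the
  algebra \<open>U\<close> is \<sigma>^(1/2) R, and the factorization \<kappa> = R \<tau> turns this
  into \<sigma>^(1/2) \<tau>^(-1) \<kappa>. Both \<sigma> and \<tau> mix the two indices of an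
  entry, but in \<tau>^2 \<sigma>^(-1) the action on one of them cancels. What remains acts on a
  single index, and so does its power -1/2, which is a polynomial in it on a finite spectrum. The
  resulting coefficients are never computed: \<open>U\<close> occurs three times in \<Theta>, and
  because it is an antimultiplicative involution they drop out. The automorphism \<sigma> is found
  by solving for it. A weighted sum of functionals b -> h(x b y), with x an entry and y the adjoint
  of one, is invariant and hence a multiple of h; unitarity then turns this into a formula for h(x
  b).\<close>

abbreviation sgl :: "'x list \<Rightarrow> complex \<Rightarrow> 'x list \<Rightarrow>\<^sub>0 complex" where
  "sgl \<equiv> Poly_Mapping.single"

lemma mult_sgl: "sgl w a * sgl v b = sgl (w @ v) (a * b)"
  by (simp add: mult_single plus_list_def)

lemma one_sgl: "(1 :: 'x list \<Rightarrow>\<^sub>0 complex) = sgl [] 1"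
  by (metis single_one zero_list_def)

lemma free_alg_induct [case_names zero single add]:
  fixes p :: "'x list \<Rightarrow>\<^sub>0 complex"
  assumes "P 0" and "\<And>w c. P (sgl w c)" and "\<And>p q. P p \<Longrightarrow> P q \<Longrightarrow> P (p + q)"
  shows "P p"
proof (induction p rule: update_induct)
  case const
  then show ?case by (rule assms(1))
next
  case (update f a b)
  have "Poly_Mapping.update a b f = f + sgl a b"
    using update(1) by (intro poly_mapping_eqI)
      (auto simp: lookup_update lookup_add lookup_single in_keys_iff when_def)
  then show ?case using assms update by simp
qed

text \<open>The representation of the free algebra in which the letter \<open>l\<close> acts as
  \<open>T l\<close>. Scalar multiplication is a parameter so that one evaluation covers linear and
  conjugate-linear substitutions, characters, and the triangular operators behind the
  cocycle.\<close>

definition ev_op :: "(complex \<Rightarrow> 'w \<Rightarrow> 'w) \<Rightarrow> ('x \<Rightarrow> 'w \<Rightarrow> 'w) \<Rightarrow> ('x list \<Rightarrow>\<^sub>0 complex)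
    \<Rightarrow> 'w::ab_group_add \<Rightarrow> 'w" where
  "ev_op sc T p \<xi> = (\<Sum>w\<in>Poly_Mapping.keys p. sc (Poly_Mapping.lookup p w) (foldr T w \<xi>))"

locale letter_ops = vector_space sc
  for sc :: "complex \<Rightarrow> 'w::ab_group_add \<Rightarrow> 'w" +
  fixes T :: "'x \<Rightarrow> 'w \<Rightarrow> 'w"
  assumes T_add: "T l (\<xi> + \<eta>) = T l \<xi> + T l \<eta>"
    and T_sc: "T l (sc c \<xi>) = sc c (T l \<xi>)"
begin

abbreviation "ev \<equiv> ev_op sc T"

lemma ev_add: "ev (p + q) \<xi> = ev p \<xi> + ev q \<xi>"
  unfolding ev_op_def
  by (rule setsum_keys_plus_distrib) (simp_all add: scale_left_distrib)

lemma ev_zero [simp]: "ev 0 \<xi> = 0"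
  by (simp add: ev_op_def)

lemma ev_single: "ev (sgl w c) \<xi> = sc c (foldr T w \<xi>)"
  by (simp add: ev_op_def)

lemma foldr_add: "foldr T w (\<xi> + \<eta>) = foldr T w \<xi> + foldr T w \<eta>"
  by (induction w) (simp_all add: T_add)

lemma foldr_sc: "foldr T w (sc c \<xi>) = sc c (foldr T w \<xi>)"
  by (induction w) (simp_all add: T_sc)

lemma foldr_zero: "foldr T w 0 = 0"
  using foldr_sc[of w 0 0] by simp

lemma ev_add_right: "ev p (\<xi> + \<eta>) = ev p \<xi> + ev p \<eta>"
  by (simp add: ev_op_def foldr_add scale_right_distrib sum.distrib)

lemma ev_sc: "ev p (sc c \<xi>) = sc c (ev p \<xi>)"
  by (simp add: ev_op_def foldr_sc scale_sum_right mult.commute)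

lemma ev_zero_right [simp]: "ev p 0 = 0"
  by (simp add: ev_op_def foldr_zero)

lemma ev_mult: "ev (p * q) \<xi> = ev p (ev q \<xi>)"
proof (induction p rule: free_alg_induct)
  case (single w c)
  show ?case
  proof (induction q rule: free_alg_induct)
    case (single v d)
    then show ?case by (simp add: mult_sgl ev_single foldr_sc)
  qed (simp_all add: distrib_left ev_add ev_add_right)
qed (simp_all add: distrib_right ev_add)

lemma ev_one: "ev 1 \<xi> = \<xi>"
  by (simp add: one_sgl ev_single)

lemma ev_fconst: "ev (sgl [] c) \<xi> = sc c \<xi>"
  by (simp add: ev_single)

lemma ev_minus: "ev (- p) \<xi> = - ev p \<xi>"
  by (metis add.left_inverse add_eq_0_iff2 ev_add ev_zero)

lemma ev_diff: "ev (p - q) \<xi> = ev p \<xi> - ev q \<xi>"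
  using ev_add[of p "- q" \<xi>] by (simp add: ev_minus)

lemma ev_sum: "ev (\<Sum>i\<in>I. f i) \<xi> = (\<Sum>i\<in>I. ev (f i) \<xi>)"
  by (induction I rule: infinite_finite_induct) (simp_all add: ev_add)

end

lemma fconst_add: "fconst (a + b) = fconst a + fconst b"
  by (simp add: fconst_def single_add)

lemma fconst_mult: "fconst (a * b) = fconst a * fconst b"
  by (simp add: fconst_def mult_sgl)

lemma fconst_0 [simp]: "fconst 0 = 0"
  by (simp add: fconst_def)

lemma fconst_1 [simp]: "fconst 1 = 1"
  by (simp add: fconst_def one_sgl)

lemma fconst_minus: "fconst (- a) = - fconst a"
  by (simp add: fconst_def single_uminus)

lemma fconst_sum: "fconst (\<Sum>i\<in>I. f i) = (\<Sum>i\<in>I. fconst (f i))"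
  by (induction I rule: infinite_finite_induct) (simp_all add: fconst_add)

lemma fconst_commute: "p * fconst c = fconst c * p"
  by (induction p rule: free_alg_induct)
     (simp_all add: fconst_def mult_sgl distrib_left distrib_right mult.commute)

lemma fconst_left_commute: "p * (fconst c * q) = fconst c * (p * q)"
  by (metis fconst_commute mult.assoc)

lemma fconst_sgl: "fconst a * sgl w c = sgl w (a * c)"
  by (simp add: fconst_def mult_sgl)

lemma fgen_fstar: "fstar (fgen x) = sgl [(x, True)] 1"
  by (simp add: fgen_def fstar_def)

lemma fstar_single: "fstar (sgl w c) = sgl (rev (map (\<lambda>(x, b). (x, \<not> b)) w)) (cnj c)"
  by (simp add: fstar_def)

lemma fstar_add: "fstar (p + q) = fstar p + fstar q"
  unfolding fstar_def
  by (rule setsum_keys_plus_distrib) (simp_all add: single_add)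

lemma fstar_zero [simp]: "fstar 0 = 0"
  by (simp add: fstar_def)

lemma fstar_mult: "fstar (p * q) = fstar q * fstar p"
proof (induction p rule: free_alg_induct)
  case (single w c)
  show ?case
    by (induction q rule: free_alg_induct)
       (simp_all add: mult_sgl fstar_single distrib_left distrib_right fstar_add mult.commute)
qed (simp_all add: distrib_left distrib_right fstar_add)

lemma fstar_fstar [simp]: "fstar (fstar p) = p"
proof (induction p rule: free_alg_induct)
  case (single w c)
  have "map ((\<lambda>(x, b). (x, \<not> b)) \<circ> (\<lambda>(x, b). (x, \<not> b))) w = w"
    by (rule map_idI) auto
  then show ?case by (simp add: fstar_single rev_map)
qed (simp_all add: fstar_add)

lemma fstar_fconst [simp]: "fstar (fconst c) = fconst (cnj c)"
  by (simp add: fconst_def fstar_single)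

lemma fstar_one [simp]: "fstar 1 = 1"
  by (simp add: one_sgl fstar_single)

lemma fstar_minus: "fstar (- p) = - fstar p"
  by (metis add.left_inverse add_eq_0_iff2 fstar_add fstar_zero)

lemma fstar_diff: "fstar (p - q) = fstar p - fstar q"
  using fstar_add[of p "- q"] by (simp add: fstar_minus)

lemma fstar_sum: "fstar (\<Sum>i\<in>I. f i) = (\<Sum>i\<in>I. fstar (f i))"
  by (induction I rule: infinite_finite_induct) (simp_all add: fstar_add)

lemma free_ring_carrier: "carrier (free_ring X) = {p. \<forall>w\<in>Poly_Mapping.keys p. fst ` set w \<subseteq> X}"
  and free_ring_ops [simp]: "(\<otimes>\<^bsub>free_ring X\<^esub>) = (*)" "\<one>\<^bsub>free_ring X\<^esub> = 1" "\<zero>\<^bsub>free_ring X\<^esub> = 0"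
     "(\<oplus>\<^bsub>free_ring X\<^esub>) = (+)"
  by (simp_all add: free_ring_def)

lemma free_carrier_add: "p \<in> carrier (free_ring X) \<Longrightarrow> q \<in> carrier (free_ring X) \<Longrightarrow>
    p + q \<in> carrier (free_ring X)"
  using keys_add[of p q] by (auto simp: free_ring_carrier)

lemma free_carrier_mult: "p \<in> carrier (free_ring X) \<Longrightarrow> q \<in> carrier (free_ring X) \<Longrightarrow>
    p * q \<in> carrier (free_ring X)"
  using keys_mult[of p q] by (fastforce simp: free_ring_carrier plus_list_def)

lemma free_carrier_single: "sgl w c \<in> carrier (free_ring X) \<longleftrightarrow> c = 0 \<or> fst ` set w \<subseteq> X"
  by (simp add: free_ring_carrier)

lemma free_carrier_0 [simp]: "0 \<in> carrier (free_ring X)"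
  by (simp add: free_ring_carrier)

lemma free_carrier_1 [simp]: "1 \<in> carrier (free_ring X)"
  by (simp add: one_sgl free_carrier_single)

lemma free_carrier_fconst [simp]: "fconst c \<in> carrier (free_ring X)"
  by (simp add: fconst_def free_carrier_single)

lemma free_carrier_fgen: "x \<in> X \<Longrightarrow> fgen x \<in> carrier (free_ring X)"
  by (simp add: fgen_def free_carrier_single)

lemma free_carrier_minus: "p \<in> carrier (free_ring X) \<Longrightarrow> - p \<in> carrier (free_ring X)"
  by (metis fconst_1 fconst_minus free_carrier_fconst free_carrier_mult mult_minus1)

lemma free_carrier_diff: "p \<in> carrier (free_ring X) \<Longrightarrow> q \<in> carrier (free_ring X) \<Longrightarrow>
    p - q \<in> carrier (free_ring X)"
  by (metis add_uminus_conv_diff free_carrier_add free_carrier_minus)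

lemma free_carrier_sum:
  "(\<And>i. i \<in> I \<Longrightarrow> f i \<in> carrier (free_ring X)) \<Longrightarrow> (\<Sum>i\<in>I. f i) \<in> carrier (free_ring X)"
  by (induction I rule: infinite_finite_induct) (auto intro: free_carrier_add)

text \<open>Words over \<open>X\<close> are peeled letter by letter. Membership of both operands is
  handed to the sum and product cases because the quotient operations are described only on the
  carrier.\<close>

lemma free_carrier_induct [consumes 1, case_names const gen star add mult]:
  assumes "p \<in> carrier (free_ring X)" and "\<And>c. P (fconst c)" and "\<And>x. x \<in> X \<Longrightarrow> P (fgen x)"
    and "\<And>x. x \<in> X \<Longrightarrow> P (fstar (fgen x))"
    and "\<And>p q. p \<in> carrier (free_ring X) \<Longrightarrow> q \<in> carrier (free_ring X) \<Longrightarrow> P p \<Longrightarrow> P q \<Longrightarrow> P (p + q)"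
    and "\<And>p q. p \<in> carrier (free_ring X) \<Longrightarrow> q \<in> carrier (free_ring X) \<Longrightarrow> P p \<Longrightarrow> P q \<Longrightarrow> P (p * q)"
  shows "P p"
proof -
  have w: "P (sgl w c)" if "fst ` set w \<subseteq> X" for w c
    using that
  proof (induction w)
    case Nil
    then show ?case using assms(2)[of c] by (simp add: fconst_def)
  next
    case (Cons l w)
    have "P (sgl [l] 1)"
      using assms(3,4)[of "fst l"] Cons.prems
      by (cases l; cases "snd l") (auto simp: fgen_fstar, simp add: fgen_def)
    then have "P (sgl [l] 1 * sgl w c)"
      using Cons by (intro assms(6)) (auto simp: free_carrier_single)
    then show ?case by (simp add: mult_sgl)
  qed
  have "p \<in> carrier (free_ring X) \<longrightarrow> P p"
  proof (induction p rule: update_induct)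
    case const
    then show ?case using assms(2)[of 0] by simp
  next
    case (update f a b)
    have e: "Poly_Mapping.update a b f = f + sgl a b"
      using update(1) by (intro poly_mapping_eqI)
        (auto simp: lookup_update lookup_add lookup_single in_keys_iff when_def)
    show ?case
    proof
      assume h: "Poly_Mapping.update a b f \<in> carrier (free_ring X)"
      then have "f \<in> carrier (free_ring X)" "fst ` set a \<subseteq> X"
        using update(1,2) by (auto simp: free_ring_carrier keys_update)
      then show "P (Poly_Mapping.update a b f)"
        unfolding e using update w by (intro assms(5)) (auto simp: free_carrier_single)
    qed
  qed
  then show ?thesis using assms(1) by simp
qed

lemma fstar_carrier: "p \<in> carrier (free_ring X) \<Longrightarrow> fstar p \<in> carrier (free_ring X)"
proof (induction p rule: free_carrier_induct)
  case (gen x)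
  then show ?case by (simp add: fgen_fstar free_carrier_single)
qed (simp_all add: fstar_add fstar_mult free_carrier_add free_carrier_mult free_carrier_fgen)

lemma free_ring_ring: "ring (free_ring X)"
proof (rule ringI)
  show "abelian_group (free_ring X)"
  proof (rule abelian_groupI)
    fix x assume "x \<in> carrier (free_ring X)"
    then show "\<exists>y\<in>carrier (free_ring X). y \<oplus>\<^bsub>free_ring X\<^esub> x = \<zero>\<^bsub>free_ring X\<^esub>"
      by (intro bexI[of _ "- x"]) (auto intro: free_carrier_minus)
  qed (auto intro: free_carrier_add simp: algebra_simps)
  show "Group.monoid (free_ring X)"
    by (rule monoidI) (auto intro: free_carrier_mult simp: algebra_simps)
qed (auto simp: algebra_simps)

section \<open>Presented star-algebras\<close>

locale presentation =
  fixes X :: "'x set" and R :: "'x free_star set"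
  assumes R_sub: "R \<subseteq> carrier (free_ring X)"
begin

abbreviation "F \<equiv> carrier (free_ring X)"
abbreviation "I \<equiv> rel_ideal X R"
abbreviation "cl \<equiv> presented_class X R"
abbreviation "A \<equiv> presented X R"

sublocale fr: ring "free_ring X" by (rule free_ring_ring)

lemma rels_sub: "R \<union> fstar ` R \<subseteq> F"
  using R_sub fstar_carrier by blast

sublocale id: ideal I "free_ring X"
  unfolding rel_ideal_def by (rule fr.genideal_ideal[OF rels_sub])

lemma rels_in: "r \<in> R \<Longrightarrow> r \<in> I" "r \<in> R \<Longrightarrow> fstar r \<in> I"
  using fr.genideal_self[OF rels_sub] unfolding rel_ideal_def by auto

lemma I_add: "p \<in> I \<Longrightarrow> q \<in> I \<Longrightarrow> p + q \<in> I"
  using id.a_closed by simp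

lemma I_zero: "0 \<in> I"
  using id.zero_closed by simp

lemma I_minus: "p \<in> I \<Longrightarrow> - p \<in> I"
  by (metis fr.one_closed free_carrier_minus free_ring_ops(1,2) id.I_l_closed mult_minus1)

lemma I_mult_l: "p \<in> I \<Longrightarrow> q \<in> F \<Longrightarrow> q * p \<in> I"
  using id.I_l_closed by simp

lemma I_mult_r: "p \<in> I \<Longrightarrow> q \<in> F \<Longrightarrow> p * q \<in> I"
  using id.I_r_closed by simp

text \<open>The induction principle for the ideal. Adjoints of relations form a separate premise,
  and closure under negation comes from multiplication by -1.\<close>

lemma I_minimal:
  assumes "R \<subseteq> Z" "fstar ` R \<subseteq> Z" "Z \<subseteq> F" "0 \<in> Z" "\<And>p q. p \<in> Z \<Longrightarrow> q \<in> Z \<Longrightarrow> p + q \<in> Z"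
    "\<And>p q. p \<in> Z \<Longrightarrow> q \<in> F \<Longrightarrow> q * p \<in> Z" "\<And>p q. p \<in> Z \<Longrightarrow> q \<in> F \<Longrightarrow> p * q \<in> Z"
  shows "I \<subseteq> Z"
proof -
  have neg: "- p \<in> Z" if "p \<in> Z" for p
    using assms(6)[OF that, of "- 1"] by (simp add: free_carrier_minus)
  have inv: "\<ominus>\<^bsub>free_ring X\<^esub> p = - p" if "p \<in> Z" for p
  proof (rule fr.minus_equality)
    show "- p \<oplus>\<^bsub>free_ring X\<^esub> p = \<zero>\<^bsub>free_ring X\<^esub>" by simp
  qed (use that assms(3) free_carrier_minus in auto)
  have "ideal Z (free_ring X)"
  proof (rule idealI[OF free_ring_ring])
    show "subgroup Z (add_monoid (free_ring X))"
    proof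
      fix x assume x: "x \<in> Z"
      show "inv\<^bsub>add_monoid (free_ring X)\<^esub> x \<in> Z"
        using inv[OF x] neg[OF x] by (simp add: a_inv_def)
    qed (use assms(3,4,5) in \<open>auto\<close>)
  qed (use assms in auto)
  then show ?thesis
    unfolding rel_ideal_def using fr.genideal_minimal assms by auto
qed

lemma I_star: assumes "p \<in> I" shows "fstar p \<in> I"
proof -
  have "I \<subseteq> {p \<in> F. fstar p \<in> I}"
    by (rule I_minimal)
       (use rels_in rels_sub in \<open>auto simp: fstar_add fstar_mult I_zero
         intro: I_add I_mult_l I_mult_r fstar_carrier free_carrier_add free_carrier_mult\<close>)
  then show ?thesis using assms by auto
qed

lemma cl_eq: "cl p = cl q \<longleftrightarrow> p - q \<in> I"
proof -
  have c: "cl r = {i + r |i. i \<in> I}" for r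
    by (auto simp: presented_class_def a_r_coset_def')
  show ?thesis
  proof
    assume "cl p = cl q"
    moreover have "p \<in> cl p" unfolding c using I_zero by force
    ultimately show "p - q \<in> I" unfolding c by auto
  next
    assume d: "p - q \<in> I"
    have "i + p \<in> cl q" if "i \<in> I" for i
    proof -
      have "i + p = (i + (p - q)) + q" by simp
      then show ?thesis unfolding c using I_add[OF that d] by blast
    qed
    moreover have "i + q \<in> cl p" if "i \<in> I" for i
    proof -
      have "i + q = (i + - (p - q)) + p" by simp
      then show ?thesis unfolding c using I_add[OF that I_minus[OF d]] by blast
    qed
    ultimately show "cl p = cl q" unfolding c by fast
  qed
qed

lemma mem_cl: "p \<in> cl q \<longleftrightarrow> cl p = cl q"
proof -
  have "p \<in> cl q \<longleftrightarrow> p - q \<in> I"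
    by (auto simp: presented_class_def a_r_coset_def' algebra_simps)
      (metis add_diff_cancel_left' add.commute diff_add_cancel)
  then show ?thesis by (simp add: cl_eq)
qed

lemma carrier_A: "carrier A = cl ` F"
  by (auto simp: presented_def Let_def FactRing_def A_RCOSETS_def' presented_class_def)

lemma add_cl: "cl p \<oplus>\<^bsub>A\<^esub> cl q = cl (p + q)" if "p \<in> F" "q \<in> F"
  using ring_hom_add[OF id.rcos_ring_hom that]
  by (simp add: presented_def Let_def presented_class_def)

lemma mult_cl: "cl p \<otimes>\<^bsub>A\<^esub> cl q = cl (p * q)" if "p \<in> F" "q \<in> F"
  using ring_hom_mult[OF id.rcos_ring_hom that]
  by (simp add: presented_def Let_def presented_class_def)

lemma one_cl: "\<one>\<^bsub>A\<^esub> = cl 1"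
  using ring_hom_one[OF id.rcos_ring_hom]
  by (simp add: presented_def Let_def presented_class_def)

lemma zero_cl: "\<zero>\<^bsub>A\<^esub> = cl 0"
proof -
  interpret q: ring_hom_ring "free_ring X" "free_ring X Quot I" "(+>\<^bsub>free_ring X\<^esub>) I"
    by (rule id.rcos_ring_hom_ring)
  show ?thesis using q.hom_zero
    by (simp add: presented_def Let_def presented_class_def)
qed

lemma smult_cl: "c \<odot>\<^bsub>A\<^esub> cl p = cl (fconst c * p)" if "p \<in> F"
  using mult_cl[OF _ that, of "fconst c"] by (simp add: presented_def Let_def)

lemma star_cl: "star A (cl p) = cl (fstar p)"
proof -
  have "fstar ` cl p = cl (fstar p)"
  proof (intro equalityI subsetI)
    fix x assume "x \<in> fstar ` cl p"
    then obtain y where y: "x = fstar y" "y - p \<in> I" by (auto simp: mem_cl cl_eq)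
    then show "x \<in> cl (fstar p)"
      using I_star[OF y(2)] by (simp add: mem_cl cl_eq fstar_diff)
  next
    fix x assume "x \<in> cl (fstar p)"
    then have "x - fstar p \<in> I" by (simp add: mem_cl cl_eq)
    from I_star[OF this] have "fstar x \<in> cl p" by (simp add: mem_cl cl_eq fstar_diff)
    then show "x \<in> fstar ` cl p" by (metis fstar_fstar imageI)
  qed
  then show ?thesis by (simp add: presented_def Let_def)
qed

lemma carrier_A_E:
  assumes "a \<in> carrier A" obtains p where "p \<in> F" "a = cl p"
  using assms by (auto simp: carrier_A)

lemma cl_closed: "p \<in> F \<Longrightarrow> cl p \<in> carrier A"
  by (simp add: carrier_A)

lemma ring_A: "ring A"
proof (rule ringI)
  show "abelian_group A"
  proof (rule abelian_groupI)
    fix x assume "x \<in> carrier A"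
    then obtain p where p: "p \<in> F" "x = cl p" by (rule carrier_A_E)
    show "\<exists>y\<in>carrier A. y \<oplus>\<^bsub>A\<^esub> x = \<zero>\<^bsub>A\<^esub>"
      using p by (intro bexI[of _ "cl (- p)"])
        (simp_all add: add_cl zero_cl cl_closed free_carrier_minus)
  qed ((elim carrier_A_E)?; simp add: add_cl zero_cl cl_closed free_carrier_add ac_simps)+
  show "Group.monoid A"
    by (rule monoidI; (elim carrier_A_E)?;
        simp add: mult_cl one_cl cl_closed free_carrier_mult mult.assoc)
qed (elim carrier_A_E; simp add: add_cl mult_cl free_carrier_add free_carrier_mult
      distrib_left distrib_right)+

end

text \<open>Closure under scalars and star keeps the relations of free products and tensor squares
  inside the free algebra; involutivity makes the lifted star an involution modulo the
  relations.\<close>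

locale star_alg = ring A for A :: "'a star_algebra" (structure) +
  assumes smult_closed: "a \<in> carrier A \<Longrightarrow> c \<odot> a \<in> carrier A"
    and star_closed: "a \<in> carrier A \<Longrightarrow> star A a \<in> carrier A"
    and star_star: "a \<in> carrier A \<Longrightarrow> star A (star A a) = a"

context presentation
begin

lemma star_alg_A: "star_alg A"
proof -
  interpret ring A by (rule ring_A)
  show ?thesis
    by unfold_locales (elim carrier_A_E; simp add: smult_cl cl_closed free_carrier_mult star_cl fstar_carrier)+
qed

text \<open>The polynomials acting as zero form an ideal, so operators that satisfy the relations
  factor through the quotient. The adjoint relations are checked separately because a representation
  by plain linear operators knows no involution.\<close>

lemma rep_lift:
  assumes "letter_ops sc T"
    and "\<And>r \<xi>. r \<in> R \<Longrightarrow> ev_op sc T r \<xi> = 0" "\<And>r \<xi>. r \<in> R \<Longrightarrow> ev_op sc T (fstar r) \<xi> = 0"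
  shows "\<exists>\<Psi>. \<forall>p\<in>F. \<Psi> (cl p) = ev_op sc T p"
proof -
  interpret letter_ops sc T by fact
  have "I \<subseteq> {p \<in> F. \<forall>\<xi>. ev p \<xi> = 0}"
    by (rule I_minimal)
      (use assms(2,3) rels_sub in \<open>auto simp: ev_add ev_mult intro: free_carrier_add free_carrier_mult\<close>)
  then have *: "ev p = ev q" if "cl p = cl q" for p q
    using that by (auto simp: cl_eq ev_diff fun_eq_iff)
  let ?\<Psi> = "\<lambda>a. ev (SOME p. cl p = a)"
  have "?\<Psi> (cl p) = ev p" for p
    by (rule *) (rule someI[of "\<lambda>q. cl q = cl p" p], simp)
  then show ?thesis by (intro exI[of _ ?\<Psi>]) simp
qed

end

lemma presentation_free_product:
  assumes "\<And>A. A \<in> set As \<Longrightarrow> star_alg A"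
  shows "presentation (free_product_gens As) (free_product_rels As)"
proof
  let ?F = "carrier (free_ring (free_product_gens As))"
  have g: "fgen (p, a) \<in> ?F" if "p < length As" "a \<in> carrier (As ! p)" for p a
    using that by (intro free_carrier_fgen) (simp add: free_product_gens_def)
  show "free_product_rels As \<subseteq> ?F"
  proof
    fix r assume "r \<in> free_product_rels As"
    then obtain p where p: "p < length As" and r:
      "r \<in> (let A = As ! p; g = (\<lambda>a. fgen (p, a)) in
     {g (a \<oplus>\<^bsub>A\<^esub> b) - (g a + g b) |a b. a \<in> carrier A \<and> b \<in> carrier A} \<union>
     {g (c \<odot>\<^bsub>A\<^esub> a) - fconst c * g a |c a. a \<in> carrier A} \<union>
     {g (a \<otimes>\<^bsub>A\<^esub> b) - g a * g b |a b. a \<in> carrier A \<and> b \<in> carrier A} \<union>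
     {g \<one>\<^bsub>A\<^esub> - 1} \<union>
     {g (star A a) - fstar (g a) |a. a \<in> carrier A})"
      by (auto simp: free_product_rels_def)
    interpret star_alg "As ! p" using assms p by simp
    show "r \<in> ?F"
      using r p by (auto simp: Let_def intro!: free_carrier_diff free_carrier_add g
        free_carrier_mult fstar_carrier smult_closed star_closed)
  qed
qed

lemma presentation_tensor_square:
  assumes "star_alg A"
  shows "presentation (carrier A \<times> carrier A) (tensor_square_rels A)"
proof
  interpret star_alg A by fact
  show "tensor_square_rels A \<subseteq> carrier (free_ring (carrier A \<times> carrier A))"
    by (auto simp: tensor_square_rels_def Let_def smult_closed star_closed intro!: free_carrier_diff
        free_carrier_add free_carrier_fgen free_carrier_mult fstar_carrier)
qed

lemma unitarity_rels_carrier: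
  assumes "\<And>i j. i < n \<Longrightarrow> j < n \<Longrightarrow> v i j \<in> carrier (free_ring X)"
  shows "unitarity_rels n v \<subseteq> carrier (free_ring X)"
  using assms by (auto simp: unitarity_rels_def intro!: free_carrier_diff free_carrier_sum
      free_carrier_mult fstar_carrier)

lemma free_conj_carrier:
  "free_conj Q i j \<in> carrier (free_ring ({..<dim_row Q} \<times> {..<dim_row Q}))"
  by (auto simp: free_conj_def intro!: free_carrier_sum free_carrier_mult fstar_carrier
      free_carrier_fgen)

lemma presentation_factor: "presentation (factor_gens F) (factor_rels F)"
proof
  have "Au_rels Q \<subseteq> carrier (free_ring ({..<dim_row Q} \<times> {..<dim_row Q}))" for Q
    unfolding Au_rels_def by (intro Un_least unitarity_rels_carrier free_conj_carrier)
      (simp add: free_carrier_fgen)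
  then show "factor_rels F \<subseteq> carrier (free_ring (factor_gens F))"
    by (cases F) (auto simp: factor_gens_def Ao_rels_def intro!: free_carrier_diff free_conj_carrier
        free_carrier_fgen)
qed

lemma star_alg_factor: "star_alg (factor_alg F)"
  unfolding factor_alg_def by (rule presentation.star_alg_A[OF presentation_factor])

lemma presentation_fp:
  "presentation (free_product_gens (map factor_alg Fs)) (free_product_rels (map factor_alg Fs))"
  by (rule presentation_free_product) (auto simp: star_alg_factor)

lemma star_alg_fp: "star_alg (fp_alg Fs)"
  unfolding fp_alg_def free_product_def by (rule presentation.star_alg_A[OF presentation_fp])

text \<open>\<open>inv_mat\<close> strips an option, so the point is that an invertible matrix is a
  unit of the matrix ring and the elimination therefore returns an inverse.\<close>

lemma inv_mat_mult:
  assumes "valid_factor F" defines "Q \<equiv> fmat F"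
  shows "\<And>i j. i < fdim F \<Longrightarrow> j < fdim F \<Longrightarrow>
      (\<Sum>k<fdim F. Q $$ (i, k) * inv_mat Q $$ (k, j)) = (if i = j then 1 else 0)"
    and "\<And>i j. i < fdim F \<Longrightarrow> j < fdim F \<Longrightarrow>
      (\<Sum>k<fdim F. inv_mat Q $$ (i, k) * Q $$ (k, j)) = (if i = j then 1 else 0)"
proof -
  define n where "n = fdim F"
  have inv: "invertible_mat Q"
    using assms(1) unfolding Q_def by (cases F) simp_all
  have n: "n = dim_row Q" by (simp add: n_def Q_def)
  from inv have "dim_col Q = n" by (simp add: invertible_mat_def n)
  then have Q: "Q \<in> carrier_mat n n" using n by auto
  obtain C where C: "inverts_mat Q C" "inverts_mat C Q"
    using inv unfolding invertible_mat_def by blast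
  have "dim_col (Q * C) = n" using C(1) n by (simp add: inverts_mat_def)
  then have c1: "dim_col C = n" by simp
  have "dim_col (C * Q) = dim_row C" using C(2) by (simp add: inverts_mat_def)
  then have c2: "dim_row C = n" using \<open>dim_col Q = n\<close> by simp
  have C': "C \<in> carrier_mat n n" using c1 c2 by auto
  have "Q * C = 1\<^sub>m n" using C(1) by (simp add: inverts_mat_def n)
  moreover have "C * Q = 1\<^sub>m n" using C(2) unfolding inverts_mat_def c2 .
  ultimately have "Q \<in> Units (ring_mat TYPE(complex) n undefined)"
    unfolding Units_def ring_mat_simps using C' Q by blast
  with mat_inverse(1)[OF Q] obtain B where B: "mat_inverse Q = Some B"
    by (meson not_None_eq)
  from mat_inverse(2)[OF Q B] have QB: "Q * B = 1\<^sub>m n" "B * Q = 1\<^sub>m n" "B \<in> carrier_mat n n"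
    by auto
  have iB: "inv_mat Q = B" by (simp add: inv_mat_def B)
  have e: "(Q * B) $$ (i, j) = (\<Sum>k<n. Q $$ (i, k) * B $$ (k, j))"
    "(B * Q) $$ (i, j) = (\<Sum>k<n. B $$ (i, k) * Q $$ (k, j))" if "i < n" "j < n" for i j
    using Q QB(3) that by (simp_all add: scalar_prod_def atLeast0LessThan)
  show "(\<Sum>k<fdim F. Q $$ (i, k) * inv_mat Q $$ (k, j)) = (if i = j then 1 else 0)"
    if "i < fdim F" "j < fdim F" for i j
    using e(1)[of i j] that by (simp add: iB QB n_def)
  show "(\<Sum>k<fdim F. inv_mat Q $$ (i, k) * Q $$ (k, j)) = (if i = j then 1 else 0)"
    if "i < fdim F" "j < fdim F" for i j
    using e(2)[of i j] that by (simp add: iB QB n_def)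
qed

section \<open>Substitutions\<close>

definition subst :: "('x \<Rightarrow> 'y free_star) \<Rightarrow> ('x list \<Rightarrow>\<^sub>0 complex) \<Rightarrow> 'y free_star" where
  "subst f p = ev_op (\<lambda>c x. fconst c * x) (\<lambda>l x. f l * x) p 1"

text \<open>Antimultiplicative substitution, conjugate-linear when \<open>b\<close> holds: the
  involution and the antipode are lifted by the same construction.\<close>

definition asubst :: "bool \<Rightarrow> ('x \<Rightarrow> 'y free_star) \<Rightarrow> ('x list \<Rightarrow>\<^sub>0 complex) \<Rightarrow> 'y free_star" where
  "asubst b f p = ev_op (\<lambda>c x. fconst (if b then cnj c else c) * x) (\<lambda>l x. x * f l) p 1"

definition chr :: "('x \<Rightarrow> complex) \<Rightarrow> ('x list \<Rightarrow>\<^sub>0 complex) \<Rightarrow> complex" where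
  "chr f p = ev_op (*) (\<lambda>l x. f l * x) p 1"

lemma vs_fconst: "vector_space (\<lambda>c (x :: 'y free_star). fconst c * x)"
  by standard (simp_all add: distrib_left distrib_right fconst_add fconst_mult mult.assoc)

lemma vs_fconst_cnj: "vector_space (\<lambda>c (x :: 'y free_star). fconst (if b then cnj c else c) * x)"
  by standard (simp_all add: distrib_left distrib_right fconst_add fconst_mult mult.assoc)

lemma vs_complex: "vector_space ((*) :: complex \<Rightarrow> complex \<Rightarrow> complex)"
  by standard (simp_all add: algebra_simps)

lemma ops_subst: "letter_ops (\<lambda>c x. fconst c * x) (\<lambda>l x. f l * x)"
  by (intro letter_ops.intro letter_ops_axioms.intro vs_fconst)
     (simp_all add: distrib_left fconst_left_commute)

lemma ops_asubst: "letter_ops (\<lambda>c x. fconst (if b then cnj c else c) * x) (\<lambda>l x. x * f l)"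
  by (intro letter_ops.intro letter_ops_axioms.intro vs_fconst_cnj)
     (simp_all add: distrib_right mult.assoc)

lemma ops_chr: "letter_ops ((*) :: complex \<Rightarrow> complex \<Rightarrow> complex) (\<lambda>l x. f l * x)"
  by (intro letter_ops.intro letter_ops_axioms.intro vs_complex)
     (simp_all add: algebra_simps)

lemma subst_add: "subst f (p + q) = subst f p + subst f q"
  and subst_zero [simp]: "subst f 0 = 0"
  and subst_one [simp]: "subst f 1 = 1"
  and subst_letter [simp]: "subst f (sgl [l] 1) = f l"
  and subst_fconst [simp]: "subst f (fconst c) = fconst c"
  and subst_diff: "subst f (p - q) = subst f p - subst f q"
  and subst_sum: "subst f (\<Sum>i\<in>I. g i) = (\<Sum>i\<in>I. subst f (g i))"
  and subst_single: "subst f (sgl w c) = fconst c * prod_list (map f w)"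
proof -
  interpret letter_ops "\<lambda>c x. fconst c * x" "\<lambda>l x. f l * x" by (rule ops_subst)
  have "foldr (\<lambda>l x. f l * x) w 1 = prod_list (map f w)" for w by (induction w) auto
  then show "subst f (p + q) = subst f p + subst f q" "subst f 0 = 0" "subst f 1 = 1"
    "subst f (sgl [l] 1) = f l"
    "subst f (p - q) = subst f p - subst f q" "subst f (\<Sum>i\<in>I. g i) = (\<Sum>i\<in>I. subst f (g i))"
    "subst f (sgl w c) = fconst c * prod_list (map f w)"
    unfolding subst_def
    by (simp_all add: ev_add ev_one ev_single ev_diff ev_sum)
  show "subst f (fconst c) = fconst c"
    using ev_single[of "[]" c 1] by (simp add: subst_def fconst_def)
qed

lemma subst_mult: "subst f (p * q) = subst f p * subst f q"
proof -
  interpret letter_ops "\<lambda>c x. fconst c * x" "\<lambda>l x. f l * x" by (rule ops_subst)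
  have f: "foldr (\<lambda>l x. f l * x) w x = foldr (\<lambda>l x. f l * x) w 1 * x" for w x
    by (induction w) (auto simp: mult.assoc)
  have "ev p x = ev p 1 * x" for p x
  proof (induction p rule: free_alg_induct)
    case (single w c)
    show ?case by (simp add: ev_single f[of w x] mult.assoc)
  qed (simp_all add: ev_add distrib_right)
  then show ?thesis unfolding subst_def by (metis ev_mult)
qed

lemma asubst_add: "asubst b f (p + q) = asubst b f p + asubst b f q"
  and asubst_zero [simp]: "asubst b f 0 = 0"
  and asubst_one [simp]: "asubst b f 1 = 1"
  and asubst_letter [simp]: "asubst b f (sgl [l] 1) = f l"
  and asubst_fconst [simp]: "asubst b f (fconst c) = fconst (if b then cnj c else c)"
  and asubst_diff: "asubst b f (p - q) = asubst b f p - asubst b f q"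
  and asubst_sum: "asubst b f (\<Sum>i\<in>I. g i) = (\<Sum>i\<in>I. asubst b f (g i))"
  and asubst_mult: "asubst b f (p * q) = asubst b f q * asubst b f p"
proof -
  interpret letter_ops "\<lambda>c x. fconst (if b then cnj c else c) * x" "\<lambda>l x. x * f l" by (rule ops_asubst)
  show "asubst b f (p + q) = asubst b f p + asubst b f q" "asubst b f 0 = 0" "asubst b f 1 = 1"
    "asubst b f (sgl [l] 1) = f l" "asubst b f (p - q) = asubst b f p - asubst b f q"
    "asubst b f (\<Sum>i\<in>I. g i) = (\<Sum>i\<in>I. asubst b f (g i))"
    unfolding asubst_def by (simp_all add: ev_add ev_one ev_single ev_diff ev_sum)
  show "asubst b f (fconst c) = fconst (if b then cnj c else c)"
    using ev_single[of "[]" c 1] by (simp add: asubst_def fconst_def)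
  have f: "foldr (\<lambda>l x. x * f l) w x = x * foldr (\<lambda>l x. x * f l) w 1" for w x
    by (induction w) (auto simp: mult.assoc)
  have "ev p x = x * ev p 1" for p x
  proof (induction p rule: free_alg_induct)
    case (single w c)
    show ?case by (simp add: ev_single f[of w x] fconst_left_commute[of x])
  qed (simp_all add: ev_add distrib_left)
  then show "asubst b f (p * q) = asubst b f q * asubst b f p" unfolding asubst_def by (metis ev_mult)
qed

lemma chr_add: "chr f (p + q) = chr f p + chr f q"
  and chr_zero [simp]: "chr f 0 = 0"
  and chr_one [simp]: "chr f 1 = 1"
  and chr_letter [simp]: "chr f (sgl [l] 1) = f l"
  and chr_fconst [simp]: "chr f (fconst c) = c"
  and chr_sum: "chr f (\<Sum>i\<in>I. g i) = (\<Sum>i\<in>I. chr f (g i))"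
proof -
  interpret letter_ops "(*) :: complex \<Rightarrow> complex \<Rightarrow> complex" "\<lambda>l x. f l * x" by (rule ops_chr)
  show "chr f (p + q) = chr f p + chr f q" "chr f 0 = 0" "chr f 1 = 1"
    "chr f (sgl [l] 1) = f l"
    "chr f (\<Sum>i\<in>I. g i) = (\<Sum>i\<in>I. chr f (g i))"
    unfolding chr_def
    by (simp_all add: ev_add ev_one ev_single ev_sum)
  show "chr f (fconst c) = c"
    using ev_single[of "[]" c 1] by (simp add: chr_def fconst_def)
qed

lemma chr_mult: "chr f (p * q) = chr f p * chr f q"
proof -
  interpret letter_ops "(*) :: complex \<Rightarrow> complex \<Rightarrow> complex" "\<lambda>l x. f l * x" by (rule ops_chr)
  have f: "foldr (\<lambda>l x. f l * x) w x = foldr (\<lambda>l x. f l * x) w 1 * x" for w x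
    by (induction w) (auto simp: mult.assoc)
  have "ev p x = ev p 1 * x" for p x
  proof (induction p rule: free_alg_induct)
    case (single w c)
    show ?case by (simp add: ev_single f[of w x] mult.assoc)
  qed (simp_all add: ev_add distrib_right)
  then show ?thesis unfolding chr_def by (metis ev_mult)
qed

lemma free_alg_induct' [case_names const letter add mult]:
  fixes p :: "'x free_star"
  assumes "\<And>c. P (fconst c)" and "\<And>l. P (sgl [l] 1)" and "\<And>p q. P p \<Longrightarrow> P q \<Longrightarrow> P (p + q)"
    and "\<And>p q. P p \<Longrightarrow> P q \<Longrightarrow> P (p * q)"
  shows "P p"
proof (induction p rule: free_alg_induct)
  case zero
  then show ?case using assms(1)[of 0] by simp
next
  case (single w c)
  show ?case
  proof (induction w)
    case Nil
    then show ?case using assms(1)[of c] by (simp add: fconst_def)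
  next
    case (Cons l w)
    then show ?case using assms(4)[OF assms(2)[of l] Cons] by (simp add: mult_sgl)
  qed
qed (rule assms(3))

section \<open>The free product as a quotient of the free algebra on matrix entries\<close>

type_synonym entry_alg = "(nat \<times> nat \<times> nat) free_star"

lemma fstar_smult: "fstar (fconst c * p) = fconst (cnj c) * fstar p"
  by (simp add: fstar_mult fconst_commute[of "fstar p"])

lemma sum4_swap:
  "(\<Sum>k\<in>K. \<Sum>l\<in>L. \<Sum>a\<in>A. \<Sum>b\<in>B. f k l a b) = (\<Sum>a\<in>A. \<Sum>b\<in>B. \<Sum>k\<in>K. \<Sum>l\<in>L. f k l a b)"
  for f :: "_ \<Rightarrow> _ \<Rightarrow> _ \<Rightarrow> _ \<Rightarrow> 'z::comm_monoid_add"
proof -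
  have "(\<Sum>k\<in>K. \<Sum>l\<in>L. \<Sum>a\<in>A. \<Sum>b\<in>B. f k l a b) = (\<Sum>k\<in>K. \<Sum>a\<in>A. \<Sum>l\<in>L. \<Sum>b\<in>B. f k l a b)"
    by (intro sum.cong[OF refl] sum.swap)
  also have "\<dots> = (\<Sum>a\<in>A. \<Sum>k\<in>K. \<Sum>l\<in>L. \<Sum>b\<in>B. f k l a b)" by (rule sum.swap)
  also have "\<dots> = (\<Sum>a\<in>A. \<Sum>k\<in>K. \<Sum>b\<in>B. \<Sum>l\<in>L. f k l a b)"
    by (intro sum.cong[OF refl] sum.swap)
  also have "\<dots> = (\<Sum>a\<in>A. \<Sum>b\<in>B. \<Sum>k\<in>K. \<Sum>l\<in>L. f k l a b)"
    by (intro sum.cong[OF refl] sum.swap)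
  finally show ?thesis .
qed

text \<open>Entrywise form of A (A' X B') B = X for scalar matrices with A A' = 1 and B' B = 1. It
  is what makes conjugating a direction twice return it.\<close>

lemma matrix_collapse:
  fixes X :: "nat \<Rightarrow> nat \<Rightarrow> 'y free_star"
  assumes "\<And>i a. i < n \<Longrightarrow> a < n \<Longrightarrow> (\<Sum>k<n. A i k * A' k a) = (if i = a then 1 else 0)"
    and "\<And>b j. b < n \<Longrightarrow> j < n \<Longrightarrow> (\<Sum>l<n. B' b l * B l j) = (if b = j then 1 else 0)"
    and "i < n" "j < n"
  shows "(\<Sum>k<n. \<Sum>l<n. fconst (A i k * B l j) * (\<Sum>a<n. \<Sum>b<n. fconst (A' k a * B' b l) * X a b))
    = X i j"
proof -
  have t: "fconst (A i k * B l j) * (fconst (A' k a * B' b l) * X a b)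
      = fconst ((A i k * A' k a) * (B' b l * B l j)) * X a b" for k l a b
    unfolding mult.assoc[symmetric, of "fconst _"] fconst_mult[symmetric] by (simp add: mult_ac)
  have "(\<Sum>k<n. \<Sum>l<n. fconst (A i k * B l j) * (\<Sum>a<n. \<Sum>b<n. fconst (A' k a * B' b l) * X a b))
    = (\<Sum>k<n. \<Sum>l<n. \<Sum>a<n. \<Sum>b<n. fconst ((A i k * A' k a) * (B' b l * B l j)) * X a b)"
    by (simp only: sum_distrib_left t)
  also have "\<dots> = (\<Sum>a<n. \<Sum>b<n. \<Sum>k<n. \<Sum>l<n.
      fconst ((A i k * A' k a) * (B' b l * B l j)) * X a b)"
    by (rule sum4_swap)
  also have "\<dots> = (\<Sum>a<n. \<Sum>b<n. fconst ((\<Sum>k<n. A i k * A' k a) * (\<Sum>l<n. B' b l * B l j)) * X a b)"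
    unfolding sum_product unfolding fconst_sum unfolding sum_distrib_right ..
  also have "\<dots> = (\<Sum>a<n. \<Sum>b<n. if a = i then if b = j then X a b else 0 else 0)"
    by (intro sum.cong refl) (simp add: assms)
  also have "\<dots> = (\<Sum>a<n. if a = i then \<Sum>b<n. if b = j then X a b else 0 else 0)"
    by (intro sum.cong refl) simp
  also have "\<dots> = X i j"
    using assms(3,4) by simp
  finally show ?thesis .
qed

locale fp =
  fixes Fs :: "factor list"
  assumes valid: "\<forall>F\<in>set Fs. valid_factor F"
begin

text \<open>Elements of the free product \<open>S\<close> are handled through representatives in the free algebra
  whose letters \<open>((p, i, j), b)\<close> stand for the \<open>(i, j)\<close> entry of the direction \<open>(p, b)\<close>; both values
  of \<open>b\<close> are used for all factors, also for those of type \<open>Ao\<close>. The quotient map is \<open>pi\<close>, and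
  \<open>st\<close>, \<open>kk\<close>, \<open>ee\<close> lift the involution, the antipode and the counit.\<close>

definition nn :: "direction \<Rightarrow> nat" where "nn \<gamma> = fdim (Fs ! fst \<gamma>)"
definition bar :: "direction \<Rightarrow> direction" where "bar \<gamma> = (fst \<gamma>, \<not> snd \<gamma>)"
definition ok :: "direction \<Rightarrow> bool" where "ok \<gamma> \<longleftrightarrow> fst \<gamma> < length Fs"
definition lt :: "direction \<Rightarrow> nat \<Rightarrow> nat \<Rightarrow> entry_alg" where
  "lt \<gamma> i j = sgl [((fst \<gamma>, i, j), snd \<gamma>)] 1"

text \<open>Letters carry unbounded indices; those that name no matrix entry are junk, and every map
  out of the free algebra defined below sends them to zero.\<close>

primrec vl :: "(nat \<times> nat \<times> nat) \<times> bool \<Rightarrow> bool" where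
  "vl (pij, b) \<longleftrightarrow> (case pij of (p, i, j) \<Rightarrow> p < length Fs \<and> i < fdim (Fs ! p) \<and> j < fdim (Fs ! p))"

text \<open>\<open>(\<gamma>\<^sub>i\<^sub>j)\<^sup>*\<close> is the sum of the \<open>dm \<gamma> i k * cnj (dm (bar \<gamma>) l j)\<close> times the \<open>(k, l)\<close> entries
  of the conjugate direction.\<close>

definition dm :: "direction \<Rightarrow> nat \<Rightarrow> nat \<Rightarrow> complex" where
  "dm \<gamma> i k = (if snd \<gamma> then cnj (fmat (Fs ! fst \<gamma>) $$ (i, k)) else inv_mat (fmat (Fs ! fst \<gamma>)) $$ (i, k))"

definition st0 :: "(nat \<times> nat \<times> nat) \<times> bool \<Rightarrow> entry_alg" where
  "st0 l = (if vl l then case l of ((p, i, j), b) \<Rightarrow> let \<gamma> = (p, b) in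
     \<Sum>k<nn \<gamma>. \<Sum>l<nn \<gamma>. fconst (dm \<gamma> i k * cnj (dm (bar \<gamma>) l j)) * lt (bar \<gamma>) k l else 0)"

definition st :: "entry_alg \<Rightarrow> entry_alg" where
  "st = asubst True st0"

text \<open>In a unitary corepresentation the antipode of an entry is the adjoint of the transposed
  entry, whence the exchange of \<open>i\<close> and \<open>j\<close>.\<close>

definition kk :: "entry_alg \<Rightarrow> entry_alg" where
  "kk = asubst False (\<lambda>((p, i, j), b). st0 ((p, j, i), b))"

definition ee :: "entry_alg \<Rightarrow> complex" where
  "ee = chr (\<lambda>l. case l of ((p, i, j), b) \<Rightarrow> if vl l \<and> i = j then 1 else 0)"

abbreviation "As \<equiv> map factor_alg Fs"
abbreviation "clo \<equiv> presented_class (free_product_gens As) (free_product_rels As)"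
abbreviation "clf p \<equiv> presented_class (factor_gens (Fs ! p)) (factor_rels (Fs ! p))"
abbreviation "S \<equiv> fp_alg Fs"
abbreviation "FR p \<equiv> carrier (free_ring (factor_gens (Fs ! p)))"

definition gg :: "nat \<Rightarrow> nat \<Rightarrow> nat \<Rightarrow> (nat \<times> (nat \<times> nat) free_star set) free_star" where
  "gg p i j = fgen (p, clf p (fgen (i, j)))"

text \<open>The free product has generators for \<open>u\<close> only, so a letter of a conjugate
  direction is spelled out through adjoints of the entries of \<open>u\<close>.\<close>

definition lo :: "(nat \<times> nat \<times> nat) \<times> bool \<Rightarrow> (nat \<times> (nat \<times> nat) free_star set) free_star" where
  "lo l = (if vl l then case l of ((p, i, j), b) \<Rightarrow>
     if b then \<Sum>k<fdim (Fs ! p). \<Sum>l<fdim (Fs ! p).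
        fconst (fmat (Fs ! p) $$ (i, k) * inv_mat (fmat (Fs ! p)) $$ (l, j)) * fstar (gg p k l)
     else gg p i j else 0)"

definition Ph :: "entry_alg \<Rightarrow> (nat \<times> (nat \<times> nat) free_star set) free_star" where
  "Ph = subst lo"

definition pi :: "entry_alg \<Rightarrow> fp_elem" where
  "pi p = clo (Ph p)"

lemma nn_bar [simp]: "nn (bar \<gamma>) = nn \<gamma>" and ok_bar [simp]: "ok (bar \<gamma>) = ok \<gamma>"
  and bar_bar [simp]: "bar (bar \<gamma>) = \<gamma>" and fst_bar [simp]: "fst (bar \<gamma>) = fst \<gamma>"
  and snd_bar [simp]: "snd (bar \<gamma>) = (\<not> snd \<gamma>)"
  by (simp_all add: nn_def bar_def ok_def)

lemma valid_nth: "p < length Fs \<Longrightarrow> valid_factor (Fs ! p)"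
  using valid by simp

text \<open>For an unconjugated direction this reads Q^-1 Q = 1; for a conjugated one it is the
  complex conjugate of Q Q^-1 = 1.\<close>

lemma dm_inv:
  assumes "ok \<gamma>" "i < nn \<gamma>" "j < nn \<gamma>"
  shows "(\<Sum>k<nn \<gamma>. dm \<gamma> i k * cnj (dm (bar \<gamma>) k j)) = (if i = j then 1 else 0)"
proof (cases "snd \<gamma>")
  case True
  have "(\<Sum>k<nn \<gamma>. dm \<gamma> i k * cnj (dm (bar \<gamma>) k j)) =
      cnj (\<Sum>k<nn \<gamma>. fmat (Fs ! fst \<gamma>) $$ (i, k) * inv_mat (fmat (Fs ! fst \<gamma>)) $$ (k, j))"
    by (simp add: dm_def True)
  also have "\<dots> = cnj (if i = j then 1 else 0)"
    using inv_mat_mult(1)[OF valid_nth, of "fst \<gamma>" i j] assms unfolding ok_def nn_def by simp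
  finally show ?thesis by simp
next
  case False
  then show ?thesis
    using inv_mat_mult(2)[OF valid_nth, of "fst \<gamma>" i j] assms by (simp add: dm_def ok_def nn_def)
qed

lemma dm_inv_cnj:
  assumes "ok \<gamma>" "i < nn \<gamma>" "j < nn \<gamma>"
  shows "(\<Sum>k<nn \<gamma>. cnj (dm \<gamma> i k) * dm (bar \<gamma>) k j) = (if i = j then 1 else 0)"
  using arg_cong[OF dm_inv[OF assms], of cnj] by (simp split: if_splits)

lemma vl_iff: "vl ((fst \<gamma>, i, j), snd \<gamma>) \<longleftrightarrow> ok \<gamma> \<and> i < nn \<gamma> \<and> j < nn \<gamma>"
  by (simp add: ok_def nn_def)

lemma st_add: "st (p + q) = st p + st q" and st_zero [simp]: "st 0 = 0"
  and st_one [simp]: "st 1 = 1" and st_fconst [simp]: "st (fconst c) = fconst (cnj c)"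
  and st_diff: "st (p - q) = st p - st q"
  and st_sum: "st (\<Sum>i\<in>I. f i) = (\<Sum>i\<in>I. st (f i))"
  and st_mult: "st (p * q) = st q * st p"
  by (simp_all add: st_def asubst_add asubst_diff asubst_sum asubst_mult)

lemma st_smult: "st (fconst c * p) = fconst (cnj c) * st p"
  by (simp add: st_mult fconst_commute[of "st p"])

lemma st_lt: "ok \<gamma> \<Longrightarrow> i < nn \<gamma> \<Longrightarrow> j < nn \<gamma> \<Longrightarrow> st (lt \<gamma> i j) =
   (\<Sum>k<nn \<gamma>. \<Sum>l<nn \<gamma>. fconst (dm \<gamma> i k * cnj (dm (bar \<gamma>) l j)) * lt (bar \<gamma>) k l)"
  unfolding st_def lt_def asubst_letter using vl_iff[of \<gamma> i j]
  by (simp add: st0_def Let_def lt_def del: vl.simps)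

lemma kk_add: "kk (p + q) = kk p + kk q" and kk_zero [simp]: "kk 0 = 0"
  and kk_one [simp]: "kk 1 = 1" and kk_fconst [simp]: "kk (fconst c) = fconst c"
  and kk_sum: "kk (\<Sum>i\<in>I. f i) = (\<Sum>i\<in>I. kk (f i))"
  and kk_mult: "kk (p * q) = kk q * kk p"
  by (simp_all add: kk_def asubst_add asubst_sum asubst_mult)

lemma kk_smult: "kk (fconst c * p) = fconst c * kk p"
  by (simp add: kk_mult fconst_commute[of "kk p"])

lemma kk_lt: "kk (lt \<gamma> i j) = st (lt \<gamma> j i)"
  by (simp add: kk_def lt_def st_def)

lemma ee_add: "ee (p + q) = ee p + ee q" and ee_zero [simp]: "ee 0 = 0"
  and ee_one [simp]: "ee 1 = 1" and ee_fconst [simp]: "ee (fconst c) = c"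
  and ee_sum: "ee (\<Sum>i\<in>I. f i) = (\<Sum>i\<in>I. ee (f i))"
  and ee_mult: "ee (p * q) = ee p * ee q"
  by (simp_all add: ee_def chr_add chr_sum chr_mult)

lemma ee_lt: "ok \<gamma> \<Longrightarrow> i < nn \<gamma> \<Longrightarrow> j < nn \<gamma> \<Longrightarrow> ee (lt \<gamma> i j) = (if i = j then 1 else 0)"
  using vl_iff[of \<gamma> i j] by (simp add: ee_def lt_def del: vl.simps)

text \<open>Pure matrix cancellation, so it holds in the free algebra and not only after
  \<open>pi\<close>.\<close>

lemma st_st_lt: "ok \<gamma> \<Longrightarrow> i < nn \<gamma> \<Longrightarrow> j < nn \<gamma> \<Longrightarrow> st (st (lt \<gamma> i j)) = lt \<gamma> i j"
proof -
  assume a: "ok \<gamma>" "i < nn \<gamma>" "j < nn \<gamma>"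
  have "st (st (lt \<gamma> i j)) = (\<Sum>k<nn \<gamma>. \<Sum>l<nn \<gamma>. fconst (cnj (dm \<gamma> i k) * dm (bar \<gamma>) l j) *
      (\<Sum>a<nn \<gamma>. \<Sum>b<nn \<gamma>. fconst (dm (bar \<gamma>) k a * cnj (dm \<gamma> b l)) * lt \<gamma> a b))"
    using a by (simp add: st_lt st_sum st_smult)
  also have "\<dots> = lt \<gamma> i j"
    using dm_inv_cnj[of \<gamma>] a by (intro matrix_collapse) auto
  finally show ?thesis .
qed

subsection \<open>Surjection onto the free product\<close>

sublocale o: presentation "free_product_gens As" "free_product_rels As"
  by (rule presentation_fp)

lemma S_eq: "S = presented (free_product_gens As) (free_product_rels As)"
  by (simp add: fp_alg_def free_product_def)

sublocale S: star_alg S by (rule star_alg_fp)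

lemma clf_closed: "p < length Fs \<Longrightarrow> f \<in> FR p \<Longrightarrow>
    clf p f \<in> carrier (factor_alg (Fs ! p))"
  unfolding factor_alg_def by (rule presentation.cl_closed[OF presentation_factor])

lemma gg_carrier: "p < length Fs \<Longrightarrow> i < fdim (Fs ! p) \<Longrightarrow> j < fdim (Fs ! p) \<Longrightarrow> gg p i j \<in> o.F"
  using clf_closed[of p "fgen (i, j)"] unfolding gg_def
  by (intro free_carrier_fgen) (simp add: free_product_gens_def free_carrier_fgen factor_gens_def)

lemma lo_carrier: "lo l \<in> o.F"
  by (auto simp: lo_def split: prod.split
      intro!: free_carrier_sum free_carrier_mult fstar_carrier gg_carrier)

lemma Ph_add: "Ph (p + q) = Ph p + Ph q" and Ph_zero [simp]: "Ph 0 = 0"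
  and Ph_one [simp]: "Ph 1 = 1" and Ph_fconst [simp]: "Ph (fconst c) = fconst c"
  and Ph_diff: "Ph (p - q) = Ph p - Ph q"
  and Ph_sum: "Ph (\<Sum>i\<in>I. f i) = (\<Sum>i\<in>I. Ph (f i))"
  and Ph_mult: "Ph (p * q) = Ph p * Ph q"
  by (simp_all add: Ph_def subst_add subst_diff subst_sum subst_mult)

lemma Ph_carrier: "Ph p \<in> o.F"
  by (induction p rule: free_alg_induct')
     (simp_all add: Ph_add Ph_mult free_carrier_add free_carrier_mult, simp add: Ph_def lo_carrier)

lemma Ph_lt: "ok \<gamma> \<Longrightarrow> i < nn \<gamma> \<Longrightarrow> j < nn \<gamma> \<Longrightarrow> Ph (lt \<gamma> i j) =
    (if snd \<gamma> then \<Sum>k<nn \<gamma>. \<Sum>l<nn \<gamma>. fconst (cnj (dm \<gamma> i k) * dm (bar \<gamma>) l j) * fstar (gg (fst \<gamma>) k l)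
     else gg (fst \<gamma>) i j)"
  unfolding Ph_def lt_def subst_letter using vl_iff[of \<gamma> i j]
  by (simp add: lo_def dm_def nn_def del: vl.simps)

lemma lt_cases:
  fixes P :: "entry_alg \<Rightarrow> bool"
  assumes "\<And>\<gamma> i j. P (lt \<gamma> i j)" shows "P (sgl [l] 1)"
  using assms[of "(fst (fst l), snd l)" "fst (snd (fst l))" "snd (snd (fst l))"]
  by (simp add: lt_def)

lemma Ph_invalid: "\<not> (ok \<gamma> \<and> i < nn \<gamma> \<and> j < nn \<gamma>) \<Longrightarrow> Ph (lt \<gamma> i j) = 0"
  using vl_iff[of \<gamma> i j] by (auto simp: Ph_def lt_def lo_def simp del: vl.simps)

lemma st_invalid: "\<not> (ok \<gamma> \<and> i < nn \<gamma> \<and> j < nn \<gamma>) \<Longrightarrow> st (lt \<gamma> i j) = 0"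
  using vl_iff[of \<gamma> i j] by (auto simp: st_def lt_def st0_def simp del: vl.simps)

lemma Ph_st: "Ph (st p) = fstar (Ph p)"
proof (induction p rule: free_alg_induct')
  case (letter l)
  show ?case
  proof (rule lt_cases)
    fix \<gamma> i j
    show "Ph (st (lt \<gamma> i j)) = fstar (Ph (lt \<gamma> i j))"
    proof (cases "ok \<gamma> \<and> i < nn \<gamma> \<and> j < nn \<gamma>")
      case True
      show ?thesis
      proof (cases "snd \<gamma>")
        case b: True
        with True show ?thesis
          by (simp add: st_lt Ph_sum Ph_mult Ph_lt fstar_sum fstar_smult)
      next
        case b: False
        have "Ph (st (lt \<gamma> i j)) = (\<Sum>k<nn \<gamma>. \<Sum>l<nn \<gamma>. fconst (dm \<gamma> i k * cnj (dm (bar \<gamma>) l j)) *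
          (\<Sum>a<nn \<gamma>. \<Sum>b<nn \<gamma>. fconst (cnj (dm (bar \<gamma>) k a) * dm \<gamma> b l) * fstar (gg (fst \<gamma>) a b)))"
          using True b by (simp add: st_lt Ph_sum Ph_mult Ph_lt)
        also have "\<dots> = fstar (gg (fst \<gamma>) i j)"
          using dm_inv[of \<gamma>] True by (intro matrix_collapse) auto
        finally show ?thesis using True b by (simp add: Ph_lt)
      qed
    qed (simp add: Ph_invalid st_invalid)
  qed
qed (simp_all add: st_add st_mult Ph_add Ph_mult fstar_add fstar_mult)

lemma pi_closed [simp, intro]: "pi p \<in> carrier S"
  unfolding pi_def S_eq by (rule o.cl_closed[OF Ph_carrier])

lemma pi_add: "pi (p + q) = pi p \<oplus>\<^bsub>S\<^esub> pi q"
  unfolding pi_def S_eq by (simp add: Ph_add o.add_cl Ph_carrier)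

lemma pi_mult: "pi (p * q) = pi p \<otimes>\<^bsub>S\<^esub> pi q"
  unfolding pi_def S_eq by (simp add: Ph_mult o.mult_cl Ph_carrier)

lemma pi_one: "pi 1 = \<one>\<^bsub>S\<^esub>" and pi_zero: "pi 0 = \<zero>\<^bsub>S\<^esub>"
  unfolding pi_def S_eq by (simp_all add: o.one_cl o.zero_cl)

lemma pi_smult: "pi (fconst c * p) = c \<odot>\<^bsub>S\<^esub> pi p"
  unfolding pi_def S_eq by (simp add: Ph_mult o.smult_cl Ph_carrier)

lemma pi_star: "pi (st p) = star S (pi p)"
  unfolding pi_def S_eq by (simp add: Ph_st o.star_cl)

lemma pi_eq_iff: "pi p = pi q \<longleftrightarrow> pi (p - q) = pi 0"
  unfolding pi_def o.cl_eq by (simp add: Ph_diff)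

lemma pi_sum_eq: "(\<And>i. i \<in> I \<Longrightarrow> pi (f i) = pi (g i)) \<Longrightarrow> pi (\<Sum>i\<in>I. f i) = pi (\<Sum>i\<in>I. g i)"
  by (induction I rule: infinite_finite_induct) (simp_all add: pi_add)

lemma pi_sum: "finite I \<Longrightarrow> pi (\<Sum>i\<in>I. f i) = (\<Oplus>\<^bsub>S\<^esub>i\<in>I. pi (f i))"
  by (induction I rule: finite_induct) (simp_all add: pi_zero pi_add S.finsum_insert Pi_def)

lemma pi_st_st: "pi (st (st p)) = pi p"
  by (simp add: pi_star S.star_star)

lemma pi_st_cong: "pi p = pi q \<Longrightarrow> pi (st p) = pi (st q)"
  by (simp add: pi_star)

lemma pi_mult_cong: "pi p = pi q \<Longrightarrow> pi p' = pi q' \<Longrightarrow> pi (p * p') = pi (q * q')"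
  by (simp add: pi_mult)

lemma pi_add_cong: "pi p = pi q \<Longrightarrow> pi p' = pi q' \<Longrightarrow> pi (p + p') = pi (q + q')"
  by (simp add: pi_add)

end

lemma subst_fstar:
  assumes "\<And>x. f (x, True) = fstar (f (x, False))"
  shows "subst f (fstar q) = fstar (subst f q)"
proof (induction q rule: free_alg_induct')
  case (letter l)
  then show ?case
    using assms[of "fst l"] by (cases l; cases "snd l") (auto simp: fstar_single)
qed (simp_all add: fstar_add fstar_mult subst_add subst_mult)

text \<open>A representation is pulled back along a substitution by composing the letter operators.
  In this way it passes through the two nested levels of presentation, factors and free
  product.\<close>

lemma ev_subst:
  fixes f :: "'x \<times> bool \<Rightarrow> 'y free_star"
  assumes "letter_ops sc T"
  shows "ev_op sc T (subst f q) \<xi> = ev_op sc (\<lambda>l. ev_op sc T (f l)) q \<xi>"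
proof -
  interpret letter_ops sc T by fact
  interpret E: letter_ops sc "\<lambda>l. ev_op sc T (f l)"
    by standard (simp_all add: ev_add_right ev_sc)
  have m: "ev (prod_list (map f w)) \<xi> = foldr (\<lambda>l. ev_op sc T (f l)) w \<xi>" for w
    by (induction w) (simp_all add: ev_one ev_mult)
  have c: "ev (fconst c) \<xi> = sc c \<xi>" for c \<xi>
    by (simp add: fconst_def ev_fconst)
  show ?thesis
    by (induction q rule: free_alg_induct)
      (simp_all add: subst_add subst_single ev_add E.ev_add E.ev_single ev_mult m c)
qed

lemma ev_op_fconst: "letter_ops sc T \<Longrightarrow> ev_op sc T (fconst c) \<xi> = sc c \<xi>"
  by (simp add: fconst_def letter_ops.ev_fconst)

lemma ev_op_letter: "letter_ops sc T \<Longrightarrow> ev_op sc T (sgl [l] 1) \<xi> = T l \<xi>"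
  by (simp add: letter_ops.ev_single letter_ops_def vector_space_def module.scale_one)

context fp
begin

section \<open>The relations of the factors inside the free product\<close>

definition fsub :: "nat \<Rightarrow> (nat \<times> nat) \<times> bool \<Rightarrow> (nat \<times> (nat \<times> nat) free_star set) free_star" where
  "fsub p l = (case l of ((i, j), b) \<Rightarrow> if b then fstar (gg p i j) else gg p i j)"

lemma fsub_fstar: "subst (fsub p) (fstar q) = fstar (subst (fsub p) q)"
  by (rule subst_fstar) (auto simp: fsub_def split: prod.split)

lemma fsub_fgen: "subst (fsub p) (fgen (i, j)) = gg p i j"
  by (simp add: fgen_def fsub_def)

lemma fp_rels:
  assumes p: "p < length Fs"
  defines "A \<equiv> factor_alg (Fs ! p)" and "g \<equiv> (\<lambda>a. fgen (p, a))"
  shows "a \<in> carrier A \<Longrightarrow> b \<in> carrier A \<Longrightarrow> g (a \<oplus>\<^bsub>A\<^esub> b) - (g a + g b) \<in> free_product_rels As"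
    and "a \<in> carrier A \<Longrightarrow> g (c \<odot>\<^bsub>A\<^esub> a) - fconst c * g a \<in> free_product_rels As"
    and "a \<in> carrier A \<Longrightarrow> b \<in> carrier A \<Longrightarrow> g (a \<otimes>\<^bsub>A\<^esub> b) - g a * g b \<in> free_product_rels As"
    and "g \<one>\<^bsub>A\<^esub> - 1 \<in> free_product_rels As"
    and "a \<in> carrier A \<Longrightarrow> g (star A a) - fstar (g a) \<in> free_product_rels As"
proof -
  have Ap: "As ! p = A" using p by (simp add: A_def)
  have sub: "x \<in> {g (a \<oplus>\<^bsub>A\<^esub> b) - (g a + g b) |a b. a \<in> carrier A \<and> b \<in> carrier A} \<union>
     {g (c \<odot>\<^bsub>A\<^esub> a) - fconst c * g a |c a. a \<in> carrier A} \<union>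
     {g (a \<otimes>\<^bsub>A\<^esub> b) - g a * g b |a b. a \<in> carrier A \<and> b \<in> carrier A} \<union>
     {g \<one>\<^bsub>A\<^esub> - 1} \<union>
     {g (star A a) - fstar (g a) |a. a \<in> carrier A} \<Longrightarrow> x \<in> free_product_rels As" for x
    unfolding free_product_rels_def Let_def
    by (rule UN_I[of p]) (use p in \<open>simp\<close>, simp only: Ap g_def)
  show "a \<in> carrier A \<Longrightarrow> b \<in> carrier A \<Longrightarrow> g (a \<oplus>\<^bsub>A\<^esub> b) - (g a + g b) \<in> free_product_rels As"
    "a \<in> carrier A \<Longrightarrow> g (c \<odot>\<^bsub>A\<^esub> a) - fconst c * g a \<in> free_product_rels As"
    "a \<in> carrier A \<Longrightarrow> b \<in> carrier A \<Longrightarrow> g (a \<otimes>\<^bsub>A\<^esub> b) - g a * g b \<in> free_product_rels As"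
    "g \<one>\<^bsub>A\<^esub> - 1 \<in> free_product_rels As"
    "a \<in> carrier A \<Longrightarrow> g (star A a) - fstar (g a) \<in> free_product_rels As"
    by (rule sub; blast)+
qed

lemma clo_rel: "r - s \<in> free_product_rels As \<Longrightarrow> clo r = clo s"
  by (simp add: o.cl_eq o.rels_in)

lemma clf_ops:
  assumes p: "p < length Fs" and f: "f \<in> FR p"
    "f' \<in> FR p"
  shows "clf p (f + f') = clf p f \<oplus>\<^bsub>factor_alg (Fs ! p)\<^esub> clf p f'"
    "clf p (f * f') = clf p f \<otimes>\<^bsub>factor_alg (Fs ! p)\<^esub> clf p f'"
    "clf p (fconst c * f) = c \<odot>\<^bsub>factor_alg (Fs ! p)\<^esub> clf p f"
    "clf p 1 = \<one>\<^bsub>factor_alg (Fs ! p)\<^esub>"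
    "clf p (fstar f) = star (factor_alg (Fs ! p)) (clf p f)"
proof -
  interpret f: presentation "factor_gens (Fs ! p)" "factor_rels (Fs ! p)"
    by (rule presentation_factor)
  show "clf p (f + f') = clf p f \<oplus>\<^bsub>factor_alg (Fs ! p)\<^esub> clf p f'"
    "clf p (f * f') = clf p f \<otimes>\<^bsub>factor_alg (Fs ! p)\<^esub> clf p f'"
    "clf p (fconst c * f) = c \<odot>\<^bsub>factor_alg (Fs ! p)\<^esub> clf p f"
    "clf p 1 = \<one>\<^bsub>factor_alg (Fs ! p)\<^esub>"
    "clf p (fstar f) = star (factor_alg (Fs ! p)) (clf p f)"
    unfolding factor_alg_def using f
    by (simp_all add: f.add_cl f.mult_cl f.smult_cl f.one_cl f.star_cl)
qed

lemma fsub_carrier: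
  assumes p: "p < length Fs" and f: "f \<in> FR p"
  shows "subst (fsub p) f \<in> o.F"
  using f
proof (induction f rule: free_carrier_induct)
  case (gen x)
  then show ?case using p by (cases x) (auto simp: fsub_fgen factor_gens_def intro: gg_carrier)
next
  case (star x)
  then show ?case using p
    by (cases x) (auto simp: fsub_fgen fsub_fstar factor_gens_def intro: fstar_carrier gg_carrier)
qed (simp_all add: subst_add subst_mult free_carrier_add free_carrier_mult)

lemma clo_cong_add: "x \<in> o.F \<Longrightarrow> y \<in> o.F \<Longrightarrow> x' \<in> o.F \<Longrightarrow> y' \<in> o.F \<Longrightarrow>
    clo x = clo x' \<Longrightarrow> clo y = clo y' \<Longrightarrow> clo (x + y) = clo (x' + y')"
  by (metis o.add_cl)

lemma clo_cong_mult: "x \<in> o.F \<Longrightarrow> y \<in> o.F \<Longrightarrow> x' \<in> o.F \<Longrightarrow> y' \<in> o.F \<Longrightarrow>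
    clo x = clo x' \<Longrightarrow> clo y = clo y' \<Longrightarrow> clo (x * y) = clo (x' * y')"
  by (metis o.mult_cl)

lemma fgen_out: "p < length Fs \<Longrightarrow> f \<in> FR p \<Longrightarrow>
    fgen (p, clf p f) \<in> o.F"
  by (rule free_carrier_fgen) (simp add: free_product_gens_def clf_closed)

text \<open>A factor enters the free product through one generator per class. The homomorphism
  relations identify the generator of a polynomial's class with the polynomial in the generators of
  the entries, by induction on the polynomial.\<close>

lemma clo_ps:
  assumes p: "p < length Fs" and f: "f \<in> FR p"
  shows "clo (subst (fsub p) f) = clo (fgen (p, clf p f))"
  using f
proof (induction f rule: free_carrier_induct)
  case (const c)
  have o: "1 \<in> FR p" by simp
  have one: "clo (fgen (p, clf p 1)) = clo 1"
    unfolding clf_ops(4)[OF p o o] by (rule clo_rel[OF fp_rels(4)[OF p]])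
  have "clo (fgen (p, clf p (fconst c * 1))) = clo (fconst c * fgen (p, clf p 1))"
    unfolding clf_ops(3)[OF p o o] by (rule clo_rel[OF fp_rels(2)[OF p clf_closed[OF p o]]])
  also have "\<dots> = clo (fconst c * 1)"
    by (rule clo_cong_mult) (simp_all add: one fgen_out[OF p])
  finally show ?case by simp
next
  case (gen x)
  then show ?case by (cases x) (simp add: fsub_fgen gg_def)
next
  case (star x)
  have f: "fgen x \<in> FR p"
    using star by (rule free_carrier_fgen)
  have "clo (fgen (p, clf p (fstar (fgen x)))) = clo (fstar (fgen (p, clf p (fgen x))))"
    unfolding clf_ops(5)[OF p f f] by (rule clo_rel[OF fp_rels(5)[OF p clf_closed[OF p f]]])
  then show ?case by (cases x) (simp add: fsub_fstar fsub_fgen gg_def)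
next
  case (add f f')
  then have "clo (subst (fsub p) (f + f')) = clo (fgen (p, clf p f) + fgen (p, clf p f'))"
    by (simp add: subst_add clo_cong_add fsub_carrier[OF p] fgen_out[OF p])
  also have "\<dots> = clo (fgen (p, clf p (f + f')))"
    unfolding clf_ops(1)[OF p add(1,2)]
    by (rule clo_rel[OF fp_rels(1)[OF p clf_closed[OF p add(1)] clf_closed[OF p add(2)]], symmetric])
  finally show ?case .
next
  case (mult f f')
  then have "clo (subst (fsub p) (f * f')) = clo (fgen (p, clf p f) * fgen (p, clf p f'))"
    by (simp add: subst_mult clo_cong_mult fsub_carrier[OF p] fgen_out[OF p])
  also have "\<dots> = clo (fgen (p, clf p (f * f')))"
    unfolding clf_ops(2)[OF p mult(1,2)]
    by (rule clo_rel[OF fp_rels(3)[OF p clf_closed[OF p mult(1)] clf_closed[OF p mult(2)]], symmetric])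
  finally show ?case .
qed

lemma clo_factor_rel:
  assumes p: "p < length Fs" and r: "r \<in> factor_rels (Fs ! p)"
  shows "clo (subst (fsub p) r) = clo 0"
proof -
  interpret f: presentation "factor_gens (Fs ! p)" "factor_rels (Fs ! p)"
    by (rule presentation_factor)
  have "clf p r = clf p 0" using r by (simp add: f.cl_eq f.rels_in)
  then show ?thesis using clo_ps[OF p, of r] clo_ps[OF p, of 0] r f.R_sub by auto
qed

lemma fsub_entry:
  assumes "ok \<gamma>" "i < nn \<gamma>" "j < nn \<gamma>"
  shows "subst (fsub (fst \<gamma>)) (if snd \<gamma> then free_conj (fmat (Fs ! fst \<gamma>)) i j else fgen (i, j)) = Ph (lt \<gamma> i j)"
  using assms by (simp add: Ph_lt fsub_fgen free_conj_def subst_sum subst_mult fsub_fstar dm_def nn_def)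

lemma unitarity_in:
  assumes "ok \<gamma>"
  shows "unitarity_rels (nn \<gamma>) (\<lambda>i j. if snd \<gamma> then free_conj (fmat (Fs ! fst \<gamma>)) i j else fgen (i, j))
    \<subseteq> factor_rels (Fs ! fst \<gamma>)"
proof -
  have "Au_rels (fmat F) \<subseteq> factor_rels F" for F by (cases F) (auto simp: Ao_rels_def)
  then show ?thesis
    by (cases "snd \<gamma>") (auto simp: Au_rels_def nn_def)
qed

lemma unitary1:
  assumes "ok \<gamma>" "i < nn \<gamma>" "j < nn \<gamma>"
  shows "pi (\<Sum>k<nn \<gamma>. lt \<gamma> i k * st (lt \<gamma> j k)) = pi (if i = j then 1 else 0)"
proof -
  let ?v = "\<lambda>i j. if snd \<gamma> then free_conj (fmat (Fs ! fst \<gamma>)) i j else fgen (i, j)"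
  let ?r = "(\<Sum>k<nn \<gamma>. ?v i k * fstar (?v j k)) - (if i = j then 1 else 0)"
  have "?r \<in> unitarity_rels (nn \<gamma>) ?v" using assms unfolding unitarity_rels_def by blast
  then have "clo (subst (fsub (fst \<gamma>)) ?r) = clo 0"
    using unitarity_in[OF assms(1)] assms(1) by (intro clo_factor_rel) (auto simp: ok_def)
  moreover have "subst (fsub (fst \<gamma>)) ?r = Ph ((\<Sum>k<nn \<gamma>. lt \<gamma> i k * st (lt \<gamma> j k)) - (if i = j then 1 else 0))"
    using assms fsub_entry by (simp add: subst_diff subst_sum subst_mult fsub_fstar Ph_diff Ph_sum Ph_mult Ph_st)
  ultimately show ?thesis unfolding pi_def o.cl_eq by (simp only: Ph_diff diff_zero)
qed

lemma unitary2:
  assumes "ok \<gamma>" "i < nn \<gamma>" "j < nn \<gamma>"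
  shows "pi (\<Sum>k<nn \<gamma>. st (lt \<gamma> k i) * lt \<gamma> k j) = pi (if i = j then 1 else 0)"
proof -
  let ?v = "\<lambda>i j. if snd \<gamma> then free_conj (fmat (Fs ! fst \<gamma>)) i j else fgen (i, j)"
  let ?r = "(\<Sum>k<nn \<gamma>. fstar (?v k i) * ?v k j) - (if i = j then 1 else 0)"
  have "?r \<in> unitarity_rels (nn \<gamma>) ?v" using assms unfolding unitarity_rels_def by blast
  then have "clo (subst (fsub (fst \<gamma>)) ?r) = clo 0"
    using unitarity_in[OF assms(1)] assms(1) by (intro clo_factor_rel) (auto simp: ok_def)
  moreover have "subst (fsub (fst \<gamma>)) ?r = Ph ((\<Sum>k<nn \<gamma>. st (lt \<gamma> k i) * lt \<gamma> k j) - (if i = j then 1 else 0))"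
    using assms fsub_entry by (simp add: subst_diff subst_sum subst_mult fsub_fstar Ph_diff Ph_sum Ph_mult Ph_st)
  ultimately show ?thesis unfolding pi_def o.cl_eq by (simp only: Ph_diff diff_zero)
qed

text \<open>For factors of type \<open>Ao\<close> the two flags name the same elements, which is why
  both can be kept in the letters of every factor.\<close>

lemma Ao_self_conj:
  assumes "p < length Fs" "Fs ! p = Ao Q" "i < dim_row Q" "j < dim_row Q"
  shows "pi (lt (p, False) i j) = pi (lt (p, True) i j)"
proof -
  have "fgen (i, j) - free_conj Q i j \<in> factor_rels (Fs ! p)"
    using assms by (auto simp: Ao_rels_def)
  then have "clo (subst (fsub p) (fgen (i, j) - free_conj Q i j)) = clo 0"
    using assms(1) by (rule clo_factor_rel[rotated])
  moreover have "subst (fsub p) (fgen (i, j) - free_conj Q i j) = Ph (lt (p, False) i j) - Ph (lt (p, True) i j)"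
    using assms fsub_entry[of "(p, False)" i j] fsub_entry[of "(p, True)" i j]
    by (simp add: subst_diff ok_def nn_def)
  ultimately show ?thesis unfolding pi_def o.cl_eq by simp
qed

text \<open>Two nested generation arguments: the free product is generated by classes of factors,
  and each such class is that of a polynomial in entries.\<close>

lemma pi_surj: assumes "x \<in> carrier S" obtains p where "x = pi p"
proof -
  have gg: "gg p i j \<in> range Ph" if "p < length Fs" "i < fdim (Fs ! p)" "j < fdim (Fs ! p)" for p i j
    using Ph_lt[of "(p, False)" i j, symmetric] that by (simp add: ok_def nn_def)
  have inner: "subst (fsub p) f \<in> range Ph"
    if p: "p < length Fs" and "f \<in> FR p" for p f
    using that(2)
  proof (induction f rule: free_carrier_induct)
    case (const c)
    have "subst (fsub p) (fconst c) = Ph (fconst c)" by simp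
    then show ?case by blast
  next
    case (gen x)
    then show ?case using gg[OF p] by (cases x) (auto simp: fsub_fgen factor_gens_def)
  next
    case (star x)
    then have "subst (fsub p) (fgen x) \<in> range Ph"
      using gg[OF p] by (cases x) (auto simp: fsub_fgen factor_gens_def)
    then obtain q where "subst (fsub p) (fgen x) = Ph q" by blast
    then have "subst (fsub p) (fstar (fgen x)) = Ph (st q)" by (simp add: fsub_fstar Ph_st)
    then show ?case by blast
  next
    case (add f f')
    then obtain q r where "subst (fsub p) f = Ph q" "subst (fsub p) f' = Ph r" by blast
    then have "subst (fsub p) (f + f') = Ph (q + r)" by (simp add: subst_add Ph_add)
    then show ?case by blast
  next
    case (mult f f')
    then obtain q r where "subst (fsub p) f = Ph q" "subst (fsub p) f' = Ph r" by blast
    then have "subst (fsub p) (f * f') = Ph (q * r)" by (simp add: subst_mult Ph_mult)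
    then show ?case by blast
  qed
  have outer: "clo (fgen x) \<in> range pi" if x0: "x \<in> free_product_gens As" for x
  proof -
    obtain p a where "x = (p, a)" "p < length As" "a \<in> carrier (As ! p)"
      using x0 unfolding free_product_gens_def by blast
    then have x: "x = (p, a)" "p < length Fs" "a \<in> carrier (factor_alg (Fs ! p))"
      by simp_all
    then obtain f where f: "f \<in> FR p" "a = clf p f"
      unfolding factor_alg_def by (elim presentation.carrier_A_E[OF presentation_factor])
    moreover from inner[OF x(2) f(1)] obtain q where "subst (fsub p) f = Ph q" by blast
    ultimately have "clo (fgen x) = pi q" using clo_ps[OF x(2) f(1)] x(1) by (simp add: pi_def)
    then show ?thesis by blast
  qed
  have "clo y \<in> range pi" if "y \<in> o.F" for y
    using that
  proof (induction y rule: free_carrier_induct)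
    case (const c)
    have "clo (fconst c) = pi (fconst c)" by (simp add: pi_def)
    then show ?case by simp
  next
    case (gen x)
    then show ?case by (rule outer)
  next
    case (star x)
    then obtain q where "clo (fgen x) = pi q" using outer by blast
    then have "clo (fstar (fgen x)) = pi (st q)"
      unfolding pi_star S_eq by (simp add: o.star_cl[symmetric])
    then show ?case by simp
  next
    case (add y z)
    then obtain q r where "clo y = pi q" "clo z = pi r" by blast
    then have "clo (y + z) = pi (q + r)"
      unfolding pi_add S_eq using add(1,2) by (simp add: o.add_cl[symmetric])
    then show ?case by simp
  next
    case (mult y z)
    then obtain q r where "clo y = pi q" "clo z = pi r" by blast
    then have "clo (y * z) = pi (q * r)"
      unfolding pi_mult S_eq using mult(1,2) by (simp add: o.mult_cl[symmetric])
    then show ?case by simp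
  qed
  moreover from assms obtain y where "y \<in> o.F" "x = clo y"
    unfolding S_eq by (rule o.carrier_A_E)
  ultimately show ?thesis using that by auto
qed

lemma carrier_S: "carrier S = range pi"
  using pi_surj by blast

lemma pi_fund:
  assumes "p < length Fs" "i < fdim (Fs ! p)" "j < fdim (Fs ! p)"
  shows "fund Fs p i j = pi (lt (p, False) i j)"
  using assms Ph_lt[of "(p, False)" i j]
  by (simp add: pi_def fund_def free_product_inj_def gg_def ok_def nn_def)

lemma pi_dir:
  assumes "ok \<gamma>" "i < nn \<gamma>" "j < nn \<gamma>"
  shows "dir_corep Fs \<gamma> i j = pi (lt \<gamma> i j)"
proof (cases "snd \<gamma>")
  case False
  then have "\<gamma> = (fst \<gamma>, False)" by (metis prod.collapse)
  then show ?thesis using assms False pi_fund[of "fst \<gamma>" i j]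
    by (simp add: dir_corep_def ok_def nn_def)
next
  case True
  let ?p = "fst \<gamma>" let ?Q = "fmat (Fs ! fst \<gamma>)"
  have "pi (lt \<gamma> i j) = pi (\<Sum>k<nn \<gamma>. \<Sum>l<nn \<gamma>. fconst (?Q $$ (i, k) * inv_mat ?Q $$ (l, j)) * st (lt (?p, False) k l))"
    unfolding pi_def using assms True
    by (simp add: Ph_lt Ph_sum Ph_mult Ph_st dm_def)
      (simp add: Ph_lt ok_def nn_def)
  also have "\<dots> = (\<Oplus>\<^bsub>S\<^esub>k\<in>{..<nn \<gamma>}. \<Oplus>\<^bsub>S\<^esub>l\<in>{..<nn \<gamma>}.
       (?Q $$ (i, k) * inv_mat ?Q $$ (l, j)) \<odot>\<^bsub>S\<^esub> star S (pi (lt (?p, False) k l)))"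
    by (simp add: pi_sum pi_smult pi_star)
  also have "\<dots> = (\<Oplus>\<^bsub>S\<^esub>k\<in>{..<nn \<gamma>}. \<Oplus>\<^bsub>S\<^esub>l\<in>{..<nn \<gamma>}.
       (?Q $$ (i, k) * inv_mat ?Q $$ (l, j)) \<odot>\<^bsub>S\<^esub> star S (fund Fs ?p k l))"
    using assms by (intro S.finsum_cong' S.finsum_closed refl)
      (auto simp: pi_fund ok_def nn_def intro!: S.smult_closed S.star_closed S.finsum_closed S.finsum_cong')
  finally show ?thesis using True by (simp add: dir_corep_def fund_conj_def nn_def Let_def)
qed

section \<open>The universal property in terms of matrix entries\<close>

definition thsub :: "nat \<Rightarrow> (nat \<times> nat) \<times> bool \<Rightarrow> entry_alg" where
  "thsub p l = (case l of ((i, j), b) \<Rightarrow> if i < fdim (Fs ! p) \<and> j < fdim (Fs ! p)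
     then if b then st (lt (p, False) i j) else lt (p, False) i j else 0)"

lemma thsub_fstar:
  assumes "p < length Fs"
  shows "subst (thsub p) (fstar q) = st (subst (thsub p) q)"
proof (induction q rule: free_alg_induct')
  case (letter l)
  obtain i j b where l: "l = ((i, j), b)" by (metis prod.collapse)
  show ?case
    using assms st_st_lt[of "(p, False)" i j]
    by (cases b) (auto simp: l thsub_def fstar_single ok_def nn_def)
qed (simp_all add: fstar_add fstar_mult subst_add subst_mult st_add st_mult)

lemma thsub_fgen: "i < fdim (Fs ! p) \<Longrightarrow> j < fdim (Fs ! p) \<Longrightarrow>
    subst (thsub p) (fgen (i, j)) = lt (p, False) i j"
  by (simp add: fgen_def thsub_def)

lemma conj_expand:
  assumes "p < length Fs" "i < fdim (Fs ! p)" "j < fdim (Fs ! p)"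
  shows "lt (p, True) i j = (\<Sum>k<fdim (Fs ! p). \<Sum>l<fdim (Fs ! p).
      fconst (fmat (Fs ! p) $$ (i, k) * inv_mat (fmat (Fs ! p)) $$ (l, j)) * st (lt (p, False) k l))"
proof -
  have "lt (p, True) i j = st (st (lt (p, True) i j))"
    using assms by (simp add: st_st_lt ok_def nn_def)
  also have "\<dots> = (\<Sum>k<fdim (Fs ! p). \<Sum>l<fdim (Fs ! p).
      fconst (fmat (Fs ! p) $$ (i, k) * inv_mat (fmat (Fs ! p)) $$ (l, j)) * st (lt (p, False) k l))"
    using assms st_lt[of "(p, True)" i j]
    by (simp add: st_sum st_smult ok_def nn_def dm_def bar_def)
  finally show ?thesis .
qed

lemma thsub_conj:
  assumes "p < length Fs" "i < fdim (Fs ! p)" "j < fdim (Fs ! p)"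
  shows "subst (thsub p) (free_conj (fmat (Fs ! p)) i j) = lt (p, True) i j"
  using assms by (simp add: free_conj_def subst_sum subst_mult thsub_fstar thsub_fgen conj_expand)

lemma thsub_entry:
  assumes "ok \<gamma>" "i < nn \<gamma>" "j < nn \<gamma>"
  shows "subst (thsub (fst \<gamma>)) (if snd \<gamma> then free_conj (fmat (Fs ! fst \<gamma>)) i j else fgen (i, j)) = lt \<gamma> i j"
  using assms thsub_conj[of "fst \<gamma>" i j] thsub_fgen[of i "fst \<gamma>" j]
  by (cases \<gamma>; cases "snd \<gamma>") (auto simp: ok_def nn_def)

text \<open>The universal property of the free product, from which linear maps out of it are constructed.\<close>

lemma lift:
  assumes ops: "letter_ops sc T" and inv: "\<And>l \<xi>. \<not> vl l \<Longrightarrow> T l \<xi> = 0"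
    and u1: "\<And>\<gamma> i j \<xi>. ok \<gamma> \<Longrightarrow> i < nn \<gamma> \<Longrightarrow> j < nn \<gamma> \<Longrightarrow>
      ev_op sc T (\<Sum>k<nn \<gamma>. lt \<gamma> i k * st (lt \<gamma> j k)) \<xi> = (if i = j then \<xi> else 0)"
    and u2: "\<And>\<gamma> i j \<xi>. ok \<gamma> \<Longrightarrow> i < nn \<gamma> \<Longrightarrow> j < nn \<gamma> \<Longrightarrow>
      ev_op sc T (\<Sum>k<nn \<gamma>. st (lt \<gamma> k i) * lt \<gamma> k j) \<xi> = (if i = j then \<xi> else 0)"
    and ao1: "\<And>p Q i j \<xi>. p < length Fs \<Longrightarrow> Fs ! p = Ao Q \<Longrightarrow> i < dim_row Q \<Longrightarrow> j < dim_row Q \<Longrightarrow>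
      ev_op sc T (lt (p, False) i j) \<xi> = ev_op sc T (lt (p, True) i j) \<xi>"
    and ao2: "\<And>p Q i j \<xi>. p < length Fs \<Longrightarrow> Fs ! p = Ao Q \<Longrightarrow> i < dim_row Q \<Longrightarrow> j < dim_row Q \<Longrightarrow>
      ev_op sc T (st (lt (p, False) i j)) \<xi> = ev_op sc T (st (lt (p, True) i j)) \<xi>"
    and pq: "pi p = pi q"
  shows "ev_op sc T p \<xi> = ev_op sc T q \<xi>"
proof -
  interpret letter_ops sc T by fact
  have ev1: "ev_op sc (\<lambda>l. ev_op sc T (f l)) r = ev (subst f r)"
    for f :: "'y \<times> bool \<Rightarrow> entry_alg" and r
    by (rule ext) (simp add: ev_subst[OF ops])
  have ops1: "letter_ops sc (\<lambda>l. ev (f l))" for f :: "'y \<times> bool \<Rightarrow> entry_alg"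
    by standard (simp_all add: ev_add_right ev_sc)
  have lev1: "\<exists>\<Psi>. \<forall>f\<in>FR p. \<Psi> (clf p f) = ev (subst (thsub p) f)"
    if p: "p < length Fs" for p
  proof -
    interpret f: presentation "factor_gens (Fs ! p)" "factor_rels (Fs ! p)"
      by (rule presentation_factor)
    \<comment> \<open>The adjoint of a unitarity relation is the same relation with its two indices
      exchanged, so the adjoint relations cost nothing extra.\<close>
    have uni: "ev (subst (thsub p) r) \<xi> = 0 \<and> ev (subst (thsub p) (fstar r)) \<xi> = 0"
      if g: "fst \<gamma> = p"
        and "r \<in> unitarity_rels (nn \<gamma>) (\<lambda>i j. if snd \<gamma> then free_conj (fmat (Fs ! fst \<gamma>)) i j else fgen (i, j))"
      for r \<gamma> \<xi>
    proof -
      let ?v = "\<lambda>i j. if snd \<gamma> then free_conj (fmat (Fs ! fst \<gamma>)) i j else fgen (i, j)"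
      have ok: "ok \<gamma>" using g p by (simp add: ok_def)
      have v: "subst (thsub p) (?v i j) = lt \<gamma> i j" if "i < nn \<gamma>" "j < nn \<gamma>" for i j
        using thsub_entry[OF ok that] g by simp
      have d: "subst (thsub p) (if i = j then 1 else 0) = (if i = j then 1 else 0)" for i j :: nat
        by simp
      have d': "fstar (if i = j then 1 else 0) = (if j = i then 1 else 0)" for i j :: nat
        by simp
      have ed: "ev (if i = j then 1 else 0) \<xi> = (if i = j then \<xi> else 0)" for i j :: nat
        by (simp add: ev_one)
      from that(2) consider
          i j where "r = (\<Sum>k<nn \<gamma>. ?v i k * fstar (?v j k)) - (if i = j then 1 else 0)" "i < nn \<gamma>" "j < nn \<gamma>"
        | i j where "r = (\<Sum>k<nn \<gamma>. fstar (?v k i) * ?v k j) - (if i = j then 1 else 0)" "i < nn \<gamma>" "j < nn \<gamma>"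
        unfolding unitarity_rels_def by blast
      then show ?thesis
      proof cases
        case 1
        have "subst (thsub p) r = (\<Sum>k<nn \<gamma>. lt \<gamma> i k * st (lt \<gamma> j k)) - (if i = j then 1 else 0)"
          using 1(2,3) v unfolding 1(1) subst_diff subst_sum subst_mult thsub_fstar[OF p] d by simp
        moreover have "subst (thsub p) (fstar r) = (\<Sum>k<nn \<gamma>. lt \<gamma> j k * st (lt \<gamma> i k)) - (if j = i then 1 else 0)"
          using 1(2,3) v
          unfolding 1(1) fstar_diff fstar_sum fstar_mult fstar_fstar d' subst_diff subst_sum subst_mult
            thsub_fstar[OF p] d by simp
        ultimately show ?thesis using u1[OF ok] 1(2,3) by (simp only: ev_diff ed diff_self)
      next
        case 2
        have "subst (thsub p) r = (\<Sum>k<nn \<gamma>. st (lt \<gamma> k i) * lt \<gamma> k j) - (if i = j then 1 else 0)"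
          using 2(2,3) v unfolding 2(1) subst_diff subst_sum subst_mult thsub_fstar[OF p] d by simp
        moreover have "subst (thsub p) (fstar r) = (\<Sum>k<nn \<gamma>. st (lt \<gamma> k j) * lt \<gamma> k i) - (if j = i then 1 else 0)"
          using 2(2,3) v
          unfolding 2(1) fstar_diff fstar_sum fstar_mult fstar_fstar d' subst_diff subst_sum subst_mult
            thsub_fstar[OF p] d by simp
        ultimately show ?thesis using u2[OF ok] 2(2,3) by (simp only: ev_diff ed diff_self)
      qed
    qed
    have rel: "ev (subst (thsub p) r) \<xi> = 0 \<and> ev (subst (thsub p) (fstar r)) \<xi> = 0"
      if rr: "r \<in> factor_rels (Fs ! p)" for r \<xi>
    proof -
      have au: "ev (subst (thsub p) r) \<xi> = 0 \<and> ev (subst (thsub p) (fstar r)) \<xi> = 0"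
        if "r \<in> Au_rels (fmat (Fs ! p))"
        using that uni[of "(p, False)" r \<xi>] uni[of "(p, True)" r \<xi>]
        by (auto simp: Au_rels_def nn_def)
      show ?thesis
      proof (cases "Fs ! p")
        case (Au Q)
        then show ?thesis using au rr by simp
      next
        case (Ao Q)
        show ?thesis
        proof (cases "r \<in> Au_rels Q")
          case True
          then show ?thesis using au Ao by simp
        next
          case False
          then obtain i j where r: "r = fgen (i, j) - free_conj Q i j" "i < dim_row Q" "j < dim_row Q"
            using rr Ao by (auto simp: Ao_rels_def)
          have s: "subst (thsub p) r = lt (p, False) i j - lt (p, True) i j"
            using r p Ao thsub_fgen[of i p j] thsub_conj[of p i j] by (simp add: subst_diff)
          show ?thesis
            using ao1[OF p Ao r(2,3)] ao2[OF p Ao r(2,3)] unfolding thsub_fstar[OF p] s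
            by (simp add: ev_diff st_diff)
        qed
      qed
    qed
    show ?thesis
      using f.rep_lift[OF ops1[of "thsub p"]] rel by (simp add: ev1)
  qed
  define Psi where "Psi p = (SOME \<Psi>. \<forall>f\<in>FR p.
      \<Psi> (clf p f) = ev (subst (thsub p) f))" for p
  have Psi: "Psi p (clf p f) = ev (subst (thsub p) f)"
    if "p < length Fs" "f \<in> FR p" for p f
    using someI_ex[OF lev1[OF that(1)]] that(2) unfolding Psi_def by blast
  \<comment> \<open>The letters of the free product include adjoints of generators; such a letter
    has to act as the class of the adjoint element.\<close>
  define T2 where "T2 l = (case l of ((p, a), b) \<Rightarrow>
     if p < length Fs \<and> a \<in> carrier (factor_alg (Fs ! p))
     then Psi p (if b then star (factor_alg (Fs ! p)) a else a) else (\<lambda>_. 0))" for l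
  have rep: "\<exists>f\<in>FR p. a = clf p f"
    if "a \<in> carrier (factor_alg (Fs ! p))" for p a
    using that unfolding factor_alg_def by (blast elim: presentation.carrier_A_E[OF presentation_factor])
  have T2: "T2 ((p, clf p f), b) = ev (subst (thsub p) (if b then fstar f else f))"
    if "p < length Fs" "f \<in> FR p" for p f b
    using that Psi[of p f] Psi[of p "fstar f"] clf_closed[of p f]
    by (simp add: T2_def clf_ops[symmetric] fstar_carrier)
  have T2cases: "T2 l = (\<lambda>_. 0) \<or> (\<exists>x. T2 l = ev x)" for l
  proof -
    obtain p a b where l: "l = ((p, a), b)" by (metis prod.collapse)
    show ?thesis
    proof (cases "p < length Fs \<and> a \<in> carrier (factor_alg (Fs ! p))")
      case True
      then obtain f where "f \<in> FR p" "a = clf p f"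
        using rep by blast
      then show ?thesis using T2[of p f b] True l by blast
    qed (auto simp: T2_def l)
  qed
  have ops2: "letter_ops sc T2"
  proof (standard, goal_cases)
    case (1 l \<xi> \<eta>)
    then show ?case using T2cases[of l] by (auto simp: ev_add_right)
  next
    case (2 l c \<xi>)
    then show ?case using T2cases[of l] by (auto simp: ev_sc)
  qed
  interpret E2: letter_ops sc T2 by (rule ops2)
  have E2l: "E2.ev (fgen (p, clf p f)) \<xi> = ev (subst (thsub p) f) \<xi>"
    "E2.ev (fstar (fgen (p, clf p f))) \<xi> = ev (st (subst (thsub p) f)) \<xi>"
    if "p < length Fs" "f \<in> FR p" for p f \<xi>
    using T2[OF that, of True] T2[OF that, of False] thsub_fstar[OF that(1)]
    unfolding fgen_fstar unfolding fgen_def by (simp_all add: ev_op_letter[OF ops2])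
  have rel2: "E2.ev r \<xi> = 0 \<and> E2.ev (fstar r) \<xi> = 0" if r: "r \<in> free_product_rels As" for r \<xi>
  proof -
    obtain p where p: "p < length Fs" and r: "r \<in> (let A = factor_alg (Fs ! p); g = (\<lambda>a. fgen (p, a)) in
     {g (a \<oplus>\<^bsub>A\<^esub> b) - (g a + g b) |a b. a \<in> carrier A \<and> b \<in> carrier A} \<union>
     {g (c \<odot>\<^bsub>A\<^esub> a) - fconst c * g a |c a. a \<in> carrier A} \<union>
     {g (a \<otimes>\<^bsub>A\<^esub> b) - g a * g b |a b. a \<in> carrier A \<and> b \<in> carrier A} \<union>
     {g \<one>\<^bsub>A\<^esub> - 1} \<union>
     {g (star A a) - fstar (g a) |a. a \<in> carrier A})"
      using r unfolding free_product_rels_def by auto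
    let ?F = "FR p"
    note cl = clf_ops[OF p]
    note sm = free_carrier_add free_carrier_mult fstar_carrier
    let ?A = "factor_alg (Fs ! p)"
    consider
        a b where "a \<in> carrier ?A" "b \<in> carrier ?A" "r = fgen (p, a \<oplus>\<^bsub>?A\<^esub> b) - (fgen (p, a) + fgen (p, b))"
      | a c where "a \<in> carrier ?A" "r = fgen (p, c \<odot>\<^bsub>?A\<^esub> a) - fconst c * fgen (p, a)"
      | a b where "a \<in> carrier ?A" "b \<in> carrier ?A" "r = fgen (p, a \<otimes>\<^bsub>?A\<^esub> b) - fgen (p, a) * fgen (p, b)"
      | "r = fgen (p, \<one>\<^bsub>?A\<^esub>) - 1"
      | a where "a \<in> carrier ?A" "r = fgen (p, star ?A a) - fstar (fgen (p, a))"
      using r unfolding Let_def by blast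
    then show ?thesis
    proof cases
      case 1
      then obtain f f' where f: "f \<in> ?F" "f' \<in> ?F" "a = clf p f" "b = clf p f'" using rep by blast
      show ?thesis using f 1(3) by (simp add: cl(1)[OF f(1,2), symmetric] fstar_diff fstar_add E2.ev_diff E2.ev_add E2l p sm
            subst_add ev_add st_add)
    next
      case 2
      then obtain f where f: "f \<in> ?F" "a = clf p f" using rep by blast
      show ?thesis using f 2(2) by (simp add: cl(3)[OF f(1,1), symmetric] fstar_diff fstar_smult E2.ev_diff E2.ev_mult E2l p sm
            subst_mult ev_mult st_smult ev_op_fconst[OF ops] ev_op_fconst[OF ops2])
    next
      case 3
      then obtain f f' where f: "f \<in> ?F" "f' \<in> ?F" "a = clf p f" "b = clf p f'" using rep by blast
      show ?thesis using f 3(3) by (simp add: cl(2)[OF f(1,2), symmetric] fstar_diff fstar_mult E2.ev_diff E2.ev_mult E2l p sm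
            subst_mult ev_mult st_mult)
    next
      case 4
      then show ?thesis
        by (simp add: cl(4)[OF free_carrier_1 free_carrier_1, symmetric] fstar_diff E2.ev_diff E2l p E2.ev_one ev_one)
    next
      case 5
      then obtain f where f: "f \<in> ?F" "a = clf p f" using rep by blast
      have "st (st (subst (thsub p) f)) = subst (thsub p) f" by (metis fstar_fstar p thsub_fstar)
      then show ?thesis using f 5(2)
        by (simp add: cl(5)[OF f(1,1), symmetric] fstar_diff E2.ev_diff E2l p sm thsub_fstar)
    qed
  qed
  have "\<exists>\<Psi>. \<forall>x\<in>o.F. \<Psi> (clo x) = E2.ev x"
    by (rule o.rep_lift[OF ops2]) (use rel2 in auto)
  then obtain \<Psi> where \<Psi>: "\<And>x. x \<in> o.F \<Longrightarrow> \<Psi> (clo x) = E2.ev x" by blast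
  \<comment> \<open>On matrix entries the operators built from classes reduce to the given ones,
    which brings the result back to the entry algebra.\<close>
  have Tlo: "E2.ev (lo l) \<xi> = T l \<xi>" for l \<xi>
  proof (cases "vl l")
    case False
    then show ?thesis by (simp add: lo_def inv)
  next
    case True
    obtain p i j b where l: "l = ((p, i, j), b)" by (metis prod.collapse)
    have v: "p < length Fs" "i < fdim (Fs ! p)" "j < fdim (Fs ! p)" using True l by auto
    have g: "E2.ev (gg p k m) \<xi> = ev (lt (p, False) k m) \<xi>"
      "E2.ev (fstar (gg p k m)) \<xi> = ev (st (lt (p, False) k m)) \<xi>"
      if "k < fdim (Fs ! p)" "m < fdim (Fs ! p)" for k m \<xi>
    proof -
      have fm: "fgen (k, m) \<in> FR p"
        using that by (intro free_carrier_fgen) (simp add: factor_gens_def)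
      show "E2.ev (gg p k m) \<xi> = ev (lt (p, False) k m) \<xi>"
        "E2.ev (fstar (gg p k m)) \<xi> = ev (st (lt (p, False) k m)) \<xi>"
        unfolding gg_def E2l[OF v(1) fm] thsub_fgen[OF that] by (rule refl)+
    qed
    show ?thesis
    proof (cases b)
      case False
      then show ?thesis using v g ev_op_letter[OF ops, of l]
        by (simp add: lo_def l lt_def)
    next
      case b: True
      have "E2.ev (lo l) \<xi> = ev (lt (p, True) i j) \<xi>"
        unfolding conj_expand[OF v] using v g b
        by (simp add: lo_def l E2.ev_sum E2.ev_mult ev_sum ev_mult ev_op_fconst[OF ops] ev_op_fconst[OF ops2])
      then show ?thesis using ev_op_letter[OF ops, of l] b by (simp add: l lt_def)
    qed
  qed
  have "(\<lambda>l. E2.ev (lo l)) = T" by (intro ext) (rule Tlo)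
  then have "E2.ev (Ph x) = ev x" for x
    unfolding Ph_def by (intro ext) (simp add: ev_subst[OF ops2])
  then show ?thesis using \<Psi>[OF Ph_carrier] pq unfolding pi_def by metis
qed

end

section \<open>Sweedler decompositions\<close>

locale fp_bialg = fp +
  fixes \<delta> :: "fp_elem comult"
  assumes coprod: "fp_coproduct Fs \<delta>"
begin

abbreviation "SS \<equiv> tensor_square S"
abbreviation "clt \<equiv> presented_class (carrier S \<times> carrier S) (tensor_square_rels S)"

sublocale t: presentation "carrier S \<times> carrier S" "tensor_square_rels S"
  by (rule presentation_tensor_square[OF star_alg_fp])

lemma SS_eq: "SS = presented (carrier S \<times> carrier S) (tensor_square_rels S)"
  by (simp add: tensor_square_def)

definition tf :: "entry_alg \<Rightarrow> entry_alg \<Rightarrow> (fp_elem \<times> fp_elem) free_star" where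
  "tf a b = fgen (pi a, pi b)"

definition tsum :: "(entry_alg \<times> entry_alg) list \<Rightarrow> (fp_elem \<times> fp_elem) free_star" where
  "tsum ps = (\<Sum>(a, b)\<leftarrow>ps. tf a b)"

definition pmul :: "('z::times \<times> 'z) list \<Rightarrow> ('z \<times> 'z) list \<Rightarrow> ('z \<times> 'z) list" where
  "pmul ps qs = concat (map (\<lambda>(a, b). map (\<lambda>(a', b'). (a * a', b * b')) qs) ps)"

definition SW :: "entry_alg \<Rightarrow> (entry_alg \<times> entry_alg) list \<Rightarrow> bool" where
  "SW p ps \<longleftrightarrow> sweedler S \<delta> (pi p) (map (\<lambda>(a, b). (pi a, pi b)) ps)"

lemma tf_carrier: "tf a b \<in> t.F"
  unfolding tf_def by (rule free_carrier_fgen) simp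

lemma tsum_carrier: "tsum ps \<in> t.F"
  by (induction ps) (auto simp: tsum_def intro: free_carrier_add tf_carrier)

lemma tsum_Nil [simp]: "tsum [] = 0" and tsum_Cons: "tsum ((a, b) # ps) = tf a b + tsum ps"
  and tsum_append: "tsum (ps @ qs) = tsum ps + tsum qs"
  by (simp_all add: tsum_def)

lemma clt_cong_add: "x \<in> t.F \<Longrightarrow> y \<in> t.F \<Longrightarrow> x' \<in> t.F \<Longrightarrow> y' \<in> t.F \<Longrightarrow>
    clt x = clt x' \<Longrightarrow> clt y = clt y' \<Longrightarrow> clt (x + y) = clt (x' + y')"
  by (metis t.add_cl)

lemma clt_cong_mult: "x \<in> t.F \<Longrightarrow> y \<in> t.F \<Longrightarrow> x' \<in> t.F \<Longrightarrow> y' \<in> t.F \<Longrightarrow>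
    clt x = clt x' \<Longrightarrow> clt y = clt y' \<Longrightarrow> clt (x * y) = clt (x' * y')"
  by (metis t.mult_cl)

lemma clt_cong_sum: "(\<And>i. i \<in> I \<Longrightarrow> f i \<in> t.F) \<Longrightarrow> (\<And>i. i \<in> I \<Longrightarrow> g i \<in> t.F) \<Longrightarrow>
    (\<And>i. i \<in> I \<Longrightarrow> clt (f i) = clt (g i)) \<Longrightarrow> clt (\<Sum>i\<in>I. f i) = clt (\<Sum>i\<in>I. g i)"
  by (induction I rule: infinite_finite_induct) (simp_all add: clt_cong_add free_carrier_sum)

lemma SW_iff: "SW p ps \<longleftrightarrow> \<delta> (pi p) = clt (tsum ps)"
proof -
  have "pair_sum SS (elem_tensor S) (map (\<lambda>(a, b). (pi a, pi b)) ps) = clt (tsum ps)"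
  proof (induction ps)
    case Nil
    then show ?case by (simp add: pair_sum_def SS_eq t.zero_cl)
  next
    case (Cons x ps)
    obtain a b where x: "x = (a, b)" by (cases x)
    have "pair_sum SS (elem_tensor S) (map (\<lambda>(a, b). (pi a, pi b)) (x # ps))
      = clt (tf a b) \<oplus>\<^bsub>SS\<^esub> clt (tsum ps)"
      using Cons by (simp add: pair_sum_def x elem_tensor_def tf_def)
    then show ?case
      unfolding SS_eq by (simp add: x tsum_Cons t.add_cl tf_carrier tsum_carrier)
  qed
  then show ?thesis by (auto simp: SW_def sweedler_def)
qed

lemma clt_rel: "r - s \<in> tensor_square_rels S \<Longrightarrow> clt r = clt s"
  by (simp add: t.cl_eq t.rels_in)

lemma tf_add_left: "clt (tf (a + a') b) = clt (tf a b + tf a' b)"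
  and tf_add_right: "clt (tf a (b + b')) = clt (tf a b + tf a b')"
  and tf_smult_left: "clt (tf (fconst c * a) b) = clt (fconst c * tf a b)"
  and tf_smult_right: "clt (tf a (fconst c * b)) = clt (fconst c * tf a b)"
  and tf_mult: "clt (tf (a * a') (b * b')) = clt (tf a b * tf a' b')"
  and tf_one: "clt (tf 1 1) = clt 1"
  and tf_star: "clt (tf (st a) (st b)) = clt (fstar (tf a b))"
proof -
  note c = pi_closed
  have r1: "fgen (x \<oplus>\<^bsub>S\<^esub> x', y) - (fgen (x, y) + fgen (x', y)) \<in> tensor_square_rels S"
    if "x \<in> carrier S" "x' \<in> carrier S" "y \<in> carrier S" for x x' y
    using that unfolding tensor_square_rels_def Let_def by blast
  have r2: "fgen (x, y \<oplus>\<^bsub>S\<^esub> y') - (fgen (x, y) + fgen (x, y')) \<in> tensor_square_rels S"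
    if "x \<in> carrier S" "y' \<in> carrier S" "y \<in> carrier S" for x y' y
    using that unfolding tensor_square_rels_def Let_def by blast
  have r3: "fgen (c \<odot>\<^bsub>S\<^esub> x, y) - fconst c * fgen (x, y) \<in> tensor_square_rels S"
    if "x \<in> carrier S" "y \<in> carrier S" for c x y
    using that unfolding tensor_square_rels_def Let_def by blast
  have r4: "fgen (x, c \<odot>\<^bsub>S\<^esub> y) - fconst c * fgen (x, y) \<in> tensor_square_rels S"
    if "x \<in> carrier S" "y \<in> carrier S" for c x y
    using that unfolding tensor_square_rels_def Let_def by blast
  have r5: "fgen (x \<otimes>\<^bsub>S\<^esub> x', y \<otimes>\<^bsub>S\<^esub> y') - fgen (x, y) * fgen (x', y') \<in> tensor_square_rels S"
    if "x \<in> carrier S" "y \<in> carrier S" "x' \<in> carrier S" "y' \<in> carrier S" for x y x' y'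
    using that unfolding tensor_square_rels_def Let_def by blast
  have r6: "fgen (\<one>\<^bsub>S\<^esub>, \<one>\<^bsub>S\<^esub>) - 1 \<in> tensor_square_rels S"
    unfolding tensor_square_rels_def Let_def by blast
  have r7: "fgen (star S x, star S y) - fstar (fgen (x, y)) \<in> tensor_square_rels S"
    if "x \<in> carrier S" "y \<in> carrier S" for x y
    using that unfolding tensor_square_rels_def Let_def by blast
  show "clt (tf (a + a') b) = clt (tf a b + tf a' b)"
    unfolding tf_def pi_add by (rule clt_rel[OF r1[OF c c c]])
  show "clt (tf a (b + b')) = clt (tf a b + tf a b')"
    unfolding tf_def pi_add by (rule clt_rel[OF r2[OF c c c]])
  show "clt (tf (fconst c * a) b) = clt (fconst c * tf a b)"
    unfolding tf_def pi_smult by (rule clt_rel[OF r3[OF c c]])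
  show "clt (tf a (fconst c * b)) = clt (fconst c * tf a b)"
    unfolding tf_def pi_smult by (rule clt_rel[OF r4[OF c c]])
  show "clt (tf (a * a') (b * b')) = clt (tf a b * tf a' b')"
    unfolding tf_def pi_mult by (rule clt_rel[OF r5[OF c c c c]])
  show "clt (tf 1 1) = clt 1"
    unfolding tf_def pi_one by (rule clt_rel[OF r6])
  show "clt (tf (st a) (st b)) = clt (fstar (tf a b))"
    unfolding tf_def pi_star by (rule clt_rel[OF r7[OF c c]])
qed

lemma tf_sum_left: "finite I \<Longrightarrow> clt (tf (\<Sum>i\<in>I. a i) b) = clt (\<Sum>i\<in>I. tf (a i) b)"
proof (induction I rule: finite_induct)
  case empty
  show ?case using tf_smult_left[of 0 0 b] by simp
next
  case (insert x F)
  have "clt (tf (\<Sum>i\<in>insert x F. a i) b) = clt (tf (a x) b + tf (\<Sum>i\<in>F. a i) b)"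
    using insert by (simp add: tf_add_left)
  also have "\<dots> = clt (tf (a x) b + (\<Sum>i\<in>F. tf (a i) b))"
    using insert by (intro clt_cong_add) (simp_all add: tf_carrier free_carrier_sum)
  finally show ?case using insert by simp
qed

lemma tf_sum_right: "finite I \<Longrightarrow> clt (tf a (\<Sum>i\<in>I. b i)) = clt (\<Sum>i\<in>I. tf a (b i))"
proof (induction I rule: finite_induct)
  case empty
  show ?case using tf_smult_right[of a 0 0] by simp
next
  case (insert x F)
  have "clt (tf a (\<Sum>i\<in>insert x F. b i)) = clt (tf a (b x) + tf a (\<Sum>i\<in>F. b i))"
    using insert by (simp add: tf_add_right)
  also have "\<dots> = clt (tf a (b x) + (\<Sum>i\<in>F. tf a (b i)))"
    using insert by (intro clt_cong_add) (simp_all add: tf_carrier free_carrier_sum)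
  finally show ?case using insert by simp
qed

lemma delta_ops:
  shows "\<And>x y. x \<in> carrier S \<Longrightarrow> y \<in> carrier S \<Longrightarrow> \<delta> (x \<oplus>\<^bsub>S\<^esub> y) = \<delta> x \<oplus>\<^bsub>SS\<^esub> \<delta> y"
    and "\<And>x y. x \<in> carrier S \<Longrightarrow> y \<in> carrier S \<Longrightarrow> \<delta> (x \<otimes>\<^bsub>S\<^esub> y) = \<delta> x \<otimes>\<^bsub>SS\<^esub> \<delta> y"
    and "\<delta> \<one>\<^bsub>S\<^esub> = \<one>\<^bsub>SS\<^esub>"
    and "\<And>x. x \<in> carrier S \<Longrightarrow> \<delta> (star S x) = star SS (\<delta> x)"
    and "\<And>x c. x \<in> carrier S \<Longrightarrow> \<delta> (c \<odot>\<^bsub>S\<^esub> x) = c \<odot>\<^bsub>SS\<^esub> \<delta> x"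
  using coprod
  by (auto simp: fp_coproduct_def Let_def star_hom_def ring_hom_add ring_hom_mult ring_hom_one)

lemma SW_one: "SW 1 [(1, 1)]"
  unfolding SW_iff pi_one delta_ops(3) SS_eq t.one_cl by (simp add: tsum_Cons tf_one)

lemma SW_add: "SW p ps \<Longrightarrow> SW q qs \<Longrightarrow> SW (p + q) (ps @ qs)"
  unfolding SW_iff pi_add delta_ops(1)[OF pi_closed pi_closed]
  by (simp add: SS_eq t.add_cl tsum_carrier tsum_append)

lemma SW_smult: "SW p ps \<Longrightarrow> SW (fconst c * p) (map (\<lambda>(a, b). (fconst c * a, b)) ps)"
proof -
  assume p: "SW p ps"
  have "clt (fconst c * tsum ps) = clt (tsum (map (\<lambda>(a, b). (fconst c * a, b)) ps))"
  proof (induction ps)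
    case (Cons x ps)
    obtain a b where x: "x = (a, b)" by (cases x)
    have "clt (fconst c * tsum (x # ps)) = clt (fconst c * tf a b + fconst c * tsum ps)"
      by (simp add: x tsum_Cons distrib_left)
    also have "\<dots> = clt (tf (fconst c * a) b + tsum (map (\<lambda>(a, b). (fconst c * a, b)) ps))"
      using Cons
      by (intro clt_cong_add) (simp_all add: tf_smult_left free_carrier_mult tf_carrier tsum_carrier)
    finally show ?case by (simp add: x tsum_Cons)
  qed simp
  with p show ?thesis
    unfolding SW_iff pi_smult delta_ops(5)[OF pi_closed]
    by (simp add: SS_eq t.smult_cl tsum_carrier)
qed

lemma SW_mult: "SW p ps \<Longrightarrow> SW q qs \<Longrightarrow> SW (p * q) (pmul ps qs)"
proof -
  assume p: "SW p ps" "SW q qs"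
  have 1: "clt (tf a b * tsum qs) = clt (tsum (map (\<lambda>(a', b'). (a * a', b * b')) qs))" for a b
  proof (induction qs)
    case (Cons x ps)
    obtain a' b' where x: "x = (a', b')" by (cases x)
    have "clt (tf a b * tsum (x # ps)) = clt (tf a b * tf a' b' + tf a b * tsum ps)"
      by (simp add: x tsum_Cons distrib_left)
    also have "\<dots> = clt (tf (a * a') (b * b') + tsum (map (\<lambda>(a', b'). (a * a', b * b')) ps))"
      using Cons
      by (intro clt_cong_add) (simp_all add: tf_mult free_carrier_mult tf_carrier tsum_carrier)
    finally show ?case by (simp add: x tsum_Cons)
  qed simp
  have "clt (tsum ps * tsum qs) = clt (tsum (pmul ps qs))"
  proof (induction ps)
    case (Cons x ps)
    obtain a b where x: "x = (a, b)" by (cases x)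
    have "clt (tsum (x # ps) * tsum qs) = clt (tf a b * tsum qs + tsum ps * tsum qs)"
      by (simp add: x tsum_Cons distrib_right)
    also have "\<dots> = clt (tsum (map (\<lambda>(a', b'). (a * a', b * b')) qs) + tsum (pmul ps qs))"
      using Cons 1
      by (intro clt_cong_add) (simp_all add: free_carrier_mult tf_carrier tsum_carrier)
    finally show ?case by (simp add: x tsum_append pmul_def)
  qed (simp add: pmul_def)
  with p show ?thesis
    unfolding SW_iff pi_mult delta_ops(2)[OF pi_closed pi_closed]
    by (simp add: SS_eq t.mult_cl tsum_carrier)
qed

lemma SW_st: "SW p ps \<Longrightarrow> SW (st p) (map (\<lambda>(a, b). (st a, st b)) ps)"
proof -
  assume p: "SW p ps"
  have "clt (fstar (tsum ps)) = clt (tsum (map (\<lambda>(a, b). (st a, st b)) ps))"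
  proof (induction ps)
    case (Cons x ps)
    obtain a b where x: "x = (a, b)" by (cases x)
    have "clt (fstar (tsum (x # ps))) = clt (fstar (tf a b) + fstar (tsum ps))"
      by (simp add: x tsum_Cons fstar_add)
    also have "\<dots> = clt (tf (st a) (st b) + tsum (map (\<lambda>(a, b). (st a, st b)) ps))"
      using Cons
      by (intro clt_cong_add) (simp_all add: tf_star fstar_carrier tf_carrier tsum_carrier)
    finally show ?case by (simp add: x tsum_Cons)
  qed simp
  with p show ?thesis
    unfolding SW_iff pi_star delta_ops(4)[OF pi_closed] by (simp add: SS_eq t.star_cl)
qed

lemma SW_cong: "SW p ps \<Longrightarrow> pi p = pi q \<Longrightarrow> SW q ps"
  by (simp add: SW_iff)

lemma SW_sum:
  assumes "finite I" and "\<And>i. i \<in> I \<Longrightarrow> \<delta> (pi (f i)) = clt (g i)" "\<And>i. i \<in> I \<Longrightarrow> g i \<in> t.F"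
  shows "\<delta> (pi (\<Sum>i\<in>I. f i)) = clt (\<Sum>i\<in>I. g i)"
  using assms
proof (induction I rule: finite_induct)
  case empty
  show ?case using SW_smult[OF SW_one, of 0] tf_smult_left[of 0 0 1]
    by (simp add: SW_iff tsum_Cons)
next
  case (insert x F)
  then show ?case
    by (simp add: pi_add delta_ops(1) SS_eq t.add_cl free_carrier_sum)
qed

lemma tsum_map: "distinct ks \<Longrightarrow> tsum (map (\<lambda>k. (f k, g k)) ks) = (\<Sum>k\<in>set ks. tf (f k) (g k))"
  by (simp add: tsum_def o_def sum_list_distinct_conv_sum_set)

lemma SW_fund:
  assumes "p < length Fs" "i < fdim (Fs ! p)" "j < fdim (Fs ! p)"
  shows "\<delta> (pi (lt (p, False) i j)) = clt (\<Sum>k<fdim (Fs ! p). tf (lt (p, False) i k) (lt (p, False) k j))"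
proof -
  interpret SS: ring SS unfolding SS_eq by (rule t.ring_A)
  have f: "(\<Oplus>\<^bsub>SS\<^esub>k\<in>I. clt (f k)) = clt (\<Sum>k\<in>I. f k)"
    if "finite I" "\<And>k. k \<in> I \<Longrightarrow> f k \<in> t.F" for I :: "nat set" and f
    using that
  proof (induction I rule: finite_induct)
    case empty
    show ?case by (simp only: SS.finsum_empty sum.empty) (simp add: SS_eq t.zero_cl)
  next
    case (insert x F)
    have c: "clt (f k) \<in> carrier SS" if "k \<in> insert x F" for k
      unfolding SS_eq using insert(4) that t.cl_closed by blast
    have "(\<Oplus>\<^bsub>SS\<^esub>k\<in>insert x F. clt (f k)) = clt (f x) \<oplus>\<^bsub>SS\<^esub> (\<Oplus>\<^bsub>SS\<^esub>k\<in>F. clt (f k))"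
      using insert(1,2) c by (intro SS.finsum_insert) auto
    also have "\<dots> = clt (f x + (\<Sum>k\<in>F. f k))"
      using insert by (simp add: SS_eq t.add_cl free_carrier_sum)
    finally show ?case using insert by simp
  qed
  have "\<delta> (fund Fs p i j) =
      (\<Oplus>\<^bsub>SS\<^esub>k\<in>{..<fdim (Fs ! p)}. elem_tensor S (fund Fs p i k) (fund Fs p k j))"
    using coprod assms by (auto simp: fp_coproduct_def Let_def)
  also have "\<dots> = (\<Oplus>\<^bsub>SS\<^esub>k\<in>{..<fdim (Fs ! p)}. clt (tf (lt (p, False) i k) (lt (p, False) k j)))"
    using assms
    by (intro SS.finsum_cong') (auto simp: pi_fund elem_tensor_def tf_def SS_eq
        intro!: t.cl_closed free_carrier_fgen)
  also have "\<dots> = clt (\<Sum>k<fdim (Fs ! p). tf (lt (p, False) i k) (lt (p, False) k j))"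
    by (rule f) (auto intro: tf_carrier)
  finally show ?thesis using assms by (simp add: pi_fund)
qed

text \<open>For \<open>u\<close> this is the prescribed coproduct. For the conjugate direction it is
  transported through the star and the matrices Q and Q^-1.\<close>

lemma SW_lt:
  assumes "ok \<gamma>" "i < nn \<gamma>" "j < nn \<gamma>"
  shows "SW (lt \<gamma> i j) (map (\<lambda>k. (lt \<gamma> i k, lt \<gamma> k j)) [0..<nn \<gamma>])"
proof (cases "snd \<gamma>")
  case False
  then have "\<gamma> = (fst \<gamma>, False)" by (metis prod.collapse)
  with SW_fund[of "fst \<gamma>" i j] assms show ?thesis
    by (simp add: SW_iff tsum_map atLeast0LessThan ok_def nn_def)
next
  case True
  define p where "p = fst \<gamma>"
  define n where "n = nn \<gamma>"
  have g: "\<gamma> = (p, True)" using True by (metis p_def prod.collapse)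
  have p: "p < length Fs" and n: "fdim (Fs ! p) = n" and ij: "i < n" "j < n"
    using assms by (auto simp: p_def n_def ok_def nn_def)
  let ?Q = "\<lambda>i k. fmat (Fs ! p) $$ (i, k)" let ?R = "\<lambda>l j. inv_mat (fmat (Fs ! p)) $$ (l, j)"
  let ?u = "\<lambda>k l. st (lt (p, False) k l)"
  have v: "lt \<gamma> i j = (\<Sum>k<n. \<Sum>l<n. fconst (?Q i k * ?R l j) * ?u k l)" if "i < n" "j < n" for i j
    using conj_expand[OF p, of i j] that by (simp add: g n)
  have du: "\<delta> (pi (?u k l)) = clt (\<Sum>m<n. tf (?u k m) (?u m l))" if "k < n" "l < n" for k l
  proof -
    have "SW (lt (p, False) k l) (map (\<lambda>m. (lt (p, False) k m, lt (p, False) m l)) [0..<n])"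
      using SW_fund[OF p, of k l] that by (simp add: SW_iff tsum_map atLeast0LessThan n)
    from SW_st[OF this] show ?thesis by (simp add: SW_iff o_def tsum_map atLeast0LessThan)
  qed
  have s1: "\<delta> (pi (fconst c * x)) = clt (fconst c * y)" if "\<delta> (pi x) = clt y" "y \<in> t.F" for c x y
    using that by (simp add: pi_smult delta_ops(5) SS_eq t.smult_cl)
  have "\<delta> (pi (lt \<gamma> i j)) = clt (\<Sum>k<n. \<Sum>l<n. fconst (?Q i k * ?R l j) * (\<Sum>m<n. tf (?u k m) (?u m l)))"
    unfolding v[OF ij]
    by (intro SW_sum s1 du finite_lessThan)
       (auto intro!: free_carrier_sum free_carrier_mult tf_carrier)
  \<comment> \<open>The identity Q^-1 Q = 1 is inserted between the two legs, so that each leg can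
    be regrouped into an entry of the conjugate direction.\<close>
  also have "(\<Sum>k<n. \<Sum>l<n. fconst (?Q i k * ?R l j) * (\<Sum>m<n. tf (?u k m) (?u m l)))
    = (\<Sum>k<n. \<Sum>b<n. \<Sum>l<n. \<Sum>a<n. \<Sum>m<n. fconst (?Q i k * ?R l m * (?Q m a * ?R b j)) * tf (?u k l) (?u a b))"
  proof (rule sum.cong[OF refl], rule sum.cong[OF refl])
    fix k b assume kb: "k \<in> {..<n}" "b \<in> {..<n}"
    have "(\<Sum>l<n. \<Sum>a<n. \<Sum>m<n. fconst (?Q i k * ?R l m * (?Q m a * ?R b j)) * tf (?u k l) (?u a b))
      = (\<Sum>l<n. \<Sum>a<n. fconst (?Q i k * ?R b j * (\<Sum>m<n. ?R l m * ?Q m a)) * tf (?u k l) (?u a b))"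
      by (simp add: sum_distrib_left sum_distrib_right[symmetric] fconst_sum[symmetric] mult_ac)
    also have "\<dots> = (\<Sum>l<n. \<Sum>a<n. if a = l then fconst (?Q i k * ?R b j) * tf (?u k l) (?u a b) else 0)"
      using inv_mat_mult(2)[OF valid_nth[OF p]] by (intro sum.cong refl) (auto simp: n)
    also have "\<dots> = fconst (?Q i k * ?R b j) * (\<Sum>m<n. tf (?u k m) (?u m b))"
      by (simp add: sum_distrib_left)
    finally show "fconst (?Q i k * ?R b j) * (\<Sum>m<n. tf (?u k m) (?u m b)) =
      (\<Sum>l<n. \<Sum>a<n. \<Sum>m<n. fconst (?Q i k * ?R l m * (?Q m a * ?R b j)) * tf (?u k l) (?u a b))" ..
  qed
  also have "\<dots> = (\<Sum>m<n. \<Sum>k<n. \<Sum>l<n. \<Sum>a<n. \<Sum>b<n.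
      fconst (?Q i k * ?R l m) * (fconst (?Q m a * ?R b j) * tf (?u k l) (?u a b)))"
  proof -
    have sw: "(\<Sum>k<n. \<Sum>b<n. \<Sum>l<n. \<Sum>a<n. \<Sum>m<n. f k b l a m) = (\<Sum>m<n. \<Sum>k<n. \<Sum>l<n. \<Sum>a<n. \<Sum>b<n. f k b l a m)"
      for f :: "nat \<Rightarrow> nat \<Rightarrow> nat \<Rightarrow> nat \<Rightarrow> nat \<Rightarrow> (fp_elem \<times> fp_elem) free_star"
    proof -
      have "(\<Sum>k<n. \<Sum>b<n. \<Sum>l<n. \<Sum>a<n. \<Sum>m<n. f k b l a m) = (\<Sum>k<n. \<Sum>b<n. \<Sum>l<n. \<Sum>m<n. \<Sum>a<n. f k b l a m)"
        by (rule sum.cong[OF refl], rule sum.cong[OF refl], rule sum.cong[OF refl], rule sum.swap)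
      also have "\<dots> = (\<Sum>k<n. \<Sum>b<n. \<Sum>m<n. \<Sum>l<n. \<Sum>a<n. f k b l a m)"
        by (rule sum.cong[OF refl], rule sum.cong[OF refl], rule sum.swap)
      also have "\<dots> = (\<Sum>k<n. \<Sum>m<n. \<Sum>b<n. \<Sum>l<n. \<Sum>a<n. f k b l a m)"
        by (rule sum.cong[OF refl], rule sum.swap)
      also have "\<dots> = (\<Sum>m<n. \<Sum>k<n. \<Sum>b<n. \<Sum>l<n. \<Sum>a<n. f k b l a m)"
        by (rule sum.swap)
      also have "\<dots> = (\<Sum>m<n. \<Sum>k<n. \<Sum>l<n. \<Sum>b<n. \<Sum>a<n. f k b l a m)"
        by (rule sum.cong[OF refl], rule sum.cong[OF refl], rule sum.swap)
      also have "\<dots> = (\<Sum>m<n. \<Sum>k<n. \<Sum>l<n. \<Sum>a<n. \<Sum>b<n. f k b l a m)"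
        by (rule sum.cong[OF refl], rule sum.cong[OF refl], rule sum.cong[OF refl], rule sum.swap)
      finally show ?thesis .
    qed
    show ?thesis
      by (rule trans[OF sw], intro sum.cong refl) (simp add: mult.assoc[symmetric] fconst_mult[symmetric])
  qed
  also have "clt \<dots> = clt (\<Sum>m<n. tf (lt \<gamma> i m) (lt \<gamma> m j))"
  proof (intro clt_cong_sum)
    fix m assume m: "m \<in> {..<n}"
    have *: "clt (fconst c * x) = clt (fconst c * y)" if "clt x = clt y" "x \<in> t.F" "y \<in> t.F" for c x y
      using that by (intro clt_cong_mult) auto
    have "clt (tf (lt \<gamma> i m) (lt \<gamma> m j)) =
      clt (\<Sum>k<n. tf (\<Sum>l<n. fconst (?Q i k * ?R l m) * ?u k l) (lt \<gamma> m j))"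
      using m ij v[of i m] by (simp add: tf_sum_left)
    also have "\<dots> = clt (\<Sum>k<n. \<Sum>l<n. tf (fconst (?Q i k * ?R l m) * ?u k l) (lt \<gamma> m j))"
      by (intro clt_cong_sum) (simp_all add: tf_sum_left tf_carrier free_carrier_sum)
    also have "\<dots> = clt (\<Sum>k<n. \<Sum>l<n. fconst (?Q i k * ?R l m) * tf (?u k l) (lt \<gamma> m j))"
      by (intro clt_cong_sum) (simp_all add: tf_smult_left tf_carrier free_carrier_sum free_carrier_mult)
    also have "\<dots> = clt (\<Sum>k<n. \<Sum>l<n. fconst (?Q i k * ?R l m) *
        (\<Sum>a<n. tf (?u k l) (\<Sum>b<n. fconst (?Q m a * ?R b j) * ?u a b)))"
      using m ij v[of m j]
      by (intro clt_cong_sum *) (simp_all add: tf_sum_right tf_carrier free_carrier_sum free_carrier_mult)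
    also have "\<dots> = clt (\<Sum>k<n. \<Sum>l<n. fconst (?Q i k * ?R l m) *
        (\<Sum>a<n. \<Sum>b<n. tf (?u k l) (fconst (?Q m a * ?R b j) * ?u a b)))"
      by (intro clt_cong_sum *) (simp_all add: tf_sum_right tf_carrier free_carrier_sum free_carrier_mult)
    also have "\<dots> = clt (\<Sum>k<n. \<Sum>l<n. fconst (?Q i k * ?R l m) *
        (\<Sum>a<n. \<Sum>b<n. fconst (?Q m a * ?R b j) * tf (?u k l) (?u a b)))"
      by (intro clt_cong_sum *) (simp_all add: tf_smult_right tf_carrier free_carrier_sum free_carrier_mult)
    finally show "clt (\<Sum>k<n. \<Sum>l<n. \<Sum>a<n. \<Sum>b<n.
      fconst (?Q i k * ?R l m) * (fconst (?Q m a * ?R b j) * tf (?u k l) (?u a b)))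
      = clt (tf (lt \<gamma> i m) (lt \<gamma> m j))"
      by (simp only: sum_distrib_left)
  qed (auto intro!: free_carrier_sum free_carrier_mult tf_carrier)
  finally show ?thesis
    by (simp add: SW_iff tsum_map atLeast0LessThan n_def)
qed

end

section \<open>Complex Hilbert spaces\<close>

lemma scaleC_one [simp]: "1 *\<^sub>C x = x"
  using scaleC_of_real[of 1 x] by simp

lemma scaleC_zero_left [simp]: "0 *\<^sub>C x = 0"
  using scaleC_of_real[of 0 x] by simp

lemma scaleC_zero_right [simp]: "a *\<^sub>C 0 = 0"
  using scaleC_add_right[of a 0 0] by simp

lemma scaleC_minus_one: "(- 1) *\<^sub>C x = - x"
  using scaleC_of_real[of "-1" x] by simp

lemma scaleC_minus_left: "(- a) *\<^sub>C x = - (a *\<^sub>C x)"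
  by (metis add.right_inverse add_eq_0_iff scaleC_add_left scaleC_zero_left)

lemma scaleC_minus_right: "a *\<^sub>C (- x) = - (a *\<^sub>C x)"
  by (metis add.right_inverse add_eq_0_iff scaleC_add_right scaleC_zero_right)

lemma scaleC_diff_right: "a *\<^sub>C (x - y) = a *\<^sub>C x - a *\<^sub>C y"
  by (metis add_uminus_conv_diff scaleC_add_right scaleC_minus_right)

lemma scaleC_diff_left: "(a - b) *\<^sub>C x = a *\<^sub>C x - b *\<^sub>C x"
  by (metis add_uminus_conv_diff scaleC_add_left scaleC_minus_left)

lemma scaleC_sum_right: "a *\<^sub>C (\<Sum>i\<in>I. f i) = (\<Sum>i\<in>I. a *\<^sub>C f i)"
  by (induction I rule: infinite_finite_induct) (simp_all add: scaleC_add_right)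

lemma scaleC_sum_left: "(\<Sum>i\<in>I. f i) *\<^sub>C x = (\<Sum>i\<in>I. f i *\<^sub>C x)"
  by (induction I rule: infinite_finite_induct) (simp_all add: scaleC_add_left)

lemma scaleC_cancel: "a *\<^sub>C x = a *\<^sub>C y \<Longrightarrow> a \<noteq> 0 \<Longrightarrow> x = y"
  by (metis left_inverse scaleC_one scaleC_scaleC)

lemma scaleC_eq_0: "a *\<^sub>C x = 0 \<longleftrightarrow> a = 0 \<or> x = 0"
  by (metis scaleC_cancel scaleC_zero_left scaleC_zero_right)

lemma cinner_add_left: "cinner (x + y) z = cinner x z + cinner y z"
  by (metis cinner_add_right cinner_commute complex_cnj_add)

lemma cinner_scaleC_left: "cinner (a *\<^sub>C x) y = cnj a * cinner x y"
  by (metis cinner_commute cinner_scaleC_right complex_cnj_mult)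

lemma cinner_zero_right [simp]: "cinner x 0 = 0"
  using cinner_scaleC_right[of x 0 0] by simp

lemma cinner_zero_left [simp]: "cinner 0 x = 0"
  using cinner_scaleC_left[of 0 0 x] by simp

lemma cinner_minus_right: "cinner x (- y) = - cinner x y"
  by (metis cinner_scaleC_right mult_minus1 scaleC_minus_one)

lemma cinner_minus_left: "cinner (- x) y = - cinner x y"
  by (metis cinner_commute cinner_minus_right complex_cnj_minus)

lemma cinner_diff_right: "cinner x (y - z) = cinner x y - cinner x z"
  by (metis add_uminus_conv_diff cinner_add_right cinner_minus_right)

lemma cinner_diff_left: "cinner (x - y) z = cinner x z - cinner y z"
  by (metis add_uminus_conv_diff cinner_add_left cinner_minus_left)

lemma cinner_sum_left: "cinner (\<Sum>i\<in>I. f i) x = (\<Sum>i\<in>I. cinner (f i) x)"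
  by (induction I rule: infinite_finite_induct) (simp_all add: cinner_add_left)

lemma cinner_self: "cinner x x = of_real ((norm x)\<^sup>2)"
proof -
  have "Im (cinner x x) = 0"
    using cinner_commute[of x x] by (metis Im_complex_of_real Reals_cnj_iff complex_is_Real_iff)
  then show ?thesis
    by (simp add: complex_eq_iff Re_cinner power2_norm_eq_inner)
qed

lemma cinner_eq_zero_iff: "cinner x x = 0 \<longleftrightarrow> x = 0"
  by (simp add: cinner_self)

lemma Im_cinner: "Im (cinner x y) = - inner x (\<i> *\<^sub>C y)"
proof -
  have "inner x (\<i> *\<^sub>C y) = Re (\<i> * cinner x y)"
    by (simp add: Re_cinner[symmetric] cinner_scaleC_right)
  then show ?thesis by simp
qed

lemma cinner_complex: "cinner x y = Complex (inner x y) (- inner x (\<i> *\<^sub>C y))"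
  by (simp add: complex_eq_iff Re_cinner Im_cinner)

lemma norm_scaleC: "norm (a *\<^sub>C x) = cmod a * norm x"
proof -
  have "cinner (a *\<^sub>C x) (a *\<^sub>C x) = (a * cnj a) * cinner x x"
    by (simp add: cinner_scaleC_left cinner_scaleC_right)
  then have "complex_of_real ((norm (a *\<^sub>C x))\<^sup>2) = of_real ((cmod a * norm x)\<^sup>2)"
    unfolding cinner_self complex_norm_square[symmetric] by (simp add: power_mult_distrib)
  then have "(norm (a *\<^sub>C x))\<^sup>2 = (cmod a * norm x)\<^sup>2"
    unfolding of_real_eq_iff .
  then show ?thesis by (simp add: power2_eq_iff_nonneg)
qed

lemma scaleC_scaleR: "a *\<^sub>C (r *\<^sub>R x) = r *\<^sub>R (a *\<^sub>C x)"
  by (simp add: scaleC_of_real[symmetric] scaleC_scaleC mult.commute)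

lemma bounded_linear_scaleC: "bounded_linear (\<lambda>x. a *\<^sub>C x)"
  by (rule bounded_linear_intro[where K = "cmod a"])
     (simp_all add: scaleC_add_right scaleC_scaleR norm_scaleC mult.commute)

lemma bounded_linear_cinner_right: "bounded_linear (\<lambda>y. cinner x y)"
proof (rule bounded_linear_intro[where K = "2 * norm x"])
  fix y z r
  show "cinner x (y + z) = cinner x y + cinner x z" by (rule cinner_add_right)
  show "cinner x (r *\<^sub>R y) = r *\<^sub>R cinner x y"
    by (simp add: scaleC_of_real[symmetric] cinner_scaleC_right scaleR_conv_of_real)
  have "cmod (cinner x y) \<le> \<bar>inner x y\<bar> + \<bar>inner x (\<i> *\<^sub>C y)\<bar>"
    using cmod_le[of "cinner x y"] by (simp add: Re_cinner Im_cinner)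
  also have "\<dots> \<le> norm x * norm y + norm x * norm (\<i> *\<^sub>C y)"
    by (intro add_mono Cauchy_Schwarz_ineq2)
  finally show "cmod (cinner x y) \<le> norm y * (2 * norm x)"
    by (simp add: norm_scaleC mult_ac)
qed

lemma continuous_scaleC: "continuous_on UNIV (\<lambda>x. a *\<^sub>C x)"
  using bounded_linear_scaleC by (rule linear_continuous_on)

lemma continuous_on_scaleC [continuous_intros]:
  fixes f :: "'z::topological_space \<Rightarrow> 'h::complex_hilbert_space"
  shows "continuous_on X f \<Longrightarrow> continuous_on X (\<lambda>x. a *\<^sub>C f x)"
  by (rule bounded_linear.continuous_on[OF bounded_linear_scaleC])

lemma continuous_on_cinner_right [continuous_intros]:
  fixes f :: "'z::topological_space \<Rightarrow> 'h::complex_hilbert_space"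
  shows "continuous_on X f \<Longrightarrow> continuous_on X (\<lambda>x. cinner a (f x))"
  by (rule bounded_linear.continuous_on[OF bounded_linear_cinner_right])

lemma continuous_on_cinner_left [continuous_intros]:
  fixes f :: "'z::topological_space \<Rightarrow> 'h::complex_hilbert_space"
  assumes "continuous_on X f" shows "continuous_on X (\<lambda>x. cinner (f x) a)"
proof -
  have "continuous_on X (\<lambda>x. cnj (cinner a (f x)))"
    using assms by (intro continuous_intros)
  then show ?thesis by (simp add: cinner_commute[of _ a, symmetric])
qed

subsection \<open>Complex subspaces\<close>

definition csub :: "'h::complex_hilbert_space set \<Rightarrow> bool" where
  "csub M \<longleftrightarrow> 0 \<in> M \<and> (\<forall>x\<in>M. \<forall>y\<in>M. x + y \<in> M) \<and> (\<forall>c. \<forall>x\<in>M. c *\<^sub>C x \<in> M)"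

lemma csub_0: "csub M \<Longrightarrow> 0 \<in> M"
  and csub_add: "csub M \<Longrightarrow> x \<in> M \<Longrightarrow> y \<in> M \<Longrightarrow> x + y \<in> M"
  and csub_scaleC: "csub M \<Longrightarrow> x \<in> M \<Longrightarrow> c *\<^sub>C x \<in> M"
  by (auto simp: csub_def)

lemma csub_minus: "csub M \<Longrightarrow> x \<in> M \<Longrightarrow> - x \<in> M"
  by (metis csub_scaleC scaleC_minus_one)

lemma csub_diff: "csub M \<Longrightarrow> x \<in> M \<Longrightarrow> y \<in> M \<Longrightarrow> x - y \<in> M"
  by (metis add_uminus_conv_diff csub_add csub_minus)

lemma csub_sum: "csub M \<Longrightarrow> (\<And>i. i \<in> I \<Longrightarrow> f i \<in> M) \<Longrightarrow> (\<Sum>i\<in>I. f i) \<in> M"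
  by (induction I rule: infinite_finite_induct) (auto intro: csub_0 csub_add)

lemma csub_subspace: "csub M \<Longrightarrow> subspace M"
  by (simp add: subspace_def csub_0 csub_add) (metis csub_scaleC scaleC_of_real)

lemma cspan_csub: "csub (cspan A)"
proof -
  let ?G = "{c *\<^sub>C x |c x. x \<in> A}"
  have "c *\<^sub>C x \<in> span ?G" if "x \<in> span ?G" for c x
    using that
  proof (induction rule: span_induct_alt)
    case (step r x y)
    then obtain d z where "x = d *\<^sub>C z" "z \<in> A" by auto
    then have "c *\<^sub>C x \<in> span ?G"
      by (auto intro!: span_base exI[of _ "c * d"] simp: scaleC_scaleC)
    then show ?case using step
      by (simp add: scaleC_add_right scaleC_scaleR span_add span_scale)
  qed (simp add: span_zero)
  then show ?thesis unfolding csub_def cspan_def by (auto intro: span_zero span_add)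
qed

lemma cspan_base: "x \<in> A \<Longrightarrow> x \<in> cspan A"
  unfolding cspan_def by (intro span_base) (auto intro: exI[of _ 1])

lemma cspan_induct [consumes 1, case_names zero add scale base]:
  assumes "x \<in> cspan A" "P 0" "\<And>x y. x \<in> cspan A \<Longrightarrow> y \<in> cspan A \<Longrightarrow> P x \<Longrightarrow> P y \<Longrightarrow> P (x + y)"
    "\<And>c x. x \<in> cspan A \<Longrightarrow> P x \<Longrightarrow> P (c *\<^sub>C x)" "\<And>x. x \<in> A \<Longrightarrow> P x"
  shows "P x"
proof -
  have s: "{c *\<^sub>C x |c x. x \<in> A} \<subseteq> cspan A"
    by (auto intro: csub_scaleC cspan_csub cspan_base)
  have "x \<in> cspan A \<and> P x"
    using assms(1)[unfolded cspan_def]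
  proof (induction rule: span_induct_alt)
    case base
    then show ?case using assms(2) csub_0[OF cspan_csub] by simp
  next
    case (step c x y)
    then obtain d z where x: "x = d *\<^sub>C z" "z \<in> A" by auto
    then have "c *\<^sub>R x = of_real c *\<^sub>C (d *\<^sub>C z)" by (simp add: scaleC_of_real)
    then have "P (c *\<^sub>R x)" "c *\<^sub>R x \<in> cspan A"
      using assms(4,5) x(2) by (simp_all add: cspan_base csub_scaleC cspan_csub)
    then show ?case using step assms(3) by (simp add: csub_add cspan_csub)
  qed
  then show ?thesis by simp
qed

lemma cspan_minimal: "csub M \<Longrightarrow> A \<subseteq> M \<Longrightarrow> cspan A \<subseteq> M"
proof
  fix x assume "csub M" "A \<subseteq> M" "x \<in> cspan A"
  from this(3,1,2) show "x \<in> M"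
    by (induction rule: cspan_induct) (auto intro: csub_0 csub_add csub_scaleC)
qed

lemma cspan_mono: "A \<subseteq> B \<Longrightarrow> cspan A \<subseteq> cspan B"
  by (rule cspan_minimal[OF cspan_csub]) (auto intro: cspan_base)

lemma cspan_csub_eq: "csub M \<Longrightarrow> cspan M = M"
  by (auto intro: cspan_base dest: cspan_minimal[of M M])

lemma subspace_closure:
  fixes G :: "'x::real_normed_vector set"
  assumes G: "subspace G"
  shows "subspace (closure G)"
proof (rule subspaceI)
  show "0 \<in> closure G" using subspace_0[OF G] closure_subset by blast
  show "x + y \<in> closure G" if xy: "x \<in> closure G" "y \<in> closure G" for x y
  proof -
    obtain f g where f: "\<And>n. f n \<in> G" "f \<longlonglongrightarrow> x" and g: "\<And>n. g n \<in> G" "g \<longlonglongrightarrow> y"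
      using xy unfolding closure_sequential by blast
    show ?thesis unfolding closure_sequential
      by (rule exI[of _ "\<lambda>n. f n + g n"]) (use f g G in \<open>auto intro: subspace_add tendsto_add\<close>)
  qed
  show "c *\<^sub>R x \<in> closure G" if "x \<in> closure G" for c x
    using image_closure_subset[of G "(*\<^sub>R) c" "closure G"] subspace_scale[OF G] closure_subset that
    by (force intro: continuous_intros)
qed

lemma csub_closure: "csub M \<Longrightarrow> csub (closure M)"
proof -
  assume M: "csub M"
  have "(*\<^sub>C) c ` closure M \<subseteq> closure M" for c
  proof (rule image_closure_subset)
    show "continuous_on (closure M) ((*\<^sub>C) c)" by (rule continuous_on_subset[OF continuous_scaleC]) simp
    show "(*\<^sub>C) c ` M \<subseteq> closure M" using csub_scaleC[OF M] closure_subset by blast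
  qed simp
  then show ?thesis
    using subspace_closure[OF csub_subspace[OF M]] by (auto simp: csub_def subspace_def)
qed

section \<open>Words of matrix entries\<close>

lemma sum_list_sum: "(\<Sum>x\<leftarrow>xs. \<Sum>k\<in>K. f x k) = (\<Sum>k\<in>K. \<Sum>x\<leftarrow>xs. f x k)"
  for f :: "'y \<Rightarrow> 'k \<Rightarrow> 'z::comm_monoid_add"
  by (induction xs) (simp_all add: sum.distrib)

locale fp_hopf = fp_bialg +
  fixes \<epsilon> :: "fp_elem \<Rightarrow> complex" and \<kappa> :: "fp_elem \<Rightarrow> fp_elem" and h :: "fp_elem \<Rightarrow> complex"
    and \<Lambda> :: "fp_elem \<Rightarrow> 'h::complex_hilbert_space"
  assumes counit: "counit S \<delta> \<epsilon>" and antipode: "antipode S \<delta> \<epsilon> \<kappa>"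
    and haar: "haar_state S \<delta> h" and gns: "gns_map S h \<Lambda>"
begin

definition hh :: "entry_alg \<Rightarrow> complex" where "hh p = h (pi p)"
definition L :: "entry_alg \<Rightarrow> 'h" where "L p = \<Lambda> (pi p)"

lemma hh_cong: "pi p = pi q \<Longrightarrow> hh p = hh q" by (simp add: hh_def)
lemma L_cong: "pi p = pi q \<Longrightarrow> L p = L q" by (simp add: L_def)

lemma hh_add: "hh (p + q) = hh p + hh q" and hh_smult: "hh (fconst c * p) = c * hh p"
  and hh_one: "hh 1 = 1"
  using haar by (auto simp: hh_def pi_add pi_smult pi_one haar_state_def linear_form_def)

lemma L_add: "L (p + q) = L p + L q" and L_smult: "L (fconst c * p) = c *\<^sub>C L p"
  using gns by (auto simp: L_def pi_add pi_smult gns_map_def linear_to_hilbert_def)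

lemma L_inner: "cinner (L p) (L q) = hh (st p * q)"
  using gns by (auto simp: L_def hh_def pi_star pi_mult gns_map_def)

lemma hh_fconst: "hh (fconst c) = c" using hh_smult[of c 1] by (simp add: hh_one)
lemma hh_zero [simp]: "hh 0 = 0" using hh_fconst[of 0] by simp
lemma hh_minus: "hh (- p) = - hh p" using hh_smult[of "-1" p] by (simp add: fconst_minus)
lemma hh_diff: "hh (p - q) = hh p - hh q" using hh_add[of p "- q"] by (simp add: hh_minus)
lemma hh_sum: "hh (\<Sum>i\<in>I. f i) = (\<Sum>i\<in>I. hh (f i))"
  by (induction I rule: infinite_finite_induct) (simp_all add: hh_add)
lemma hh_sum_list: "hh (\<Sum>i\<leftarrow>xs. f i) = (\<Sum>i\<leftarrow>xs. hh (f i))"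
  by (induction xs) (simp_all add: hh_add)

lemma L_zero [simp]: "L 0 = 0" using L_smult[of 0 0] by simp
lemma L_minus: "L (- p) = - L p" using L_smult[of "-1" p] by (simp add: fconst_minus scaleC_minus_one)
lemma L_diff: "L (p - q) = L p - L q" using L_add[of p "- q"] by (simp add: L_minus)
lemma L_sum: "L (\<Sum>i\<in>I. f i) = (\<Sum>i\<in>I. L (f i))"
  by (induction I rule: infinite_finite_induct) (simp_all add: L_add)
lemma hh_st: "hh (st p) = cnj (hh p)"
proof -
  have "hh (st p * 1) = cinner (L p) (L 1)" by (rule L_inner[symmetric])
  also have "\<dots> = cnj (cinner (L 1) (L p))" by (rule cinner_commute)
  finally show ?thesis by (simp add: L_inner)
qed

lemma pair_sum_pi:
  assumes "\<And>a b. f (pi a) (pi b) = pi (F a b)"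
  shows "pair_sum S f (map (\<lambda>(a, b). (pi a, pi b)) ps) = pi (\<Sum>(a, b)\<leftarrow>ps. F a b)"
  by (induction ps) (auto simp: pair_sum_def pi_zero pi_add assms)

lemma haar_left: "SW p ps \<Longrightarrow> pi (\<Sum>(a, b)\<leftarrow>ps. fconst (hh a) * b) = pi (fconst (hh p))"
  and haar_right: "SW p ps \<Longrightarrow> pi (\<Sum>(a, b)\<leftarrow>ps. fconst (hh b) * a) = pi (fconst (hh p))"
proof -
  have e: "pi (fconst (hh p)) = h (pi p) \<odot>\<^bsub>S\<^esub> \<one>\<^bsub>S\<^esub>"
    using pi_smult[of "hh p" 1] by (simp add: hh_def pi_one)
  show "SW p ps \<Longrightarrow> pi (\<Sum>(a, b)\<leftarrow>ps. fconst (hh a) * b) = pi (fconst (hh p))"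
    using haar unfolding SW_def haar_state_def e
    by (subst pair_sum_pi[symmetric, of "\<lambda>a b. h a \<odot>\<^bsub>S\<^esub> b"]) (auto simp: pi_smult hh_def)
  show "SW p ps \<Longrightarrow> pi (\<Sum>(a, b)\<leftarrow>ps. fconst (hh b) * a) = pi (fconst (hh p))"
    using haar unfolding SW_def haar_state_def e
    by (subst pair_sum_pi[symmetric, of "\<lambda>a b. h b \<odot>\<^bsub>S\<^esub> a"]) (auto simp: pi_smult hh_def)
qed

lemma counit_left: "SW p ps \<Longrightarrow> pi (\<Sum>(a, b)\<leftarrow>ps. fconst (\<epsilon> (pi a)) * b) = pi p"
  and counit_right: "SW p ps \<Longrightarrow> pi (\<Sum>(a, b)\<leftarrow>ps. fconst (\<epsilon> (pi b)) * a) = pi p"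
proof -
  show "SW p ps \<Longrightarrow> pi (\<Sum>(a, b)\<leftarrow>ps. fconst (\<epsilon> (pi a)) * b) = pi p"
    using counit unfolding SW_def counit_def
    by (subst pair_sum_pi[symmetric, of "\<lambda>a b. \<epsilon> a \<odot>\<^bsub>S\<^esub> b"]) (auto simp: pi_smult)
  show "SW p ps \<Longrightarrow> pi (\<Sum>(a, b)\<leftarrow>ps. fconst (\<epsilon> (pi b)) * a) = pi p"
    using counit unfolding SW_def counit_def
    by (subst pair_sum_pi[symmetric, of "\<lambda>a b. \<epsilon> b \<odot>\<^bsub>S\<^esub> a"]) (auto simp: pi_smult)
qed

text \<open>A chosen representative of the antipode, needed until \<open>kappa_pi\<close> shows that
  \<open>kk\<close> computes it.\<close>

definition K :: "entry_alg \<Rightarrow> entry_alg" where "K p = (SOME q. pi q = \<kappa> (pi p))"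

lemma pi_K: "pi (K p) = \<kappa> (pi p)"
proof -
  have "\<kappa> (pi p) \<in> carrier S" using antipode by (auto simp: antipode_def linear_endo_def)
  then have "\<exists>q. pi q = \<kappa> (pi p)" by (metis pi_surj)
  then show ?thesis unfolding K_def by (rule someI_ex)
qed

lemma K_left: "SW p ps \<Longrightarrow> pi (\<Sum>(a, b)\<leftarrow>ps. K a * b) = pi (fconst (\<epsilon> (pi p)))"
proof -
  have e: "pi (fconst (\<epsilon> (pi p))) = \<epsilon> (pi p) \<odot>\<^bsub>S\<^esub> \<one>\<^bsub>S\<^esub>"
    using pi_smult[of "\<epsilon> (pi p)" 1] by (simp add: pi_one)
  show "SW p ps \<Longrightarrow> pi (\<Sum>(a, b)\<leftarrow>ps. K a * b) = pi (fconst (\<epsilon> (pi p)))"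
    using antipode unfolding SW_def antipode_def e
    by (subst pair_sum_pi[symmetric, of "\<lambda>a b. \<kappa> a \<otimes>\<^bsub>S\<^esub> b"]) (auto simp: pi_mult pi_K)
qed

lemma kappa_linear: "\<kappa> (pi (p + q)) = \<kappa> (pi p) \<oplus>\<^bsub>S\<^esub> \<kappa> (pi q)" "\<kappa> (pi (fconst c * p)) = c \<odot>\<^bsub>S\<^esub> \<kappa> (pi p)"
  using antipode by (auto simp: antipode_def linear_endo_def pi_add pi_smult)

lemma eps_linear: "\<epsilon> (pi (p + q)) = \<epsilon> (pi p) + \<epsilon> (pi q)" "\<epsilon> (pi (fconst c * p)) = c * \<epsilon> (pi p)"
  using counit by (auto simp: counit_def linear_form_def pi_add pi_smult)

lemma pi_sum_list_cong: "(\<And>x. x \<in> set xs \<Longrightarrow> pi (f x) = pi (g x)) \<Longrightarrow>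
    pi (\<Sum>x\<leftarrow>xs. f x) = pi (\<Sum>x\<leftarrow>xs. g x)"
  by (induction xs) (simp_all add: pi_add)

lemma pi_mult_cong_left: "pi p = pi q \<Longrightarrow> pi (p * r) = pi (q * r)" by (simp add: pi_mult)
lemma pi_mult_cong_right: "pi p = pi q \<Longrightarrow> pi (r * p) = pi (r * q)" by (simp add: pi_mult)

text \<open>Finite-dimensional unitary corepresentations, with identities modulo \<open>pi\<close>.
  The index set is a list because it also enumerates the terms of a Sweedler decomposition.\<close>

definition ucorep :: "'i list \<Rightarrow> ('i \<Rightarrow> 'i \<Rightarrow> entry_alg) \<Rightarrow> bool" where
  "ucorep I a \<longleftrightarrow> distinct I \<and>
     (\<forall>i\<in>set I. \<forall>j\<in>set I. SW (a i j) (map (\<lambda>k. (a i k, a k j)) I) \<and>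
        pi (\<Sum>k\<in>set I. a i k * st (a j k)) = pi (if i = j then 1 else 0) \<and>
        pi (\<Sum>k\<in>set I. st (a k i) * a k j) = pi (if i = j then 1 else 0))"

lemma ucorep_lt: "ok \<gamma> \<Longrightarrow> ucorep [0..<nn \<gamma>] (lt \<gamma>)"
  using SW_lt unitary1 unitary2 by (simp add: ucorep_def atLeast0LessThan)

lemma ucorepD:
  assumes "ucorep I a"
  shows "distinct I"
    and "\<And>i j. i \<in> set I \<Longrightarrow> j \<in> set I \<Longrightarrow> SW (a i j) (map (\<lambda>k. (a i k, a k j)) I)"
    and "\<And>i j. i \<in> set I \<Longrightarrow> j \<in> set I \<Longrightarrow>
      pi (\<Sum>k\<in>set I. a i k * st (a j k)) = pi (if i = j then 1 else 0)"
    and "\<And>i j. i \<in> set I \<Longrightarrow> j \<in> set I \<Longrightarrow>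
      pi (\<Sum>k\<in>set I. st (a k i) * a k j) = pi (if i = j then 1 else 0)"
  using assms by (simp_all add: ucorep_def)

lemma SW_sum_I:
  fixes f :: "_ \<Rightarrow> _ \<Rightarrow> 'z::comm_monoid_add"
  assumes "ucorep I a" "i \<in> set I" "j \<in> set I"
  shows "(\<Sum>(x, y)\<leftarrow>map (\<lambda>k. (a i k, a k j)) I. f x y) = (\<Sum>k\<in>set I. f (a i k) (a k j))"
  using assms by (simp add: o_def ucorep_def sum_list_distinct_conv_sum_set)

text \<open>Right multiplication by a unitary matrix is undone by its adjoint. Counit, antipode and
  Haar values of entries are all found by solving such an equation.\<close>

lemma ucorep_cancel:
  assumes a: "ucorep I a" and "\<And>j. j \<in> set I \<Longrightarrow> pi (\<Sum>k\<in>set I. x k * a k j) = pi (y j)" and "l \<in> set I"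
  shows "pi (x l) = pi (\<Sum>j\<in>set I. y j * st (a l j))"
proof -
  have "pi (\<Sum>j\<in>set I. y j * st (a l j)) = pi (\<Sum>j\<in>set I. (\<Sum>k\<in>set I. x k * a k j) * st (a l j))"
    by (rule pi_sum_eq, rule pi_mult_cong_left, rule assms(2)[symmetric])
  also have "(\<Sum>j\<in>set I. (\<Sum>k\<in>set I. x k * a k j) * st (a l j)) =
      (\<Sum>k\<in>set I. x k * (\<Sum>j\<in>set I. a k j * st (a l j)))"
    unfolding sum_distrib_right sum_distrib_left mult.assoc by (rule sum.swap)
  also have "pi \<dots> = pi (\<Sum>k\<in>set I. x k * (if k = l then 1 else 0))"
    using ucorepD(3)[OF a _ assms(3)] by (intro pi_sum_eq pi_mult_cong_right)
  also have "(\<Sum>k\<in>set I. x k * (if k = l then 1 else 0)) = x l"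
    using assms(3) by (simp add: if_distrib cong: if_cong)
  finally show ?thesis ..
qed

text \<open>By the counit axiom the scalar matrix of counits fixes \<open>a\<close> under left
  multiplication, so it must be the identity.\<close>

lemma ucorep_eps:
  assumes a: "ucorep I a" "i \<in> set I" "l \<in> set I"
  shows "\<epsilon> (pi (a i l)) = (if i = l then 1 else 0)"
proof -
  have "pi (fconst (\<epsilon> (pi (a i l)))) = pi (\<Sum>j\<in>set I. a i j * st (a l j))"
  proof (rule ucorep_cancel[OF a(1) _ a(3), of "\<lambda>k. fconst (\<epsilon> (pi (a i k)))"])
    fix j assume j: "j \<in> set I"
    show "pi (\<Sum>k\<in>set I. fconst (\<epsilon> (pi (a i k))) * a k j) = pi (a i j)"
      using counit_left[OF ucorepD(2)[OF a(1,2) j]] unfolding SW_sum_I[OF a(1,2) j] .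
  qed
  also have "\<dots> = pi (fconst (if i = l then 1 else 0))"
    using ucorepD(3)[OF a] by (simp split: if_splits)
  finally show ?thesis by (drule_tac hh_cong) (simp only: hh_fconst)
qed

text \<open>The antipode axiom makes the matrix of antipodes a left inverse of \<open>a\<close>, and
  the adjoint is one too.\<close>

lemma ucorep_K:
  assumes a: "ucorep I a" "i \<in> set I" "l \<in> set I"
  shows "\<kappa> (pi (a i l)) = pi (st (a l i))"
proof -
  have "pi (K (a i l)) = pi (\<Sum>j\<in>set I. (if i = j then 1 else 0) * st (a l j))"
  proof (rule ucorep_cancel[OF a(1) _ a(3), of "\<lambda>k. K (a i k)"])
    fix j assume j: "j \<in> set I"
    have "pi (\<Sum>k\<in>set I. K (a i k) * a k j) = pi (fconst (if i = j then 1 else 0))"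
      using K_left[OF ucorepD(2)[OF a(1,2) j]] unfolding SW_sum_I[OF a(1,2) j] ucorep_eps[OF a(1,2) j] .
    then show "pi (\<Sum>k\<in>set I. K (a i k) * a k j) = pi (if i = j then 1 else 0)"
      by (simp split: if_splits)
  qed
  also have "(\<Sum>j\<in>set I. (if i = j then 1 else 0) * st (a l j)) = st (a l i)"
    using a(2) by (simp add: if_distribR if_distrib cong: if_cong)
  finally show ?thesis by (simp add: pi_K)
qed

text \<open>Left invariance says H a = H for the scalar matrix H of Haar values. Cancelling
  \<open>a\<close> and applying \<open>hh\<close> once more shows that H equals H times its own
  adjoint, and such a product is self-adjoint.\<close>

lemma ucorep_hh_proj:
  assumes a: "ucorep I a" "i \<in> set I" "l \<in> set I"
  shows "hh (a i l) = cnj (hh (a l i))"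
    and "\<And>j. j \<in> set I \<Longrightarrow> pi (\<Sum>k\<in>set I. fconst (hh (a i k)) * a k j) = pi (fconst (hh (a i j)))"
proof -
  have 1: "pi (\<Sum>k\<in>set I. fconst (hh (a i k)) * a k j) = pi (fconst (hh (a i j)))"
    if "i \<in> set I" "j \<in> set I" for i j
    using haar_left[OF ucorepD(2)[OF a(1) that]] unfolding SW_sum_I[OF a(1) that] .
  show "\<And>j. j \<in> set I \<Longrightarrow> pi (\<Sum>k\<in>set I. fconst (hh (a i k)) * a k j) = pi (fconst (hh (a i j)))"
    by (rule 1[OF a(2)])
  have 2: "hh (a i l) = (\<Sum>j\<in>set I. hh (a i j) * cnj (hh (a l j)))" if "i \<in> set I" "l \<in> set I" for i l
  proof -
    have "pi (fconst (hh (a i l))) = pi (\<Sum>j\<in>set I. fconst (hh (a i j)) * st (a l j))"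
      using that by (intro ucorep_cancel[OF a(1) 1])
    from hh_cong[OF this] show ?thesis by (simp add: hh_fconst hh_sum hh_smult hh_st)
  qed
  show "hh (a i l) = cnj (hh (a l i))"
    using 2[OF a(2,3)] 2[OF a(3,2)] by (simp add: mult.commute)
qed

text \<open>Entries of the tensor product of the directions \<open>gs\<close>, with lists as
  multi-indices; lists of unequal lengths give 0.\<close>

fun wd :: "direction list \<Rightarrow> nat list \<Rightarrow> nat list \<Rightarrow> entry_alg" where
  "wd [] [] [] = 1"
| "wd (g # gs) (i # is) (j # js) = lt g i j * wd gs is js"
| "wd _ _ _ = 0"

primrec Ix :: "direction list \<Rightarrow> nat list list" where
  "Ix [] = [[]]"
| "Ix (g # gs) = concat (map (\<lambda>k. map ((#) k) (Ix gs)) [0..<nn g])"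

lemma Ix_Cons: "set (Ix (g # gs)) = (\<lambda>(k, ks). k # ks) ` ({..<nn g} \<times> set (Ix gs))"
  by auto

lemma sum_Ix_Cons: "(\<Sum>ks\<in>set (Ix (g # gs)). f ks) = (\<Sum>k<nn g. \<Sum>ks\<in>set (Ix gs). f (k # ks))"
proof -
  have "(\<Sum>ks\<in>set (Ix (g # gs)). f ks) = (\<Sum>(k, ks)\<in>{..<nn g} \<times> set (Ix gs). f (k # ks))"
    unfolding Ix_Cons by (subst sum.reindex) (auto simp: inj_on_def intro!: sum.cong)
  then show ?thesis by (simp add: sum.cartesian_product)
qed

lemma distinct_Ix: "distinct (Ix gs)"
proof (induction gs)
  case (Cons g gs)
  have "distinct (concat (map (\<lambda>k. map ((#) k) (Ix gs)) ks))" if "distinct ks" for ks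
    using that Cons by (induction ks) (auto simp: distinct_map inj_on_def)
  then show ?case by simp
qed simp

text \<open>In one unitarity relation the sum over the tail collapses first, between two outer
  letters; in the other the outer letters meet in the middle and collapse first.\<close>

lemma ucorep_wd: "list_all ok gs \<Longrightarrow> ucorep (Ix gs) (wd gs)"
proof (induction gs)
  case Nil
  show ?case using SW_one by (simp add: ucorep_def)
next
  case (Cons g gs)
  then have g: "ok g" and u: "ucorep (Ix gs) (wd gs)" by auto
  have I: "\<exists>k ks. is = k # ks \<and> k < nn g \<and> ks \<in> set (Ix gs)" if "is \<in> set (Ix (g # gs))" for "is"
    using that by auto
  show ?case
    unfolding ucorep_def
  proof (intro conjI ballI)
    show "distinct (Ix (g # gs))" by (rule distinct_Ix)
    fix is0 js0 assume "is0 \<in> set (Ix (g # gs))" "js0 \<in> set (Ix (g # gs))"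
    then obtain i "is" j js where x: "is0 = i # is" "js0 = j # js" "i < nn g" "j < nn g"
      "is \<in> set (Ix gs)" "js \<in> set (Ix gs)"
      using I by blast
    have "SW (lt g i j * wd gs is js) (pmul (map (\<lambda>k. (lt g i k, lt g k j)) [0..<nn g])
        (map (\<lambda>k. (wd gs is k, wd gs k js)) (Ix gs)))"
      using u x by (intro SW_mult SW_lt[OF g]) (auto simp: ucorep_def)
    then show "SW (wd (g # gs) is0 js0) (map (\<lambda>k. (wd (g # gs) is0 k, wd (g # gs) k js0)) (Ix (g # gs)))"
      by (simp add: x pmul_def map_concat o_def)
    have "pi (\<Sum>ks\<in>set (Ix (g # gs)). wd (g # gs) is0 ks * st (wd (g # gs) js0 ks)) =
      pi (\<Sum>k<nn g. lt g i k * (\<Sum>ks\<in>set (Ix gs). wd gs is ks * st (wd gs js ks)) * st (lt g j k))"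
      unfolding sum_Ix_Cons x by (simp add: st_mult sum_distrib_left sum_distrib_right mult.assoc)
    also have "\<dots> = pi (\<Sum>k<nn g. lt g i k * (if is = js then 1 else 0) * st (lt g j k))"
      using ucorepD(3)[OF u x(5,6)] by (intro pi_sum_eq pi_mult_cong_left pi_mult_cong_right)
    also have "\<dots> = pi (if is0 = js0 then 1 else 0)"
      using unitary1[OF g x(3,4)] x(1,2) by (cases "is = js") simp_all
    finally show "pi (\<Sum>ks\<in>set (Ix (g # gs)). wd (g # gs) is0 ks * st (wd (g # gs) js0 ks)) =
      pi (if is0 = js0 then 1 else 0)" .
    have "pi (\<Sum>ks\<in>set (Ix (g # gs)). st (wd (g # gs) ks is0) * wd (g # gs) ks js0) =
      pi (\<Sum>k<nn g. \<Sum>ks\<in>set (Ix gs). st (wd gs ks is) * (st (lt g k i) * lt g k j) * wd gs ks js)"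
      unfolding sum_Ix_Cons x by (simp add: st_mult mult.assoc)
    also have "(\<Sum>k<nn g. \<Sum>ks\<in>set (Ix gs). st (wd gs ks is) * (st (lt g k i) * lt g k j) * wd gs ks js)
      = (\<Sum>ks\<in>set (Ix gs). st (wd gs ks is) * (\<Sum>k<nn g. st (lt g k i) * lt g k j) * wd gs ks js)"
      by (subst sum.swap) (simp add: sum_distrib_left sum_distrib_right)
    also have "pi \<dots> = pi (\<Sum>ks\<in>set (Ix gs). st (wd gs ks is) * (if i = j then 1 else 0) * wd gs ks js)"
      using unitary2[OF g x(3,4)] by (intro pi_sum_eq pi_mult_cong_left pi_mult_cong_right)
    also have "\<dots> = pi (if is0 = js0 then 1 else 0)"
      using ucorepD(4)[OF u x(5,6)] x(1,2) by (cases "i = j") simp_all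
    finally show "pi (\<Sum>ks\<in>set (Ix (g # gs)). st (wd (g # gs) ks is0) * wd (g # gs) ks js0) =
      pi (if is0 = js0 then 1 else 0)" .
  qed
qed

lemma pi_lt_invalid: "\<not> (ok \<gamma> \<and> i < nn \<gamma> \<and> j < nn \<gamma>) \<Longrightarrow> pi (lt \<gamma> i j) = pi 0"
  by (simp add: pi_def Ph_invalid)

lemma ee_lt_invalid: "\<not> (ok \<gamma> \<and> i < nn \<gamma> \<and> j < nn \<gamma>) \<Longrightarrow> ee (lt \<gamma> i j) = 0"
  using vl_iff[of \<gamma> i j] by (auto simp: ee_def lt_def simp del: vl.simps)

text \<open>A monomial with an out-of-range letter is killed by \<open>pi\<close>, \<open>ee\<close>
  and \<open>kk\<close> alike, so identities between these need only be tested on words of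
  entries.\<close>

lemma monomial_cases:
  obtains gs "is" js where "list_all ok gs" "is \<in> set (Ix gs)" "js \<in> set (Ix gs)" "sgl w 1 = wd gs is js"
  | "pi (sgl w 1) = pi 0" "ee (sgl w 1) = 0" "kk (sgl w 1) = 0"
proof -
  have "(\<exists>gs is js. list_all ok gs \<and> is \<in> set (Ix gs) \<and> js \<in> set (Ix gs) \<and> sgl w 1 = wd gs is js)
      \<or> pi (sgl w 1) = pi 0 \<and> ee (sgl w 1) = 0 \<and> kk (sgl w 1) = 0"
  proof (induction w)
    case Nil
    show ?case by (intro disjI1 exI[of _ "[]"]) (simp add: one_sgl)
  next
    case (Cons l w)
    obtain p i j b where l: "l = ((p, i, j), b)" by (metis prod.collapse)
    have e: "sgl (l # w) 1 = lt (p, b) i j * sgl w 1" by (simp add: lt_def l mult_sgl)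
    show ?case
    proof (cases "ok (p, b) \<and> i < nn (p, b) \<and> j < nn (p, b)")
      case False
      then have "pi (sgl (l # w) 1) = pi (0 * sgl w 1)"
        unfolding e by (intro pi_mult_cong_left pi_lt_invalid)
      moreover have "ee (lt (p, b) i j) = 0" "kk (lt (p, b) i j) = 0"
        using False by (auto simp: ee_lt_invalid kk_lt intro!: st_invalid)
      ultimately show ?thesis by (simp add: e ee_mult kk_mult)
    next
      case v: True
      show ?thesis
        using Cons
      proof
        assume 0: "pi (sgl w 1) = pi 0 \<and> ee (sgl w 1) = 0 \<and> kk (sgl w 1) = 0"
        then have "pi (sgl (l # w) 1) = pi (lt (p, b) i j * 0)"
          unfolding e by (intro pi_mult_cong_right) simp
        with 0 show ?thesis by (simp add: e ee_mult kk_mult)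
      next
        assume "\<exists>gs is js. list_all ok gs \<and> is \<in> set (Ix gs) \<and> js \<in> set (Ix gs) \<and> sgl w 1 = wd gs is js"
        then obtain gs "is" js where g: "list_all ok gs" "is \<in> set (Ix gs)" "js \<in> set (Ix gs)"
          "sgl w 1 = wd gs is js" by blast
        then show ?thesis using v e
          by (intro disjI1 exI[of _ "(p, b) # gs"] exI[of _ "i # is"] exI[of _ "j # js"]) auto
      qed
    qed
  qed
  then show ?thesis using that by blast
qed

text \<open>Reduces statements that respect \<open>pi\<close> to entries of unitary
  corepresentations, where invariance and unitarity are available as matrix equations.\<close>

lemma pi_induct [case_names cong add scale word]:
  assumes "\<And>p q. Q p \<Longrightarrow> pi p = pi q \<Longrightarrow> Q q" "\<And>p q. Q p \<Longrightarrow> Q q \<Longrightarrow> Q (p + q)"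
    "\<And>c p. Q p \<Longrightarrow> Q (fconst c * p)"
    "\<And>gs is js. list_all ok gs \<Longrightarrow> is \<in> set (Ix gs) \<Longrightarrow> js \<in> set (Ix gs) \<Longrightarrow> Q (wd gs is js)"
  shows "Q p"
proof -
  have z: "Q 0" using assms(3)[OF assms(4)[of "[]" "[]" "[]"], of 0] by simp
  have "Q (sgl w 1)" for w
    by (rule monomial_cases[of w]) (use assms(1)[OF z] assms(4) in auto)
  then show ?thesis
  proof (induction p rule: free_alg_induct)
    case (single w c)
    then show ?case using assms(3)[of "sgl w 1" c] by (simp add: fconst_sgl)
  qed (use z assms(2) in auto)
qed

lemma ee_wd: "list_all ok gs \<Longrightarrow> is \<in> set (Ix gs) \<Longrightarrow> js \<in> set (Ix gs) \<Longrightarrow>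
    ee (wd gs is js) = (if is = js then 1 else 0)"
  by (induction gs arbitrary: "is" js) (auto simp: ee_mult ee_lt split: if_splits)

lemma kk_wd: "kk (wd gs is js) = st (wd gs js is)"
  by (induction gs "is" js rule: wd.induct) (auto simp: kk_mult st_mult kk_lt)

text \<open>The axioms determine the counit on entries of unitary corepresentations, hence
  everywhere; this also supplies its multiplicativity.\<close>

lemma eps_pi: "\<epsilon> (pi p) = ee p"
proof (induction p rule: free_alg_induct)
  case zero
  show ?case using eps_linear(2)[of 0 0] by simp
next
  case (single w c)
  have "\<epsilon> (pi (sgl w 1)) = ee (sgl w 1)"
  proof (rule monomial_cases[of w])
    fix gs "is" js
    assume "list_all ok gs" "is \<in> set (Ix gs)" "js \<in> set (Ix gs)" "sgl w 1 = wd gs is js"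
    then show ?thesis by (simp add: ucorep_eps[OF ucorep_wd] ee_wd)
  next
    assume "pi (sgl w 1) = pi 0" "ee (sgl w 1) = 0"
    then show ?thesis using eps_linear(2)[of 0 0] by simp
  qed
  then show ?case using eps_linear(2)[of c "sgl w 1"] ee_mult[of "fconst c" "sgl w 1"]
    by (simp add: fconst_sgl)
next
  case (add p q)
  then show ?case unfolding eps_linear(1) ee_add by simp
qed

lemma kappa_pi: "\<kappa> (pi p) = pi (kk p)"
proof (induction p rule: free_alg_induct)
  case zero
  show ?case using kappa_linear(2)[of 0 0] pi_smult[of 0 "K 0"] by (simp add: pi_K)
next
  case (single w c)
  have "\<kappa> (pi (sgl w 1)) = pi (kk (sgl w 1))"
  proof (rule monomial_cases[of w])
    fix gs "is" js
    assume "list_all ok gs" "is \<in> set (Ix gs)" "js \<in> set (Ix gs)" "sgl w 1 = wd gs is js"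
    then show ?thesis by (simp add: ucorep_K[OF ucorep_wd] kk_wd)
  next
    assume "pi (sgl w 1) = pi 0" "kk (sgl w 1) = 0"
    then show ?thesis using kappa_linear(2)[of 0 0] pi_smult[of 0 "K 0"] by (simp add: pi_K)
  qed
  then show ?case using kappa_linear(2)[of c "sgl w 1"] kk_smult[of c "sgl w 1"]
    by (simp add: fconst_sgl pi_smult)
next
  case (add p q)
  then show ?case unfolding kappa_linear(1) unfolding kk_add unfolding pi_add by simp
qed

lemma kk_cong: "pi p = pi q \<Longrightarrow> pi (kk p) = pi (kk q)"
  by (metis kappa_pi)

lemma ee_cong: "pi p = pi q \<Longrightarrow> ee p = ee q"
  by (metis eps_pi)

end

section \<open>Faithfulness of the Haar state\<close>

lemma sum_list_add: "(\<Sum>x\<leftarrow>xs. f x + g x) = (\<Sum>x\<leftarrow>xs. f x) + (\<Sum>x\<leftarrow>xs. g x :: 'z::comm_monoid_add)"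
  by (induction xs) (simp_all add: ac_simps)

lemma sum_list_mult_left: "(\<Sum>x\<leftarrow>xs. c * f x) = c * (\<Sum>x\<leftarrow>xs. f x :: 'z::semiring_0)"
  by (induction xs) (simp_all add: distrib_left)

lemma sum_list_mult_right: "(\<Sum>x\<leftarrow>xs. f x * c) = (\<Sum>x\<leftarrow>xs. f x :: 'z::semiring_0) * c"
  by (induction xs) (simp_all add: distrib_right)

lemma sum_list_remove1':
  "x \<in> set xs \<Longrightarrow> (\<Sum>y\<leftarrow>xs. f y) = f x + (\<Sum>y\<leftarrow>remove1 x xs. f y :: 'z::comm_monoid_add)"
  by (induction xs) (auto simp: ac_simps)

context fp_hopf
begin

lemma sum_pmul:
  fixes F :: "_ \<Rightarrow> _ \<Rightarrow> 'z::comm_monoid_add"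
  assumes "distinct I"
  shows "(\<Sum>(c, d)\<leftarrow>pmul (map (\<lambda>l. (f l, g l)) I) ps. F c d) =
    (\<Sum>l\<in>set I. \<Sum>(b, b')\<leftarrow>ps. F (f l * b) (g l * b'))"
proof -
  have "(\<Sum>(c, d)\<leftarrow>pmul (map (\<lambda>l. (f l, g l)) J) ps. F c d) =
    (\<Sum>l\<leftarrow>J. \<Sum>(b, b')\<leftarrow>ps. F (f l * b) (g l * b'))" for J
    by (induction J) (simp_all add: pmul_def o_def case_prod_unfold)
  then show ?thesis using assms by (simp add: sum_list_distinct_conv_sum_set)
qed

lemma sum_pmul_right:
  fixes F :: "_ \<Rightarrow> _ \<Rightarrow> 'z::comm_monoid_add"
  assumes "distinct I"
  shows "(\<Sum>(c, d)\<leftarrow>pmul ps (map (\<lambda>l. (f l, g l)) I). F c d) =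
    (\<Sum>(b, b')\<leftarrow>ps. \<Sum>l\<in>set I. F (b * f l) (b' * g l))"
proof -
  have "(\<Sum>(c, d)\<leftarrow>pmul ps (map (\<lambda>l. (f l, g l)) I). F c d) =
    (\<Sum>(b, b')\<leftarrow>ps. \<Sum>l\<leftarrow>I. F (b * f l) (b' * g l))"
    by (induction ps) (simp_all add: pmul_def o_def case_prod_unfold)
  then show ?thesis using assms by (simp add: sum_list_distinct_conv_sum_set)
qed

lemma ucorep_cancel_left:
  assumes a: "ucorep I a" and k: "\<And>k. k \<in> set I \<Longrightarrow> pi (\<Sum>l\<in>set I. a k l * x l) = pi (y k)" and "i \<in> set I"
  shows "pi (x i) = pi (\<Sum>k\<in>set I. st (a k i) * y k)"
proof -
  have "pi (\<Sum>k\<in>set I. st (a k i) * y k) = pi (\<Sum>k\<in>set I. st (a k i) * (\<Sum>l\<in>set I. a k l * x l))"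
    by (rule pi_sum_eq, rule pi_mult_cong_right, rule k[symmetric])
  also have "(\<Sum>k\<in>set I. st (a k i) * (\<Sum>l\<in>set I. a k l * x l)) =
      (\<Sum>l\<in>set I. (\<Sum>k\<in>set I. st (a k i) * a k l) * x l)"
    unfolding sum_distrib_right sum_distrib_left mult.assoc[symmetric] by (rule sum.swap)
  also have "pi \<dots> = pi (\<Sum>l\<in>set I. (if i = l then 1 else 0) * x l)"
    using ucorepD(4)[OF a assms(3)] by (intro pi_sum_eq pi_mult_cong_left)
  also have "(\<Sum>l\<in>set I. (if i = l then 1 else 0) * x l) = x i"
    using assms(3) by (simp add: if_distribR if_distrib cong: if_cong)
  finally show ?thesis ..
qed

lemma hh_pi_st_st: "hh (st (st p) * q) = hh (p * q)"
  by (rule hh_cong, rule pi_mult_cong_left, rule pi_st_st)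

lemma L_eq_0_iff: "L z = 0 \<longleftrightarrow> (\<forall>a. hh (a * z) = 0)"
proof
  assume "L z = 0"
  then have "hh (st (st a) * z) = 0" for a using L_inner[of "st a" z] by simp
  then show "\<forall>a. hh (a * z) = 0" by (simp add: hh_pi_st_st)
next
  assume "\<forall>a. hh (a * z) = 0"
  then show "L z = 0" using L_inner[of z z] by (simp add: cinner_eq_zero_iff)
qed

lemma hh_smult_right: "hh (a * (fconst c * b)) = c * hh (a * b)"
  by (simp add: fconst_left_commute[of a] hh_smult)

lemma fconst_fconst: "fconst c * (fconst d * x) = fconst (c * d) * x"
  by (simp add: fconst_mult mult.assoc)

text \<open>For a null \<open>z\<close> every \<open>wd gs k js * z\<close> has Haar value 0. Right
  invariance turns this into a linear system for the slices of the coproduct, with coefficients the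
  entries \<open>wd gs k l\<close>, and unitarity inverts it.\<close>

lemma null_slice:
  assumes z: "SW z ps" "L z = 0"
  shows "pi (\<Sum>(b, b')\<leftarrow>ps. fconst (hh (a * b')) * b) = pi 0"
proof (induction a rule: pi_induct)
  case (cong p q)
  have "hh (q * b') = hh (p * b')" for b'
    by (rule hh_cong, rule pi_mult_cong_left, rule cong(2)[symmetric])
  then show ?case using cong(1) by simp
next
  case (add p q)
  have "(\<Sum>(b, b')\<leftarrow>ps. fconst (hh ((p + q) * b')) * b) =
    (\<Sum>(b, b')\<leftarrow>ps. fconst (hh (p * b')) * b) + (\<Sum>(b, b')\<leftarrow>ps. fconst (hh (q * b')) * b)"
    by (simp add: sum_list_add[symmetric] case_prod_unfold distrib_right hh_add fconst_add)
  then show ?case using pi_add_cong[OF add] by simp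
next
  case (scale c p)
  have "(\<Sum>(b, b')\<leftarrow>ps. fconst (hh (fconst c * p * b')) * b) =
    fconst c * (\<Sum>(b, b')\<leftarrow>ps. fconst (hh (p * b')) * b)"
    by (simp add: sum_list_mult_left[symmetric] case_prod_unfold hh_smult fconst_mult mult.assoc)
  then show ?case using pi_mult_cong_right[OF scale, of "fconst c"] by simp
next
  case (word gs "is" js)
  note u = ucorep_wd[OF word(1)]
  have "pi (\<Sum>l\<in>set (Ix gs). wd gs k l * (\<Sum>(b, b')\<leftarrow>ps. fconst (hh (wd gs l js * b')) * b)) = pi 0"
    if k: "k \<in> set (Ix gs)" for k
  proof -
    have "hh (wd gs k js * z) = 0" using z(2) by (simp add: L_eq_0_iff)
    with haar_right[OF SW_mult[OF ucorepD(2)[OF u k word(3)] z(1)]] show ?thesis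
      unfolding sum_pmul[OF distinct_Ix]
      by (simp add: sum_list_mult_left[symmetric] case_prod_unfold fconst_left_commute[of "wd gs k _"])
  qed
  from ucorep_cancel_left[OF u this word(2)] show ?case by simp
qed

text \<open>Elimination on the number of terms replaces the choice of linearly independent first
  legs in a decomposition of the coproduct.\<close>

lemma null_elimination:
  fixes F :: "entry_alg \<Rightarrow> entry_alg \<Rightarrow> entry_alg"
  assumes add1: "\<And>b c b'. F (b + c) b' = F b b' + F c b'"
    and sm1: "\<And>r b b'. F (fconst r * b) b' = fconst r * F b b'"
    and add2: "\<And>b b' c'. F b (b' + c') = F b b' + F b c'"
    and sm2: "\<And>r b b'. F b (fconst r * b') = fconst r * F b b'"
    and cg: "\<And>b c b'. pi b = pi c \<Longrightarrow> pi (F b b') = pi (F c b')"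
    and null: "\<And>b b'. (\<And>a. hh (a * b') = 0) \<Longrightarrow> pi (F b b') = pi 0"
    and ps: "\<And>a. pi (\<Sum>(b, b')\<leftarrow>ps. fconst (hh (a * b')) * b) = pi 0"
  shows "pi (\<Sum>(b, b')\<leftarrow>ps. F b b') = pi 0"
  using ps
proof (induction "length ps" arbitrary: ps rule: less_induct)
  case less
  show ?case
  proof (cases "\<forall>(b, b')\<in>set ps. \<forall>a. hh (a * b') = 0")
    case True
    then have "pi (\<Sum>(b, b')\<leftarrow>ps. F b b') = pi (\<Sum>x\<leftarrow>ps. 0)"
      by (intro pi_sum_list_cong) (auto intro!: null)
    then show ?thesis by simp
  next
    case False
    then obtain b1 b1' a0 where x: "(b1, b1') \<in> set ps" and a0: "hh (a0 * b1') \<noteq> 0" by blast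
    define c where "c = hh (a0 * b1')"
    define rs where "rs = remove1 (b1, b1') ps"
    define t where "t b' = hh (a0 * b') / c" for b'
    define qs where "qs = map (\<lambda>(b, b'). (b, b' + fconst (- t b') * b1')) rs"
    have c: "c \<noteq> 0" using a0 by (simp add: c_def)
    have len: "length qs < length ps"
      using x length_pos_if_in_set[OF x] by (simp add: qs_def rs_def length_remove1)
    define B where "B = (\<Sum>(b, b')\<leftarrow>rs. fconst (t b') * b)"
    \<comment> \<open>\<open>b1'\<close> pairs nontrivially with \<open>a0\<close>, so the slice at
      \<open>a0\<close> expresses \<open>b1\<close> through the other first legs. Its term can then
      be absorbed into corrected second legs of the remaining ones.\<close>
    have B: "pi b1 = pi (- B)"
    proof -
      have "fconst (1 / c) * (\<Sum>(b, b')\<leftarrow>ps. fconst (hh (a0 * b')) * b) = b1 + B"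
        unfolding sum_list_remove1'[OF x] B_def t_def rs_def using c
        by (simp add: distrib_left sum_list_mult_left[symmetric] case_prod_unfold mult.assoc[symmetric]
            fconst_mult[symmetric] c_def[symmetric])
      then have "pi (b1 + B) = pi (fconst (1 / c) * 0)"
        using pi_mult_cong_right[OF less.prems[of a0], of "fconst (1 / c)"] by simp
      then have "pi (b1 + B + - B) = pi (0 + - B)"
        by (intro pi_add_cong) simp_all
      then show ?thesis by simp
    qed
    have lin: "(\<Sum>(b, b')\<leftarrow>qs. G b b') = (\<Sum>(b, b')\<leftarrow>rs. G b b') + G (- B) b1'"
      if "\<And>b c b'. G (b + c) b' = G b b' + G c b'" "\<And>r b b'. G (fconst r * b) b' = fconst r * G b b'"
        "\<And>b b' c'. G b (b' + c') = G b b' + G b c'" "\<And>r b b'. G b (fconst r * b') = fconst r * G b b'"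
      for G :: "entry_alg \<Rightarrow> entry_alg \<Rightarrow> entry_alg"
    proof -
      have z: "G 0 b1' = 0" using that(2)[of 0 0 b1'] by simp
      have "G (- B) b1' = (\<Sum>(b, b')\<leftarrow>rs. fconst (- t b') * G b b1')"
      proof -
        have gm: "G (- x) y = - G x y" for x y
          using that(2)[of "- 1" x y] by (simp add: fconst_minus)
        have gd: "G (x - x') y = G x y - G x' y" for x x' y
          using that(1)[of x "- x'" y] by (simp add: gm)
        have "G (- (\<Sum>(b, b')\<leftarrow>rs'. fconst (t b') * b)) b1' =
          (\<Sum>(b, b')\<leftarrow>rs'. fconst (- t b') * G b b1')" for rs'
          by (induction rs') (simp_all add: z gm gd that(2) case_prod_unfold fconst_minus)
        then show ?thesis unfolding B_def .
      qed
      then show ?thesis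
        unfolding qs_def by (simp add: case_prod_unfold o_def that sum_list_add)
    qed
    have "pi (\<Sum>(b, b')\<leftarrow>qs. fconst (hh (a * b')) * b) = pi 0" for a
    proof -
      have "(\<Sum>(b, b')\<leftarrow>qs. fconst (hh (a * b')) * b) =
         (\<Sum>(b, b')\<leftarrow>rs. fconst (hh (a * b')) * b) + fconst (hh (a * b1')) * (- B)"
        by (rule lin) (simp_all add: distrib_left distrib_right hh_add fconst_add fconst_fconst
            hh_smult_right mult.commute)
      also have "pi \<dots> = pi ((\<Sum>(b, b')\<leftarrow>rs. fconst (hh (a * b')) * b) + fconst (hh (a * b1')) * b1)"
        using B by (intro pi_add_cong pi_mult_cong_right) simp_all
      also have "\<dots> = pi 0"
        using less.prems[of a] unfolding sum_list_remove1'[OF x] rs_def by (simp add: add.commute)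
      finally show ?thesis .
    qed
    from less.hyps[OF len this] have "pi (\<Sum>(b, b')\<leftarrow>qs. F b b') = pi 0" .
    moreover have "pi (\<Sum>(b, b')\<leftarrow>ps. F b b') = pi (\<Sum>(b, b')\<leftarrow>qs. F b b')"
    proof -
      have "pi (\<Sum>(b, b')\<leftarrow>ps. F b b') = pi ((\<Sum>(b, b')\<leftarrow>rs. F b b') + F b1 b1')"
        unfolding sum_list_remove1'[OF x] rs_def by (simp add: add.commute)
      also have "\<dots> = pi ((\<Sum>(b, b')\<leftarrow>rs. F b b') + F (- B) b1')"
        by (rule pi_add_cong[OF refl cg[OF B]])
      also have "(\<Sum>(b, b')\<leftarrow>rs. F b b') + F (- B) b1' = (\<Sum>(b, b')\<leftarrow>qs. F b b')"
        by (rule lin[symmetric]) (simp_all add: add1 sm1 add2 sm2)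
      finally show ?thesis .
    qed
    ultimately show ?thesis by simp
  qed
qed

lemma SW_exists: "\<exists>ps. SW p ps"
proof (induction p rule: pi_induct)
  case (cong p q)
  then show ?case using SW_cong by blast
next
  case (word gs "is" js)
  then show ?case using ucorepD(2)[OF ucorep_wd] by blast
qed (use SW_add SW_smult in blast)+

text \<open>By \<open>null_slice\<close> the second legs of the coproduct of a null element may be
  treated as null. The antipode axiom then shows that null elements have counit 0, and the counit
  axiom applied to the null second legs kills the element itself.\<close>

lemma L_eq_0: assumes "L z = 0" shows "pi z = pi 0"
proof -
  \<comment> \<open>The pairing of \<open>b\<close> and \<open>b'\<close> by
    \<open>hh (kk b * b')\<close> vanishes for null \<open>b'\<close>, while on the coproduct of
    \<open>z\<close> it evaluates to the counit.\<close>
  have ee0: "ee z = 0" if z: "L z = 0" for z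
  proof -
    obtain ps where ps: "SW z ps" using SW_exists by blast
    have "pi (\<Sum>(b, b')\<leftarrow>ps. fconst (hh (kk b * b'))) = pi 0"
    proof (rule null_elimination)
      fix b c b' :: entry_alg assume "pi b = pi c"
      then have "hh (kk b * b') = hh (kk c * b')"
        by (intro hh_cong pi_mult_cong_left kk_cong)
      then show "pi (fconst (hh (kk b * b'))) = pi (fconst (hh (kk c * b')))" by simp
    qed (use null_slice[OF ps z] in \<open>simp_all add: kk_add kk_smult distrib_left distrib_right hh_add
        fconst_add hh_smult_right hh_smult fconst_mult mult.assoc\<close>)
    from hh_cong[OF this] have 1: "hh (\<Sum>(b, b')\<leftarrow>ps. fconst (hh (kk b * b'))) = 0"
      by simp
    have "pi (\<Sum>(b, b')\<leftarrow>ps. kk b * b') = pi (\<Sum>(b, b')\<leftarrow>ps. K b * b')"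
      by (intro pi_sum_list_cong) (simp add: case_prod_unfold pi_mult pi_K kappa_pi)
    also have "\<dots> = pi (fconst (ee z))"
      using K_left[OF ps] by (simp add: eps_pi)
    finally have "pi (\<Sum>(b, b')\<leftarrow>ps. kk b * b') = pi (fconst (ee z))" .
    from hh_cong[OF this] have "hh (\<Sum>(b, b')\<leftarrow>ps. kk b * b') = ee z"
      by (simp add: hh_fconst)
    then show ?thesis using 1 by (simp add: hh_sum_list case_prod_unfold hh_fconst)
  qed
  obtain ps where ps: "SW z ps" using SW_exists by blast
  have "pi (\<Sum>(b, b')\<leftarrow>ps. fconst (ee b') * b) = pi 0"
  proof (rule null_elimination)
    fix b b' assume "\<And>a. hh (a * b') = 0"
    then have "L b' = 0" by (simp add: L_eq_0_iff)
    then show "pi (fconst (ee b') * b) = pi 0" using ee0 by simp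
  next
    fix b c b' assume "pi b = pi c"
    then show "pi (fconst (ee b') * b) = pi (fconst (ee b') * c)" by (rule pi_mult_cong_right)
  qed (use null_slice[OF ps assms] in \<open>simp_all add: distrib_left distrib_right ee_add ee_mult
        fconst_add fconst_fconst mult.commute\<close>)
  then show ?thesis using counit_right[OF ps] by (simp add: eps_pi)
qed

lemma L_eq_iff: "L p = L q \<longleftrightarrow> pi p = pi q"
proof
  assume "L p = L q"
  then have "L (p - q) = 0" by (simp add: L_diff)
  then show "pi p = pi q" unfolding pi_eq_iff[of p q] by (rule L_eq_0)
qed (rule L_cong)

text \<open>Haar values with an arbitrary left factor separate elements. Identities for \<sigma>
  become accessible this way, because \<sigma> is known only under \<open>hh\<close>.\<close>

lemma L_eqI: assumes "\<And>a. hh (a * p) = hh (a * q)" shows "L p = L q"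
proof -
  have "L (p - q) = 0" unfolding L_eq_0_iff by (simp add: right_diff_distrib hh_diff assms)
  then show ?thesis by (simp add: L_diff)
qed

lemma L_mult: "L p = L p' \<Longrightarrow> L q = L q' \<Longrightarrow> L (p * q) = L (p' * q')"
  unfolding L_eq_iff by (rule pi_mult_cong)

lemma L_st: "L p = L q \<Longrightarrow> L (st p) = L (st q)"
  unfolding L_eq_iff by (rule pi_st_cong)

lemma L_kk: "L p = L q \<Longrightarrow> L (kk p) = L (kk q)"
  unfolding L_eq_iff by (rule kk_cong)

lemma L_st_st: "L (st (st p)) = L p"
  unfolding L_eq_iff by (rule pi_st_st)

lemma hh_eq: "L p = L q \<Longrightarrow> hh p = hh q"
  unfolding L_eq_iff by (rule hh_cong)

end

section \<open>The modular automorphism of the Haar state\<close>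

lemma sum3_front:
  "(\<Sum>a\<in>A. \<Sum>b\<in>B. \<Sum>c\<in>C. f a b c) = (\<Sum>c\<in>C. \<Sum>a\<in>A. \<Sum>b\<in>B. f a b c)"
  for f :: "_ \<Rightarrow> _ \<Rightarrow> _ \<Rightarrow> 'z::comm_monoid_add"
proof -
  have "(\<Sum>a\<in>A. \<Sum>b\<in>B. \<Sum>c\<in>C. f a b c) = (\<Sum>a\<in>A. \<Sum>c\<in>C. \<Sum>b\<in>B. f a b c)"
    by (rule sum.cong[OF refl], rule sum.swap)
  also have "\<dots> = (\<Sum>c\<in>C. \<Sum>a\<in>A. \<Sum>b\<in>B. f a b c)" by (rule sum.swap)
  finally show ?thesis .
qed

context fp_hopf
begin

lemma fconst_mult_mult: "(fconst c * x) * (fconst d * y) = fconst (c * d) * (x * y)"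
  by (metis fconst_fconst fconst_left_commute mult.assoc)

text \<open>The positive matrix D D^* for D = \<open>dm \<gamma>\<close>; \<open>MI\<close> below is
  its inverse. These weights measure how far the matrix of adjoint entries is from being
  unitary.\<close>

definition MM :: "direction \<Rightarrow> nat \<Rightarrow> nat \<Rightarrow> complex" where
  "MM \<gamma> k d = (\<Sum>x<nn \<gamma>. dm \<gamma> k x * cnj (dm \<gamma> d x))"

definition MI :: "direction \<Rightarrow> nat \<Rightarrow> nat \<Rightarrow> complex" where
  "MI \<gamma> e i = (\<Sum>x<nn \<gamma>. dm (bar \<gamma>) x e * cnj (dm (bar \<gamma>) x i))"

lemma MM_MI:
  assumes "ok \<gamma>" "k < nn \<gamma>" "i < nn \<gamma>"
  shows "(\<Sum>e<nn \<gamma>. MM \<gamma> k e * MI \<gamma> e i) = (if k = i then 1 else 0)"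
proof -
  have "(\<Sum>e<nn \<gamma>. MM \<gamma> k e * MI \<gamma> e i) = (\<Sum>e<nn \<gamma>. \<Sum>x<nn \<gamma>. \<Sum>y<nn \<gamma>.
      (dm \<gamma> k x * cnj (dm (bar \<gamma>) y i)) * (dm (bar \<gamma>) y e * cnj (dm \<gamma> e x)))"
    unfolding MM_def MI_def sum_product by (simp add: mult_ac)
  also have "\<dots> = (\<Sum>x<nn \<gamma>. \<Sum>y<nn \<gamma>. \<Sum>e<nn \<gamma>.
      (dm \<gamma> k x * cnj (dm (bar \<gamma>) y i)) * (dm (bar \<gamma>) y e * cnj (dm \<gamma> e x)))"
    by (subst sum.swap, rule sum.cong[OF refl], rule sum.swap)
  also have "\<dots> = (\<Sum>x<nn \<gamma>. \<Sum>y<nn \<gamma>. (dm \<gamma> k x * cnj (dm (bar \<gamma>) y i)) * (if y = x then 1 else 0))"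
    unfolding sum_distrib_left[symmetric] using dm_inv[of "bar \<gamma>"] assms by (intro sum.cong refl) simp
  also have "\<dots> = (\<Sum>x<nn \<gamma>. dm \<gamma> k x * cnj (dm (bar \<gamma>) x i))"
    by (intro sum.cong refl) (simp add: if_distrib cong: if_cong)
  finally show ?thesis using dm_inv assms by simp
qed

lemma dm_st:
  assumes "ok \<gamma>" "k < nn \<gamma>" "z < nn \<gamma>"
  shows "(\<Sum>f<nn \<gamma>. fconst (dm \<gamma> f z) * st (lt \<gamma> k f)) = (\<Sum>x<nn \<gamma>. fconst (dm \<gamma> k x) * lt (bar \<gamma>) x z)"
proof -
  have "(\<Sum>f<nn \<gamma>. fconst (dm \<gamma> f z) * st (lt \<gamma> k f)) = (\<Sum>f<nn \<gamma>. \<Sum>x<nn \<gamma>. \<Sum>l<nn \<gamma>.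
      fconst (dm \<gamma> k x * (cnj (dm (bar \<gamma>) l f) * dm \<gamma> f z)) * lt (bar \<gamma>) x l)"
    using assms by (intro sum.cong refl) (simp add: st_lt sum_distrib_left fconst_fconst mult_ac)
  also have "\<dots> = (\<Sum>x<nn \<gamma>. \<Sum>l<nn \<gamma>. \<Sum>f<nn \<gamma>.
      fconst (dm \<gamma> k x * (cnj (dm (bar \<gamma>) l f) * dm \<gamma> f z)) * lt (bar \<gamma>) x l)"
    by (subst sum.swap, rule sum.cong[OF refl], rule sum.swap)
  also have "\<dots> = (\<Sum>x<nn \<gamma>. \<Sum>l<nn \<gamma>. fconst (dm \<gamma> k x * (if l = z then 1 else 0)) * lt (bar \<gamma>) x l)"
    unfolding sum_distrib_right[symmetric] fconst_sum[symmetric] sum_distrib_left[symmetric]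
    using dm_inv_cnj[of "bar \<gamma>"] assms by (intro sum.cong refl) simp
  also have "\<dots> = (\<Sum>x<nn \<gamma>. \<Sum>l<nn \<gamma>. if l = z then fconst (dm \<gamma> k x) * lt (bar \<gamma>) x l else 0)"
    by (intro sum.cong refl) simp
  finally show ?thesis using assms(3) by simp
qed

lemma dm_st':
  assumes "ok \<gamma>" "d < nn \<gamma>" "z < nn \<gamma>"
  shows "(\<Sum>g<nn \<gamma>. fconst (cnj (dm \<gamma> g z)) * lt \<gamma> d g) =
    (\<Sum>x<nn \<gamma>. fconst (cnj (dm \<gamma> d x)) * st (lt (bar \<gamma>) x z))"
  using arg_cong[OF dm_st[OF assms], of st] assms by (simp add: st_sum st_smult st_st_lt)

text \<open>The matrix of adjoints is D b D^-1 with D = \<open>dm \<gamma>\<close> and b the unitary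
  conjugate direction. The weight D D^* lets both factors D be moved across, after which unitarity
  of b applies.\<close>

lemma MM_rel:
  assumes "ok \<gamma>" "k < nn \<gamma>" "d < nn \<gamma>"
  shows "pi (\<Sum>f<nn \<gamma>. \<Sum>g<nn \<gamma>. fconst (MM \<gamma> f g) * (st (lt \<gamma> k f) * lt \<gamma> d g)) = pi (fconst (MM \<gamma> k d))"
proof -
  let ?a = "lt \<gamma>" let ?b = "lt (bar \<gamma>)" let ?n = "nn \<gamma>"
  have "(\<Sum>f<?n. \<Sum>g<?n. fconst (MM \<gamma> f g) * (st (?a k f) * ?a d g)) =
    (\<Sum>f<?n. \<Sum>g<?n. \<Sum>z<?n. (fconst (dm \<gamma> f z) * st (?a k f)) * (fconst (cnj (dm \<gamma> g z)) * ?a d g))"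
    unfolding fconst_mult_mult by (simp add: MM_def fconst_sum sum_distrib_right)
  also have "\<dots> = (\<Sum>z<?n. \<Sum>f<?n. \<Sum>g<?n. (fconst (dm \<gamma> f z) * st (?a k f)) * (fconst (cnj (dm \<gamma> g z)) * ?a d g))"
    by (rule sum3_front)
  also have "\<dots> = (\<Sum>z<?n. (\<Sum>f<?n. fconst (dm \<gamma> f z) * st (?a k f)) * (\<Sum>g<?n. fconst (cnj (dm \<gamma> g z)) * ?a d g))"
    by (simp add: sum_product)
  also have "\<dots> = (\<Sum>z<?n. (\<Sum>x<?n. fconst (dm \<gamma> k x) * ?b x z) * (\<Sum>y<?n. fconst (cnj (dm \<gamma> d y)) * st (?b y z)))"
    using assms by (intro sum.cong refl) (simp add: dm_st dm_st')
  also have "\<dots> = (\<Sum>z<?n. \<Sum>x<?n. \<Sum>y<?n. fconst (dm \<gamma> k x * cnj (dm \<gamma> d y)) * (?b x z * st (?b y z)))"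
    by (simp add: sum_product fconst_mult_mult)
  also have "\<dots> = (\<Sum>x<?n. \<Sum>y<?n. fconst (dm \<gamma> k x * cnj (dm \<gamma> d y)) * (\<Sum>z<?n. ?b x z * st (?b y z)))"
    unfolding sum_distrib_left by (subst sum.swap, rule sum.cong[OF refl], rule sum.swap)
  also have "pi \<dots> = pi (\<Sum>x<?n. \<Sum>y<?n. fconst (dm \<gamma> k x * cnj (dm \<gamma> d y)) * (if x = y then 1 else 0))"
    using assms unitary1[of "bar \<gamma>"] by (intro pi_sum_eq pi_mult_cong_right) simp
  also have "(\<Sum>x<?n. \<Sum>y<?n. fconst (dm \<gamma> k x * cnj (dm \<gamma> d y)) * (if x = y then 1 else 0)) = fconst (MM \<gamma> k d)"
    by (simp add: MM_def fconst_sum if_distrib cong: if_cong)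
  finally show ?thesis .
qed

section \<open>An invariant functional obtained from the Haar state\<close>

definition HH :: "direction \<Rightarrow> nat \<Rightarrow> nat \<Rightarrow> nat \<Rightarrow> nat \<Rightarrow> entry_alg \<Rightarrow> complex" where
  "HH \<gamma> j c f g b = hh (lt \<gamma> f j * b * st (lt \<gamma> g c))"

text \<open>Right invariance is applied to an entry times \<open>b\<close> times an adjoint entry.
  Unitarity cancels the outer first legs on either side and leaves the slices of the coproduct of
  \<open>b\<close>.\<close>

lemma HH_inv:
  assumes ok: "ok \<gamma>" and jc: "j < nn \<gamma>" "c < nn \<gamma>" and fg: "f < nn \<gamma>" "g < nn \<gamma>" and ps: "SW b ps"
  shows "pi (\<Sum>(b1, b2)\<leftarrow>ps. fconst (HH \<gamma> j c f g b2) * b1) =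
    pi (\<Sum>k<nn \<gamma>. \<Sum>d<nn \<gamma>. fconst (HH \<gamma> j c k d b) * (st (lt \<gamma> k f) * lt \<gamma> d g))"
proof -
  define n where "n = nn \<gamma>"
  define a where "a = lt \<gamma>"
  define Y where "Y l e = (\<Sum>(b1, b2)\<leftarrow>ps. fconst (HH \<gamma> j c l e b2) * b1)" for l e
  have u: "ucorep [0..<n] a" using ucorep_lt[OF ok] by (simp add: n_def a_def)
  have I: "set [0..<n] = {..<n}" by auto
  have 1: "pi (\<Sum>l<n. a k l * (\<Sum>e<n. Y l e * st (a d e))) = pi (fconst (HH \<gamma> j c k d b))"
    if "k < n" "d < n" for k d
  proof -
    have s1: "SW (a k j * b) (pmul (map (\<lambda>l. (a k l, a l j)) [0..<n]) ps)"
      using ucorepD(2)[OF u] that jc ps by (intro SW_mult) (auto simp: n_def)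
    have s2: "SW (st (a d c)) (map (\<lambda>e. (st (a d e), st (a e c))) [0..<n])"
      using SW_st[OF ucorepD(2)[OF u]] that jc by (simp add: o_def n_def)
    have "pi (\<Sum>l<n. \<Sum>(b1, b2)\<leftarrow>ps. \<Sum>e<n. fconst (hh (a l j * b2 * st (a e c))) * (a k l * b1 * st (a d e)))
        = pi (fconst (HH \<gamma> j c k d b))"
      using haar_right[OF SW_mult[OF s1 s2]]
      unfolding sum_pmul_right[OF distinct_upt] sum_pmul[OF distinct_upt] I HH_def a_def .
    also have "(\<Sum>l<n. \<Sum>(b1, b2)\<leftarrow>ps. \<Sum>e<n. fconst (hh (a l j * b2 * st (a e c))) * (a k l * b1 * st (a d e)))
      = (\<Sum>l<n. a k l * (\<Sum>e<n. Y l e * st (a d e)))"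
      unfolding case_prod_unfold sum_list_sum Y_def HH_def sum_distrib_left
      by (simp add: sum_list_mult_left[symmetric] sum_list_mult_right[symmetric] a_def mult.assoc
          fconst_left_commute[of "lt \<gamma> _ _"])
    finally show ?thesis .
  qed
  have 2: "pi (\<Sum>e<n. Y f e * st (a d e)) = pi (\<Sum>k<n. st (a k f) * fconst (HH \<gamma> j c k d b))"
    if "d < n" for d
    using ucorep_cancel_left[OF u, of "\<lambda>l. \<Sum>e<n. Y l e * st (a d e)" "\<lambda>k. fconst (HH \<gamma> j c k d b)" f] 1 that fg
    by (simp add: n_def atLeast0LessThan)
  have "pi (Y f g) = pi (\<Sum>e<n. Y f e * (if e = g then 1 else 0))"
    using fg by (simp add: n_def if_distrib cong: if_cong)
  also have "\<dots> = pi (\<Sum>e<n. Y f e * (\<Sum>d<n. st (a d e) * a d g))"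
    using ucorepD(4)[OF u] fg by (intro pi_sum_eq pi_mult_cong_right) (simp add: n_def atLeast0LessThan)
  also have "(\<Sum>e<n. Y f e * (\<Sum>d<n. st (a d e) * a d g)) = (\<Sum>d<n. (\<Sum>e<n. Y f e * st (a d e)) * a d g)"
    unfolding sum_distrib_left sum_distrib_right mult.assoc by (rule sum.swap)
  also have "pi \<dots> = pi (\<Sum>d<n. (\<Sum>k<n. st (a k f) * fconst (HH \<gamma> j c k d b)) * a d g)"
    by (rule pi_sum_eq, rule pi_mult_cong_left, rule 2, simp)
  also have "(\<Sum>d<n. (\<Sum>k<n. st (a k f) * fconst (HH \<gamma> j c k d b)) * a d g) =
      (\<Sum>k<n. \<Sum>d<n. fconst (HH \<gamma> j c k d b) * (st (a k f) * a d g))"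
    unfolding sum_distrib_right fconst_commute[of "st _"] mult.assoc by (rule sum.swap)
  finally show ?thesis unfolding Y_def n_def a_def .
qed

text \<open>The weights are chosen so that the factors produced by \<open>HH_inv\<close> recombine
  through \<open>MM_rel\<close>.\<close>

definition om :: "direction \<Rightarrow> nat \<Rightarrow> nat \<Rightarrow> entry_alg \<Rightarrow> complex" where
  "om \<gamma> j c b = (\<Sum>f<nn \<gamma>. \<Sum>g<nn \<gamma>. MM \<gamma> f g * HH \<gamma> j c f g b)"

lemma HH_add: "HH \<gamma> j c f g (x + y) = HH \<gamma> j c f g x + HH \<gamma> j c f g y"
  and HH_smult: "HH \<gamma> j c f g (fconst r * x) = r * HH \<gamma> j c f g x"
  unfolding HH_def by (simp_all add: distrib_left distrib_right hh_add hh_smult_right mult.assoc)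

lemma HH_cong: "pi x = pi y \<Longrightarrow> HH \<gamma> j c f g x = HH \<gamma> j c f g y"
  unfolding HH_def by (intro hh_cong pi_mult_cong_left pi_mult_cong_right)

lemma om_lin: "om \<gamma> j c (x + y) = om \<gamma> j c x + om \<gamma> j c y"
    "om \<gamma> j c (fconst r * x) = r * om \<gamma> j c x"
  by (simp_all add: om_def HH_add HH_smult distrib_left sum.distrib sum_distrib_left mult_ac)

lemma om_cong: "pi x = pi y \<Longrightarrow> om \<gamma> j c x = om \<gamma> j c y"
  unfolding om_def by (simp add: HH_cong[of x y])

text \<open>Slicing the coproduct of \<open>b\<close> with \<open>om\<close> gives the constant
  \<open>om b\<close>, by \<open>HH_inv\<close> and \<open>MM_rel\<close>. Applying
  \<open>hh\<close> to the other leg and using left invariance shows that \<open>om\<close> is a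
  multiple of \<open>hh\<close>.\<close>

lemma om_hh:
  assumes ok: "ok \<gamma>" and jc: "j < nn \<gamma>" "c < nn \<gamma>"
  shows "om \<gamma> j c b = om \<gamma> j c 1 * hh b"
proof -
  obtain ps where ps: "SW b ps" using SW_exists by blast
  let ?n = "nn \<gamma>" let ?H = "HH \<gamma> j c" let ?a = "lt \<gamma>"
  have e1: "(\<Sum>(b1, b2)\<leftarrow>ps. fconst (om \<gamma> j c b2) * b1) =
    (\<Sum>f<?n. \<Sum>g<?n. fconst (MM \<gamma> f g) * (\<Sum>(b1, b2)\<leftarrow>ps. fconst (?H f g b2) * b1))"
    by (simp add: om_def fconst_sum sum_distrib_right sum_list_sum case_prod_unfold
        sum_list_mult_left[symmetric] fconst_fconst)
  have e2: "pi (\<Sum>f<?n. \<Sum>g<?n. fconst (MM \<gamma> f g) * (\<Sum>(b1, b2)\<leftarrow>ps. fconst (?H f g b2) * b1)) =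
    pi (\<Sum>f<?n. \<Sum>g<?n. fconst (MM \<gamma> f g) *
      (\<Sum>k<?n. \<Sum>d<?n. fconst (?H k d b) * (st (?a k f) * ?a d g)))"
    using HH_inv[OF ok jc _ _ ps] by (intro pi_sum_eq pi_mult_cong_right) simp
  have e3: "(\<Sum>f<?n. \<Sum>g<?n. fconst (MM \<gamma> f g) * (\<Sum>k<?n. \<Sum>d<?n. fconst (?H k d b) * (st (?a k f) * ?a d g)))
    = (\<Sum>k<?n. \<Sum>d<?n. fconst (?H k d b) * (\<Sum>f<?n. \<Sum>g<?n. fconst (MM \<gamma> f g) * (st (?a k f) * ?a d g)))"
  proof -
    have "(\<Sum>f<?n. \<Sum>g<?n. fconst (MM \<gamma> f g) * (\<Sum>k<?n. \<Sum>d<?n. fconst (?H k d b) * (st (?a k f) * ?a d g)))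
      = (\<Sum>f<?n. \<Sum>g<?n. \<Sum>k<?n. \<Sum>d<?n. fconst (MM \<gamma> f g * ?H k d b) * (st (?a k f) * ?a d g))"
      by (simp only: sum_distrib_left fconst_fconst)
    also have "\<dots> = (\<Sum>k<?n. \<Sum>d<?n. \<Sum>f<?n. \<Sum>g<?n. fconst (MM \<gamma> f g * ?H k d b) * (st (?a k f) * ?a d g))"
      by (rule sum4_swap)
    also have "\<dots> = (\<Sum>k<?n. \<Sum>d<?n. \<Sum>f<?n. \<Sum>g<?n. fconst (?H k d b * MM \<gamma> f g) * (st (?a k f) * ?a d g))"
      by (simp only: mult.commute)
    also have "\<dots> = (\<Sum>k<?n. \<Sum>d<?n. fconst (?H k d b) * (\<Sum>f<?n. \<Sum>g<?n. fconst (MM \<gamma> f g) * (st (?a k f) * ?a d g)))"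
      by (simp only: sum_distrib_left fconst_fconst)
    finally show ?thesis .
  qed
  have e4: "pi (\<Sum>k<?n. \<Sum>d<?n. fconst (?H k d b) * (\<Sum>f<?n. \<Sum>g<?n. fconst (MM \<gamma> f g) * (st (?a k f) * ?a d g)))
    = pi (\<Sum>k<?n. \<Sum>d<?n. fconst (?H k d b) * fconst (MM \<gamma> k d))"
    using MM_rel[OF ok] by (intro pi_sum_eq pi_mult_cong_right) simp
  have e5: "(\<Sum>k<?n. \<Sum>d<?n. fconst (?H k d b) * fconst (MM \<gamma> k d)) = fconst (om \<gamma> j c b)"
    by (simp add: om_def fconst_sum fconst_mult[symmetric] mult.commute)
  have "pi (\<Sum>(b1, b2)\<leftarrow>ps. fconst (om \<gamma> j c b2) * b1) = pi (fconst (om \<gamma> j c b))"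
    unfolding e1 e2 e3 e4 e5 ..
  from hh_cong[OF this] have "hh (\<Sum>(b1, b2)\<leftarrow>ps. fconst (om \<gamma> j c b2) * b1) = om \<gamma> j c b"
    by (simp add: hh_fconst)
  moreover have "hh (\<Sum>(b1, b2)\<leftarrow>ps. fconst (om \<gamma> j c b2) * b1) = om \<gamma> j c (\<Sum>(b1, b2)\<leftarrow>ps. fconst (hh b1) * b2)"
  proof (induction ps)
    case Nil
    then show ?case using om_lin(2)[of \<gamma> j c 0 0] by simp
  qed (simp add: hh_add case_prod_unfold hh_smult om_lin mult.commute)
  moreover have "om \<gamma> j c (\<Sum>(b1, b2)\<leftarrow>ps. fconst (hh b1) * b2) = om \<gamma> j c (fconst (hh b) * 1)"
    using haar_left[OF ps] by (intro om_cong) simp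
  ultimately show ?thesis by (simp only: om_lin(2) mult.commute)
qed

lemma unitary_hh1:
  assumes "ok \<gamma>" "i < nn \<gamma>" "j < nn \<gamma>"
  shows "(\<Sum>k<nn \<gamma>. hh (x * (lt \<gamma> i k * (st (lt \<gamma> j k) * y)))) = (if i = j then hh (x * y) else 0)"
proof -
  have "pi (x * ((\<Sum>k<nn \<gamma>. lt \<gamma> i k * st (lt \<gamma> j k)) * y)) = pi (x * ((if i = j then 1 else 0) * y))"
    by (intro pi_mult_cong_left pi_mult_cong_right unitary1 assms)
  from hh_cong[OF this] show ?thesis
    by (simp add: sum_distrib_left sum_distrib_right mult.assoc hh_sum split: if_splits)
qed

lemma unitary_hh2:
  assumes "ok \<gamma>" "i < nn \<gamma>" "j < nn \<gamma>"
  shows "(\<Sum>k<nn \<gamma>. hh (x * (st (lt \<gamma> k i) * (lt \<gamma> k j * y)))) = (if i = j then hh (x * y) else 0)"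
proof -
  have "pi (x * ((\<Sum>k<nn \<gamma>. st (lt \<gamma> k i) * lt \<gamma> k j) * y)) = pi (x * ((if i = j then 1 else 0) * y))"
    by (intro pi_mult_cong_left pi_mult_cong_right unitary2 assms)
  from hh_cong[OF this] show ?thesis
    by (simp add: sum_distrib_left sum_distrib_right mult.assoc hh_sum split: if_splits)
qed

section \<open>The modular automorphism and its KMS relation\<close>

definition CC :: "direction \<Rightarrow> nat \<Rightarrow> nat \<Rightarrow> complex" where
  "CC \<gamma> j c = om \<gamma> j c 1"

text \<open>Evaluate \<open>om_hh\<close> at \<open>b\<close> times an entry and sum over the column
  of that entry: unitarity removes it against the adjoint entry in \<open>HH\<close>. This leaves
  \<open>hh (lt \<gamma> k j * b)\<close> weighted by \<open>MM\<close>, and \<open>MI\<close>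
  inverts the weight.\<close>

lemma kms_letter:
  assumes ok: "ok \<gamma>" and ij: "i < nn \<gamma>" "j < nn \<gamma>"
  shows "hh (lt \<gamma> i j * b) = (\<Sum>e<nn \<gamma>. \<Sum>c<nn \<gamma>. MI \<gamma> e i * CC \<gamma> j c * hh (b * lt \<gamma> e c))"
proof -
  let ?n = "nn \<gamma>" let ?a = "lt \<gamma>"
  have 1: "(\<Sum>k<?n. MM \<gamma> k e * hh (?a k j * b)) = (\<Sum>c<?n. CC \<gamma> j c * hh (b * ?a e c))" if e: "e < ?n" for e
  proof -
    have "(\<Sum>c<?n. CC \<gamma> j c * hh (b * ?a e c)) = (\<Sum>c<?n. om \<gamma> j c (b * ?a e c))"
      using om_hh[OF ok ij(2), symmetric] by (simp add: CC_def)
    also have "\<dots> = (\<Sum>c<?n. \<Sum>k<?n. \<Sum>d<?n. MM \<gamma> k d * hh (?a k j * b * (?a e c * (st (?a d c) * 1))))"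
      by (simp add: om_def HH_def mult.assoc)
    also have "\<dots> = (\<Sum>k<?n. \<Sum>d<?n. \<Sum>c<?n. MM \<gamma> k d * hh (?a k j * b * (?a e c * (st (?a d c) * 1))))"
      by (subst sum.swap, rule sum.cong[OF refl], rule sum.swap)
    also have "\<dots> = (\<Sum>k<?n. \<Sum>d<?n. MM \<gamma> k d * (if e = d then hh (?a k j * b * 1) else 0))"
      unfolding sum_distrib_left[symmetric]
      by (intro sum.cong refl, rule arg_cong2[of _ _ _ _ "(*)"], rule refl, rule unitary_hh1[OF ok e], simp)
    also have "\<dots> = (\<Sum>k<?n. MM \<gamma> k e * hh (?a k j * b))"
      using e by (simp add: if_distrib cong: if_cong)
    finally show ?thesis ..
  qed
  have "(\<Sum>e<?n. \<Sum>c<?n. MI \<gamma> e i * CC \<gamma> j c * hh (b * ?a e c)) =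
    (\<Sum>e<?n. MI \<gamma> e i * (\<Sum>k<?n. MM \<gamma> k e * hh (?a k j * b)))"
    using 1 by (intro sum.cong refl) (simp add: sum_distrib_left[symmetric] mult.assoc)
  also have "\<dots> = (\<Sum>k<?n. (\<Sum>e<?n. MM \<gamma> k e * MI \<gamma> e i) * hh (?a k j * b))"
    unfolding sum_distrib_left sum_distrib_right by (subst sum.swap) (simp add: mult_ac)
  also have "\<dots> = (\<Sum>k<?n. if k = i then hh (?a k j * b) else 0)"
    by (rule sum.cong[OF refl]) (simp add: MM_MI[OF ok _ ij(1)])
  also have "\<dots> = hh (?a i j * b)" using ij by simp
  finally show ?thesis ..
qed

text \<open>Read off from \<open>kms_letter\<close>; moving one factor after the other around the
  Haar state extends it multiplicatively.\<close>

definition s0 :: "(nat \<times> nat \<times> nat) \<times> bool \<Rightarrow> entry_alg" where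
  "s0 l = (if vl l then case l of ((p, i, j), b) \<Rightarrow> let \<gamma> = (p, b) in
     \<Sum>e<nn \<gamma>. \<Sum>c<nn \<gamma>. fconst (MI \<gamma> e i * CC \<gamma> j c) * lt \<gamma> e c else 0)"

definition ss :: "entry_alg \<Rightarrow> entry_alg" where "ss = subst s0"

lemma ss_lt: "ok \<gamma> \<Longrightarrow> i < nn \<gamma> \<Longrightarrow> j < nn \<gamma> \<Longrightarrow>
    ss (lt \<gamma> i j) = (\<Sum>e<nn \<gamma>. \<Sum>c<nn \<gamma>. fconst (MI \<gamma> e i * CC \<gamma> j c) * lt \<gamma> e c)"
  unfolding ss_def lt_def subst_letter using vl_iff[of \<gamma> i j]
  by (simp add: s0_def Let_def lt_def del: vl.simps)

lemma ss_invalid: "\<not> (ok \<gamma> \<and> i < nn \<gamma> \<and> j < nn \<gamma>) \<Longrightarrow> ss (lt \<gamma> i j) = 0"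
  using vl_iff[of \<gamma> i j] by (auto simp: ss_def lt_def s0_def simp del: vl.simps)

lemma ss_add: "ss (p + q) = ss p + ss q" and ss_mult: "ss (p * q) = ss p * ss q"
  and ss_fconst [simp]: "ss (fconst c) = fconst c" and ss_zero [simp]: "ss 0 = 0" and ss_one [simp]: "ss 1 = 1"
  by (simp_all add: ss_def subst_add subst_mult)

lemma kms: "hh (p * b) = hh (b * ss p)"
proof (induction p arbitrary: b rule: free_alg_induct')
  case (const c)
  show ?case by (simp add: fconst_commute[of b])
next
  case (letter l)
  have "\<forall>b. hh (sgl [l] 1 * b) = hh (b * ss (sgl [l] 1))"
  proof (rule lt_cases, intro allI)
    fix \<gamma> i j b
    show "hh (lt \<gamma> i j * b) = hh (b * ss (lt \<gamma> i j))"
    proof (cases "ok \<gamma> \<and> i < nn \<gamma> \<and> j < nn \<gamma>")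
      case True
      then show ?thesis
        by (simp add: kms_letter ss_lt sum_distrib_left hh_sum hh_smult_right)
    next
      case False
      then have "hh (lt \<gamma> i j * b) = hh (0 * b)"
        by (intro hh_cong pi_mult_cong_left pi_lt_invalid)
      then show ?thesis using False by (simp add: ss_invalid)
    qed
  qed
  then show ?case by blast
next
  case (add p q)
  then show ?case by (simp add: distrib_left distrib_right hh_add ss_add)
next
  case (mult p q)
  have "hh (p * q * b) = hh (q * b * ss p)" using mult(1)[of "q * b"] by (simp add: mult.assoc)
  also have "\<dots> = hh (b * ss p * ss q)" using mult(2)[of "b * ss p"] by (simp add: mult.assoc)
  finally show ?case by (simp add: ss_mult mult.assoc)
qed

lemma L_ss: "L p = L q \<Longrightarrow> L (ss p) = L (ss q)"
proof (rule L_eqI)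
  fix a assume "L p = L q"
  then have "hh (p * a) = hh (q * a)" by (intro hh_eq L_mult refl)
  then show "hh (a * ss p) = hh (a * ss q)" by (simp only: kms[symmetric])
qed

lemma ss_st: "L (ss (st (ss p))) = L (st p)"
proof (rule L_eqI)
  fix a
  have "hh (a * ss (st (ss p))) = hh (st (ss p) * a)" by (rule kms[symmetric])
  also have "\<dots> = hh (st (ss p) * st (st a))" by (intro hh_eq L_mult refl L_st_st[symmetric])
  also have "\<dots> = cnj (hh (st a * ss p))" by (simp only: st_mult[symmetric] hh_st)
  also have "\<dots> = cnj (hh (p * st a))" by (simp only: kms[symmetric])
  also have "\<dots> = hh (st (st a) * st p)" by (simp only: st_mult[symmetric] hh_st)
  also have "\<dots> = hh (a * st p)" by (intro hh_eq L_mult refl L_st_st)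
  finally show "hh (a * ss (st (ss p))) = hh (a * st p)" .
qed

lemma hh_kk: "hh (kk p) = hh p"
proof (induction p rule: pi_induct)
  case (cong p q)
  then show ?case using hh_cong[OF kk_cong[OF cong(2)]] hh_cong[OF cong(2)] by simp
next
  case (word gs "is" js)
  then show ?case
    using ucorep_hh_proj(1)[OF ucorep_wd[OF word(1)] word(2,3)] by (simp add: kk_wd hh_st)
qed (simp_all add: kk_add kk_smult hh_add hh_smult)

text \<open>On a word the antipode is the adjoint of the transposed word, so two applications with a
  star between them cancel the transposition.\<close>

lemma kk_st_kk: "L (kk (st (kk p))) = L (st p)"
proof (induction p rule: pi_induct)
  case (cong p q)
  then show ?case
    by (metis L_cong L_eq_iff kk_cong pi_st_cong)
next
  case (word gs "is" js)
  have "L (st (kk (wd gs is js))) = L (wd gs js is)" by (simp add: kk_wd L_st_st)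
  from L_kk[OF this] show ?case by (simp add: kk_wd)
qed (simp_all add: kk_add kk_smult st_add st_smult L_add L_smult)

lemma kk_surj: "\<exists>q. L (kk q) = L p"
  using kk_st_kk[of "st p"] by (metis L_st_st)

section \<open>The squared antipode and its relation to the modular automorphism\<close>

definition k2 :: "entry_alg \<Rightarrow> entry_alg" where "k2 p = kk (kk p)"

lemma k2_add: "k2 (p + q) = k2 p + k2 q" and k2_mult: "k2 (p * q) = k2 p * k2 q"
  and k2_smult: "k2 (fconst c * p) = fconst c * k2 p"
  by (simp_all add: k2_def kk_add kk_mult kk_smult)

lemma k2_surj: "\<exists>q. L (k2 q) = L p"
  unfolding k2_def by (metis L_kk kk_surj)

lemma L_k2: "L p = L q \<Longrightarrow> L (k2 p) = L (k2 q)"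
  unfolding k2_def by (intro L_kk)

lemma hh_k2: "hh (k2 p) = hh p"
  by (simp add: k2_def hh_kk)

text \<open>\<sigma> is determined by the Haar state, and the squared antipode is a homomorphism
  preserving that state. Surjectivity allows testing against elements of the form
  \<open>k2 b\<close>.\<close>

lemma ss_k2: "L (ss (k2 p)) = L (k2 (ss p))"
proof (rule L_eqI)
  fix a
  obtain b where b: "L (k2 b) = L a" using k2_surj by blast
  have "hh (a * ss (k2 p)) = hh (k2 p * k2 b)"
    unfolding kms[symmetric] by (intro hh_eq L_mult refl b[symmetric])
  also have "\<dots> = hh (p * b)" by (simp add: k2_mult[symmetric] hh_k2)
  also have "\<dots> = hh (k2 b * k2 (ss p))" by (simp only: kms[of p b] k2_mult[symmetric] hh_k2)
  also have "\<dots> = hh (a * k2 (ss p))" by (intro hh_eq L_mult refl b)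
  finally show "hh (a * ss (k2 p)) = hh (a * k2 (ss p))" .
qed

text \<open>On adjoint entries both maps produce the same weight \<open>MM\<close> on the row index;
  eliminating it leaves a relation between column indices only. That \<open>A\<close> does not
  depend on the row \<open>e\<close> is what later makes \<open>U\<close> act on one index.\<close>

lemma k2_ss_st:
  assumes ok: "ok \<gamma>"
  shows "\<exists>A. \<forall>e<nn \<gamma>. \<forall>a<nn \<gamma>. L (k2 (st (lt \<gamma> e a))) = (\<Sum>j<nn \<gamma>. A j a *\<^sub>C L (ss (st (lt \<gamma> e j))))"
proof -
  let ?n = "nn \<gamma>" let ?a = "lt \<gamma>"
  have k1: "(\<Sum>b<?n. fconst (MM \<gamma> b c) * k2 (st (?a e b))) = (\<Sum>g<?n. fconst (MM \<gamma> e g) * st (?a g c))"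
    if "e < ?n" "c < ?n" for e c
  proof -
    have a: "(\<Sum>f<?n. fconst (dm \<gamma> f z) * k2 (st (?a e f))) = (\<Sum>x<?n. fconst (dm \<gamma> e x) * kk (st (lt (bar \<gamma>) z x)))"
      if "z < ?n" for z
      using arg_cong[OF dm_st[OF ok \<open>e < ?n\<close> that], of "\<lambda>x. kk (kk x)"]
      by (simp add: kk_sum kk_smult kk_lt k2_def)
    have b: "(\<Sum>z<?n. fconst (cnj (dm \<gamma> c z)) * kk (st (lt (bar \<gamma>) z x))) = (\<Sum>g<?n. fconst (cnj (dm \<gamma> g x)) * st (?a g c))"
      if "x < ?n" for x
      using arg_cong[OF dm_st'[OF ok \<open>c < ?n\<close> that], of kk]
      by (simp add: kk_sum kk_smult kk_lt)
    have "(\<Sum>b<?n. fconst (MM \<gamma> b c) * k2 (st (?a e b))) =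
      (\<Sum>b<?n. \<Sum>z<?n. fconst (cnj (dm \<gamma> c z)) * (fconst (dm \<gamma> b z) * k2 (st (?a e b))))"
      by (simp add: MM_def fconst_sum sum_distrib_right fconst_fconst mult.commute)
    also have "\<dots> = (\<Sum>z<?n. fconst (cnj (dm \<gamma> c z)) * (\<Sum>b<?n. fconst (dm \<gamma> b z) * k2 (st (?a e b))))"
      unfolding sum_distrib_left by (rule sum.swap)
    also have "\<dots> = (\<Sum>z<?n. fconst (cnj (dm \<gamma> c z)) * (\<Sum>x<?n. fconst (dm \<gamma> e x) * kk (st (lt (bar \<gamma>) z x))))"
      by (intro sum.cong refl) (simp add: a)
    also have "\<dots> = (\<Sum>x<?n. fconst (dm \<gamma> e x) * (\<Sum>z<?n. fconst (cnj (dm \<gamma> c z)) * kk (st (lt (bar \<gamma>) z x))))"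
      unfolding sum_distrib_left by (subst sum.swap) (simp add: fconst_fconst mult.commute)
    also have "\<dots> = (\<Sum>x<?n. fconst (dm \<gamma> e x) * (\<Sum>g<?n. fconst (cnj (dm \<gamma> g x)) * st (?a g c)))"
      by (intro sum.cong refl) (simp add: b)
    also have "\<dots> = (\<Sum>g<?n. fconst (MM \<gamma> e g) * st (?a g c))"
      unfolding sum_distrib_left MM_def fconst_sum sum_distrib_right by (subst sum.swap) (simp add: fconst_fconst)
    finally show ?thesis .
  qed
  \<comment> \<open>This has the same left-hand side as the right-hand side of \<open>k1\<close>,
    but now expressed through \<sigma>; the two are compared below and the weight \<open>MM\<close>
    is inverted.\<close>
  have k2': "L (\<Sum>g<?n. fconst (MM \<gamma> e g) * st (?a g c)) = L (\<Sum>j<?n. fconst (CC \<gamma> j c) * ss (st (?a e j)))"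
    if e: "e < ?n" and c: "c < ?n" for e c
  proof (rule L_eqI)
    fix b
    have "hh (b * (\<Sum>j<?n. fconst (CC \<gamma> j c) * ss (st (?a e j)))) = (\<Sum>j<?n. CC \<gamma> j c * hh (st (?a e j) * b))"
      by (simp add: sum_distrib_left hh_sum hh_smult_right kms[symmetric])
    also have "\<dots> = (\<Sum>j<?n. om \<gamma> j c (st (?a e j) * b))"
      using om_hh[OF ok _ c, symmetric] by (simp add: CC_def)
    also have "\<dots> = (\<Sum>j<?n. \<Sum>k<?n. \<Sum>d<?n. MM \<gamma> k d * hh (1 * (?a k j * (st (?a e j) * (b * st (?a d c))))))"
      by (simp add: om_def HH_def mult.assoc)
    also have "\<dots> = (\<Sum>k<?n. \<Sum>d<?n. \<Sum>j<?n. MM \<gamma> k d * hh (1 * (?a k j * (st (?a e j) * (b * st (?a d c))))))"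
      by (subst sum.swap, rule sum.cong[OF refl], rule sum.swap)
    also have "\<dots> = (\<Sum>k<?n. \<Sum>d<?n. MM \<gamma> k d * (if k = e then hh (1 * (b * st (?a d c))) else 0))"
      unfolding sum_distrib_left[symmetric]
      by (intro sum.cong refl, rule arg_cong2[of _ _ _ _ "(*)"], rule refl, rule unitary_hh1[OF ok _ e], simp)
    also have "\<dots> = (\<Sum>d<?n. MM \<gamma> e d * hh (b * st (?a d c)))"
      using e by (subst sum.swap) (simp add: if_distrib cong: if_cong)
    finally show "hh (b * (\<Sum>g<?n. fconst (MM \<gamma> e g) * st (?a g c))) =
      hh (b * (\<Sum>j<?n. fconst (CC \<gamma> j c) * ss (st (?a e j))))"
      by (simp add: sum_distrib_left hh_sum hh_smult_right)
  qed
  define A where "A j a = (\<Sum>c<?n. CC \<gamma> j c * MI \<gamma> c a)" for j a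
  have "L (k2 (st (?a e a))) = (\<Sum>j<?n. A j a *\<^sub>C L (ss (st (?a e j))))" if e: "e < ?n" and a: "a < ?n" for e a
  proof -
    have "(\<Sum>j<?n. A j a *\<^sub>C L (ss (st (?a e j)))) =
      (\<Sum>c<?n. MI \<gamma> c a *\<^sub>C (\<Sum>j<?n. CC \<gamma> j c *\<^sub>C L (ss (st (?a e j)))))"
      unfolding A_def scaleC_sum_left scaleC_sum_right by (subst sum.swap) (simp add: scaleC_scaleC mult.commute)
    also have "\<dots> = (\<Sum>c<?n. MI \<gamma> c a *\<^sub>C (\<Sum>b<?n. MM \<gamma> b c *\<^sub>C L (k2 (st (?a e b)))))"
    proof (rule sum.cong[OF refl])
      fix c assume "c \<in> {..<?n}"
      then have "L (\<Sum>b<?n. fconst (MM \<gamma> b c) * k2 (st (?a e b))) = L (\<Sum>j<?n. fconst (CC \<gamma> j c) * ss (st (?a e j)))"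
        using k1[OF e, of c] k2'[OF e, of c] by simp
      then show "MI \<gamma> c a *\<^sub>C (\<Sum>j<?n. CC \<gamma> j c *\<^sub>C L (ss (st (?a e j)))) =
        MI \<gamma> c a *\<^sub>C (\<Sum>b<?n. MM \<gamma> b c *\<^sub>C L (k2 (st (?a e b))))"
        by (simp add: L_sum L_smult)
    qed
    also have "\<dots> = (\<Sum>b<?n. (\<Sum>c<?n. MM \<gamma> b c * MI \<gamma> c a) *\<^sub>C L (k2 (st (?a e b))))"
      unfolding scaleC_sum_left scaleC_sum_right by (subst sum.swap) (simp add: scaleC_scaleC mult.commute)
    also have "\<dots> = (\<Sum>b<?n. if b = a then L (k2 (st (?a e b))) else 0)"
      using MM_MI[OF ok _ a] by (intro sum.cong refl) simp
    also have "\<dots> = L (k2 (st (?a e a)))" using a by simp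
    finally show ?thesis ..
  qed
  then show ?thesis by blast
qed

end

section \<open>Symmetric operators with finite-dimensional orbits\<close>

definition papp :: "('h::complex_hilbert_space \<Rightarrow> 'h) \<Rightarrow> complex poly \<Rightarrow> 'h \<Rightarrow> 'h" where
  "papp A p x = (\<Sum>k\<le>degree p. coeff p k *\<^sub>C (A ^^ k) x)"

lemma papp_ge: "degree p \<le> n \<Longrightarrow> papp A p x = (\<Sum>k\<le>n. coeff p k *\<^sub>C (A ^^ k) x)"
  unfolding papp_def by (rule sum.mono_neutral_left) (auto simp: coeff_eq_0)

lemma papp_root:
  assumes V: "csub V" "\<And>x. x \<in> V \<Longrightarrow> A x \<in> V"
    and A: "\<And>x y. x \<in> V \<Longrightarrow> y \<in> V \<Longrightarrow> A (x + y) = A x + A y"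
      "\<And>c x. x \<in> V \<Longrightarrow> A (c *\<^sub>C x) = c *\<^sub>C A x" and x: "x \<in> V"
  shows "papp A ([:- z, 1:] * q) x = papp A q (A x - z *\<^sub>C x)"
proof -
  have p: "[:- z, 1:] * q = pCons 0 q - Polynomial.smult z q" by simp
  define n where "n = Suc (degree q)"
  have it: "(A ^^ k) y \<in> V" if "y \<in> V" for k y
    using that V(2) by (induction k) auto
  have lin: "(A ^^ k) (A x - z *\<^sub>C x) = (A ^^ Suc k) x - z *\<^sub>C (A ^^ k) x" for k
  proof (induction k)
    case (Suc k)
    have d: "A (u - z *\<^sub>C v) = A u - z *\<^sub>C A v" if "u \<in> V" "v \<in> V" for u v
      using A(1)[OF that(1) csub_scaleC[OF V(1) that(2)], of "- z"] A(2)[OF that(2), of "- z"]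
      by (simp add: scaleC_minus_left)
    have "(A ^^ Suc k) (A x - z *\<^sub>C x) = A ((A ^^ Suc k) x - z *\<^sub>C (A ^^ k) x)"
      using Suc by simp
    also have "\<dots> = A ((A ^^ Suc k) x) - z *\<^sub>C A ((A ^^ k) x)"
      by (rule d) (use it[OF x] in blast)+
    finally show ?case by simp
  qed simp
  have "degree ([:- z, 1:] * q) \<le> n"
    unfolding n_def by (rule order_trans[OF degree_mult_le]) simp
  then have "papp A ([:- z, 1:] * q) x = (\<Sum>k\<le>n. coeff (pCons 0 q - Polynomial.smult z q) k *\<^sub>C (A ^^ k) x)"
    unfolding p by (rule papp_ge)
  also have "\<dots> = (\<Sum>k\<le>n. coeff (pCons 0 q) k *\<^sub>C (A ^^ k) x) - (\<Sum>k\<le>n. coeff q k *\<^sub>C z *\<^sub>C (A ^^ k) x)"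
    by (simp add: scaleC_diff_left sum_subtractf scaleC_scaleC mult.commute)
  also have "(\<Sum>k\<le>n. coeff (pCons 0 q) k *\<^sub>C (A ^^ k) x) = (\<Sum>k\<le>degree q. coeff q k *\<^sub>C (A ^^ Suc k) x)"
    unfolding n_def by (subst sum.atMost_Suc_shift) simp
  also have "(\<Sum>k\<le>n. coeff q k *\<^sub>C z *\<^sub>C (A ^^ k) x) = (\<Sum>k\<le>degree q. coeff q k *\<^sub>C z *\<^sub>C (A ^^ k) x)"
    unfolding n_def by (simp add: coeff_eq_0)
  finally show ?thesis
    by (simp add: papp_def lin scaleC_diff_right sum_subtractf del: funpow.simps)
qed

text \<open>One subtracts a solution of the equation for A - z inside the eigenspan. Symmetry rules
  out a Jordan block at z, so the remainder is an eigenvector; it vanishes unless z is real.\<close>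

lemma eigen_step:
  assumes V: "csub V" "\<And>x. x \<in> V \<Longrightarrow> A x \<in> V"
    and A: "\<And>x y. x \<in> V \<Longrightarrow> y \<in> V \<Longrightarrow> A (x + y) = A x + A y"
      "\<And>c x. x \<in> V \<Longrightarrow> A (c *\<^sub>C x) = c *\<^sub>C A x"
    and sym: "\<And>x y. x \<in> V \<Longrightarrow> y \<in> V \<Longrightarrow> cinner x (A y) = cinner (A x) y"
    and x: "x \<in> V" and y: "A x - z *\<^sub>C x \<in> cspan {v \<in> V. \<exists>l::real. A v = l *\<^sub>R v}"
  shows "x \<in> cspan {v \<in> V. \<exists>l::real. A v = l *\<^sub>R v}" (is "_ \<in> cspan ?E")
proof -
  have EV: "cspan ?E \<subseteq> V" by (rule cspan_minimal[OF V(1)]) auto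
  \<comment> \<open>On an eigenvector with eigenvalue different from z the operator A - z is
    inverted explicitly. Only the component at z itself resists, and it is collected in
    \<open>y0\<close>.\<close>
  have "\<exists>x'\<in>cspan ?E. \<exists>y0\<in>V. A y0 = z *\<^sub>C y0 \<and> A x - z *\<^sub>C x = (A x' - z *\<^sub>C x') + y0"
    using y
  proof (induction rule: cspan_induct)
    case zero
    have "A 0 = 0" using A(2)[OF csub_0[OF V(1)], of 0] by simp
    then show ?case using csub_0[OF cspan_csub[of ?E]] csub_0[OF V(1)]
      by (intro bexI[of _ 0]) auto
  next
    case (add u v)
    then obtain u' u0 v' v0 where *: "u' \<in> cspan ?E" "u0 \<in> V" "A u0 = z *\<^sub>C u0" "u = A u' - z *\<^sub>C u' + u0"
      "v' \<in> cspan ?E" "v0 \<in> V" "A v0 = z *\<^sub>C v0" "v = A v' - z *\<^sub>C v' + v0" by blast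
    then have "u' \<in> V" "v' \<in> V" using EV by auto
    with * show ?case
      by (intro bexI[of _ "u' + v'"] bexI[of _ "u0 + v0"])
        (auto simp: A scaleC_add_right intro: csub_add[OF V(1)] csub_add[OF cspan_csub])
  next
    case (scale c u)
    then obtain u' u0 where *: "u' \<in> cspan ?E" "u0 \<in> V" "A u0 = z *\<^sub>C u0" "u = A u' - z *\<^sub>C u' + u0"
      by blast
    then have "u' \<in> V" using EV by auto
    with * show ?case
      by (intro bexI[of _ "c *\<^sub>C u'"] bexI[of _ "c *\<^sub>C u0"])
        (auto simp: A scaleC_add_right scaleC_diff_right scaleC_scaleC mult.commute
          intro: csub_scaleC[OF V(1)] csub_scaleC[OF cspan_csub])
  next
    case (base v)
    then obtain l :: real where v: "v \<in> V" "A v = of_real l *\<^sub>C v" by (auto simp: scaleC_of_real)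
    show ?case
    proof (cases "of_real l = z")
      case True
      have "A 0 = 0" using A(2)[OF csub_0[OF V(1)], of 0] by simp
      then show ?thesis using v True csub_0[OF cspan_csub[of ?E]] by (intro bexI[of _ 0] bexI[of _ v]) auto
    next
      case False
      have "A (inverse (of_real l - z) *\<^sub>C v) - z *\<^sub>C inverse (of_real l - z) *\<^sub>C v =
         ((of_real l - z) * inverse (of_real l - z)) *\<^sub>C v"
        using v by (simp add: A scaleC_scaleC scaleC_diff_left[symmetric] algebra_simps)
      also have "\<dots> = v" using False by simp
      finally show ?thesis using base csub_0[OF V(1)] A(2)[OF csub_0[OF V(1)], of 0]
        by (intro bexI[of _ "inverse (of_real l - z) *\<^sub>C v"] bexI[of _ 0])
          (auto intro: csub_scaleC[OF cspan_csub] cspan_base)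
    qed
  qed
  then obtain x' y0 where x': "x' \<in> cspan ?E" and y0: "y0 \<in> V" "A y0 = z *\<^sub>C y0"
    and e: "A x - z *\<^sub>C x = (A x' - z *\<^sub>C x') + y0" by blast
  have x'V: "x' \<in> V" using x' EV by auto
  define w where "w = x - x'"
  have wV: "w \<in> V" unfolding w_def by (intro csub_diff V x x'V)
  have "A x = A w + A x'" using A(1)[OF wV x'V] by (simp add: w_def)
  with e have w: "A w = z *\<^sub>C w + y0" by (simp add: w_def scaleC_diff_right algebra_simps)
  \<comment> \<open>For real z the vector \<open>y0\<close> lies in both the kernel and the range of
    A - z, which are orthogonal; for other z a symmetric operator has no eigenvector.\<close>
  have y0z: "y0 = 0"
  proof (cases "cnj z = z")
    case False
    have "z * cinner y0 y0 = cnj z * cinner y0 y0"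
      using sym[OF y0(1) y0(1)] by (simp add: y0 cinner_scaleC_left cinner_scaleC_right)
    then show ?thesis using False by (auto simp: cinner_eq_zero_iff)
  next
    case True
    have "cinner y0 (A w) = cinner (A y0) w" by (rule sym[OF y0(1) wV])
    then have "cinner y0 y0 = 0"
      using True by (simp add: w y0 cinner_scaleC_left cinner_scaleC_right cinner_add_right)
    then show ?thesis by (simp add: cinner_eq_zero_iff)
  qed
  have "w \<in> cspan ?E"
  proof (cases "cnj z = z")
    case True
    then obtain r where "z = of_real r" by (metis Reals_cnj_iff Reals_cases)
    then have "w \<in> ?E" using w wV y0z by (auto simp: scaleC_of_real)
    then show ?thesis by (rule cspan_base)
  next
    case False
    have "z * cinner w w = cnj z * cinner w w"
      using sym[OF wV wV] by (simp add: w y0z cinner_scaleC_left cinner_scaleC_right)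
    then have "w = 0" using False by (auto simp: cinner_eq_zero_iff)
    then show ?thesis using csub_0[OF cspan_csub] by simp
  qed
  then have "w + x' \<in> cspan ?E" using x' by (rule csub_add[OF cspan_csub])
  then show ?thesis by (simp add: w_def)
qed

lemma eigen_poly:
  assumes V: "csub V" "\<And>x. x \<in> V \<Longrightarrow> A x \<in> V"
    and A: "\<And>x y. x \<in> V \<Longrightarrow> y \<in> V \<Longrightarrow> A (x + y) = A x + A y"
      "\<And>c x. x \<in> V \<Longrightarrow> A (c *\<^sub>C x) = c *\<^sub>C A x"
    and sym: "\<And>x y. x \<in> V \<Longrightarrow> y \<in> V \<Longrightarrow> cinner x (A y) = cinner (A x) y"
    and "p \<noteq> 0" "papp A p x = 0" "x \<in> V"
  shows "x \<in> cspan {v \<in> V. \<exists>l::real. A v = l *\<^sub>R v}"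
  using assms(6-8)
proof (induction "degree p" arbitrary: p x)
  case 0
  then obtain a where p: "p = [:a:]" "a \<noteq> 0" by (metis degree_eq_zeroE pCons_0_0)
  with 0 have "x = 0" by (simp add: papp_def scaleC_eq_0)
  then show ?case using csub_0[OF cspan_csub] by simp
next
  case (Suc n)
  then have "\<not> constant (poly p)" by (metis constant_degree nat.distinct(1))
  then obtain z where "poly p z = 0" using fundamental_theorem_of_algebra by blast
  then obtain q where q: "p = [:- z, 1:] * q" by (auto simp: poly_eq_0_iff_dvd)
  then have q0: "q \<noteq> 0" using Suc.prems(1) by auto
  have "degree p = 1 + degree q" using q q0 by (subst q, subst degree_mult_eq) auto
  then have n: "n = degree q" using Suc.hyps(2) by simp
  have "papp A q (A x - z *\<^sub>C x) = 0"
    using papp_root[OF V A Suc.prems(3), of z q] Suc.prems(2) q by simp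
  moreover have "A x - z *\<^sub>C x \<in> V"
    using Suc.prems(3) V by (intro csub_diff[OF V(1)] csub_scaleC[OF V(1)]) auto
  ultimately have "A x - z *\<^sub>C x \<in> cspan {v \<in> V. \<exists>l::real. A v = l *\<^sub>R v}"
    using Suc.hyps(1)[OF n q0] by blast
  from eigen_step[where A = A and V = V and x = x and z = z, OF V A sym Suc.prems(3) this]
  show ?case .
qed

text \<open>Inside a finite-dimensional invariant span the iterates of \<open>x\<close> are
  dependent, which provides an annihilating polynomial for \<open>eigen_poly\<close>.\<close>

lemma eigen_decomposition:
  assumes V: "csub V" "\<And>x. x \<in> V \<Longrightarrow> A x \<in> V"
    and A: "\<And>x y. x \<in> V \<Longrightarrow> y \<in> V \<Longrightarrow> A (x + y) = A x + A y"
      "\<And>c x. x \<in> V \<Longrightarrow> A (c *\<^sub>C x) = c *\<^sub>C A x"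
    and sym: "\<And>x y. x \<in> V \<Longrightarrow> y \<in> V \<Longrightarrow> cinner x (A y) = cinner (A x) y"
    and B: "finite B" "x \<in> cspan B" "\<And>y. y \<in> cspan B \<Longrightarrow> A y \<in> cspan B" and x: "x \<in> V"
  shows "x \<in> cspan {v \<in> V. \<exists>l::real. A v = l *\<^sub>R v}"
proof -
  \<comment> \<open>Over the reals the complex span of B is spanned by B together with \<i> B, so
    the dimension bound for real spans applies.\<close>
  define G where "G = B \<union> (\<lambda>b. \<i> *\<^sub>C b) ` B"
  have G: "finite G" using B by (simp add: G_def)
  have "cspan B \<subseteq> span G"
  proof
    fix y assume "y \<in> cspan B"
    then show "y \<in> span G"
      unfolding cspan_def
    proof (induction rule: span_induct_alt)
      case (step r u v)
      then obtain c b where u: "u = c *\<^sub>C b" "b \<in> B" by auto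
      have "u = Re c *\<^sub>R b + Im c *\<^sub>R (\<i> *\<^sub>C b)"
        unfolding u(1) scaleC_of_real[symmetric] scaleC_scaleC scaleC_add_left[symmetric]
        by (simp add: complex_eq[symmetric] mult.commute)
      also have "\<dots> \<in> span G" using u(2)
        by (intro span_add span_scale span_base) (auto simp: G_def)
      finally show ?case using step by (intro span_add span_scale)
    qed (rule span_zero)
  qed
  moreover have it: "(A ^^ k) x \<in> cspan B" for k
    using B by (induction k) auto
  ultimately have itG: "(A ^^ k) x \<in> span G" for k by blast
  define N where "N = card G"
  define f where "f k = (A ^^ k) x" for k
  \<comment> \<open>Dependence concerns the set of iterates, so coinciding iterates need a separate
    polynomial, a difference of two monomials.\<close>
  have "\<exists>p. p \<noteq> 0 \<and> papp A p x = 0"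
  proof (cases "inj_on f {..N}")
    case False
    then obtain i j where ij: "i \<le> N" "j \<le> N" "i \<noteq> j" "f i = f j" by (auto simp: inj_on_def)
    define p :: "complex poly" where "p = monom 1 i - monom 1 j"
    have "coeff p i = 1" using ij by (simp add: p_def)
    then have "p \<noteq> 0" by auto
    moreover have "degree p \<le> N" unfolding p_def
      by (rule degree_diff_le) (use ij degree_monom_le le_trans in blast)+
    then have "papp A p x = (\<Sum>k\<le>N. coeff p k *\<^sub>C (A ^^ k) x)" by (rule papp_ge)
    then have "papp A p x = (\<Sum>k\<le>N. (if k = i then f k else 0) - (if k = j then f k else 0))"
      using ij(3) by (simp add: p_def) (intro sum.cong refl, auto simp: scaleC_minus_one f_def)
    then have "papp A p x = 0" using ij by (simp add: sum_subtractf)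
    ultimately show ?thesis by blast
  next
    case True
    have "dependent (f ` {..N})"
    proof (rule ccontr)
      assume "independent (f ` {..N})"
      then have "card (f ` {..N}) \<le> card G"
        using independent_span_bound[OF G] itG by (auto simp: f_def)
      then show False using True by (simp add: card_image N_def)
    qed
    then obtain u v where u: "v \<in> f ` {..N}" "u v \<noteq> 0" "(\<Sum>v\<in>f ` {..N}. u v *\<^sub>R v) = 0"
      by (subst (asm) dependent_finite) auto
    then obtain i where i: "i \<le> N" "v = f i" by auto
    define p :: "complex poly" where "p = (\<Sum>k\<le>N. monom (of_real (u (f k))) k)"
    have c: "coeff p k = (if k \<le> N then of_real (u (f k)) else 0)" for k
      by (simp add: p_def coeff_sum)
    have "coeff p i \<noteq> 0" using i u(2) by (simp add: c)
    then have "p \<noteq> 0" by auto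
    moreover have "degree p \<le> N" unfolding p_def
      by (rule degree_sum_le) (auto intro: order_trans[OF degree_monom_le])
    then have "papp A p x = (\<Sum>k\<le>N. coeff p k *\<^sub>C (A ^^ k) x)" by (rule papp_ge)
    then have "papp A p x = (\<Sum>k\<le>N. u (f k) *\<^sub>R f k)"
      by (simp add: c f_def scaleC_of_real)
    then have "papp A p x = 0" using u(3) True by (simp add: sum.reindex)
    ultimately show ?thesis by blast
  qed
  then obtain p where "p \<noteq> 0" "papp A p x = 0" by blast
  from eigen_poly[where A = A and V = V and x = x, OF V A sym this x] show ?thesis .
qed

text \<open>\<open>Op f\<close> scales a basis of joint eigenvectors. It is correct on every joint
  eigenvector, whatever the basis, because such a vector involves only basis vectors with the same
  pair of eigenvalues.\<close>

lemma diagonal_calculus: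
  fixes A B :: "'h::real_vector \<Rightarrow> 'h"
  assumes V: "subspace V"
    and A: "\<And>x y. x \<in> V \<Longrightarrow> y \<in> V \<Longrightarrow> A (x + y) = A x + A y" "\<And>c x. x \<in> V \<Longrightarrow> A (c *\<^sub>R x) = c *\<^sub>R A x"
    and B: "\<And>x y. x \<in> V \<Longrightarrow> y \<in> V \<Longrightarrow> B (x + y) = B x + B y" "\<And>c x. x \<in> V \<Longrightarrow> B (c *\<^sub>R x) = c *\<^sub>R B x"
  shows "\<exists>Op. \<forall>f. linear (Op f) \<and>
    (\<forall>a b \<xi>. \<xi> \<in> V \<and> A \<xi> = a *\<^sub>R \<xi> \<and> B \<xi> = b *\<^sub>R \<xi> \<longrightarrow> Op f \<xi> = (f a b :: real) *\<^sub>R \<xi>)"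
proof -
  define E where "E = {\<xi> \<in> V. \<exists>a b. A \<xi> = a *\<^sub>R \<xi> \<and> B \<xi> = b *\<^sub>R \<xi>}"
  obtain X where X: "X \<subseteq> E" "independent X" "E \<subseteq> span X"
    using maximal_independent_subset[of E] by blast
  have "\<forall>x\<in>X. \<exists>a b. A x = a *\<^sub>R x \<and> B x = b *\<^sub>R x" using X(1) by (auto simp: E_def)
  then obtain al be where ab: "\<And>x. x \<in> X \<Longrightarrow> A x = al x *\<^sub>R x" "\<And>x. x \<in> X \<Longrightarrow> B x = be x *\<^sub>R x"
    by metis
  have XV: "x \<in> V" if "x \<in> X" for x using that X(1) by (auto simp: E_def)
  have sumA: "C (\<Sum>x\<in>T. r x *\<^sub>R x) = (\<Sum>x\<in>T. r x *\<^sub>R C x)"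
    if C: "\<And>x y. x \<in> V \<Longrightarrow> y \<in> V \<Longrightarrow> C (x + y) = C x + C y" "\<And>c x. x \<in> V \<Longrightarrow> C (c *\<^sub>R x) = c *\<^sub>R C x"
      and T: "finite T" "T \<subseteq> X" for C :: "'h \<Rightarrow> 'h" and T r
    using T
  proof (induction T rule: finite_induct)
    case empty
    then show ?case using C(2)[of 0 0] subspace_0[OF V] by simp
  next
    case (insert x F)
    have "(\<Sum>x\<in>F. r x *\<^sub>R x) \<in> V" "r x *\<^sub>R x \<in> V"
      using insert XV by (auto intro!: subspace_sum[OF V] subspace_scale[OF V])
    then show ?case using insert C XV by simp
  qed
  \<comment> \<open>Applying A and B to the expansion and comparing coefficients shows that a basis
    vector occurs only if its eigenvalues are those of \<xi>.\<close>
  have eig: "r x * (al x - a) = 0 \<and> r x * (be x - b) = 0"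
    if \<xi>: "A \<xi> = a *\<^sub>R \<xi>" "B \<xi> = b *\<^sub>R \<xi>" "\<xi> = (\<Sum>x\<in>T. r x *\<^sub>R x)" and T: "finite T" "T \<subseteq> X" "x \<in> T"
    for \<xi> a b r T x
  proof -
    have z: "\<forall>x\<in>T. r x * (c x - d) = 0"
      if "(\<Sum>x\<in>T. r x *\<^sub>R (c x *\<^sub>R x)) = d *\<^sub>R \<xi>" for c d
    proof -
      have "(\<Sum>x\<in>T. (r x * (c x - d)) *\<^sub>R x) = 0"
        using that unfolding \<xi>(3)
        by (simp add: scaleR_sum_right right_diff_distrib scaleR_left_diff_distrib sum_subtractf mult.commute)
      then show ?thesis
        using independentD[OF X(2) T(1,2), of "\<lambda>x. r x * (c x - d)"] by blast
    qed
    have "(\<Sum>x\<in>T. r x *\<^sub>R (al x *\<^sub>R x)) = a *\<^sub>R \<xi>"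
      using sumA[OF A T(1,2)] \<xi>(1,3) ab(1) T(2) by (simp add: subset_iff)
    moreover have "(\<Sum>x\<in>T. r x *\<^sub>R (be x *\<^sub>R x)) = b *\<^sub>R \<xi>"
      using sumA[OF B T(1,2)] \<xi>(2,3) ab(2) T(2) by (simp add: subset_iff)
    ultimately show ?thesis using z T(3) by blast
  qed
  define Op where "Op f = construct X (\<lambda>x. f (al x) (be x) *\<^sub>R x)" for f :: "real \<Rightarrow> real \<Rightarrow> real"
  have lin: "linear (Op f)" for f unfolding Op_def by (rule linear_construct[OF X(2)])
  have "Op f \<xi> = f a b *\<^sub>R \<xi>" if \<xi>: "\<xi> \<in> V" "A \<xi> = a *\<^sub>R \<xi>" "B \<xi> = b *\<^sub>R \<xi>" for f a b \<xi>
  proof -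
    have "\<xi> \<in> span X" using \<xi> X(3) by (auto simp: E_def)
    then obtain T r where T: "finite T" "T \<subseteq> X" "\<xi> = (\<Sum>x\<in>T. r x *\<^sub>R x)"
      by (auto simp: span_explicit)
    have "Op f \<xi> = (\<Sum>x\<in>T. r x *\<^sub>R f (al x) (be x) *\<^sub>R x)"
      unfolding T(3) linear_sum[OF lin] linear_scale[OF lin]
      using T(2) by (intro sum.cong refl) (auto simp: Op_def construct_basis[OF X(2)])
    also have "\<dots> = (\<Sum>x\<in>T. f a b *\<^sub>R r x *\<^sub>R x)"
      using eig[OF \<xi>(2,3) T(3,1,2)] by (intro sum.cong refl) auto
    finally show ?thesis by (simp add: T(3) scaleR_sum_right)
  qed
  with lin show ?thesis by blast
qed

section \<open>Extension of operators and orthogonal projections\<close>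

text \<open>The closure of the graph is again a graph: the bound passes to limits and sends Cauchy
  sequences to Cauchy sequences. It also takes care of linear dependences among the
  \<open>g i\<close>.\<close>

lemma bounded_extension:
  fixes g :: "'i \<Rightarrow> 'x::real_normed_vector" and f :: "'i \<Rightarrow> 'y::banach"
  assumes dense: "closure (span (g ` I)) = UNIV"
    and bound: "\<And>F c. finite F \<Longrightarrow> F \<subseteq> I \<Longrightarrow>
      norm (\<Sum>i\<in>F. c i *\<^sub>R f i) \<le> C * norm (\<Sum>i\<in>F. c i *\<^sub>R g i)"
  shows "\<exists>T. bounded_linear T \<and> (\<forall>i\<in>I. T (g i) = f i)"
proof -
  define G where "G = span ((\<lambda>i. (g i, f i)) ` I)"
  have sumG: "\<exists>F c. finite F \<and> F \<subseteq> I \<and> z = (\<Sum>i\<in>F. c i *\<^sub>R (g i, f i))" if "z \<in> G" for z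
    using that unfolding G_def
  proof (induction rule: span_induct_alt)
    case base
    show ?case by (intro exI[of _ "{}"]) simp
  next
    case (step r x y)
    then obtain F c j where F: "finite F" "F \<subseteq> I" "y = (\<Sum>i\<in>F. c i *\<^sub>R (g i, f i))" "j \<in> I" "x = (g j, f j)"
      by auto
    let ?c = "\<lambda>i. (if i \<in> F then c i else 0) + (if i = j then r else 0)"
    have "(\<Sum>i\<in>insert j F. ?c i *\<^sub>R (g i, f i)) =
      (\<Sum>i\<in>insert j F. (if i \<in> F then c i *\<^sub>R (g i, f i) else 0) + (if i = j then r *\<^sub>R (g i, f i) else 0))"
      by (intro sum.cong refl) (simp add: scaleR_add_left zero_prod_def)
    also have "\<dots> = y + r *\<^sub>R x"
      using F by (simp add: sum.distrib sum.inter_restrict[symmetric] insert_absorb Int_absorb1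
          Int_insert_left sum.If_cases)
    finally show ?case using F by (intro exI[of _ "insert j F"] exI[of _ ?c]) (simp add: add.commute)
  qed
  have bG: "norm (snd z) \<le> C * norm (fst z)" if zG: "z \<in> G" for z
  proof -
    obtain F c where F: "finite F" "F \<subseteq> I" "z = (\<Sum>i\<in>F. c i *\<^sub>R (g i, f i))"
      using sumG[OF zG] by blast
    have "fst z = (\<Sum>i\<in>F. c i *\<^sub>R g i)" "snd z = (\<Sum>i\<in>F. c i *\<^sub>R f i)"
      unfolding F(3) by (simp_all add: fst_sum snd_sum)
    then show ?thesis using bound[OF F(1,2), of c] by simp
  qed
  have "closed {z :: 'x \<times> 'y. norm (snd z) \<le> C * norm (fst z)}"
    by (intro closed_Collect_le continuous_intros)
  have bH: "norm (snd z) \<le> C * norm (fst z)" if "z \<in> closure G" for z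
  proof -
    have "G \<subseteq> {z. norm (snd z) \<le> C * norm (fst z)}" using bG by blast
    from closure_minimal[OF this] that show ?thesis
      using \<open>closed {z :: 'x \<times> 'y. norm (snd z) \<le> C * norm (fst z)}\<close> by blast
  qed
  have sG: "subspace G" unfolding G_def by (rule subspace_span)
  have sH: "subspace (closure G)" by (rule subspace_closure[OF sG])
  have ex: "\<exists>w. (x, w) \<in> closure G" for x
  proof -
    have "x \<in> closure (span (g ` I))" using dense by simp
    then obtain v where v: "\<And>n. v n \<in> span (g ` I)" "v \<longlonglongrightarrow> x" unfolding closure_sequential by blast
    have "\<exists>w. (u, w) \<in> G" if "u \<in> span (g ` I)" for u
      using that
    proof (induction rule: span_induct_alt)
      case base
      then show ?case using subspace_0[OF sG] by (intro exI[of _ 0]) (simp add: zero_prod_def)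
    next
      case (step r u y)
      then obtain i w where i: "i \<in> I" "u = g i" "(y, w) \<in> G" by auto
      have "(g i, f i) \<in> G" unfolding G_def using i by (intro span_base) auto
      then have "r *\<^sub>R (g i, f i) + (y, w) \<in> G" using i sG by (intro subspace_add subspace_scale)
      then show ?case using i by auto
    qed
    then have "\<forall>n. \<exists>w. (v n, w) \<in> G" using v by blast
    then obtain w where w: "\<And>n. (v n, w n) \<in> G" by metis
    have "norm (w m - w n) \<le> C * norm (v m - v n)" for m n
      using bG[OF subspace_diff[OF sG w[of m] w[of n]]] by simp
    then have le: "norm (w m - w n) \<le> (\<bar>C\<bar> + 1) * norm (v m - v n)" for m n
      by (rule order_trans) (intro mult_right_mono, auto)
    have "Cauchy w"
    proof (rule CauchyI)
      fix e :: real assume "0 < e"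
      then have "0 < e / (\<bar>C\<bar> + 1)" by (simp add: add_nonneg_pos)
      moreover have "Cauchy v" using v(2) by (rule LIMSEQ_imp_Cauchy)
      ultimately obtain M where M: "\<And>m n. m \<ge> M \<Longrightarrow> n \<ge> M \<Longrightarrow> norm (v m - v n) < e / (\<bar>C\<bar> + 1)"
        by (metis CauchyD)
      have "norm (w m - w n) < e" if "m \<ge> M" "n \<ge> M" for m n
      proof -
        have "(\<bar>C\<bar> + 1) * norm (v m - v n) < e"
          using M[OF that] by (simp add: pos_less_divide_eq add_nonneg_pos mult.commute)
        then show ?thesis using le[of m n] by simp
      qed
      then show "\<exists>M. \<forall>m\<ge>M. \<forall>n\<ge>M. norm (w m - w n) < e" by blast
    qed
    then obtain y where "w \<longlonglongrightarrow> y" using Cauchy_convergent convergentD by blast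
    then have "(\<lambda>n. (v n, w n)) \<longlonglongrightarrow> (x, y)" using v(2) by (intro tendsto_Pair)
    then show ?thesis using w unfolding closure_sequential
      by (intro exI[of _ y] exI[of _ "\<lambda>n. (v n, w n)"]) simp
  qed
  define T where "T x = (SOME w. (x, w) \<in> closure G)" for x
  have T: "(x, T x) \<in> closure G" for x unfolding T_def by (rule someI_ex[OF ex])
  have uniq: "w = T x" if "(x, w) \<in> closure G" for x w
  proof -
    have "(x, w) + (-1) *\<^sub>R (x, T x) \<in> closure G" by (intro subspace_add[OF sH] subspace_scale[OF sH] that T)
    then show ?thesis using bH by fastforce
  qed
  have "bounded_linear T"
  proof (rule bounded_linear_intro[where K = C])
    fix x y r
    show "T (x + y) = T x + T y" using uniq[of "x + y" "T x + T y"] subspace_add[OF sH T T, of x y] by simp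
    show "T (r *\<^sub>R x) = r *\<^sub>R T x" using uniq[of "r *\<^sub>R x" "r *\<^sub>R T x"] subspace_scale[OF sH T, of r x] by simp
    show "norm (T x) \<le> norm x * C" using bH[OF T] by (simp add: mult.commute)
  qed
  moreover have "T (g i) = f i" if "i \<in> I" for i
  proof (rule uniq[symmetric])
    have "(g i, f i) \<in> G" unfolding G_def using that by (intro span_base) auto
    then show "(g i, f i) \<in> closure G" using closure_subset by blast
  qed
  ultimately show ?thesis by blast
qed

lemma dense_induct:
  assumes "closure (span A) = UNIV" and "closed {x. P x}" "subspace {x. P x}" "\<And>x. x \<in> A \<Longrightarrow> P x"
  shows "P x"
proof -
  have "span A \<subseteq> {x. P x}" using assms(3,4) by (intro span_minimal) auto
  then have "closure (span A) \<subseteq> {x. P x}" using assms(2) by (rule closure_minimal)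
  then show ?thesis using assms(1) by auto
qed

text \<open>A minimizing sequence is Cauchy by the parallelogram identity, and minimality at its
  limit forces orthogonality.\<close>

lemma orth_decomp:
  fixes M :: "'x::{real_inner, complete_space} set"
  assumes "subspace M" "closed M"
  shows "\<exists>y\<in>M. \<forall>z\<in>M. inner z (x - y) = 0"
proof -
  define D where "D = (\<lambda>m. (norm (x - m))\<^sup>2) ` M"
  have ne: "D \<noteq> {}" using subspace_0[OF assms(1)] by (auto simp: D_def)
  have bd: "bdd_below D" by (rule bdd_belowI[of _ 0]) (auto simp: D_def)
  define d where "d = Inf D"
  have d: "d \<le> (norm (x - m))\<^sup>2" if "m \<in> M" for m
    unfolding d_def using that by (intro cInf_lower bd) (auto simp: D_def)
  have "\<exists>m\<in>M. (norm (x - m))\<^sup>2 < d + e" if "e > 0" for e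
  proof -
    have "Inf D < d + e" using that by (simp add: d_def)
    from cInf_lessD[OF ne this] show ?thesis by (auto simp: D_def)
  qed
  then have "\<forall>n. \<exists>m\<in>M. (norm (x - m))\<^sup>2 < d + inverse (real (Suc n))" by simp
  then obtain m where m: "\<And>n. m n \<in> M" "\<And>n. (norm (x - m n))\<^sup>2 < d + inverse (real (Suc n))" by metis
  have par: "(norm (m i - m j))\<^sup>2 \<le> 2 * inverse (real (Suc i)) + 2 * inverse (real (Suc j))" for i j
  proof -
    have "(norm (m i - m j))\<^sup>2 + 4 * (norm (x - (1/2) *\<^sub>R (m i + m j)))\<^sup>2 = 2 * (norm (x - m i))\<^sup>2 + 2 * (norm (x - m j))\<^sup>2"
      by (simp add: power2_norm_eq_inner inner_diff_left inner_diff_right inner_add_left inner_add_right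
          inner_commute algebra_simps)
    moreover have "d \<le> (norm (x - (1/2) *\<^sub>R (m i + m j)))\<^sup>2"
      by (rule d) (intro subspace_scale subspace_add assms m)
    ultimately show ?thesis using m(2)[of i] m(2)[of j] by linarith
  qed
  have "Cauchy m"
  proof (rule CauchyI)
    fix e :: real assume e: "0 < e"
    then obtain N where N: "inverse (real (Suc N)) < e\<^sup>2 / 4" using reals_Archimedean[of "e\<^sup>2 / 4"] by auto
    have "norm (m i - m j) < e" if "i \<ge> N" "j \<ge> N" for i j
    proof -
      have "inverse (real (Suc i)) \<le> inverse (real (Suc N))" "inverse (real (Suc j)) \<le> inverse (real (Suc N))"
        using that by (auto intro!: le_imp_inverse_le)
      then have "(norm (m i - m j))\<^sup>2 < e\<^sup>2" using par[of i j] N by linarith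
      then show ?thesis using e by (simp add: power_less_imp_less_base)
    qed
    then show "\<exists>M. \<forall>i\<ge>M. \<forall>j\<ge>M. norm (m i - m j) < e" by blast
  qed
  then obtain y where y: "m \<longlonglongrightarrow> y" using Cauchy_convergent convergentD by blast
  have yM: "y \<in> M" using closed_sequentially[OF assms(2) _ y] m(1) by blast
  have yd: "(norm (x - y))\<^sup>2 \<le> d"
  proof (rule LIMSEQ_le)
    show "(\<lambda>n. (norm (x - m n))\<^sup>2) \<longlonglongrightarrow> (norm (x - y))\<^sup>2" by (intro tendsto_intros y)
    show "(\<lambda>n. d + inverse (real (Suc n))) \<longlonglongrightarrow> d"
      using tendsto_add[OF tendsto_const LIMSEQ_inverse_real_of_nat, of d] by simp
    show "\<exists>N. \<forall>n\<ge>N. (norm (x - m n))\<^sup>2 \<le> d + inverse (real (Suc n))" using m(2) less_imp_le by blast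
  qed
  have "inner z (x - y) = 0" if z: "z \<in> M" for z
  proof (rule ccontr)
    assume n: "inner z (x - y) \<noteq> 0"
    then have zz: "inner z z > 0" by auto
    \<comment> \<open>The minimizer of the quadratic function of s given by the squared distance
      from x to y + s z.\<close>
    define s where "s = inner z (x - y) / inner z z"
    have "(norm (x - y))\<^sup>2 \<le> (norm (x - (y + s *\<^sub>R z)))\<^sup>2"
      using yd d[of "y + s *\<^sub>R z"] yM z assms(1) by (intro order_trans[OF yd d] subspace_add subspace_scale)
    also have "\<dots> = (norm (x - y))\<^sup>2 - 2 * s * inner z (x - y) + s * s * inner z z"
      by (simp add: power2_norm_eq_inner inner_diff_left inner_diff_right inner_add_left inner_add_right
          inner_commute algebra_simps)
    also have "\<dots> = (norm (x - y))\<^sup>2 - (inner z (x - y))\<^sup>2 / inner z z"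
      using zz by (simp add: s_def power2_eq_square field_simps)
    finally have "(inner z (x - y))\<^sup>2 / inner z z \<le> 0" by simp
    then show False using zz n by (simp add: divide_le_0_iff)
  qed
  with yM show ?thesis by blast
qed

section \<open>Spectral decomposition of the modular group and of the squared antipode\<close>

interpretation P: vector_space "\<lambda>c (x :: 'y free_star). fconst c * x"
  by (rule vs_fconst)

lemma P_span_mult:
  assumes "x \<in> P.span A" "y \<in> P.span B"
  shows "x * y \<in> P.span {a * b |a b. a \<in> A \<and> b \<in> B}" (is "_ \<in> P.span ?C")
proof -
  have 1: "a * y \<in> P.span ?C" if "a \<in> A" for a
    using assms(2)
  proof (induction rule: P.span_induct_alt)
    case base
    then show ?case by (simp add: P.span_zero)
  next
    case (step c b z)
    have "a * (fconst c * b + z) = fconst c * (a * b) + a * z"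
      by (simp add: distrib_left fconst_left_commute[of a])
    then show ?case using step that by (auto intro!: P.span_add P.span_scale intro: P.span_base)
  qed
  show ?thesis
    using assms(1)
  proof (induction rule: P.span_induct_alt)
    case base
    then show ?case by (simp add: P.span_zero)
  next
    case (step c a z)
    have "(fconst c * a + z) * y = fconst c * (a * y) + z * y"
      by (simp add: distrib_right mult.assoc)
    then show ?case using step 1 by (auto intro!: P.span_add P.span_scale)
  qed
qed

lemma P_span_fconst_sum:
  "(\<And>i j. i \<in> I \<Longrightarrow> j \<in> J \<Longrightarrow> f i j \<in> P.span A) \<Longrightarrow> (\<Sum>i\<in>I. \<Sum>j\<in>J. fconst (c i j) * f i j) \<in> P.span A"
  by (intro P.span_sum P.span_scale)

locale fp_kac = fp_hopf Fs \<delta> \<epsilon> \<kappa> h \<Lambda>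
  for Fs \<delta> \<epsilon> \<kappa> h and \<Lambda> :: "fp_elem \<Rightarrow> 'h::complex_hilbert_space" +
  fixes R :: "fp_elem \<Rightarrow> fp_elem"
  assumes uantipode: "unitary_antipode S \<kappa> h R"
begin

section \<open>The image of the algebra and finite-dimensional invariant subspaces\<close>

definition HH0 :: "'h set" where "HH0 = range L"

lemma csub_HH0: "csub HH0"
  unfolding csub_def HH0_def
proof (intro conjI ballI allI)
  show "0 \<in> range L" using L_zero by (metis rangeI)
  fix x y assume "x \<in> range L" "y \<in> range L"
  then show "x + y \<in> range L" by (auto simp: L_add[symmetric])
next
  fix c x assume "x \<in> range L"
  then show "c *\<^sub>C x \<in> range L" by (auto simp: L_smult[symmetric])
qed

lemma L_in [simp, intro]: "L p \<in> HH0" by (simp add: HH0_def)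

lemma Lambda_carrier: "\<Lambda> ` carrier S = HH0"
  by (auto simp: HH0_def L_def carrier_S)

lemma HH0_dense: "closure HH0 = UNIV"
  using gns Lambda_carrier by (simp add: gns_map_def)

lemma L_span: "L ` P.span A = cspan (L ` A)"
proof (intro equalityI subsetI)
  fix x assume "x \<in> L ` P.span A"
  then obtain p where p: "p \<in> P.span A" "x = L p" by blast
  from p(1) have "L p \<in> cspan (L ` A)"
  proof (induction rule: P.span_induct_alt)
    case base
    then show ?case using csub_0[OF cspan_csub] by simp
  next
    case (step c a y)
    then show ?case unfolding L_add L_smult
      by (intro csub_add[OF cspan_csub] csub_scaleC[OF cspan_csub]) (auto intro: cspan_base)
  qed
  then show "x \<in> cspan (L ` A)" using p by simp
next
  fix x assume "x \<in> cspan (L ` A)"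
  then show "x \<in> L ` P.span A"
  proof (induction rule: cspan_induct)
    case zero
    then show ?case using P.span_zero[of A] L_zero by (metis imageI)
  next
    case (add x y)
    then obtain p q where "p \<in> P.span A" "q \<in> P.span A" "x = L p" "y = L q" by blast
    then show ?case by (auto simp: L_add[symmetric] intro!: imageI P.span_add)
  next
    case (scale c x)
    then obtain p where "p \<in> P.span A" "x = L p" by blast
    then show ?case by (auto simp: L_smult[symmetric] intro!: imageI P.span_scale)
  qed (auto intro: P.span_base)
qed

text \<open>Maps are written on representatives but the spectral results concern vectors;
  compatibility with \<open>L\<close> makes the choice of representative immaterial.\<close>

definition lop :: "(entry_alg \<Rightarrow> entry_alg) \<Rightarrow> 'h \<Rightarrow> 'h" where
  "lop T \<xi> = L (T (SOME p. L p = \<xi>))"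

lemma lop_L: "(\<And>p q. L p = L q \<Longrightarrow> L (T p) = L (T q)) \<Longrightarrow> lop T (L p) = L (T p)"
  unfolding lop_def by (metis (mono_tags, lifting) someI_ex)

abbreviation "Sg \<equiv> lop ss"
abbreviation "K2 \<equiv> lop k2"

lemma Sg_L: "Sg (L p) = L (ss p)" by (rule lop_L[OF L_ss])
lemma K2_L: "K2 (L p) = L (k2 p)" by (rule lop_L[OF L_k2])

lemma ss_smult: "ss (fconst c * p) = fconst c * ss p" by (simp add: ss_mult)

lemma hom_wd:
  assumes T: "\<And>p q. T (p * q) = T p * T q" "T 1 = 1"
    and lt: "\<And>g i j. ok g \<Longrightarrow> i < nn g \<Longrightarrow> j < nn g \<Longrightarrow> T (lt g i j) \<in> P.span {lt g e c |e c. e < nn g \<and> c < nn g}"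
    and "list_all ok gs" "is \<in> set (Ix gs)" "js \<in> set (Ix gs)"
  shows "T (wd gs is js) \<in> P.span {wd gs ks ls |ks ls. ks \<in> set (Ix gs) \<and> ls \<in> set (Ix gs)}"
  using assms(4-6)
proof (induction gs arbitrary: "is" js)
  case Nil
  then show ?case using T(2) by (auto intro!: P.span_base exI[of _ "[]"])
next
  case (Cons g gs)
  from Cons.prems(2,3) obtain i "is'" j js' where x: "is = i # is'" "js = j # js'" "i < nn g" "j < nn g"
    "is' \<in> set (Ix gs)" "js' \<in> set (Ix gs)" by auto
  have "T (lt g i j) * T (wd gs is' js') \<in> P.span {a * b |a b. a \<in> {lt g e c |e c. e < nn g \<and> c < nn g} \<and>
     b \<in> {wd gs ks ls |ks ls. ks \<in> set (Ix gs) \<and> ls \<in> set (Ix gs)}}"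
    using Cons x by (intro P_span_mult lt) auto
  also have "\<dots> \<subseteq> P.span {wd (g # gs) ks ls |ks ls. ks \<in> set (Ix (g # gs)) \<and> ls \<in> set (Ix (g # gs))}"
  proof (rule P.span_mono, rule subsetI)
    fix y assume "y \<in> {a * b |a b. a \<in> {lt g e c |e c. e < nn g \<and> c < nn g} \<and>
     b \<in> {wd gs ks ls |ks ls. ks \<in> set (Ix gs) \<and> ls \<in> set (Ix gs)}}"
    then obtain e c ks ls where y: "e < nn g" "c < nn g" "ks \<in> set (Ix gs)" "ls \<in> set (Ix gs)"
      "y = lt g e c * wd gs ks ls" by blast
    then have "y = wd (g # gs) (e # ks) (c # ls)" by simp
    moreover have "e # ks \<in> set (Ix (g # gs))" "c # ls \<in> set (Ix (g # gs))" using y by auto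
    ultimately show "y \<in> {wd (g # gs) ks ls |ks ls. ks \<in> set (Ix (g # gs)) \<and> ls \<in> set (Ix (g # gs))}" by blast
  qed
  finally show ?case by (simp add: x T)
qed

text \<open>\<open>T\<close> preserves the span of the entries of each direction, hence that of each
  tensor product of directions. These spans are finite-dimensional and exhaust the algebra.\<close>

lemma hom_locally_finite:
  assumes T: "\<And>p q. T (p + q) = T p + T q" "\<And>c p. T (fconst c * p) = fconst c * T p"
      "\<And>p q. T (p * q) = T p * T q" "T 1 = 1"
    and lt: "\<And>g i j. ok g \<Longrightarrow> i < nn g \<Longrightarrow> j < nn g \<Longrightarrow> T (lt g i j) \<in> P.span {lt g e c |e c. e < nn g \<and> c < nn g}"
    and A: "\<And>p. A (L p) = L (T p)"
  shows "\<exists>B. finite B \<and> B \<subseteq> HH0 \<and> L p \<in> cspan B \<and> (\<forall>y\<in>cspan B. A y \<in> cspan B)"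
proof -
  have inv: "A y \<in> cspan (L ` X)" if X: "\<And>x. x \<in> X \<Longrightarrow> T x \<in> P.span X" and y: "y \<in> cspan (L ` X)" for X y
  proof -
    obtain q where q: "q \<in> P.span X" "y = L q" using y unfolding L_span[symmetric] by blast
    from q(1) have "T q \<in> P.span X"
    proof (induction rule: P.span_induct_alt)
      case base
      have "T 0 = 0" using T(2)[of 0 0] by simp
      then show ?case by (simp add: P.span_zero)
    next
      case (step c a y)
      then show ?case unfolding T(1,2) by (intro P.span_add P.span_scale) (auto intro: X)
    qed
    then show ?thesis using q(2) A unfolding L_span[symmetric] by auto
  qed
  have "\<exists>X q. finite X \<and> q \<in> P.span X \<and> (\<forall>x\<in>X. T x \<in> P.span X) \<and> L q = L p"
  proof (induction p rule: pi_induct)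
    case (cong p q)
    then show ?case using L_cong[OF cong(2)] by simp
  next
    case (add p q)
    then obtain X p' Y q' where *: "finite X" "p' \<in> P.span X" "\<forall>x\<in>X. T x \<in> P.span X" "L p' = L p"
      "finite Y" "q' \<in> P.span Y" "\<forall>x\<in>Y. T x \<in> P.span Y" "L q' = L q" by blast
    have "p' + q' \<in> P.span (X \<union> Y)"
      using * P.span_mono[of X "X \<union> Y"] P.span_mono[of Y "X \<union> Y"] by (intro P.span_add) auto
    moreover have "\<forall>x\<in>X \<union> Y. T x \<in> P.span (X \<union> Y)"
      using * P.span_mono[of X "X \<union> Y"] P.span_mono[of Y "X \<union> Y"] by auto
    ultimately show ?case using * by (intro exI[of _ "X \<union> Y"] exI[of _ "p' + q'"]) (auto simp: L_add)
  next
    case (scale c p)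
    then obtain X q where "finite X" "q \<in> P.span X" "\<forall>x\<in>X. T x \<in> P.span X" "L q = L p" by blast
    then show ?case by (intro exI[of _ X] exI[of _ "fconst c * q"]) (auto simp: L_smult intro: P.span_scale)
  next
    case (word gs "is" js)
    let ?X = "{wd gs ks ls |ks ls. ks \<in> set (Ix gs) \<and> ls \<in> set (Ix gs)}"
    have "?X = (\<lambda>(k, l). wd gs k l) ` (set (Ix gs) \<times> set (Ix gs))" by auto
    then have "finite ?X" by simp
    moreover have "\<forall>x\<in>?X. T x \<in> P.span ?X" using hom_wd[OF T(3,4) lt word(1)] by blast
    ultimately show ?case using word by (intro exI[of _ ?X] exI[of _ "wd gs is js"]) (auto intro: P.span_base)
  qed
  then obtain X q where X: "finite X" "q \<in> P.span X" "\<forall>x\<in>X. T x \<in> P.span X" "L q = L p" by blast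
  then have "L p \<in> L ` P.span X" by (metis imageI)
  then show ?thesis using X inv unfolding L_span
    by (intro exI[of _ "L ` X"]) (auto simp: HH0_def)
qed

lemma ss_locally_finite: "\<exists>B. finite B \<and> B \<subseteq> HH0 \<and> L p \<in> cspan B \<and> (\<forall>y\<in>cspan B. Sg y \<in> cspan B)"
proof (rule hom_locally_finite[of ss])
  fix g i j assume "ok g" "i < nn g" "j < nn g"
  then show "ss (lt g i j) \<in> P.span {lt g e c |e c. e < nn g \<and> c < nn g}"
    by (simp add: ss_lt) (intro P_span_fconst_sum P.span_base, blast)
qed (simp_all add: ss_add ss_mult ss_smult Sg_L)

lemma k2_one: "k2 1 = 1"
  unfolding k2_def kk_one ..

lemma k2_locally_finite: "\<exists>B. finite B \<and> B \<subseteq> HH0 \<and> L p \<in> cspan B \<and> (\<forall>y\<in>cspan B. K2 y \<in> cspan B)"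
proof (rule hom_locally_finite[of k2])
  fix g i j assume g: "ok g" "i < nn g" "j < nn g"
  have 1: "st (lt (bar g) l k) \<in> P.span {lt g e c |e c. e < nn g \<and> c < nn g}" if "l < nn g" "k < nn g" for k l
    using g that by (simp add: st_lt) (intro P_span_fconst_sum P.span_base, blast)
  have "k2 (lt g i j) = (\<Sum>k<nn g. \<Sum>l<nn g. fconst (dm g j k * cnj (dm (bar g) l i)) * st (lt (bar g) l k))"
    using g by (simp add: k2_def kk_lt st_lt kk_sum kk_smult)
  also have "\<dots> \<in> P.span {lt g e c |e c. e < nn g \<and> c < nn g}"
    by (rule P_span_fconst_sum) (simp add: 1)
  finally show "k2 (lt g i j) \<in> P.span {lt g e c |e c. e < nn g \<and> c < nn g}" .
qed (simp_all add: k2_add k2_smult k2_one K2_L, rule k2_mult)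

lemma L_inner_ss: "cinner (L p) (L (ss q)) = hh (q * st p)"
  by (simp add: L_inner kms[symmetric])

lemma Sg_sym: "cinner (L p) (L (ss q)) = cinner (L (ss p)) (L q)"
proof -
  have "cinner (L (ss p)) (L q) = cnj (cinner (L q) (L (ss p)))" by (rule cinner_commute)
  also have "\<dots> = hh (st (p * st q))" by (simp add: L_inner_ss hh_st)
  also have "\<dots> = hh (q * st p)" unfolding st_mult by (intro hh_eq L_mult L_st_st refl)
  finally show ?thesis by (simp add: L_inner_ss)
qed

subsection \<open>The unitary antipode\<close>

definition ta :: "fp_elem \<Rightarrow> fp_elem" where
  "ta = (SOME \<tau>. linear_endo S \<tau> \<and> \<tau> \<in> Ring.ring_hom S S \<and>
        (\<forall>x\<in>carrier S. \<kappa> x = R (\<tau> x) \<and> R (\<tau> x) = \<tau> (R x) \<and>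
           h (star S x \<otimes>\<^bsub>S\<^esub> \<tau> x) \<in> \<real>\<^sub>\<ge>\<^sub>0))"

lemma ta: "linear_endo S ta" "\<And>x. x \<in> carrier S \<Longrightarrow> \<kappa> x = R (ta x)"
    "\<And>x. x \<in> carrier S \<Longrightarrow> R (ta x) = ta (R x)"
    "\<And>x. x \<in> carrier S \<Longrightarrow> h (star S x \<otimes>\<^bsub>S\<^esub> ta x) \<in> \<real>\<^sub>\<ge>\<^sub>0"
proof -
  have "\<exists>\<tau>. linear_endo S \<tau> \<and> \<tau> \<in> Ring.ring_hom S S \<and>
        (\<forall>x\<in>carrier S. \<kappa> x = R (\<tau> x) \<and> R (\<tau> x) = \<tau> (R x) \<and>
           h (star S x \<otimes>\<^bsub>S\<^esub> \<tau> x) \<in> \<real>\<^sub>\<ge>\<^sub>0)"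
    using uantipode unfolding unitary_antipode_def by blast
  from someI_ex[OF this] show "linear_endo S ta" "\<And>x. x \<in> carrier S \<Longrightarrow> \<kappa> x = R (ta x)"
    "\<And>x. x \<in> carrier S \<Longrightarrow> R (ta x) = ta (R x)"
    "\<And>x. x \<in> carrier S \<Longrightarrow> h (star S x \<otimes>\<^bsub>S\<^esub> ta x) \<in> \<real>\<^sub>\<ge>\<^sub>0"
    unfolding ta_def[symmetric] by blast+
qed

lemma R_props: "linear_endo S R" "\<And>x y. x \<in> carrier S \<Longrightarrow> y \<in> carrier S \<Longrightarrow> R (x \<otimes>\<^bsub>S\<^esub> y) = R y \<otimes>\<^bsub>S\<^esub> R x"
    "\<And>x. x \<in> carrier S \<Longrightarrow> R (star S x) = star S (R x)" "\<And>x. x \<in> carrier S \<Longrightarrow> R (R x) = x"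
  using uantipode unfolding unitary_antipode_def by blast+

definition rr :: "entry_alg \<Rightarrow> entry_alg" where "rr p = (SOME q. pi q = R (pi p))"
definition tt :: "entry_alg \<Rightarrow> entry_alg" where "tt p = (SOME q. pi q = ta (pi p))"

lemma pi_rr: "pi (rr p) = R (pi p)"
proof -
  have "R (pi p) \<in> carrier S" using R_props(1) pi_closed unfolding linear_endo_def by blast
  then obtain q where "R (pi p) = pi q" by (rule pi_surj)
  then show ?thesis unfolding rr_def by (intro someI[of "\<lambda>q. pi q = R (pi p)"]) (rule sym)
qed

lemma pi_tt: "pi (tt p) = ta (pi p)"
proof -
  have "ta (pi p) \<in> carrier S" using ta(1) pi_closed unfolding linear_endo_def by blast
  then obtain q where "ta (pi p) = pi q" by (rule pi_surj)
  then show ?thesis unfolding tt_def by (intro someI[of "\<lambda>q. pi q = ta (pi p)"]) (rule sym)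
qed

lemma L_rr: "L p = L q \<Longrightarrow> L (rr p) = L (rr q)" and L_tt: "L p = L q \<Longrightarrow> L (tt p) = L (tt q)"
  unfolding L_eq_iff pi_rr pi_tt by simp_all

lemma rr_add: "L (rr (p + q)) = L (rr p) + L (rr q)"
  and rr_smult: "L (rr (fconst c * p)) = c *\<^sub>C L (rr p)"
  and rr_mult: "L (rr (p * q)) = L (rr q * rr p)"
  and rr_st: "L (rr (st p)) = L (st (rr p))"
  and rr_rr: "L (rr (rr p)) = L p"
proof -
  show "L (rr (p + q)) = L (rr p) + L (rr q)"
    using R_props(1) unfolding L_add[symmetric] L_eq_iff pi_add pi_rr linear_endo_def by simp
  show "L (rr (fconst c * p)) = c *\<^sub>C L (rr p)"
    using R_props(1) unfolding L_smult[symmetric] L_eq_iff pi_smult pi_rr linear_endo_def by simp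
  show "L (rr (p * q)) = L (rr q * rr p)"
    using R_props(2) unfolding L_eq_iff pi_mult pi_rr by simp
  show "L (rr (st p)) = L (st (rr p))"
    using R_props(3) unfolding L_eq_iff pi_star pi_rr by simp
  show "L (rr (rr p)) = L p"
    using R_props(4) unfolding L_eq_iff pi_rr by simp
qed

lemma tt_add: "L (tt (p + q)) = L (tt p) + L (tt q)"
  and tt_smult: "L (tt (fconst c * p)) = c *\<^sub>C L (tt p)"
  and tt_pos: "cinner (L p) (L (tt p)) \<in> \<real>\<^sub>\<ge>\<^sub>0"
  and rr_tt: "L (rr (tt p)) = L (kk p)"
  and tt_rr: "L (tt (rr p)) = L (kk p)"
proof -
  show "L (tt (p + q)) = L (tt p) + L (tt q)"
    using ta(1) unfolding L_add[symmetric] L_eq_iff pi_add pi_tt linear_endo_def by simp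
  show "L (tt (fconst c * p)) = c *\<^sub>C L (tt p)"
    using ta(1) unfolding L_smult[symmetric] L_eq_iff pi_smult pi_tt linear_endo_def by simp
  show "cinner (L p) (L (tt p)) \<in> \<real>\<^sub>\<ge>\<^sub>0"
    using ta(4)[of "pi p"] unfolding L_inner hh_def pi_mult pi_star pi_tt by simp
  show "L (rr (tt p)) = L (kk p)"
    using ta(2)[of "pi p"] unfolding L_eq_iff pi_rr pi_tt kappa_pi[symmetric] by simp
  show "L (tt (rr p)) = L (kk p)"
    using ta(2,3)[of "pi p"] unfolding L_eq_iff pi_rr pi_tt kappa_pi[symmetric] by simp
qed

lemma tt_tt: "L (tt (tt p)) = L (k2 p)"
proof -
  have "L (k2 p) = L (kk (rr (tt p)))" unfolding k2_def by (rule L_kk[OF rr_tt[symmetric]])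
  also have "\<dots> = L (tt (rr (rr (tt p))))" by (rule tt_rr[symmetric])
  also have "\<dots> = L (tt (tt p))" by (rule L_tt[OF rr_rr])
  finally show ?thesis ..
qed

text \<open>Polarization: an operator with real quadratic form is symmetric.\<close>

lemma tt_sym: "cinner (L p) (L (tt q)) = cinner (L (tt p)) (L q)"
proof -
  define b where "b p q = cinner (L p) (L (tt q))" for p q
  have add: "b (p + q) (p + q) = b p p + b p q + b q p + b q q" for p q
    by (simp add: b_def L_add tt_add cinner_add_left cinner_add_right)
  have sm: "b (fconst c * p) q = cnj c * b p q" "b p (fconst c * q) = c * b p q" for c p q
    by (simp_all add: b_def L_smult tt_smult cinner_scaleC_left cinner_scaleC_right)
  have re: "Im (b p p) = 0" for p
    using tt_pos[of p] by (auto simp: b_def nonneg_Reals_def complex_is_Real_iff)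
  have "Im (b p q) + Im (b q p) = 0" for p q
    using arg_cong[OF add[of p q], of Im] re by simp
  then have 1: "Im (b p q) = - Im (b q p)" for p q by (metis add_eq_0_iff2)
  have 2: "Re (b p q) = Re (b q p)" for p q
    using 1[of p "fconst \<i> * q"] by (simp add: sm)
  have "b p q = cnj (b q p)" using 1[of p q] 2[of p q] by (simp add: complex_eq_iff)
  also have "\<dots> = cinner (L (tt p)) (L q)" by (simp add: b_def cinner_commute[of "L (tt p)"])
  finally show ?thesis by (simp add: b_def)
qed

lemma k2_sym: "cinner (L p) (L (k2 q)) = cinner (L (k2 p)) (L q)"
  by (simp add: tt_tt[symmetric] tt_sym)

lemma kk_inj: "L (kk p) = 0 \<Longrightarrow> L p = 0"
proof -
  assume "L (kk p) = 0"
  then have "L (kk p) = L 0" by simp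
  from L_kk[OF L_st[OF this]] have "L (kk (st (kk p))) = 0" by simp
  then have "L (st p) = L 0" by (simp add: kk_st_kk)
  from L_st[OF this] show ?thesis by (simp add: L_st_st)
qed

text \<open>The eigenvalue of the squared antipode is written as a square because its positive root
  \<nu> will turn out to be the eigenvalue of \<tau>.\<close>

definition eig :: "entry_alg \<Rightarrow> real \<Rightarrow> real \<Rightarrow> bool" where
  "eig p \<mu> \<nu> \<longleftrightarrow> 0 < \<mu> \<and> 0 < \<nu> \<and> L (ss p) = \<mu> *\<^sub>R L p \<and> L (k2 p) = \<nu>\<^sup>2 *\<^sub>R L p"

text \<open>The vector is decomposed under \<sigma>, then each eigenspace of \<sigma> under the
  squared antipode, which preserves it. Positivity of the eigenvalues m and l comes from m |q|^2 =
  |st q|^2 and l |q|^2 = |tt q|^2.\<close>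

lemma eig_span: "L p \<in> cspan {L q |q. \<exists>\<mu> \<nu>. eig q \<mu> \<nu>}" (is "_ \<in> cspan ?E")
proof -
  have Slin: "Sg (x + y) = Sg x + Sg y" "Sg (c *\<^sub>C x) = c *\<^sub>C Sg x" "Sg x \<in> HH0"
    and Klin: "K2 (x + y) = K2 x + K2 y" "K2 (c *\<^sub>C x) = c *\<^sub>C K2 x" "K2 x \<in> HH0"
    if xy: "x \<in> HH0" "y \<in> HH0" for x y c
  proof -
    obtain p q where pq: "x = L p" "y = L q" using xy by (auto simp: HH0_def)
    show "Sg (x + y) = Sg x + Sg y" "Sg (c *\<^sub>C x) = c *\<^sub>C Sg x" "Sg x \<in> HH0"
      by (simp_all add: pq L_add[symmetric] L_smult[symmetric] Sg_L ss_add ss_smult)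
    show "K2 (x + y) = K2 x + K2 y" "K2 (c *\<^sub>C x) = c *\<^sub>C K2 x" "K2 x \<in> HH0"
      by (simp_all add: pq L_add[symmetric] L_smult[symmetric] K2_L k2_add k2_smult)
  qed
  have Ssym: "cinner x (Sg y) = cinner (Sg x) y" and Ksym: "cinner x (K2 y) = cinner (K2 x) y"
    if "x \<in> HH0" "y \<in> HH0" for x y
    using that by (auto simp: HH0_def Sg_L K2_L Sg_sym k2_sym)
  obtain B where B: "finite B" "L p \<in> cspan B" "\<And>y. y \<in> cspan B \<Longrightarrow> Sg y \<in> cspan B"
    using ss_locally_finite[of p] by blast
  have step1: "L p \<in> cspan {v \<in> HH0. \<exists>l::real. Sg v = l *\<^sub>R v}"
    by (rule eigen_decomposition[OF csub_HH0 _ _ _ Ssym B]) (use Slin in auto)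
  have "cspan {v \<in> HH0. \<exists>l::real. Sg v = l *\<^sub>R v} \<subseteq> cspan ?E"
  proof (rule cspan_minimal[OF cspan_csub], rule subsetI)
    fix v assume "v \<in> {v \<in> HH0. \<exists>l::real. Sg v = l *\<^sub>R v}"
    then obtain m :: real where v: "v \<in> HH0" "Sg v = m *\<^sub>R v" by blast
    define W where "W = {w \<in> HH0. Sg w = m *\<^sub>R w}"
    have W: "csub W"
      unfolding csub_def W_def using csub_0[OF csub_HH0] Slin(2)[of 0 0 0]
      by (auto simp: Slin scaleR_add_right scaleC_scaleR intro: csub_add[OF csub_HH0] csub_scaleC[OF csub_HH0])
    have KW: "K2 w \<in> W" if w: "w \<in> W" for w
    proof -
      obtain q where q: "w = L q" "L (ss q) = L (fconst (of_real m) * q)"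
        using w unfolding W_def HH0_def L_smult scaleC_of_real by (auto simp: Sg_L)
      have "L (ss (k2 q)) = L (k2 (fconst (of_real m) * q))"
        using ss_k2[of q] L_k2[OF q(2)] by simp
      then show ?thesis by (simp add: W_def q(1) K2_L Sg_L k2_smult L_smult scaleC_of_real)
    qed
    obtain B where B: "finite B" "v \<in> cspan B" "\<And>y. y \<in> cspan B \<Longrightarrow> K2 y \<in> cspan B"
    proof -
      obtain q where "v = L q" using v by (auto simp: HH0_def)
      then show thesis using k2_locally_finite[of q] that by blast
    qed
    have vW: "v \<in> W" using v by (simp add: W_def)
    have "v \<in> cspan {w \<in> W. \<exists>l::real. K2 w = l *\<^sub>R w}"
      by (rule eigen_decomposition[OF W KW _ _ _ B vW]) (auto simp: W_def Klin Ksym)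
    moreover have "w \<in> cspan ?E" if w: "w \<in> {w \<in> W. \<exists>l::real. K2 w = l *\<^sub>R w}" for w
    proof (cases "w = 0")
      case True
      then show ?thesis using csub_0[OF cspan_csub] by simp
    next
      case False
      obtain l :: real and q where q: "w = L q" "L (ss q) = m *\<^sub>R L q" "L (k2 q) = l *\<^sub>R L q"
      proof -
        obtain q where q: "w = L q" using w by (auto simp: W_def HH0_def)
        then show thesis using w that[of q] by (auto simp: W_def Sg_L K2_L)
      qed
      have ns: "norm (L q) \<noteq> 0" using False q by simp
      have "of_real m * cinner (L q) (L q) = cinner (L q) (L (ss q))"
        by (simp add: q scaleC_of_real[symmetric] cinner_scaleC_right)
      also have "\<dots> = hh (q * st q)" by (rule L_inner_ss)
      also have "\<dots> = hh (st (st q) * st q)" by (intro hh_eq L_mult L_st_st[symmetric] refl)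
      also have "\<dots> = cinner (L (st q)) (L (st q))" by (simp add: L_inner)
      finally have m: "m * (norm (L q))\<^sup>2 = (norm (L (st q)))\<^sup>2"
        unfolding cinner_self of_real_mult[symmetric] of_real_eq_iff .
      have "L (st q) \<noteq> L 0"
      proof
        assume "L (st q) = L 0"
        from L_st[OF this] show False using ns by (simp add: L_st_st)
      qed
      then have "m > 0" using m ns by (metis L_zero norm_eq_zero not_less power2_less_eq_zero_iff
            zero_less_mult_pos2 zero_less_power2 linorder_not_less)
      have "of_real l * cinner (L q) (L q) = cinner (L q) (L (k2 q))"
        by (simp add: q scaleC_of_real[symmetric] cinner_scaleC_right)
      also have "\<dots> = cinner (L (tt q)) (L (tt q))" by (simp add: tt_tt[symmetric] tt_sym)
      finally have l: "l * (norm (L q))\<^sup>2 = (norm (L (tt q)))\<^sup>2"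
        unfolding cinner_self of_real_mult[symmetric] of_real_eq_iff .
      have "L (tt q) \<noteq> 0"
      proof
        assume "L (tt q) = 0"
        then have "L (tt q) = L 0" by simp
        from L_rr[OF this] have "L (kk q) = L (rr 0)" by (simp add: rr_tt)
        also have "\<dots> = 0" using rr_smult[of 0 0] by simp
        finally show False using kk_inj[of q] ns by simp
      qed
      then have "l > 0" using l ns by (metis norm_eq_zero zero_less_mult_pos2 zero_less_power2)
      then have "eig q m (sqrt l)" using q \<open>m > 0\<close> by (simp add: eig_def)
      then show ?thesis using q(1) by (auto intro!: cspan_base)
    qed
    ultimately show "v \<in> cspan ?E"
      using cspan_minimal[OF cspan_csub[of ?E], of "{w \<in> W. \<exists>l::real. K2 w = l *\<^sub>R w}"] by blast
  qed
  with step1 show ?thesis by blast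
qed

lemma eig_smult: "eig p \<mu> \<nu> \<Longrightarrow> eig (fconst c * p) \<mu> \<nu>"
  by (simp add: eig_def ss_smult k2_smult L_smult scaleC_scaleR)

lemma eig_induct [case_names cong zero add eig]:
  assumes cong: "\<And>p q. Q p \<Longrightarrow> L p = L q \<Longrightarrow> Q q" and zero: "Q 0" and add: "\<And>p q. Q p \<Longrightarrow> Q q \<Longrightarrow> Q (p + q)"
    and eig: "\<And>p \<mu> \<nu>. eig p \<mu> \<nu> \<Longrightarrow> Q p"
  shows "Q p"
proof -
  have "L p \<in> span {c *\<^sub>C x |c x. x \<in> {L q |q. \<exists>\<mu> \<nu>. eig q \<mu> \<nu>}}"
    using eig_span[of p] by (simp add: cspan_def)
  then have "\<exists>q. L q = L p \<and> Q q"
  proof (induction rule: span_induct_alt)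
    case base
    then show ?case using zero L_zero by blast
  next
    case (step r x y)
    then obtain c q \<mu> \<nu> q' where q: "x = c *\<^sub>C L q" "eig q \<mu> \<nu>" "L q' = y" "Q q'" by blast
    have "Q (fconst (of_real r * c) * q + q')"
      using q by (intro add eig[OF eig_smult]) auto
    moreover have "L (fconst (of_real r * c) * q + q') = r *\<^sub>R x + y"
      by (simp add: L_add L_smult q scaleC_of_real[symmetric] scaleC_scaleC)
    ultimately show ?case by blast
  qed
  then show ?thesis using cong by blast
qed

text \<open>Uniqueness of the positive root: w = (\<tau> - \<nu>) p satisfies \<tau> w = -\<nu> w,
  which positivity of \<tau> allows only for w = 0.\<close>

lemma eig_tt: assumes "eig p \<mu> \<nu>" shows "L (tt p) = \<nu> *\<^sub>R L p"
proof -
  define w where "w = tt p + fconst (- of_real \<nu>) * p"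
  have n: "0 < \<nu>" "L (k2 p) = \<nu>\<^sup>2 *\<^sub>R L p" using assms by (auto simp: eig_def)
  have w: "L w = L (tt p) - \<nu> *\<^sub>R L p"
    unfolding w_def L_add L_smult by (simp add: scaleC_minus_left scaleC_of_real)
  have "L (tt w) = L (k2 p) - \<nu> *\<^sub>R L (tt p)"
    unfolding w_def tt_add tt_smult tt_tt by (simp add: scaleC_minus_left scaleC_of_real)
  also have "\<dots> = (- of_real \<nu>) *\<^sub>C L w"
    by (simp add: n(2) w scaleC_minus_left scaleC_of_real scaleR_diff_right power2_eq_square)
  finally have "cinner (L w) (L (tt w)) = of_real (- \<nu> * (norm (L w))\<^sup>2)"
    by (simp add: cinner_scaleC_right cinner_self)
  then have "0 \<le> - \<nu> * (norm (L w))\<^sup>2"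
    using tt_pos[of w] by (simp add: nonneg_Reals_def) (auto simp: complex_eq_iff)
  then have "norm (L w) = 0" using n(1) by (auto simp: mult_le_0_iff)
  then show ?thesis using w by simp
qed

lemma eig_kk: "eig p \<mu> \<nu> \<Longrightarrow> L (kk p) = \<nu> *\<^sub>R L (rr p)"
proof -
  assume "eig p \<mu> \<nu>"
  then have "L (tt p) = L (fconst (of_real \<nu>) * p)" by (simp add: eig_tt L_smult scaleC_of_real)
  from L_rr[OF this] show ?thesis by (simp add: rr_tt rr_smult scaleC_of_real)
qed

lemma hh_L: "hh p = cinner (L 1) (L p)"
  by (simp add: L_inner)

text \<open>On an eigenvector, invariance of \<open>hh\<close> under the squared antipode leaves
  only a vanishing Haar value or \<nu> = 1, and in the latter case \<open>R\<close> agrees with the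
  antipode.\<close>

lemma hh_rr: "hh (rr p) = hh p"
proof (induction p rule: eig_induct)
  case (cong p q)
  then show ?case using hh_eq[OF L_rr[OF cong(2)]] hh_eq[OF cong(2)] by simp
next
  case zero
  show ?case using rr_smult[of 0 0] by (simp add: hh_L)
next
  case (add p q)
  then show ?case by (simp add: hh_L rr_add L_add cinner_add_right)
next
  case (eig p \<mu> \<nu>)
  have n: "0 < \<nu>" "L (k2 p) = \<nu>\<^sup>2 *\<^sub>R L p" using eig by (auto simp: eig_def)
  have "hh p = of_real (\<nu>\<^sup>2) * hh p"
    using hh_k2[of p] unfolding hh_L n(2) scaleC_of_real[symmetric] cinner_scaleC_right by simp
  moreover have "hh p = of_real \<nu> * hh (rr p)"
    using hh_kk[of p] unfolding hh_L eig_kk[OF eig] scaleC_of_real[symmetric] cinner_scaleC_right by simp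
  ultimately show ?case
  proof (cases "hh p = 0")
    case True
    then show ?thesis using \<open>hh p = of_real \<nu> * hh (rr p)\<close> n(1) by simp
  next
    case False
    then have "complex_of_real (\<nu>\<^sup>2) = 1" using \<open>hh p = of_real (\<nu>\<^sup>2) * hh p\<close> by simp
    then have "\<nu>\<^sup>2 = 1" by (metis of_real_eq_1_iff)
    then have "\<nu> = 1" using n(1) by (simp add: power2_eq_1_iff)
    then show ?thesis using \<open>hh p = of_real \<nu> * hh (rr p)\<close> by simp
  qed
qed

text \<open>\<open>R\<close> reverses products and preserves the Haar state, so it turns the KMS
  relation around and conjugates \<sigma> into its inverse.\<close>

lemma ss_rr_ss_rr: "L (ss (rr (ss (rr p)))) = L p"
proof (rule L_eqI)
  fix b
  have "hh (b * p) = hh (rr (b * p))" by (rule hh_rr[symmetric])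
  also have "\<dots> = hh (rr p * rr b)" by (rule hh_eq[OF rr_mult])
  also have "\<dots> = hh (rr b * ss (rr p))" by (rule kms)
  also have "\<dots> = hh (rr (rr b * ss (rr p)))" by (rule hh_rr[symmetric])
  also have "\<dots> = hh (rr (ss (rr p)) * rr (rr b))" by (rule hh_eq[OF rr_mult])
  also have "\<dots> = hh (rr (ss (rr p)) * b)" by (intro hh_eq L_mult refl rr_rr)
  also have "\<dots> = hh (b * ss (rr (ss (rr p))))" by (rule kms)
  finally show "hh (b * ss (rr (ss (rr p)))) = hh (b * p)" ..
qed

lemma eig_rr: "eig p \<mu> \<nu> \<Longrightarrow> L (ss (rr p)) = (1 / \<mu>) *\<^sub>R L (rr p)"
proof -
  assume e: "eig p \<mu> \<nu>"
  then have m: "0 < \<mu>" "L (ss p) = L (fconst (of_real \<mu>) * p)" by (simp_all add: eig_def L_smult scaleC_of_real)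
  have "L (rr p) = L (ss (rr (ss (rr (rr p)))))" by (rule ss_rr_ss_rr[symmetric])
  also have "\<dots> = L (ss (rr (fconst (of_real \<mu>) * p)))"
    by (intro L_ss L_rr) (metis L_ss rr_rr m(2))
  also have "\<dots> = L (ss (fconst (of_real \<mu>) * rr p))"
    by (intro L_ss) (simp add: rr_smult L_smult)
  also have "\<dots> = \<mu> *\<^sub>R L (ss (rr p))" by (simp add: ss_smult L_smult scaleC_of_real)
  finally show ?thesis using m(1) by simp
qed

lemma eig_st: "eig p \<mu> \<nu> \<Longrightarrow> L (ss (st p)) = (1 / \<mu>) *\<^sub>R L (st p)"
proof -
  assume e: "eig p \<mu> \<nu>"
  then have m: "0 < \<mu>" "L (ss p) = L (fconst (of_real \<mu>) * p)" by (simp_all add: eig_def L_smult scaleC_of_real)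
  have "L (st p) = L (ss (st (ss p)))" by (rule ss_st[symmetric])
  also have "\<dots> = L (ss (st (fconst (of_real \<mu>) * p)))" by (intro L_ss L_st m(2))
  also have "\<dots> = \<mu> *\<^sub>R L (ss (st p))" by (simp add: st_smult ss_smult L_smult scaleC_of_real)
  finally show ?thesis using m(1) by simp
qed

lemma eig_mult_ss: "eig p \<mu> \<nu> \<Longrightarrow> eig q \<mu>' \<nu>' \<Longrightarrow> eig (p * q) (\<mu> * \<mu>') (\<nu> * \<nu>')"
proof -
  assume e: "eig p \<mu> \<nu>" "eig q \<mu>' \<nu>'"
  have c: "L (fconst a * p * (fconst b * q)) = (a * b) *\<^sub>C L (p * q)" for a b
    by (simp add: mult.assoc fconst_left_commute[of p] fconst_fconst L_smult)
  have "L (ss p * ss q) = L (fconst (of_real \<mu>) * p * (fconst (of_real \<mu>') * q))"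
    using e by (intro L_mult) (auto simp: eig_def L_smult scaleC_of_real)
  moreover have "L (k2 p * k2 q) = L (fconst (of_real (\<nu>\<^sup>2)) * p * (fconst (of_real (\<nu>'\<^sup>2)) * q))"
    using e unfolding eig_def by (intro L_mult) (simp_all only: L_smult scaleC_of_real)
  ultimately show ?thesis
    using e unfolding c by (simp add: eig_def ss_mult k2_mult of_real_mult[symmetric] scaleC_of_real
        power_mult_distrib del: of_real_mult of_real_power)
qed

end

section \<open>Functional calculus on the algebra\<close>

context fp_kac
begin

text \<open>The functional calculus f(\<sigma>, \<tau>) on the algebra. Only the values on
  \<open>HH0\<close> matter; away from it the choice leaves the linear map free.\<close>

definition Op :: "(real \<Rightarrow> real \<Rightarrow> real) \<Rightarrow> 'h \<Rightarrow> 'h" where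
  "Op = (SOME Op. \<forall>f. linear (Op f) \<and> (\<forall>p \<mu> \<nu>. eig p \<mu> \<nu> \<longrightarrow> Op f (L p) = f \<mu> \<nu> *\<^sub>R L p))"

lemma Op: "linear (Op f)" "eig p \<mu> \<nu> \<Longrightarrow> Op f (L p) = f \<mu> \<nu> *\<^sub>R L p"
proof -
  have Slin: "Sg (x + y) = Sg x + Sg y" "Sg (c *\<^sub>R x) = c *\<^sub>R Sg x" if xy: "x \<in> HH0" "y \<in> HH0" for x y c
  proof -
    obtain p q where pq: "x = L p" "y = L q" using xy by (auto simp: HH0_def)
    show "Sg (x + y) = Sg x + Sg y" "Sg (c *\<^sub>R x) = c *\<^sub>R Sg x"
      by (simp_all add: pq L_add[symmetric] scaleC_of_real[symmetric] L_smult[symmetric] Sg_L ss_add ss_smult)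
  qed
  have Klin: "K2 (x + y) = K2 x + K2 y" "K2 (c *\<^sub>R x) = c *\<^sub>R K2 x" if xy: "x \<in> HH0" "y \<in> HH0" for x y c
  proof -
    obtain p q where pq: "x = L p" "y = L q" using xy by (auto simp: HH0_def)
    show "K2 (x + y) = K2 x + K2 y" "K2 (c *\<^sub>R x) = c *\<^sub>R K2 x"
      by (simp_all add: pq L_add[symmetric] scaleC_of_real[symmetric] L_smult[symmetric] K2_L k2_add k2_smult)
  qed
  from diagonal_calculus[OF csub_subspace[OF csub_HH0] Slin Klin]
  obtain O1 where O: "\<forall>f. linear (O1 f) \<and> (\<forall>a b \<xi>. \<xi> \<in> HH0 \<and> Sg \<xi> = a *\<^sub>R \<xi> \<and> K2 \<xi> = b *\<^sub>R \<xi> \<longrightarrow>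
      O1 f \<xi> = (f a b :: real) *\<^sub>R \<xi>)" ..
  have O1: "linear (O1 f)" "\<xi> \<in> HH0 \<Longrightarrow> Sg \<xi> = a *\<^sub>R \<xi> \<Longrightarrow> K2 \<xi> = b *\<^sub>R \<xi> \<Longrightarrow> O1 f \<xi> = f a b *\<^sub>R \<xi>"
    for f a b \<xi> using O by simp_all
  \<comment> \<open>The diagonal calculus is fed with \<sigma> and the squared antipode, so the
    second eigenvalue has to be replaced by its root.\<close>
  have "\<forall>f. linear (O1 (\<lambda>a b. f a (sqrt b))) \<and>
      (\<forall>p \<mu> \<nu>. eig p \<mu> \<nu> \<longrightarrow> O1 (\<lambda>a b. f a (sqrt b)) (L p) = f \<mu> \<nu> *\<^sub>R L p)"
  proof (intro allI conjI impI O1(1))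
    fix f p \<mu> \<nu> assume e: "eig p \<mu> \<nu>"
    then have "sqrt (\<nu>\<^sup>2) = \<nu>" "Sg (L p) = \<mu> *\<^sub>R L p" "K2 (L p) = \<nu>\<^sup>2 *\<^sub>R L p"
      by (simp_all add: eig_def Sg_L K2_L)
    with O1(2)[OF L_in this(2,3), of "\<lambda>a b. f a (sqrt b)"]
    show "O1 (\<lambda>a b. f a (sqrt b)) (L p) = f \<mu> \<nu> *\<^sub>R L p" by simp
  qed
  then have "\<exists>Op. \<forall>f. linear (Op f) \<and> (\<forall>p \<mu> \<nu>. eig p \<mu> \<nu> \<longrightarrow> Op f (L p) = f \<mu> \<nu> *\<^sub>R L p)"
    by (intro exI[of _ "\<lambda>f. O1 (\<lambda>a b. f a (sqrt b))"])
  from someI_ex[OF this] show "linear (Op f)" "eig p \<mu> \<nu> \<Longrightarrow> Op f (L p) = f \<mu> \<nu> *\<^sub>R L p"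
    unfolding Op_def[symmetric] by blast+
qed

abbreviation "Dh \<equiv> Op (\<lambda>\<mu> \<nu>. sqrt \<mu>)"

lemma Op_add: "Op f (x + y) = Op f x + Op f y" and Op_zero: "Op f 0 = 0"
  and Op_scaleR: "Op f (r *\<^sub>R x) = r *\<^sub>R Op f x" and Op_sum: "Op f (\<Sum>i\<in>I. g i) = (\<Sum>i\<in>I. Op f (g i))"
  using Op(1)[of f] by (simp_all add: linear_add linear_0 linear_scale linear_sum)

text \<open>The diagonal calculus is only real-linear; complex linearity follows because complex
  multiples of joint eigenvectors are joint eigenvectors with the same eigenvalues.\<close>

lemma Op_scaleC: "Op f (c *\<^sub>C L p) = c *\<^sub>C Op f (L p)"
proof (induction p rule: eig_induct)
  case (eig p \<mu> \<nu>)
  show ?case using Op(2)[OF eig] Op(2)[OF eig_smult[OF eig], of f c] by (simp add: L_smult scaleC_scaleR)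
qed (simp_all add: Op_zero Op_add L_add scaleC_add_right)

lemma Op_in: "\<exists>q. L q = Op f (L p)"
proof (induction p rule: eig_induct)
  case (add p q)
  then obtain p' q' where "L p' = Op f (L p)" "L q' = Op f (L q)" by blast
  then have "L (p' + q') = Op f (L (p + q))" by (simp add: Op_add L_add)
  then show ?case by blast
next
  case (eig p \<mu> \<nu>)
  then have "L (fconst (of_real (f \<mu> \<nu>)) * p) = Op f (L p)" by (simp add: L_smult scaleC_of_real Op(2))
  then show ?case by blast
next
  case zero
  have "L 0 = Op f (L 0)" by (simp add: Op_zero)
  then show ?case by blast
qed metis

lemma Op_Op: "Op f (Op g (L p)) = Op (\<lambda>\<mu> \<nu>. f \<mu> \<nu> * g \<mu> \<nu>) (L p)"
  by (induction p rule: eig_induct) (simp_all add: Op_zero Op_add L_add Op(2) Op_scaleR)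

lemma Op_plus: "Op (\<lambda>\<mu> \<nu>. f \<mu> \<nu> + g \<mu> \<nu>) (L p) = Op f (L p) + Op g (L p)"
  by (induction p rule: eig_induct) (simp_all add: Op_zero Op_add L_add Op(2) scaleR_add_left)

lemma Op_const: "Op (\<lambda>\<mu> \<nu>. r) (L p) = r *\<^sub>R L p"
  by (induction p rule: eig_induct) (simp_all add: Op_zero Op_add L_add Op(2) scaleR_add_right)

lemma Sg_Op: "L (ss p) = Op (\<lambda>\<mu> \<nu>. \<mu>) (L p)"
proof (induction p rule: eig_induct)
  case (cong p q)
  then show ?case using L_ss[OF cong(2)] by simp
next
  case zero
  show ?case using ss_smult[of 0 0] by (simp add: Op_zero)
next
  case (eig p \<mu> \<nu>)
  then show ?case by (simp add: Op(2)[OF eig]) (simp add: eig_def)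
qed (simp add: Op_add L_add ss_add)

lemma K2_Op: "L (k2 p) = Op (\<lambda>\<mu> \<nu>. \<nu>\<^sup>2) (L p)"
proof (induction p rule: eig_induct)
  case (cong p q)
  then show ?case using L_k2[OF cong(2)] by simp
next
  case zero
  show ?case using k2_smult[of 0 0] by (simp add: Op_zero)
next
  case (eig p \<mu> \<nu>)
  then show ?case by (simp add: Op(2)[OF eig]) (simp add: eig_def)
qed (simp add: Op_add L_add k2_add)

lemma eig_st_eig: assumes "eig p \<mu> \<nu>" shows "eig (st p) (1 / \<mu>) (1 / \<nu>)"
proof -
  have e: "0 < \<mu>" "0 < \<nu>" "L (k2 p) = L (fconst (of_real (\<nu>\<^sup>2)) * p)"
    using assms by (simp_all add: eig_def L_smult scaleC_of_real[symmetric])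
  have "L (st p) = L (kk (st (kk p)))" by (rule kk_st_kk[symmetric])
  also have "\<dots> = L (kk (kk (st (kk (kk p)))))" by (rule L_kk[OF kk_st_kk[symmetric]])
  also have "\<dots> = L (k2 (st (k2 p)))" by (simp only: k2_def)
  also have "\<dots> = L (k2 (st (fconst (of_real (\<nu>\<^sup>2)) * p)))" by (rule L_k2[OF L_st[OF e(3)]])
  also have "\<dots> = \<nu>\<^sup>2 *\<^sub>R L (k2 (st p))"
    by (simp add: st_smult k2_smult L_smult scaleC_of_real[symmetric])
  finally have "L (k2 (st p)) = (1 / \<nu>)\<^sup>2 *\<^sub>R L (st p)" using e by (simp add: power_divide)
  then show ?thesis using e eig_st[OF assms] by (simp add: eig_def)
qed

lemma eig_rr_eig: assumes "eig p \<mu> \<nu>" shows "eig (rr p) (1 / \<mu>) \<nu>"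
proof -
  have e: "0 < \<mu>" "0 < \<nu>" using assms by (simp_all add: eig_def)
  have "L (k2 (rr p)) = L (tt (tt (rr p)))" by (rule tt_tt[symmetric])
  also have "\<dots> = L (tt (kk p))" by (rule L_tt[OF tt_rr])
  also have "\<dots> = L (tt (fconst (of_real \<nu>) * rr p))"
    using eig_kk[OF assms] by (intro L_tt) (simp add: L_smult scaleC_of_real)
  also have "\<dots> = \<nu>\<^sup>2 *\<^sub>R L (rr p)"
    using eig_kk[OF assms] by (simp add: tt_smult tt_rr scaleC_of_real power2_eq_square)
  finally show ?thesis using e eig_rr[OF assms] by (simp add: eig_def)
qed

subsection \<open>The operator U on the algebra\<close>

text \<open>The anticipated value \<sigma>^(1/2) R of \<open>U\<close> on the algebra;
  \<open>kac_U\<close> confirms it once the modular conjugation is known.\<close>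

definition UU :: "'h \<Rightarrow> 'h" where
  "UU \<xi> = Dh (lop rr \<xi>)"

lemma UU_L: "UU (L p) = Dh (L (rr p))"
  unfolding UU_def by (subst lop_L[OF L_rr]) simp_all

lemma UU_eig: assumes "eig p \<mu> \<nu>" shows "UU (L p) = (1 / sqrt \<mu>) *\<^sub>R L (rr p)"
  unfolding UU_L using Op(2)[OF eig_rr_eig[OF assms], of "\<lambda>\<mu> \<nu>. sqrt \<mu>"] by (simp add: real_sqrt_divide)

lemma UU_add: "UU (L p + L q) = UU (L p) + UU (L q)"
  by (simp add: L_add[symmetric] UU_L) (simp add: L_add rr_add Op_add)

lemma UU_scaleC: "UU (c *\<^sub>C L p) = c *\<^sub>C UU (L p)"
  by (simp add: L_smult[symmetric] UU_L) (simp add: L_smult rr_smult Op_scaleC)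

lemma UU_in: "\<exists>q. L q = UU (L p)"
  unfolding UU_L by (rule Op_in)

definition uu :: "entry_alg \<Rightarrow> entry_alg" where "uu p = (SOME q. L q = UU (L p))"

lemma L_uu: "L (uu p) = UU (L p)"
  unfolding uu_def by (rule someI_ex[OF UU_in])

lemma UU_scaleR: "UU (r *\<^sub>R L p) = r *\<^sub>R UU (L p)"
  using UU_scaleC[of "of_real r" p] by (simp add: scaleC_of_real)

lemma UU_zero: "UU 0 = 0"
  using UU_scaleC[of 0 0] by simp

lemma UU_UU: "UU (UU (L p)) = L p"
proof (induction p rule: eig_induct)
  case zero
  show ?case by (simp add: UU_zero)
next
  case (add p q)
  then show ?case using UU_add[of "uu p" "uu q"] by (simp add: L_add UU_add L_uu)
next
  case (eig p \<mu> \<nu>)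
  then have "0 < \<mu>" by (simp add: eig_def)
  then show ?case using UU_eig[OF eig_rr_eig[OF eig]] rr_rr[of p]
    by (simp add: UU_eig[OF eig] UU_scaleR real_sqrt_divide)
qed simp

text \<open>On eigenvectors \<open>U\<close> is \<open>R\<close> divided by sqrt \<mu>: the scalar
  is multiplicative in products of eigenvectors and \<open>R\<close> is antimultiplicative.\<close>

lemma UU_mult: "UU (L (p * q)) = L (uu q * uu p)"
proof (induction p rule: eig_induct)
  case (cong p p')
  have u: "L (uu p) = L (uu p')" unfolding L_uu cong(2) ..
  show ?case using cong(1) unfolding L_mult[OF cong(2) refl] L_mult[OF refl u] .
next
  case zero
  have "L (uu q * uu 0) = L (uu q * 0)" by (rule L_mult[OF refl]) (simp add: L_uu UU_zero)
  then show ?case by (simp add: UU_zero)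
next
  case (add p p')
  have "L (uu q * uu (p + p')) = L (uu q * (uu p + uu p'))"
    by (rule L_mult[OF refl]) (simp add: L_uu L_add UU_add)
  then show ?case using add by (simp add: distrib_left distrib_right L_add UU_add)
next
  case (eig p \<mu> \<nu>)
  show ?case
  proof (induction q rule: eig_induct)
    case (cong q q')
    have u: "L (uu q) = L (uu q')" unfolding L_uu cong(2) ..
    show ?case using cong(1) unfolding L_mult[OF refl cong(2)] L_mult[OF u refl] .
  next
    case zero
    have "L (uu 0 * uu p) = L (0 * uu p)" by (rule L_mult[OF _ refl]) (simp add: L_uu UU_zero)
    then show ?case by (simp add: UU_zero)
  next
    case (add q q')
    have "L (uu (q + q') * uu p) = L ((uu q + uu q') * uu p)"
      by (rule L_mult[OF _ refl]) (simp add: L_uu L_add UU_add)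
    then show ?case using add by (simp add: distrib_left distrib_right L_add UU_add)
  next
    case e: (eig q \<mu>' \<nu>')
    have "L (uu q * uu p) = L ((fconst (of_real (1 / sqrt \<mu>')) * rr q) * (fconst (of_real (1 / sqrt \<mu>)) * rr p))"
      by (rule L_mult) (simp_all only: L_uu UU_eig[OF eig] UU_eig[OF e] L_smult scaleC_of_real)
    also have "\<dots> = (1 / sqrt \<mu>' * (1 / sqrt \<mu>)) *\<^sub>R L (rr (p * q))"
      unfolding fconst_mult_mult L_smult of_real_mult[symmetric] scaleC_of_real rr_mult ..
    also have "\<dots> = UU (L (p * q))"
      unfolding UU_eig[OF eig_mult_ss[OF eig e]] by (simp add: real_sqrt_mult mult.commute)
    finally show ?case ..
  qed
qed

end

text \<open>Lets an inverse square root on a finite spectrum be replaced by a polynomial.\<close>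

lemma finite_interpolation:
  fixes f :: "'a::field \<Rightarrow> 'a"
  assumes "finite X"
  shows "\<exists>q. \<forall>x\<in>X. poly q x = f x"
  using assms
proof (induction X rule: finite_induct)
  case (insert a X)
  then obtain q where q: "\<forall>x\<in>X. poly q x = f x" by blast
  define w where "w = (\<Prod>x\<in>X. [:- x, 1:])"
  have w: "poly w a \<noteq> 0" "\<forall>x\<in>X. poly w x = 0" using insert by (auto simp: w_def poly_prod)
  then have "\<forall>x\<in>insert a X. poly (q + Polynomial.smult ((f a - poly q a) / poly w a) w) x = f x"
    using q by simp
  then show ?case by blast
qed simp

context fp_kac
begin

text \<open>A vector has finitely many joint eigencomponents, so \<open>Op f\<close> sees finitely
  many values of f. The premises 0 < \<mu> and 0 < \<nu> permit identities that hold only for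
  positive arguments.\<close>

lemma Op_cong:
  "\<exists>F. finite F \<and> (\<forall>f g. (\<forall>(\<mu>, \<nu>)\<in>F. 0 < \<mu> \<longrightarrow> 0 < \<nu> \<longrightarrow> f \<mu> \<nu> = g \<mu> \<nu>) \<longrightarrow> Op f (L p) = Op g (L p))"
proof (induction p rule: eig_induct)
  case (cong p q)
  then show ?case by simp
next
  case (add p q)
  then obtain F G where
    F: "finite F" "\<forall>f g. (\<forall>(\<mu>, \<nu>)\<in>F. 0 < \<mu> \<longrightarrow> 0 < \<nu> \<longrightarrow> f \<mu> \<nu> = g \<mu> \<nu>) \<longrightarrow> Op f (L p) = Op g (L p)"
    and G: "finite G" "\<forall>f g. (\<forall>(\<mu>, \<nu>)\<in>G. 0 < \<mu> \<longrightarrow> 0 < \<nu> \<longrightarrow> f \<mu> \<nu> = g \<mu> \<nu>) \<longrightarrow> Op f (L q) = Op g (L q)"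
    by (elim exE conjE)
  show ?case
  proof (intro exI[of _ "F \<union> G"] conjI allI impI)
    fix f g :: "real \<Rightarrow> real \<Rightarrow> real"
    assume "\<forall>(\<mu>, \<nu>)\<in>F \<union> G. 0 < \<mu> \<longrightarrow> 0 < \<nu> \<longrightarrow> f \<mu> \<nu> = g \<mu> \<nu>"
    then have "Op f (L p) = Op g (L p)" "Op f (L q) = Op g (L q)" using F(2) G(2) by simp_all
    then show "Op f (L (p + q)) = Op g (L (p + q))" by (simp add: L_add Op_add)
  qed (use F G in simp)
next
  case (eig p \<mu> \<nu>)
  then have "0 < \<mu>" "0 < \<nu>" by (simp_all add: eig_def)
  then show ?case by (intro exI[of _ "{(\<mu>, \<nu>)}"]) (simp add: Op(2)[OF eig])
qed (auto simp: Op_zero)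

lemma Op_eqI: "(\<And>\<mu> \<nu>. 0 < \<mu> \<Longrightarrow> 0 < \<nu> \<Longrightarrow> f \<mu> \<nu> = g \<mu> \<nu>) \<Longrightarrow> Op f (L p) = Op g (L p)"
  using Op_cong[of p] by auto

lemma kk_Op: "L (kk p) = Op (\<lambda>\<mu> \<nu>. \<nu>) (L (rr p))"
proof (induction p rule: eig_induct)
  case (cong p q)
  then show ?case using L_kk[OF cong(2)] L_rr[OF cong(2)] by simp
next
  case zero
  show ?case using rr_smult[of 0 0] by (simp add: Op_zero)
next
  case (eig p \<mu> \<nu>)
  then show ?case by (simp add: Op(2)[OF eig_rr_eig[OF eig]] eig_kk[OF eig])
qed (simp add: Op_add L_add kk_add rr_add)

lemma UU_kk: "UU (L p) = Op (\<lambda>\<mu> \<nu>. sqrt \<mu> / \<nu>) (L (kk p))"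
  unfolding UU_L kk_Op Op_Op by (rule Op_eqI) simp

text \<open>After the antipode has produced an adjoint entry, \<open>U\<close> is the power -1/2 of
  the operator with eigenvalue \<nu>^2 / \<mu>. By \<open>k2_ss_st\<close> that operator acts on the
  column index alone, hence so does any polynomial in it, and interpolation covers the
  power.\<close>

lemma UU_lt:
  assumes ok: "ok \<gamma>"
  shows "\<exists>\<phi>. \<forall>i<nn \<gamma>. \<forall>j<nn \<gamma>. UU (L (lt \<gamma> i j)) = (\<Sum>k<nn \<gamma>. \<phi> i k *\<^sub>C L (st (lt \<gamma> j k)))"
proof -
  let ?n = "nn \<gamma>" and ?x = "\<lambda>e a. L (st (lt \<gamma> e a))" and ?s = "\<lambda>\<mu> \<nu>. \<nu>\<^sup>2 / \<mu> :: real"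
  obtain A where A: "\<And>e a. e < ?n \<Longrightarrow> a < ?n \<Longrightarrow> L (k2 (st (lt \<gamma> e a))) = (\<Sum>j<?n. A j a *\<^sub>C L (ss (st (lt \<gamma> e j))))"
    using k2_ss_st[OF ok] by blast
  have s: "Op ?s (?x e a) = (\<Sum>j<?n. A j a *\<^sub>C ?x e j)" if "e < ?n" "a < ?n" for e a
  proof -
    have "Op ?s (?x e a) = Op (\<lambda>\<mu> \<nu>. 1 / \<mu>) (L (k2 (st (lt \<gamma> e a))))"
      unfolding K2_Op Op_Op by simp
    also have "\<dots> = (\<Sum>j<?n. A j a *\<^sub>C Op (\<lambda>\<mu> \<nu>. 1 / \<mu>) (L (ss (st (lt \<gamma> e j)))))"
      unfolding A[OF that] Op_sum Op_scaleC ..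
    also have "\<dots> = (\<Sum>j<?n. A j a *\<^sub>C ?x e j)"
    proof (intro sum.cong refl arg_cong[of _ _ "(*\<^sub>C) _"])
      fix j
      have "Op (\<lambda>\<mu> \<nu>. 1 / \<mu>) (L (ss (st (lt \<gamma> e j)))) = Op (\<lambda>\<mu> \<nu>. 1) (?x e j)"
        unfolding Sg_Op Op_Op by (rule Op_eqI) simp
      then show "Op (\<lambda>\<mu> \<nu>. 1 / \<mu>) (L (ss (st (lt \<gamma> e j)))) = ?x e j" by (simp add: Op_const)
    qed
    finally show ?thesis .
  qed
  \<comment> \<open>The quantifiers matter: for a given polynomial one coefficient matrix serves all
    rows \<open>e\<close>.\<close>
  have "\<exists>B. \<forall>e<?n. \<forall>a<?n. Op (\<lambda>\<mu> \<nu>. poly q (?s \<mu> \<nu>)) (?x e a) = (\<Sum>j<?n. B j a *\<^sub>C ?x e j)" for q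
  proof (induction q)
    case 0
    show ?case using Op_const[of 0] by (intro exI[of _ "\<lambda>_ _. 0"]) simp
  next
    case (pCons c q)
    then obtain B where B: "\<And>e a. e < ?n \<Longrightarrow> a < ?n \<Longrightarrow>
        Op (\<lambda>\<mu> \<nu>. poly q (?s \<mu> \<nu>)) (?x e a) = (\<Sum>j<?n. B j a *\<^sub>C ?x e j)" by blast
    have "Op (\<lambda>\<mu> \<nu>. poly (pCons c q) (?s \<mu> \<nu>)) (?x e a)
        = (\<Sum>k<?n. ((if k = a then of_real c else 0) + (\<Sum>j<?n. B j a * A k j)) *\<^sub>C ?x e k)"
      if ea: "e < ?n" "a < ?n" for e a
    proof -
      have "Op (\<lambda>\<mu> \<nu>. poly (pCons c q) (?s \<mu> \<nu>)) (?x e a)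
          = c *\<^sub>R ?x e a + Op ?s (Op (\<lambda>\<mu> \<nu>. poly q (?s \<mu> \<nu>)) (?x e a))"
        unfolding Op_Op by (simp only: poly_pCons Op_plus Op_const)
      also have "Op ?s (Op (\<lambda>\<mu> \<nu>. poly q (?s \<mu> \<nu>)) (?x e a)) = (\<Sum>j<?n. B j a *\<^sub>C (\<Sum>k<?n. A k j *\<^sub>C ?x e k))"
        unfolding B[OF ea] Op_sum Op_scaleC using s ea by (intro sum.cong) auto
      also have "\<dots> = (\<Sum>k<?n. (\<Sum>j<?n. B j a * A k j) *\<^sub>C ?x e k)"
        unfolding scaleC_sum_right scaleC_sum_left scaleC_scaleC by (rule sum.swap)
      also have "c *\<^sub>R ?x e a = (\<Sum>k<?n. (if k = a then of_real c else 0) *\<^sub>C ?x e k)"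
        using ea by (simp add: if_distrib[of "\<lambda>c. c *\<^sub>C _"] scaleC_of_real cong: if_cong)
      finally show ?thesis by (simp add: scaleC_add_left sum.distrib)
    qed
    then show ?case
      by (intro exI[of _ "\<lambda>k a. (if k = a then of_real c else 0) + (\<Sum>j<?n. B j a * A k j)"]) simp
  qed
  note poly = this
  have "\<forall>e a. \<exists>F. finite F \<and> (\<forall>f g. (\<forall>(\<mu>, \<nu>)\<in>F. 0 < \<mu> \<longrightarrow> 0 < \<nu> \<longrightarrow> f \<mu> \<nu> = g \<mu> \<nu>) \<longrightarrow>
      Op f (?x e a) = Op g (?x e a))"
    by (intro allI Op_cong)
  then obtain F where F': "\<forall>e a. finite (F e a) \<and> (\<forall>f g. (\<forall>(\<mu>, \<nu>)\<in>F e a. 0 < \<mu> \<longrightarrow> 0 < \<nu> \<longrightarrow> f \<mu> \<nu> = g \<mu> \<nu>) \<longrightarrow>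
      Op f (?x e a) = Op g (?x e a))"
    unfolding choice_iff by (elim exE)
  have F: "finite (F e a)" for e a using F' by simp
  have F2: "Op f (?x e a) = Op g (?x e a)"
    if "\<And>\<mu> \<nu>. (\<mu>, \<nu>) \<in> F e a \<Longrightarrow> 0 < \<mu> \<Longrightarrow> 0 < \<nu> \<Longrightarrow> f \<mu> \<nu> = g \<mu> \<nu>" for e a f g
  proof -
    have "\<forall>(\<mu>, \<nu>)\<in>F e a. 0 < \<mu> \<longrightarrow> 0 < \<nu> \<longrightarrow> f \<mu> \<nu> = g \<mu> \<nu>" using that by auto
    with F' show ?thesis by simp
  qed
  \<comment> \<open>All values of \<nu>^2 / \<mu> relevant for any of the finitely many adjoint
    entries, so that one polynomial interpolates for all of them.\<close>
  define X where "X = (\<lambda>(\<mu>, \<nu>). ?s \<mu> \<nu>) ` (\<Union>e<?n. \<Union>a<?n. F e a)"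
  have "finite X" using F by (simp add: X_def)
  then obtain q where q: "\<And>x. x \<in> X \<Longrightarrow> poly q x = 1 / sqrt x"
    using finite_interpolation[of X "\<lambda>x. 1 / sqrt x"] by blast
  obtain B where B: "\<And>e a. e < ?n \<Longrightarrow> a < ?n \<Longrightarrow>
        Op (\<lambda>\<mu> \<nu>. poly q (?s \<mu> \<nu>)) (?x e a) = (\<Sum>j<?n. B j a *\<^sub>C ?x e j)" using poly[of q] by blast
  have "UU (L (lt \<gamma> i j)) = (\<Sum>k<?n. B k i *\<^sub>C ?x j k)" if ij: "i < ?n" "j < ?n" for i j
  proof -
    have "UU (L (lt \<gamma> i j)) = Op (\<lambda>\<mu> \<nu>. sqrt \<mu> / \<nu>) (?x j i)"
      unfolding UU_kk kk_lt ..
    also have "\<dots> = Op (\<lambda>\<mu> \<nu>. poly q (?s \<mu> \<nu>)) (?x j i)"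
    proof (rule F2)
      fix \<mu> \<nu> :: real assume m: "(\<mu>, \<nu>) \<in> F j i" "0 < \<mu>" "0 < \<nu>"
      have "?s \<mu> \<nu> \<in> X" unfolding X_def using m(1) ij by (intro image_eqI[of _ _ "(\<mu>, \<nu>)"]) auto
      then show "sqrt \<mu> / \<nu> = poly q (?s \<mu> \<nu>)" using m(2,3) by (simp add: q real_sqrt_divide)
    qed
    finally show ?thesis using B ij by simp
  qed
  then show ?thesis by (intro exI[of _ "\<lambda>i k. B k i"]) blast
qed

end

section \<open>Operators on complex Hilbert spaces\<close>

instance complex_hilbert_space \<subseteq> banach ..

lemma bcl:
  assumes "bounded_clinear T"
  shows bcl_bounded: "bounded_linear T" and bcl_add: "T (x + y) = T x + T y" and bcl_zero: "T 0 = 0"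
    and bcl_minus: "T (- x) = - T x" and bcl_diff: "T (x - y) = T x - T y"
    and bcl_scaleC: "T (c *\<^sub>C x) = c *\<^sub>C T x" and bcl_sum: "T (\<Sum>i\<in>I. f i) = (\<Sum>i\<in>I. T (f i))"
    and bcl_cont: "continuous_on A T"
proof -
  show b: "bounded_linear T" "T (c *\<^sub>C x) = c *\<^sub>C T x" using assms by (simp_all add: bounded_clinear_def)
  then interpret bounded_linear T by simp
  show "T (x + y) = T x + T y" "T 0 = 0" "T (- x) = - T x" "T (x - y) = T x - T y"
    "T (\<Sum>i\<in>I. f i) = (\<Sum>i\<in>I. T (f i))"
    by (simp_all add: add zero neg diff sum)
  show "continuous_on A T" by (rule linear_continuous_on[OF b(1)])
qed

lemma bcl_comp: "bounded_clinear S \<Longrightarrow> bounded_clinear T \<Longrightarrow> bounded_clinear (\<lambda>x. S (T x))"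
  unfolding bounded_clinear_def using bounded_linear_compose by auto

lemma bcl_plus: "bounded_clinear S \<Longrightarrow> bounded_clinear T \<Longrightarrow> bounded_clinear (\<lambda>x. S x + T x)"
  unfolding bounded_clinear_def using bounded_linear_add by (auto simp: scaleC_add_right)

lemma bcl_minus_fun: "bounded_clinear S \<Longrightarrow> bounded_clinear T \<Longrightarrow> bounded_clinear (\<lambda>x. S x - T x)"
  unfolding bounded_clinear_def using bounded_linear_sub by (auto simp: scaleC_diff_right)

lemma bcl_scale: "bounded_clinear S \<Longrightarrow> bounded_clinear (\<lambda>x. c *\<^sub>C S x)"
  unfolding bounded_clinear_def
  using bounded_linear_compose[OF bounded_linear_scaleC] by (auto simp: scaleC_scaleC mult.commute)

lemma bcl_id: "bounded_clinear (\<lambda>x. x)" and bcl_0: "bounded_clinear (\<lambda>x. 0)"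
  unfolding bounded_clinear_def by (auto simp: bounded_linear_ident bounded_linear_zero)

lemma cdense_induct:
  assumes "closure (cspan A) = UNIV" "closed {x. P x}" "csub {x. P x}" "\<And>x. x \<in> A \<Longrightarrow> P x"
  shows "P x"
proof -
  have "cspan A \<subseteq> {x. P x}" using assms(3,4) by (intro cspan_minimal) auto
  then have "closure (cspan A) \<subseteq> {x. P x}" using assms(2) by (rule closure_minimal)
  then show ?thesis using assms(1) by auto
qed

lemma csub_eq_bcl: "bounded_clinear S \<Longrightarrow> bounded_clinear T \<Longrightarrow> csub {x. S x = T x}"
  by (simp add: csub_def bcl_add bcl_zero bcl_scaleC)

lemma bcl_eq_on:
  assumes "bounded_clinear S" "bounded_clinear T" "\<And>x. x \<in> A \<Longrightarrow> S x = T x" "x \<in> closure (cspan A)"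
  shows "S x = T x"
proof -
  have "cspan A \<subseteq> {x. S x = T x}"
    using assms(3) by (intro cspan_minimal csub_eq_bcl[OF assms(1,2)]) auto
  moreover have "closed {x. S x = T x}"
    by (intro closed_Collect_eq bcl_cont[OF assms(1)] bcl_cont[OF assms(2)])
  ultimately show ?thesis using assms(4) closure_minimal by blast
qed

lemma bcl_ext:
  assumes "bounded_clinear S" "bounded_clinear T" "closure (cspan A) = UNIV" "\<And>x. x \<in> A \<Longrightarrow> S x = T x"
  shows "S = T"
  using bcl_eq_on[OF assms(1,2,4)] assms(3) by auto

lemma antilinear_ext:
  assumes "bounded_antilinear S" "bounded_antilinear T" "closure (cspan A) = UNIV" "\<And>x. x \<in> A \<Longrightarrow> S x = T x"
  shows "S = T"
proof
  fix x
  have S: "bounded_linear S" "\<And>c x. S (c *\<^sub>C x) = cnj c *\<^sub>C S x"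
    and T: "bounded_linear T" "\<And>c x. T (c *\<^sub>C x) = cnj c *\<^sub>C T x"
    using assms(1,2) by (simp_all add: bounded_antilinear_def)
  interpret S: bounded_linear S by fact
  interpret T: bounded_linear T by fact
  show "S x = T x"
  proof (rule cdense_induct[OF assms(3)])
    show "closed {x. S x = T x}"
      by (intro closed_Collect_eq linear_continuous_on S(1) T(1))
    show "csub {x. S x = T x}" by (simp add: csub_def S T S.add T.add S.zero T.zero)
  qed (rule assms(4))
qed

lemma norm_sum_square:
  "(norm (\<Sum>i\<in>F. c i *\<^sub>R v i))\<^sup>2 = (\<Sum>i\<in>F. \<Sum>j\<in>F. c i * c j * inner (v i) (v j))"
  unfolding power2_norm_eq_inner inner_sum_left unfolding inner_sum_right
  by (simp only: inner_scaleR_left inner_scaleR_right mult.left_commute mult.assoc)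

text \<open>The case \<open>s = cnj\<close> yields antilinear extensions; a finite family of operators is extended at
  once because only the sum of the squared norms is controlled.\<close>

lemma semilinear_extension:
  fixes g :: "'i \<Rightarrow> 'x::complex_hilbert_space" and f :: "'k \<Rightarrow> 'i \<Rightarrow> 'y::complex_hilbert_space"
  assumes dense: "closure (cspan (g ` I)) = UNIV" and fin: "finite K"
    and s: "\<And>c d. s (c * d) = s c * s d" "s 1 = 1"
    and inner: "\<And>i j c d. i \<in> I \<Longrightarrow> j \<in> I \<Longrightarrow>
      (\<Sum>k\<in>K. inner (s c *\<^sub>C f k i) (s d *\<^sub>C f k j)) = inner (c *\<^sub>C g i) (d *\<^sub>C g j)"
    and k: "k \<in> K"
  shows "\<exists>T. bounded_linear T \<and> (\<forall>c x. T (c *\<^sub>C x) = s c *\<^sub>C T x) \<and> (\<forall>i\<in>I. T (g i) = f k i)"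
proof -
  define g' where "g' = (\<lambda>(c, i). c *\<^sub>C g i)"
  define f' where "f' k = (\<lambda>(c, i). s c *\<^sub>C f k i)" for k
  have "g' ` (UNIV \<times> I) = {c *\<^sub>C x |c x. x \<in> g ` I}" by (auto simp: g'_def)
  then have dense': "closure (span (g' ` (UNIV \<times> I))) = UNIV" using dense by (simp add: cspan_def)
  have "\<exists>T. bounded_linear T \<and> (\<forall>i\<in>UNIV \<times> I. T (g' i) = f' k i)"
  proof (rule bounded_extension[OF dense', where C = 1])
    fix F :: "(complex \<times> 'i) set" and c :: "complex \<times> 'i \<Rightarrow> real" assume F: "finite F" "F \<subseteq> UNIV \<times> I"
    have "(norm (\<Sum>i\<in>F. c i *\<^sub>R f' k i))\<^sup>2 \<le> (\<Sum>k\<in>K. (norm (\<Sum>i\<in>F. c i *\<^sub>R f' k i))\<^sup>2)"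
      using k fin by (intro member_le_sum) auto
    also have "\<dots> = (\<Sum>k\<in>K. \<Sum>i\<in>F. \<Sum>j\<in>F. c i * c j * inner (f' k i) (f' k j))"
      by (simp only: norm_sum_square)
    also have "\<dots> = (\<Sum>i\<in>F. \<Sum>j\<in>F. \<Sum>k\<in>K. c i * c j * inner (f' k i) (f' k j))"
      by (subst sum.swap, rule sum.cong[OF refl], rule sum.swap)
    also have "\<dots> = (\<Sum>i\<in>F. \<Sum>j\<in>F. c i * c j * inner (g' i) (g' j))"
    proof (intro sum.cong refl)
      fix i j assume "i \<in> F" "j \<in> F"
      then have "snd i \<in> I" "snd j \<in> I" using F(2) by auto
      from inner[OF this, of "fst i" "fst j"]
      show "(\<Sum>k\<in>K. c i * c j * inner (f' k i) (f' k j)) = c i * c j * inner (g' i) (g' j)"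
        by (simp add: sum_distrib_left[symmetric] f'_def g'_def split_beta)
    qed
    also have "\<dots> = (norm (\<Sum>i\<in>F. c i *\<^sub>R g' i))\<^sup>2"
      by (simp only: norm_sum_square)
    finally show "norm (\<Sum>i\<in>F. c i *\<^sub>R f' k i) \<le> 1 * norm (\<Sum>i\<in>F. c i *\<^sub>R g' i)"
      unfolding mult_1 by (rule power2_le_imp_le) (rule norm_ge_zero)
  qed
  then obtain T where T: "bounded_linear T" "\<And>c i. i \<in> I \<Longrightarrow> T (c *\<^sub>C g i) = s c *\<^sub>C f k i"
    by (auto simp: g'_def f'_def)
  interpret T: bounded_linear T by fact
  have "T (c *\<^sub>C x) = s c *\<^sub>C T x" for c x
  proof (rule dense_induct[OF dense'])
    have T': "continuous_on UNIV T" by (rule linear_continuous_on[OF T(1)])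
    show "closed {x. T (c *\<^sub>C x) = s c *\<^sub>C T x}"
      by (rule closed_Collect_eq[OF continuous_on_compose2[OF T' continuous_scaleC subset_UNIV] continuous_on_scaleC[OF T']])
    show "subspace {x. T (c *\<^sub>C x) = s c *\<^sub>C T x}"
      by (rule subspaceI) (simp_all add: T.zero scaleC_add_right T.add scaleC_scaleR T.scaleR)
    show "T (c *\<^sub>C x) = s c *\<^sub>C T x" if "x \<in> g' ` (UNIV \<times> I)" for x
      using that by (auto simp: g'_def T(2) scaleC_scaleC s)
  qed
  moreover have "T (g i) = f k i" if "i \<in> I" for i using T(2)[OF that, of 1] by (simp add: s)
  ultimately show ?thesis using T(1) by blast
qed

text \<open>For a one-element K this extends an isometry. For a column of a unitary matrix the sum
  over K bounds each entry of the column.\<close>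

lemma column_extension:
  fixes g :: "'i \<Rightarrow> 'x::complex_hilbert_space" and f :: "'k \<Rightarrow> 'i \<Rightarrow> 'y::complex_hilbert_space"
  assumes dense: "closure (cspan (g ` I)) = UNIV" and fin: "finite K"
    and inner: "\<And>i j. i \<in> I \<Longrightarrow> j \<in> I \<Longrightarrow> (\<Sum>k\<in>K. cinner (f k i) (f k j)) = cinner (g i) (g j)"
    and k: "k \<in> K"
  shows "\<exists>T. bounded_clinear T \<and> (\<forall>i\<in>I. T (g i) = f k i)"
proof -
  have "(\<Sum>k\<in>K. inner (c *\<^sub>C f k i) (d *\<^sub>C f k j)) = inner (c *\<^sub>C g i) (d *\<^sub>C g j)"
    if "i \<in> I" "j \<in> I" for i j c d
  proof -
    have "(\<Sum>k\<in>K. cinner (c *\<^sub>C f k i) (d *\<^sub>C f k j)) = cinner (c *\<^sub>C g i) (d *\<^sub>C g j)"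
      by (simp add: cinner_scaleC_left cinner_scaleC_right sum_distrib_left[symmetric] inner[OF that])
    then show ?thesis by (simp add: Re_cinner[symmetric] Re_sum[symmetric])
  qed
  from semilinear_extension[OF dense fin, of "\<lambda>c. c", OF _ _ this k] show ?thesis
    by (auto simp: bounded_clinear_def)
qed

lemma isometry_extension:
  fixes g :: "'i \<Rightarrow> 'x::complex_hilbert_space" and f :: "'i \<Rightarrow> 'y::complex_hilbert_space"
  assumes dense: "closure (cspan (g ` I)) = UNIV"
    and inner: "\<And>i j. i \<in> I \<Longrightarrow> j \<in> I \<Longrightarrow> cinner (f i) (f j) = cinner (g i) (g j)"
  shows "\<exists>T. bounded_clinear T \<and> (\<forall>i\<in>I. T (g i) = f i) \<and> (\<forall>x y. cinner (T x) (T y) = cinner x y)"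
proof -
  obtain T where T: "bounded_clinear T" "\<And>i. i \<in> I \<Longrightarrow> T (g i) = f i"
    using column_extension[OF dense, of "{()}" "\<lambda>_. f"] inner by auto
  have c: "continuous_on UNIV T" by (rule bcl_cont[OF T(1)])
  have 1: "cinner (T (g i)) (T y) = cinner (g i) y" if i: "i \<in> I" for i y
  proof (rule cdense_induct[OF dense, where P = "\<lambda>y. cinner (T (g i)) (T y) = cinner (g i) y"])
    show "closed {y. cinner (T (g i)) (T y) = cinner (g i) y}"
      using c by (intro closed_Collect_eq) (auto intro!: continuous_intros)
    show "csub {y. cinner (T (g i)) (T y) = cinner (g i) y}"
      by (simp add: csub_def bcl_zero[OF T(1)] bcl_add[OF T(1)] bcl_scaleC[OF T(1)] cinner_add_right cinner_scaleC_right)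
  qed (use i inner T(2) in auto)
  have "cinner (T x) (T y) = cinner x y" for x y
  proof (rule cdense_induct[OF dense, where P = "\<lambda>x. cinner (T x) (T y) = cinner x y"])
    show "closed {x. cinner (T x) (T y) = cinner x y}"
      using c by (intro closed_Collect_eq) (auto intro!: continuous_intros)
    show "csub {x. cinner (T x) (T y) = cinner x y}"
      by (simp add: csub_def bcl_zero[OF T(1)] bcl_add[OF T(1)] bcl_scaleC[OF T(1)] cinner_add_left cinner_scaleC_left)
  qed (use 1 in auto)
  then show ?thesis using T by blast
qed

lemma antiisometry_extension:
  fixes g :: "'i \<Rightarrow> 'x::complex_hilbert_space" and f :: "'i \<Rightarrow> 'y::complex_hilbert_space"
  assumes dense: "closure (cspan (g ` I)) = UNIV"
    and inner: "\<And>i j. i \<in> I \<Longrightarrow> j \<in> I \<Longrightarrow> cinner (f i) (f j) = cinner (g j) (g i)"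
  shows "\<exists>T. bounded_antilinear T \<and> (\<forall>i\<in>I. T (g i) = f i) \<and> (\<forall>x y. cinner (T x) (T y) = cinner y x)"
proof -
  have "(\<Sum>k\<in>{()}. inner (cnj c *\<^sub>C f i) (cnj d *\<^sub>C f j)) = inner (c *\<^sub>C g i) (d *\<^sub>C g j)"
    if "i \<in> I" "j \<in> I" for i j c d
  proof -
    have "inner (cnj c *\<^sub>C f i) (cnj d *\<^sub>C f j) = inner (d *\<^sub>C g j) (c *\<^sub>C g i)"
      unfolding Re_cinner[symmetric] cinner_scaleC_left cinner_scaleC_right inner[OF that] by (simp add: mult.commute mult.left_commute)
    then show ?thesis by (simp add: inner_commute)
  qed
  from semilinear_extension[OF dense _ _ _ this, of "()"]
  obtain T where T: "bounded_linear T" "\<And>c x. T (c *\<^sub>C x) = cnj c *\<^sub>C T x" "\<And>i. i \<in> I \<Longrightarrow> T (g i) = f i"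
    by auto
  interpret T: bounded_linear T by fact
  have c: "continuous_on UNIV T" by (rule linear_continuous_on[OF T(1)])
  have 1: "cinner (T (g i)) (T y) = cinner y (g i)" if i: "i \<in> I" for i y
  proof (rule cdense_induct[OF dense, where P = "\<lambda>y. cinner (T (g i)) (T y) = cinner y (g i)"])
    show "closed {y. cinner (T (g i)) (T y) = cinner y (g i)}"
      using c by (intro closed_Collect_eq) (auto intro!: continuous_intros)
    show "csub {y. cinner (T (g i)) (T y) = cinner y (g i)}"
      by (simp add: csub_def T.zero T.add T(2) cinner_add_right cinner_scaleC_right cinner_add_left cinner_scaleC_left)
  qed (use i inner T(3) in auto)
  have "cinner (T x) (T y) = cinner y x" for x y
  proof (rule cdense_induct[OF dense, where P = "\<lambda>x. cinner (T x) (T y) = cinner y x"])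
    show "closed {x. cinner (T x) (T y) = cinner y x}"
      using c by (intro closed_Collect_eq) (auto intro!: continuous_intros)
    show "csub {x. cinner (T x) (T y) = cinner y x}"
      by (simp add: csub_def T.zero T.add T(2) cinner_add_right cinner_scaleC_right cinner_add_left cinner_scaleC_left)
  qed (use 1 in auto)
  then show ?thesis using T unfolding bounded_antilinear_def by blast
qed

text \<open>The range of an isometry of a complete space is complete, hence closed.\<close>

lemma isometry_surj:
  fixes T :: "'x::complex_hilbert_space \<Rightarrow> 'y::complex_hilbert_space"
  assumes T: "bounded_clinear T" "\<And>x y. cinner (T x) (T y) = cinner x y" and dense: "closure (range T) = UNIV"
  shows "surj T"
proof -
  have "norm (T x) = norm x" for x
    using T(2)[of x x] by (simp add: cinner_self flip: of_real_power)
  then have "complete (range T)"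
    using complete_isometric_image[of 1 UNIV T] bcl_bounded[OF T(1)] complete_UNIV by simp
  then show ?thesis using dense complete_imp_closed closure_closed by blast
qed

subsection \<open>Orthogonal projections\<close>

text \<open>Testing with \<i> z as well as z recovers the imaginary part; this transfers the real
  projection theorem to complex subspaces.\<close>

lemma inner_cinner_orth:
  assumes "csub M" "\<And>z. z \<in> M \<Longrightarrow> inner z x = 0" "z \<in> M"
  shows "cinner z x = 0"
proof -
  have "Re (cinner z x) = 0" using assms by (simp add: Re_cinner)
  moreover have "Re (cinner (\<i> *\<^sub>C z) x) = 0" using assms csub_scaleC[OF assms(1,3)] by (simp add: Re_cinner)
  ultimately show ?thesis by (simp add: cinner_scaleC_left complex_eq_iff)
qed

lemma orth_proj_ex1:
  assumes M: "csub M" "closed M"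
  shows "\<exists>!y. y \<in> M \<and> (\<forall>z\<in>M. cinner z (x - y) = 0)"
proof -
  obtain y where y: "y \<in> M" "\<And>z. z \<in> M \<Longrightarrow> inner z (x - y) = 0"
    using orth_decomp[OF csub_subspace[OF M(1)] M(2)] by blast
  show ?thesis
  proof (rule ex1I[of _ y])
    show "y \<in> M \<and> (\<forall>z\<in>M. cinner z (x - y) = 0)" using y inner_cinner_orth[OF M(1) y(2)] by blast
    fix w assume w: "w \<in> M \<and> (\<forall>z\<in>M. cinner z (x - w) = 0)"
    have "w - y \<in> M" using w y csub_diff[OF M(1)] by blast
    then have "cinner (w - y) (x - y) = 0" "cinner (w - y) (x - w) = 0"
      using w inner_cinner_orth[OF M(1) y(2)] by auto
    then have "cinner (w - y) (w - y) = 0" by (simp add: cinner_diff_right)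
    then show "w = y" by (simp add: cinner_eq_zero_iff)
  qed
qed

lemma orth_proj:
  assumes M: "csub M" "closed M"
  shows orth_proj_in: "orth_proj M x \<in> M"
    and orth_proj_orth: "z \<in> M \<Longrightarrow> cinner z (x - orth_proj M x) = 0"
  using theI'[OF orth_proj_ex1[OF M, of x]] unfolding orth_proj_def[symmetric] by auto

lemma orth_proj_eqI:
  assumes M: "csub M" "closed M" and "y \<in> M" "\<And>z. z \<in> M \<Longrightarrow> cinner z (x - y) = 0"
  shows "orth_proj M x = y"
  using orth_proj_ex1[OF M, of x] orth_proj_in[OF M, of x] orth_proj_orth[OF M, of _ x] assms(3,4) by blast

lemma orth_proj_sym:
  assumes M: "csub M" "closed M"
  shows "cinner (orth_proj M x) y = cinner (orth_proj M x) (orth_proj M y)"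
  using orth_proj_orth[OF M orth_proj_in[OF M, of x], of y] by (simp add: cinner_diff_right)

lemma orth_proj_add:
  assumes M: "csub M" "closed M"
  shows "orth_proj M (x + y) = orth_proj M x + orth_proj M y"
proof (rule orth_proj_eqI[OF M])
  fix z assume z: "z \<in> M"
  have "x + y - (orth_proj M x + orth_proj M y) = (x - orth_proj M x) + (y - orth_proj M y)" by simp
  then show "cinner z (x + y - (orth_proj M x + orth_proj M y)) = 0"
    by (simp only: cinner_add_right orth_proj_orth[OF M z] add_0)
qed (intro csub_add M orth_proj_in)

lemma orth_proj_scaleC:
  assumes M: "csub M" "closed M"
  shows "orth_proj M (c *\<^sub>C x) = c *\<^sub>C orth_proj M x"
proof (rule orth_proj_eqI[OF M])
  fix z assume z: "z \<in> M"
  then show "cinner z (c *\<^sub>C x - c *\<^sub>C orth_proj M x) = 0"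
    using orth_proj_orth[OF M z, of x] by (simp add: scaleC_diff_right[symmetric] cinner_scaleC_right)
qed (intro csub_scaleC M orth_proj_in)

lemma orth_proj_bcl:
  assumes M: "csub M" "closed M"
  shows "bounded_clinear (orth_proj M)"
proof -
  have n: "norm (orth_proj M x) \<le> 1 * norm x" for x
  proof -
    have "cinner (orth_proj M x) (orth_proj M x) = cinner (orth_proj M x) x" by (rule orth_proj_sym[OF M, symmetric])
    then have "(norm (orth_proj M x))\<^sup>2 = inner (orth_proj M x) x"
      by (metis Re_cinner power2_norm_eq_inner)
    also have "\<dots> \<le> norm (orth_proj M x) * norm x" by (rule norm_cauchy_schwarz)
    finally show ?thesis by (cases "norm (orth_proj M x) = 0") (simp_all add: power2_eq_square)
  qed
  have "orth_proj M (r *\<^sub>R x) = r *\<^sub>R orth_proj M x" for r x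
    using orth_proj_scaleC[OF M, of "of_real r" x] by (simp add: scaleC_of_real)
  then have "bounded_linear (orth_proj M)"
    using n by (intro bounded_linear_intro[of _ 1]) (auto simp: orth_proj_add[OF M] mult.commute)
  then show ?thesis by (simp add: bounded_clinear_def orth_proj_scaleC[OF M])
qed

lemma orth_proj_id: "csub M \<Longrightarrow> closed M \<Longrightarrow> x \<in> M \<Longrightarrow> orth_proj M x = x"
  by (rule orth_proj_eqI) auto

lemma orth_proj_0: "csub M \<Longrightarrow> closed M \<Longrightarrow> (\<And>z. z \<in> M \<Longrightarrow> cinner z x = 0) \<Longrightarrow> orth_proj M x = 0"
  by (rule orth_proj_eqI) (auto simp: csub_0)

subsection \<open>Finite-dimensional subspaces\<close>

lemma cspan_insert_orth:
  assumes M: "m \<in> cspan B"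
  shows "cspan (insert (m + e) B) = {x + c *\<^sub>C e |x c. x \<in> cspan B}"
proof (intro equalityI cspan_minimal[of "{x + c *\<^sub>C e |x c. x \<in> cspan B}"] subsetI)
  show "csub {x + c *\<^sub>C e |x c. x \<in> cspan B}"
    unfolding csub_def
  proof (intro conjI ballI allI)
    show "0 \<in> {x + c *\<^sub>C e |x c. x \<in> cspan B}"
      using csub_0[OF cspan_csub[of B]] by (intro CollectI exI[of _ 0]) auto
    fix x y assume "x \<in> {x + c *\<^sub>C e |x c. x \<in> cspan B}" "y \<in> {x + c *\<^sub>C e |x c. x \<in> cspan B}"
    then obtain u c v d where "x = u + c *\<^sub>C e" "u \<in> cspan B" "y = v + d *\<^sub>C e" "v \<in> cspan B" by blast
    then show "x + y \<in> {x + c *\<^sub>C e |x c. x \<in> cspan B}"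
      by (intro CollectI exI[of _ "u + v"] exI[of _ "c + d"]) (simp add: scaleC_add_left csub_add[OF cspan_csub])
  next
    fix a x assume "x \<in> {x + c *\<^sub>C e |x c. x \<in> cspan B}"
    then obtain u c where "x = u + c *\<^sub>C e" "u \<in> cspan B" by blast
    then show "a *\<^sub>C x \<in> {x + c *\<^sub>C e |x c. x \<in> cspan B}"
      by (intro CollectI exI[of _ "a *\<^sub>C u"] exI[of _ "a * c"])
        (simp add: scaleC_add_right scaleC_scaleC csub_scaleC[OF cspan_csub])
  qed
  fix x assume "x \<in> insert (m + e) B"
  then show "x \<in> {x + c *\<^sub>C e |x c. x \<in> cspan B}"
  proof
    assume "x = m + e"
    then show ?thesis using M by (intro CollectI exI[of _ m] exI[of _ 1]) simp
  next
    assume "x \<in> B"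
    then show ?thesis using cspan_base[of x B] by (intro CollectI exI[of _ x] exI[of _ 0]) simp
  qed
next
  fix x assume "x \<in> {x + c *\<^sub>C e |x c. x \<in> cspan B}"
  then obtain u c where u: "x = u + c *\<^sub>C e" "u \<in> cspan B" by blast
  have s: "cspan B \<subseteq> cspan (insert (m + e) B)" by (rule cspan_mono) auto
  have "m + e - m \<in> cspan (insert (m + e) B)"
    using s M by (intro csub_diff[OF cspan_csub]) (auto intro: cspan_base)
  then have "c *\<^sub>C e \<in> cspan (insert (m + e) B)" by (simp add: csub_scaleC[OF cspan_csub])
  then show "x \<in> cspan (insert (m + e) B)" using u s by (auto intro: csub_add[OF cspan_csub])
qed

text \<open>Both claims are proved in one induction in Gram-Schmidt style, since splitting the new
  vector orthogonally requires the smaller span to be closed.\<close>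

lemma finite_cspan:
  fixes B :: "'x::complex_hilbert_space set"
  assumes "finite B"
  shows finite_cspan_closed: "closed (cspan B)"
    and finite_cspan_riesz: "(\<And>x y. x \<in> cspan B \<Longrightarrow> y \<in> cspan B \<Longrightarrow> f (x + y) = f x + f y) \<Longrightarrow>
      (\<And>c x. x \<in> cspan B \<Longrightarrow> f (c *\<^sub>C x) = c * f x) \<Longrightarrow> \<exists>e\<in>cspan B. \<forall>y\<in>cspan B. cinner e y = f y"
proof -
  have "closed (cspan B) \<and> ((\<forall>x\<in>cspan B. \<forall>y\<in>cspan B. f (x + y) = f x + f y) \<longrightarrow>
      (\<forall>x\<in>cspan B. \<forall>c. f (c *\<^sub>C x) = c * f x) \<longrightarrow> (\<exists>e\<in>cspan B. \<forall>y\<in>cspan B. cinner e y = f y))" for f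
    using assms
  proof (induction B rule: finite_induct)
    case empty
    have "cspan {} = {0 :: 'x}" by (simp add: cspan_def)
    then show ?case by (auto dest: spec[of _ 0])
  next
    case (insert b B)
    then have cl: "closed (cspan B)" by blast
    let ?m = "orth_proj (cspan B) b"
    define e where "e = b - ?m"
    have m: "?m \<in> cspan B" and orth: "\<And>z. z \<in> cspan B \<Longrightarrow> cinner z e = 0"
      unfolding e_def using orth_proj[OF cspan_csub cl] by auto
    have orth': "cinner e z = 0" if "z \<in> cspan B" for z using orth[OF that] cinner_commute[of e z] by simp
    have eq: "cspan (insert b B) = {x + c *\<^sub>C e |x c. x \<in> cspan B}"
      using cspan_insert_orth[OF m, of e] by (simp add: e_def)
    show ?case
    proof (cases "e = 0")
      case True
      then have "cspan (insert b B) = cspan B" by (auto simp: eq)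
      then show ?thesis using insert.IH by simp
    next
      case False
      then have n: "cinner e e \<noteq> 0" by (simp add: cinner_eq_zero_iff)
      \<comment> \<open>The larger span is the preimage of the smaller one under the continuous map
        that removes the component along e, hence closed.\<close>
      have "cspan (insert b B) = {x. x - (cinner e x / cinner e e) *\<^sub>C e \<in> cspan B}"
      proof (intro equalityI subsetI)
        fix x assume "x \<in> cspan (insert b B)"
        then obtain u c where "x = u + c *\<^sub>C e" "u \<in> cspan B" using eq by blast
        then show "x \<in> {x. x - (cinner e x / cinner e e) *\<^sub>C e \<in> cspan B}"
          using n by (simp add: cinner_add_right orth' cinner_scaleC_right)
      next
        fix x assume "x \<in> {x. x - (cinner e x / cinner e e) *\<^sub>C e \<in> cspan B}"
        then show "x \<in> cspan (insert b B)"
          unfolding eq by (intro CollectI exI[of _ "x - (cinner e x / cinner e e) *\<^sub>C e"] exI[of _ "cinner e x / cinner e e"]) simp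
      qed
      moreover have "continuous_on UNIV (\<lambda>x. x - (cinner e x / cinner e e) *\<^sub>C e)"
      proof -
        have "bounded_linear (\<lambda>z::complex. z *\<^sub>C e)"
          by (rule bounded_linear_intro[of _ "norm e"])
            (simp_all add: scaleC_add_left norm_scaleC scaleR_conv_of_real scaleC_scaleC[symmetric] scaleC_of_real)
        then have "continuous_on UNIV (\<lambda>z::complex. z *\<^sub>C e)" by (rule linear_continuous_on)
        moreover have "continuous_on UNIV (\<lambda>x. cinner e x / cinner e e)"
          using n by (intro continuous_intros) auto
        ultimately have "continuous_on UNIV (\<lambda>x. (cinner e x / cinner e e) *\<^sub>C e)"
          by (rule continuous_on_compose2) simp
        then show ?thesis by (intro continuous_on_diff continuous_on_id)
      qed
      ultimately have "closed (cspan (insert b B))"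
        using continuous_closed_vimage[OF cl, of "\<lambda>x. x - (cinner e x / cinner e e) *\<^sub>C e"]
        by (simp add: vimage_def continuous_on_eq_continuous_at)
      moreover have "\<exists>e\<in>cspan (insert b B). \<forall>y\<in>cspan (insert b B). cinner e y = f y"
        if f: "\<forall>x\<in>cspan (insert b B). \<forall>y\<in>cspan (insert b B). f (x + y) = f x + f y"
          "\<forall>x\<in>cspan (insert b B). \<forall>c. f (c *\<^sub>C x) = c * f x"
      proof -
        have s: "cspan B \<subseteq> cspan (insert b B)" by (rule cspan_mono) auto
        then obtain e0 where e0: "e0 \<in> cspan B" "\<And>y. y \<in> cspan B \<Longrightarrow> cinner e0 y = f y"
          using insert.IH f by (meson subsetD)
        have e: "e \<in> cspan (insert b B)"
          using csub_0[OF cspan_csub[of B]] unfolding eq by (intro CollectI exI[of _ 0] exI[of _ 1]) simp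
        define e' where "e' = e0 + cnj (f e / cinner e e) *\<^sub>C e"
        have "cinner e' y = f y" if y: "y \<in> cspan (insert b B)" for y
        proof -
          obtain u c where u: "y = u + c *\<^sub>C e" "u \<in> cspan B" using eq y by blast
          then have "f y = f u + c * f e" using f s e csub_scaleC[OF cspan_csub e] by auto
          then show ?thesis using u n e0 orth orth'
            by (simp add: e'_def cinner_add_left cinner_add_right cinner_scaleC_left cinner_scaleC_right)
        qed
        moreover have "e' \<in> cspan (insert b B)" unfolding e'_def eq using e0(1) by blast
        ultimately show ?thesis by blast
      qed
      ultimately show ?thesis by blast
    qed
  qed
  note * = this
  show "closed (cspan B)" using * by blast
  show "(\<And>x y. x \<in> cspan B \<Longrightarrow> y \<in> cspan B \<Longrightarrow> f (x + y) = f x + f y) \<Longrightarrow>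
      (\<And>c x. x \<in> cspan B \<Longrightarrow> f (c *\<^sub>C x) = c * f x) \<Longrightarrow> \<exists>e\<in>cspan B. \<forall>y\<in>cspan B. cinner e y = f y"
    using * by simp
qed

section \<open>The modular conjugation and the Kac system\<close>

lemma involution_closure:
  assumes "continuous_on UNIV f" "\<And>x. f (f x) = x"
  shows "closure (f ` A) = f ` closure A"
proof
  have 1: "f ` closure B \<subseteq> closure (f ` B)" for B
    by (rule image_closure_subset[OF continuous_on_subset[OF assms(1)]]) (auto intro: closure_subset[THEN subsetD])
  show "f ` closure A \<subseteq> closure (f ` A)" by (rule 1)
  have "f ` f ` A = A" by (simp add: image_image assms(2))
  then have "f ` closure (f ` A) \<subseteq> closure A" using 1[of "f ` A"] by simp
  then show "closure (f ` A) \<subseteq> f ` closure A" using assms(2) by (metis image_iff subset_iff)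
qed

lemma continuous_cinner: "continuous_on UNIV (\<lambda>z. cinner (fst z) (snd z))"
proof -
  have "continuous_on UNIV (\<lambda>z. Complex (inner (fst z) (snd z)) (- inner (fst z) (\<i> *\<^sub>C snd z)))"
    by (intro continuous_on_Complex continuous_intros)
  then show ?thesis by (simp only: cinner_complex)
qed

lemma antilinear_bounded:
  assumes "bounded_antilinear T"
  shows "bounded_linear T" "T (c *\<^sub>C x) = cnj c *\<^sub>C T x" "T (x + y) = T x + T y" "T 0 = 0" "T (r *\<^sub>R x) = r *\<^sub>R T x"
proof -
  show b: "bounded_linear T" "T (c *\<^sub>C x) = cnj c *\<^sub>C T x" using assms by (simp_all add: bounded_antilinear_def)
  then interpret bounded_linear T by simp
  show "T (x + y) = T x + T y" "T 0 = 0" "T (r *\<^sub>R x) = r *\<^sub>R T x" by (simp_all add: add zero scaleR)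
qed

context fp_kac
begin

section \<open>The candidate for the modular conjugation\<close>

definition EE :: "'h set" where "EE = {L q |q. \<exists>\<mu> \<nu>. eig q \<mu> \<nu>}"

lemma EE_dense: "closure (cspan EE) = UNIV"
proof -
  have "HH0 \<subseteq> cspan EE" using eig_span by (auto simp: HH0_def EE_def)
  then show ?thesis using HH0_dense closure_mono by blast
qed

lemma HH0_orth: "(\<And>p. inner u (L p) = 0) \<Longrightarrow> u = 0"
proof -
  assume "\<And>p. inner u (L p) = 0"
  then have "HH0 \<subseteq> {x. inner u x = 0}" by (auto simp: HH0_def)
  moreover have "closed {x. inner u x = 0}" by (intro closed_Collect_eq continuous_intros)
  ultimately have "closure HH0 \<subseteq> {x. inner u x = 0}" by (rule closure_minimal)
  then have "inner u u = 0" using HH0_dense by blast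
  then show "u = 0" by simp
qed

lemma L_inner_st: "cinner (L (st p)) (L (st q)) = cinner (L q) (L (ss p))"
proof -
  have "cinner (L (st p)) (L (st q)) = hh (st (st p) * st q)" by (rule L_inner)
  also have "\<dots> = hh (p * st q)" by (rule hh_eq[OF L_mult[OF L_st_st refl]])
  also have "\<dots> = cinner (L q) (L (ss p))" unfolding L_inner by (rule kms)
  finally show ?thesis .
qed

lemma eig_orth: assumes "eig p \<mu> \<nu>" "eig q \<mu>' \<nu>'" "\<mu> \<noteq> \<mu>' \<or> \<nu> \<noteq> \<nu>'" shows "cinner (L p) (L q) = 0"
proof -
  have 1: "of_real \<mu>' * cinner (L p) (L q) = of_real \<mu> * cinner (L p) (L q)"
    using Sg_sym[of p q] assms(1,2) by (simp add: eig_def scaleC_of_real[symmetric] cinner_scaleC_left cinner_scaleC_right)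
  have 2: "of_real (\<nu>'\<^sup>2) * cinner (L p) (L q) = of_real (\<nu>\<^sup>2) * cinner (L p) (L q)"
    using k2_sym[of p q] assms(1,2)
    by (simp add: eig_def scaleC_of_real[symmetric] cinner_scaleC_left cinner_scaleC_right flip: of_real_power)
  show ?thesis
  proof (cases "\<mu> = \<mu>'")
    case False
    then show ?thesis using 1 by simp
  next
    case True
    then have "\<nu>\<^sup>2 \<noteq> \<nu>'\<^sup>2" using assms by (auto simp: eig_def power2_eq_iff)
    then have "complex_of_real (\<nu>\<^sup>2) \<noteq> of_real (\<nu>'\<^sup>2)" by (simp only: of_real_eq_iff not_False_eq_True)
    then show ?thesis using 2 by simp
  qed
qed

lemma Op_sym: "cinner (L p) (Op f (L q)) = cinner (Op f (L p)) (L q)"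
proof (induction p rule: eig_induct)
  case (eig p \<mu> \<nu>)
  show ?case
  proof (induction q rule: eig_induct)
    case e: (eig q \<mu>' \<nu>')
    show ?case using eig_orth[OF eig e]
      by (cases "\<mu> = \<mu>' \<and> \<nu> = \<nu>'")
        (auto simp: Op(2)[OF eig] Op(2)[OF e] scaleC_of_real[symmetric] cinner_scaleC_left cinner_scaleC_right)
  qed (simp_all add: Op_zero Op_add L_add cinner_add_right)
qed (simp_all add: Op_zero Op_add L_add cinner_add_left)

text \<open>The star maps an eigenvector to one whose squared norm is \<mu> times as large, so
  division by sqrt \<mu> makes it antiisometric.\<close>

definition JJ :: "'h \<Rightarrow> 'h" where
  "JJ = (SOME J. bounded_antilinear J \<and> (\<forall>p \<mu> \<nu>. eig p \<mu> \<nu> \<longrightarrow> J (L p) = (1 / sqrt \<mu>) *\<^sub>R L (st p)) \<and>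
     (\<forall>x y. cinner (J x) (J y) = cinner y x))"

lemma JJ: "bounded_antilinear JJ" "eig p \<mu> \<nu> \<Longrightarrow> JJ (L p) = (1 / sqrt \<mu>) *\<^sub>R L (st p)"
  "cinner (JJ x) (JJ y) = cinner y x"
proof -
  have "\<exists>T. bounded_antilinear T \<and> (\<forall>i\<in>{(p, \<mu>, \<nu>). eig p \<mu> \<nu>}. T ((\<lambda>(p, \<mu>, \<nu>). L p) i) = (\<lambda>(p, \<mu>, \<nu>). (1 / sqrt \<mu>) *\<^sub>R L (st p)) i) \<and>
      (\<forall>x y. cinner (T x) (T y) = cinner y x)"
  proof (rule antiisometry_extension)
    have "(\<lambda>(p, \<mu>, \<nu>). L p) ` {(p, \<mu>, \<nu>). eig p \<mu> \<nu>} = EE" by (force simp: EE_def)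
    then show "closure (cspan ((\<lambda>(p, \<mu>, \<nu>). L p) ` {(p, \<mu>, \<nu>). eig p \<mu> \<nu>})) = UNIV" using EE_dense by simp
    fix i j assume "i \<in> {(p, \<mu>, \<nu>). eig p \<mu> \<nu>}" "j \<in> {(p, \<mu>, \<nu>). eig p \<mu> \<nu>}"
    then obtain p \<mu> \<nu> q \<mu>' \<nu>' where ij: "i = (p, \<mu>, \<nu>)" "j = (q, \<mu>', \<nu>')" and e: "eig p \<mu> \<nu>" "eig q \<mu>' \<nu>'"
      by blast
    have m: "0 < \<mu>" "L (ss p) = \<mu> *\<^sub>R L p" using e by (simp_all add: eig_def)
    have "cinner ((1 / sqrt \<mu>) *\<^sub>R L (st p)) ((1 / sqrt \<mu>') *\<^sub>R L (st q))
        = of_real (1 / sqrt \<mu> * (1 / sqrt \<mu>') * \<mu>) * cinner (L q) (L p)"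
      by (simp add: scaleC_of_real[symmetric] cinner_scaleC_left cinner_scaleC_right L_inner_st m)
    also have "\<dots> = cinner (L q) (L p)"
    proof (cases "\<mu> = \<mu>'")
      case True
      then have "1 / sqrt \<mu> * (1 / sqrt \<mu>') * \<mu> = 1" using m by simp
      then show ?thesis by (simp only: of_real_1 mult_1)
    next
      case False
      then show ?thesis using eig_orth[OF e(2,1)] by simp
    qed
    finally show "cinner ((\<lambda>(p, \<mu>, \<nu>). (1 / sqrt \<mu>) *\<^sub>R L (st p)) i) ((\<lambda>(p, \<mu>, \<nu>). (1 / sqrt \<mu>) *\<^sub>R L (st p)) j)
        = cinner ((\<lambda>(p, \<mu>, \<nu>). L p) j) ((\<lambda>(p, \<mu>, \<nu>). L p) i)" by (simp add: ij)
  qed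
  then have "\<exists>J. bounded_antilinear J \<and> (\<forall>p \<mu> \<nu>. eig p \<mu> \<nu> \<longrightarrow> J (L p) = (1 / sqrt \<mu>) *\<^sub>R L (st p)) \<and>
     (\<forall>x y. cinner (J x) (J y) = cinner y x)" by auto
  from someI_ex[OF this] show "bounded_antilinear JJ" "eig p \<mu> \<nu> \<Longrightarrow> JJ (L p) = (1 / sqrt \<mu>) *\<^sub>R L (st p)"
    "cinner (JJ x) (JJ y) = cinner y x"
    unfolding JJ_def[symmetric] by blast+
qed

lemma JJ_JJ: "JJ (JJ x) = x"
proof -
  have "bounded_clinear (\<lambda>x. JJ (JJ x))"
    using bounded_linear_compose[OF antilinear_bounded(1)[OF JJ(1)] antilinear_bounded(1)[OF JJ(1)]]
    by (simp add: bounded_clinear_def antilinear_bounded(2)[OF JJ(1)])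
  then have "(\<lambda>x. JJ (JJ x)) = (\<lambda>x. x)"
  proof (rule bcl_ext[OF _ bcl_id EE_dense])
    fix x assume "x \<in> EE"
    then obtain p \<mu> \<nu> where p: "x = L p" "eig p \<mu> \<nu>" by (auto simp: EE_def)
    have "0 < \<mu>" using p by (simp add: eig_def)
    then show "JJ (JJ x) = x"
      by (simp add: p(1) JJ(2)[OF p(2)] antilinear_bounded(5)[OF JJ(1)] JJ(2)[OF eig_st_eig[OF p(2)]] L_st_st
          real_sqrt_divide)
  qed
  then show ?thesis by (rule fun_cong)
qed

lemma JJ_antiunitary: "antiunitary_op JJ"
  unfolding antiunitary_op_def using JJ(1,3) JJ_JJ by (metis surjI)

lemma JJ_Op: "JJ (Dh (L p)) = L (st p)"
proof (induction p rule: eig_induct)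
  case (cong p q)
  then show ?case using L_st[OF cong(2)] by simp
next
  case zero
  show ?case using st_smult[of 0 0] by (simp add: Op_zero antilinear_bounded(4)[OF JJ(1)])
next
  case (eig p \<mu> \<nu>)
  then have "0 < \<mu>" by (simp add: eig_def)
  then show ?case by (simp add: Op(2)[OF eig] JJ(2)[OF eig] antilinear_bounded(5)[OF JJ(1)])
qed (simp add: L_add Op_add st_add antilinear_bounded(3)[OF JJ(1)])

section \<open>The closure of \<sigma>^(1/2) as a positive self-adjoint operator\<close>

definition GG0 :: "('h \<times> 'h) set" where "GG0 = range (\<lambda>p. (L p, Dh (L p)))"
text \<open>The operator is kept as its graph, so that taking the closure needs no domain; domain
  and values are extracted later in \<open>MD\<close> and \<open>DD0\<close>.\<close>

definition GG :: "('h \<times> 'h) set" where "GG = closure GG0"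

lemma GG_minimal: "closed C \<Longrightarrow> (\<And>p. (L p, Dh (L p)) \<in> C) \<Longrightarrow> GG \<subseteq> C"
  unfolding GG_def GG0_def by (rule closure_minimal) auto

lemma GG_base: "(L p, Dh (L p)) \<in> GG"
  unfolding GG_def GG0_def by (rule closure_subset[THEN subsetD]) auto

lemma GG_lin: "z \<in> GG \<Longrightarrow> w \<in> GG \<Longrightarrow> (fst z + c *\<^sub>C fst w, snd z + c *\<^sub>C snd w) \<in> GG"
proof -
  let ?f = "\<lambda>z w :: 'h \<times> 'h. (fst z + c *\<^sub>C fst w, snd z + c *\<^sub>C snd w)"
  have c1: "closed {w. ?f z w \<in> GG}" and c2: "closed {z. ?f z w \<in> GG}" for z w
  proof -
    have "closed ((\<lambda>w. ?f z w) -` GG)" "closed ((\<lambda>z. ?f z w) -` GG)"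
      by (rule closed_vimage; (simp add: GG_def)?; intro continuous_intros)+
    then show "closed {w. ?f z w \<in> GG}" "closed {z. ?f z w \<in> GG}" by (simp_all add: vimage_def)
  qed
  have "GG \<subseteq> {w. ?f (L p, Dh (L p)) w \<in> GG}" for p
  proof (rule GG_minimal[OF c1], rule CollectI)
    fix q
    have "?f (L p, Dh (L p)) (L q, Dh (L q))
      = (L (p + fconst c * q), Dh (L (p + fconst c * q)))"
      by (simp add: L_add L_smult Op_add Op_scaleC)
    then show "?f (L p, Dh (L p)) (L q, Dh (L q)) \<in> GG"
      using GG_base by simp
  qed
  moreover assume "z \<in> GG" "w \<in> GG"
  ultimately have "GG \<subseteq> {z. ?f z w \<in> GG}"
    by (intro GG_minimal[OF c2]) blast
  then show ?thesis using \<open>z \<in> GG\<close> by blast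
qed

lemma GG_sym: "z \<in> GG \<Longrightarrow> w \<in> GG \<Longrightarrow> cinner (fst z) (snd w) = cinner (snd z) (fst w)"
proof -
  let ?P = "\<lambda>z w :: 'h \<times> 'h. cinner (fst z) (snd w) = cinner (snd z) (fst w)"
  have "GG \<subseteq> {w. ?P (L p, Dh (L p)) w}" for p
    by (rule GG_minimal) (auto intro!: closed_Collect_eq continuous_intros simp: Op_sym)
  moreover assume "z \<in> GG" "w \<in> GG"
  ultimately have "GG \<subseteq> {z. ?P z w}"
    by (intro GG_minimal) (auto intro!: closed_Collect_eq continuous_intros)
  then show ?thesis using \<open>z \<in> GG\<close> by blast
qed

text \<open>A densely defined symmetric operator is closable: a limit value at 0 is orthogonal to
  the dense domain.\<close>

lemma GG_fun: assumes "(x, y) \<in> GG" "(x, y') \<in> GG" shows "y = y'"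
proof -
  have "(0, y - y') \<in> GG" using GG_lin[OF assms, of "-1"] by (simp add: scaleC_minus_left)
  then have "cinner (L p) (y - y') = 0" for p
    using GG_sym[OF GG_base, of "(0, y - y')" p] by simp
  then have "inner (y - y') (L p) = 0" for p by (metis Re_cinner inner_commute zero_complex.simps(1))
  from HH0_orth[OF this] show ?thesis by simp
qed

definition MD :: "'h set" where "MD = fst ` GG"
definition DD0 :: "'h \<Rightarrow> 'h" where "DD0 x = (SOME y. (x, y) \<in> GG)"

lemma GG_iff: "(x, y) \<in> GG \<longleftrightarrow> x \<in> MD \<and> y = DD0 x"
proof
  assume "(x, y) \<in> GG"
  moreover from this have "(x, DD0 x) \<in> GG" unfolding DD0_def by (rule someI)
  ultimately show "x \<in> MD \<and> y = DD0 x" using GG_fun by (force simp: MD_def)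
next
  assume "x \<in> MD \<and> y = DD0 x"
  then obtain y' where "(x, y') \<in> GG" "y = DD0 x" by (auto simp: MD_def)
  then show "(x, y) \<in> GG" unfolding DD0_def by (metis someI)
qed

lemma L_MD: "L p \<in> MD" "DD0 (L p) = Dh (L p)"
  using GG_base[of p] by (simp_all add: GG_iff)

text \<open>For self-adjointness, the part of a point of the adjoint graph that is orthogonal to the
  graph is shown to be orthogonal to all eigenvectors, whose span is dense.\<close>

lemma pos_selfadjoint_DD0: "pos_selfadjoint MD DD0"
  unfolding pos_selfadjoint_def
proof (intro conjI)
  have lin: "x + c *\<^sub>C y \<in> MD \<and> DD0 (x + c *\<^sub>C y) = DD0 x + c *\<^sub>C DD0 y" if xy: "x \<in> MD" "y \<in> MD" for x y c
  proof -
    have "(x, DD0 x) \<in> GG" "(y, DD0 y) \<in> GG" using xy by (simp_all add: GG_iff)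
    from GG_lin[OF this, of c] show ?thesis by (auto simp: GG_iff)
  qed
  have "0 \<in> MD" using L_MD(1)[of 0] by simp
  then have "csub MD"
    unfolding csub_def using lin[of _ _ 1] lin[of 0 _] by auto
  then show "cspan MD = MD" by (rule cspan_csub_eq)
  have "HH0 \<subseteq> MD" using L_MD(1) by (auto simp: HH0_def)
  then show "closure MD = UNIV" using HH0_dense closure_mono by blast
  show "\<forall>x\<in>MD. \<forall>y\<in>MD. \<forall>c. DD0 (x + c *\<^sub>C y) = DD0 x + c *\<^sub>C DD0 y" using lin by blast
  have "GG \<subseteq> {z. cinner (fst z) (snd z) \<in> \<real>\<^sub>\<ge>\<^sub>0}"
  proof (rule GG_minimal)
    show "closed {z :: 'h \<times> 'h. cinner (fst z) (snd z) \<in> \<real>\<^sub>\<ge>\<^sub>0}"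
    proof -
      have "isCont (\<lambda>z :: 'h \<times> 'h. cinner (fst z) (snd z)) x" for x
        using continuous_cinner continuous_on_eq_continuous_at[OF open_UNIV] by blast
      from continuous_closed_vimage[OF closed_nonneg_Reals_complex this] show ?thesis by (simp only: vimage_def)
    qed
    fix p
    \<comment> \<open>Positivity is witnessed by the fourth root: the quadratic form of
      \<sigma>^(1/2) at p is the squared norm of \<sigma>^(1/4) p.\<close>
    let ?w = "Op (\<lambda>\<mu> \<nu>. sqrt (sqrt \<mu>)) (L p)"
    obtain q where q: "L q = ?w" using Op_in by blast
    have "cinner (L p) (Dh (L p)) = cinner (L p) (Op (\<lambda>\<mu> \<nu>. sqrt (sqrt \<mu>)) ?w)"
      unfolding Op_Op by (intro arg_cong[of _ _ "cinner _"] Op_eqI) simp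
    also have "\<dots> = cinner ?w ?w" using Op_sym[of p _ q] by (simp add: q)
    finally show "(L p, Dh (L p)) \<in> {z. cinner (fst z) (snd z) \<in> \<real>\<^sub>\<ge>\<^sub>0}"
      by (simp add: cinner_self)
  qed
  then show "\<forall>x\<in>MD. cinner x (DD0 x) \<in> \<real>\<^sub>\<ge>\<^sub>0" using GG_iff by force
  show "{(y, z). \<forall>x\<in>MD. cinner y (DD0 x) = cinner z x} = {(x, DD0 x) |x. x \<in> MD}" (is "?A = ?B")
  proof
    have B: "?B = GG" using GG_iff by auto
    have sym: "cinner y (DD0 x) = cinner z x" if "(y, z) \<in> GG" "x \<in> MD" for x y z
      using GG_sym[OF that(1), of "(x, DD0 x)"] that(2) by (simp add: GG_iff)
    then show "?B \<subseteq> ?A" unfolding B by auto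
    show "?A \<subseteq> ?B" unfolding B
    proof
      fix yz assume "yz \<in> ?A"
      then obtain y z where yz: "yz = (y, z)" "\<And>x. x \<in> MD \<Longrightarrow> cinner y (DD0 x) = cinner z x" by blast
      have sub: "subspace GG"
      proof (rule subspaceI)
        show "0 \<in> GG" using GG_base[of 0] by (simp add: Op_zero zero_prod_def)
        show "u + v \<in> GG" if "u \<in> GG" "v \<in> GG" for u v
          using GG_lin[OF that, of 1] by (simp add: plus_prod_def)
        show "r *\<^sub>R u \<in> GG" if "u \<in> GG" for r u
          using GG_lin[OF _ that, of 0 "of_real r"] \<open>0 \<in> GG\<close> by (simp add: scaleR_prod_def scaleC_of_real)
      qed
      \<comment> \<open>The graph is closed, so the point can be projected onto it in the product
        Hilbert space. The remainder is orthogonal to the graph and still belongs to the adjoint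
        graph.\<close>
      then obtain ab where ab: "ab \<in> GG" "\<And>g. g \<in> GG \<Longrightarrow> inner g (yz - ab) = 0"
        using orth_decomp[of GG yz] by (auto simp: GG_def)
      define u v where "u = y - fst ab" and "v = z - snd ab"
      have 1: "inner x u + inner (DD0 x) v = 0" if "x \<in> MD" for x
        using ab(2)[of "(x, DD0 x)"] that by (simp add: GG_iff inner_prod_def yz u_def v_def)
      have 2: "inner u (DD0 x) = inner v x" if "x \<in> MD" for x
      proof -
        have "cinner u (DD0 x) = cinner v x"
          using yz(2)[OF that] sym[of "fst ab" "snd ab" x] ab(1) that by (simp add: u_def v_def cinner_diff_left)
        then show ?thesis by (metis Re_cinner)
      qed
      \<comment> \<open>On an eigenvector the two relations combine to (1 + \<mu>) times the inner
        product with u being 0.\<close>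
      have 3: "inner u (L p) = 0 \<and> inner v (L p) = 0" for p
      proof (induction p rule: eig_induct)
        case (eig p \<mu> \<nu>)
        then have m: "0 < \<mu>" by (simp add: eig_def)
        have uv: "inner u (L p) + sqrt \<mu> * inner v (L p) = 0" "sqrt \<mu> * inner u (L p) = inner v (L p)"
          using 1[OF L_MD(1)[of p]] 2[OF L_MD(1)[of p]]
          by (simp_all add: L_MD(2) Op(2)[OF eig] inner_commute)
        have "inner u (L p) * (1 + \<mu>) = inner u (L p) + (sqrt \<mu> * sqrt \<mu>) * inner u (L p)"
          using m by (simp add: algebra_simps)
        also have "\<dots> = 0" using uv by (simp only: mult.assoc)
        finally have "inner u (L p) * (1 + \<mu>) = 0" .
        then show ?case using m \<open>sqrt \<mu> * inner u (L p) = inner v (L p)\<close> by simp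
      qed (simp_all add: L_add inner_add_right)
      then have "u = 0" "v = 0" using HH0_orth by blast+
      then have "yz = ab" by (simp add: yz u_def v_def prod_eq_iff)
      then show "yz \<in> GG" using ab by simp
    qed
  qed
qed

lemma star_graph: "{(\<Lambda> x, \<Lambda> (star S x)) |x. x \<in> carrier S} = range (\<lambda>p. (L p, L (st p)))"
  by (auto simp: carrier_S L_def pi_star)

text \<open>Applying \<open>JJ\<close> to the second component is a continuous involution, so it
  commutes with closures; it carries the graph of \<sigma>^(1/2) to that of the star.\<close>

lemma star_graph_closure:
  "closure {(\<Lambda> x, \<Lambda> (star S x)) |x. x \<in> carrier S} = {(\<xi>, JJ (DD0 \<xi>)) |\<xi>. \<xi> \<in> MD}"
proof -
  define f where "f z = (fst z, JJ (snd z))" for z :: "'h \<times> 'h"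
  have J: "continuous_on UNIV JJ" by (rule linear_continuous_on[OF antilinear_bounded(1)[OF JJ(1)]])
  have "continuous_on UNIV f"
    unfolding f_def[abs_def]
    by (rule continuous_on_Pair[OF continuous_on_fst[OF continuous_on_id]
          continuous_on_compose2[OF J continuous_on_snd[OF continuous_on_id] subset_UNIV]])
  then have "closure (f ` GG0) = f ` GG" unfolding GG_def by (rule involution_closure) (simp add: f_def JJ_JJ)
  moreover have "f ` GG0 = range (\<lambda>p. (L p, L (st p)))" by (auto simp: GG0_def f_def JJ_Op image_image)
  moreover have "f ` GG = {(\<xi>, JJ (DD0 \<xi>)) |\<xi>. \<xi> \<in> MD}" using GG_iff by (force simp: f_def)
  ultimately show ?thesis by (simp add: star_graph)
qed

text \<open>In any polar decomposition of the closed star map, antiunitarity of J forces D to square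
  to \<mu> on an eigenvector. Positivity of D leaves the root sqrt \<mu>, and this determines
  J.\<close>

lemma modular_conj_unique:
  assumes J: "antiunitary_op J" and D: "pos_selfadjoint M D"
    and cl: "closure {(\<Lambda> x, \<Lambda> (star S x)) |x. x \<in> carrier S} = {(\<xi>, J (D \<xi>)) |\<xi>. \<xi> \<in> M}"
    and p: "eig p \<mu> \<nu>"
  shows "J (L p) = (1 / sqrt \<mu>) *\<^sub>R L (st p)"
proof -
  have m: "0 < \<mu>" "L (ss p) = \<mu> *\<^sub>R L p" using p by (simp_all add: eig_def)
  have Ja: "bounded_antilinear J" "\<And>x y. cinner (J x) (J y) = cinner y x"
    using J by (simp_all add: antiunitary_op_def)
  have graph: "closure (range (\<lambda>p. (L p, L (st p)))) = {(\<xi>, J (D \<xi>)) |\<xi>. \<xi> \<in> M}"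
    using cl by (simp add: star_graph)
  have LM: "L q \<in> M" "J (D (L q)) = L (st q)" for q
  proof -
    have "(L q, L (st q)) \<in> {(\<xi>, J (D \<xi>)) |\<xi>. \<xi> \<in> M}"
      unfolding graph[symmetric] by (rule closure_subset[THEN subsetD]) auto
    then show "L q \<in> M" "J (D (L q)) = L (st q)" by auto
  qed
  have lin: "D (x + c *\<^sub>C y) = D x + c *\<^sub>C D y" if "x \<in> M" "y \<in> M" for x y c
    using D that by (simp add: pos_selfadjoint_def)
  have Msub: "csub M" using D cspan_csub[of M] by (simp add: pos_selfadjoint_def)
  have adj: "(\<forall>x\<in>M. cinner y (D x) = cinner z x) \<longleftrightarrow> y \<in> M \<and> z = D y" for y z
  proof -
    have "{(y, z). \<forall>x\<in>M. cinner y (D x) = cinner z x} = {(x, D x) |x. x \<in> M}"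
      using D by (simp add: pos_selfadjoint_def)
    then have "(y, z) \<in> {(y, z). \<forall>x\<in>M. cinner y (D x) = cinner z x} \<longleftrightarrow> (y, z) \<in> {(x, D x) |x. x \<in> M}"
      by simp
    then show ?thesis by auto
  qed
  let ?y = "L p"
  have *: "cinner (L (st p)) w = of_real \<mu> * cinner x ?y" if "(x, w) \<in> closure (range (\<lambda>p. (L p, L (st p))))" for x w
  proof -
    have "closure (range (\<lambda>p. (L p, L (st p)))) \<subseteq> {z. cinner (L (st p)) (snd z) = of_real \<mu> * cinner (fst z) ?y}"
    proof (rule closure_minimal)
      show "range (\<lambda>p. (L p, L (st p))) \<subseteq> {z. cinner (L (st p)) (snd z) = of_real \<mu> * cinner (fst z) ?y}"
        by (auto simp: L_inner_st m(2) scaleC_of_real[symmetric] cinner_scaleC_right)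
      show "closed {z. cinner (L (st p)) (snd z) = of_real \<mu> * cinner (fst z) ?y}"
        by (intro closed_Collect_eq continuous_intros)
    qed
    then show ?thesis using that by auto
  qed
  \<comment> \<open>This places \<open>D ?y\<close> in the domain of the adjoint of D, which is the
    domain of D, so that D may be applied twice.\<close>
  have Dy: "cinner (D ?y) (D x) = cinner (\<mu> *\<^sub>R ?y) x" if x: "x \<in> M" for x
  proof -
    have "cinner (D x) (D ?y) = cinner (L (st p)) (J (D x))"
      using Ja(2)[of "D ?y" "D x"] LM(2)[of p] by simp
    also have "\<dots> = of_real \<mu> * cinner x ?y" using * graph x by blast
    finally have "cinner (D ?y) (D x) = cnj (of_real \<mu> * cinner x ?y)"
      by (metis cinner_commute)
    then show ?thesis
      by (simp add: scaleC_of_real[symmetric] cinner_scaleC_left cinner_commute[of ?y x])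
  qed
  then have DM: "D ?y \<in> M" "\<mu> *\<^sub>R ?y = D (D ?y)" using adj[of "D ?y" "\<mu> *\<^sub>R ?y"] by auto
  \<comment> \<open>As for \<tau> before: this vector is an eigenvector of D with eigenvalue - sqrt
    \<mu>, which positivity excludes unless it is zero.\<close>
  define z where "z = D ?y + (- of_real (sqrt \<mu>)) *\<^sub>C ?y"
  have zM: "z \<in> M" unfolding z_def using Msub DM(1) LM(1) by (auto intro: csub_add csub_scaleC)
  have "D z = \<mu> *\<^sub>R ?y + (- of_real (sqrt \<mu>)) *\<^sub>C D ?y" unfolding z_def DM(2) by (rule lin[OF DM(1) LM(1)])
  also have "\<mu> *\<^sub>R ?y = (of_real (sqrt \<mu>) * of_real (sqrt \<mu>)) *\<^sub>C ?y"
    using m(1) by (simp add: scaleC_of_real flip: of_real_mult)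
  finally have "D z = (- of_real (sqrt \<mu>)) *\<^sub>C z"
    by (simp add: z_def scaleC_add_right scaleC_scaleC)
  then have "cinner z (D z) = of_real (- (sqrt \<mu> * (norm z)\<^sup>2))"
    by (simp add: cinner_scaleC_right cinner_self)
  moreover have "cinner z (D z) \<in> \<real>\<^sub>\<ge>\<^sub>0" using D zM by (simp add: pos_selfadjoint_def)
  ultimately have "0 \<le> - (sqrt \<mu> * (norm z)\<^sup>2)" by (simp add: nonneg_Reals_of_real_iff del: of_real_minus of_real_mult of_real_power)
  then have "z = 0" using m(1) by (auto simp: mult_le_0_iff)
  then have "D ?y = sqrt \<mu> *\<^sub>R ?y" by (simp add: z_def scaleC_minus_left scaleC_of_real)
  then have "sqrt \<mu> *\<^sub>R J ?y = L (st p)" using LM(2)[of p] antilinear_bounded(5)[OF Ja(1)] by simp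
  then have "(1 / sqrt \<mu>) *\<^sub>R (sqrt \<mu> *\<^sub>R J ?y) = (1 / sqrt \<mu>) *\<^sub>R L (st p)" by simp
  then show ?thesis using m(1) by simp
qed

lemma modular_conj_eq: "modular_conj S \<Lambda> = JJ"
  unfolding modular_conj_def
proof (rule the_equality)
  show "antiunitary_op JJ \<and> (\<exists>M D. pos_selfadjoint M D \<and>
        closure {(\<Lambda> x, \<Lambda> (star S x)) |x. x \<in> carrier S} = {(\<xi>, JJ (D \<xi>)) |\<xi>. \<xi> \<in> M})"
    using JJ_antiunitary pos_selfadjoint_DD0 star_graph_closure by blast
  fix J assume J: "antiunitary_op J \<and> (\<exists>M D. pos_selfadjoint M D \<and>
        closure {(\<Lambda> x, \<Lambda> (star S x)) |x. x \<in> carrier S} = {(\<xi>, J (D \<xi>)) |\<xi>. \<xi> \<in> M})"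
  then obtain M D where MD: "pos_selfadjoint M D"
    "closure {(\<Lambda> x, \<Lambda> (star S x)) |x. x \<in> carrier S} = {(\<xi>, J (D \<xi>)) |\<xi>. \<xi> \<in> M}" by blast
  show "J = JJ"
  proof (rule antilinear_ext[OF _ JJ(1) EE_dense])
    show "bounded_antilinear J" using J by (simp add: antiunitary_op_def)
    fix x assume "x \<in> EE"
    then obtain p \<mu> \<nu> where "x = L p" "eig p \<mu> \<nu>" by (auto simp: EE_def)
    then show "J x = JJ x" using modular_conj_unique[OF _ MD] J JJ(2) by simp
  qed
qed

section \<open>The dual conjugation and the operator U\<close>

definition TT :: "'h \<Rightarrow> 'h" where "TT = dual_conj S R \<Lambda>"

lemma HH0_dense': "closure (cspan HH0) = UNIV"
  by (simp add: cspan_csub_eq[OF csub_HH0] HH0_dense)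

lemma TT: "bounded_antilinear TT" "TT (L p) = L (st (rr p))" "cinner (TT x) (TT y) = cinner y x"
proof -
  have "\<exists>T. bounded_antilinear T \<and> (\<forall>p\<in>UNIV. T (L p) = L (st (rr p))) \<and> (\<forall>x y. cinner (T x) (T y) = cinner y x)"
  proof (rule antiisometry_extension)
    show "closure (cspan (range L)) = UNIV" using HH0_dense' by (simp add: HH0_def)
    fix p q
    have "cinner (L (st (rr p))) (L (st (rr q))) = hh (st (st (rr p)) * st (rr q))" by (rule L_inner)
    also have "\<dots> = hh (rr p * rr (st q))" by (intro hh_eq L_mult L_st_st rr_st[symmetric])
    also have "\<dots> = hh (rr (st q * p))" by (rule hh_eq[OF rr_mult[symmetric]])
    also have "\<dots> = cinner (L q) (L p)" by (simp add: hh_rr L_inner)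
    finally show "cinner (L (st (rr p))) (L (st (rr q))) = cinner (L q) (L p)" .
  qed
  then obtain T where T: "bounded_antilinear T" "\<And>p. T (L p) = L (st (rr p))" "\<And>x y. cinner (T x) (T y) = cinner y x"
    by blast
  have "TT = T"
    unfolding TT_def dual_conj_def
  proof (rule the_equality)
    show "bounded_antilinear T \<and> (\<forall>x\<in>carrier S. T (\<Lambda> x) = \<Lambda> (star S (R x)))"
      using T by (auto simp: carrier_S L_def pi_star pi_rr)
    fix T' assume T': "bounded_antilinear T' \<and> (\<forall>x\<in>carrier S. T' (\<Lambda> x) = \<Lambda> (star S (R x)))"
    show "T' = T"
    proof (rule antilinear_ext[OF _ T(1) HH0_dense'])
      fix x assume "x \<in> HH0"
      then obtain p where p: "x = L p" by (auto simp: HH0_def)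
      have "T' (L p) = L (st (rr p))" using T' by (simp add: carrier_S L_def pi_star pi_rr)
      then show "T' x = T x" by (simp add: p T(2))
    qed (use T' in blast)
  qed
  then show "bounded_antilinear TT" "TT (L p) = L (st (rr p))" "cinner (TT x) (TT y) = cinner y x"
    using T by simp_all
qed

lemma kac_U_eq: "kac_U S R \<Lambda> = JJ \<circ> TT"
  unfolding kac_U_def modular_conj_eq TT_def ..

lemma kac_U: "bounded_clinear (kac_U S R \<Lambda>)" "cinner (kac_U S R \<Lambda> x) (kac_U S R \<Lambda> y) = cinner x y"
    "kac_U S R \<Lambda> (L p) = UU (L p)"
proof -
  show *: "bounded_clinear (kac_U S R \<Lambda>)"
    using bounded_linear_compose[OF antilinear_bounded(1)[OF JJ(1)] antilinear_bounded(1)[OF TT(1)]]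
    by (simp add: bounded_clinear_def kac_U_eq o_def antilinear_bounded(2)[OF JJ(1)] antilinear_bounded(2)[OF TT(1)])
  show "cinner (kac_U S R \<Lambda> x) (kac_U S R \<Lambda> y) = cinner x y"
    by (simp add: kac_U_eq JJ(3) TT(3))
  show "kac_U S R \<Lambda> (L p) = UU (L p)"
  proof (induction p rule: eig_induct)
    case zero
    show ?case by (simp add: bcl_zero[OF *] UU_zero)
  next
    case (add p q)
    then show ?case by (simp add: L_add bcl_add[OF *] UU_add)
  next
    case (eig p \<mu> \<nu>)
    show ?case using JJ(2)[OF eig_st_eig[OF eig_rr_eig[OF eig]]]
      by (simp add: kac_U_eq TT(2) UU_eig[OF eig] L_st_st)
  qed simp
qed

end

section \<open>Operators on the Hilbert space tensor square\<close>

lemma cinner_sum_list_right: "cinner y (\<Sum>x\<leftarrow>xs. f x) = (\<Sum>x\<leftarrow>xs. cinner y (f x))"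
  by (induction xs) (simp_all add: cinner_add_right)

lemma cinner_sum_list_left: "cinner (\<Sum>x\<leftarrow>xs. f x) y = (\<Sum>x\<leftarrow>xs. cinner (f x) y)"
  by (induction xs) (simp_all add: cinner_add_left)

locale fp_tensor = fp_kac Fs \<delta> \<epsilon> \<kappa> h \<Lambda> R
  for Fs \<delta> \<epsilon> \<kappa> h and \<Lambda> :: "fp_elem \<Rightarrow> 'h::complex_hilbert_space" and R +
  fixes t :: "'h \<Rightarrow> 'h \<Rightarrow> 't::complex_hilbert_space"
  assumes tensor: "hilbert_tensor t"
begin

lemma t_lin: "t (x + c *\<^sub>C y) z = t x z + c *\<^sub>C t y z" "t z (x + c *\<^sub>C y) = t z x + c *\<^sub>C t z y"
  and t_inner: "cinner (t x y) (t x' y') = cinner x x' * cinner y y'"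
  using tensor unfolding hilbert_tensor_def by blast+

lemma t_add: "t (x + y) z = t x z + t y z" "t z (x + y) = t z x + t z y"
  and t_zero: "t 0 z = 0" "t z 0 = 0"
  and t_scaleC: "t (c *\<^sub>C y) z = c *\<^sub>C t y z" "t z (c *\<^sub>C y) = c *\<^sub>C t z y"
proof -
  show "t (x + y) z = t x z + t y z" "t z (x + y) = t z x + t z y"
    using t_lin(1)[of x 1 y z] t_lin(2)[of z x 1 y] by simp_all
  then have "t (0 + 0) z = t 0 z + t 0 z" "t z (0 + 0) = t z 0 + t z 0" for z
    using t_lin(1)[of 0 1 0 z] t_lin(2)[of z 0 1 0] by simp_all
  then show z: "t 0 z = 0" "t z 0 = 0" for z by simp_all
  show "t (c *\<^sub>C y) z = c *\<^sub>C t y z" "t z (c *\<^sub>C y) = c *\<^sub>C t z y"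
    using t_lin(1)[of 0 c y z] t_lin(2)[of z 0 c y] z by simp_all
qed

lemma t_sum: "t (\<Sum>i\<in>I. f i) z = (\<Sum>i\<in>I. t (f i) z)" "t z (\<Sum>i\<in>I. f i) = (\<Sum>i\<in>I. t z (f i))"
  by (induction I rule: infinite_finite_induct) (simp_all add: t_zero t_add)

lemma norm_t: "norm (t x y) = norm x * norm y"
proof -
  have "complex_of_real ((norm (t x y))\<^sup>2) = of_real ((norm x * norm y)\<^sup>2)"
    using t_inner[of x y x y] by (simp add: cinner_self power_mult_distrib)
  then have "(norm (t x y))\<^sup>2 = (norm x * norm y)\<^sup>2" by (simp only: of_real_eq_iff)
  then show ?thesis by (simp add: power2_eq_iff_nonneg)
qed

lemma t_bcl: "bounded_clinear (\<lambda>x. t x y)" "bounded_clinear (t x)"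
proof -
  have "t (r *\<^sub>R x) y = r *\<^sub>R t x y" "t x (r *\<^sub>R y) = r *\<^sub>R t x y" for r x y
    using t_scaleC(1)[of "of_real r" x y] t_scaleC(2)[of x "of_real r" y] by (simp_all add: scaleC_of_real)
  then have "bounded_linear (\<lambda>x. t x y)" "bounded_linear (t x)"
    by (intro bounded_linear_intro[of _ "norm y"] bounded_linear_intro[of _ "norm x"]; simp add: t_add norm_t mult.commute)+
  then show "bounded_clinear (\<lambda>x. t x y)" "bounded_clinear (t x)" by (simp_all add: bounded_clinear_def t_scaleC)
qed

lemma csub_vimage: "bounded_clinear T \<Longrightarrow> csub C \<Longrightarrow> csub {x. T x \<in> C}"
  by (simp add: csub_def bcl_add bcl_zero bcl_scaleC)

lemma closed_vimage_bcl: "bounded_clinear T \<Longrightarrow> closed C \<Longrightarrow> closed {x. T x \<in> C}"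
  using closed_vimage[of C T] bcl_cont[of T UNIV] by (simp add: vimage_def)

lemma t_in_closure:
  assumes C: "csub C" "closed C" and t: "\<And>x y. x \<in> A \<Longrightarrow> y \<in> B \<Longrightarrow> t x y \<in> C"
    and x: "x \<in> closure (cspan A)" and y: "y \<in> closure (cspan B)"
  shows "t x y \<in> C"
proof -
  have "t a y \<in> C" if "a \<in> A" for a
  proof -
    have "cspan B \<subseteq> {y. t a y \<in> C}"
      using t that by (intro cspan_minimal csub_vimage[OF t_bcl(2) C(1)]) auto
    then have "closure (cspan B) \<subseteq> {y. t a y \<in> C}"
      by (rule closure_minimal[OF _ closed_vimage_bcl[OF t_bcl(2) C(2)]])
    then show ?thesis using y by blast
  qed
  then have "cspan A \<subseteq> {x. t x y \<in> C}"
    by (intro cspan_minimal csub_vimage[OF t_bcl(1) C(1)]) auto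
  then have "closure (cspan A) \<subseteq> {x. t x y \<in> C}"
    by (rule closure_minimal[OF _ closed_vimage_bcl[OF t_bcl(1) C(2)]])
  then show ?thesis using x by blast
qed

definition tL :: "entry_alg \<times> entry_alg \<Rightarrow> 't" where "tL = (\<lambda>(p, q). t (L p) (L q))"

lemma tL_dense: "closure (cspan (range tL)) = UNIV"
proof -
  have "t x y \<in> closure (cspan (range tL))" for x y
  proof (rule t_in_closure[OF csub_closure[OF cspan_csub] closed_closure])
    show "t a b \<in> closure (cspan (range tL))" if ab: "a \<in> HH0" "b \<in> HH0" for a b
    proof -
      obtain p q where "a = L p" "b = L q" using ab by (auto simp: HH0_def)
      then have "t a b = tL (p, q)" by (simp add: tL_def)
      then show ?thesis by (metis cspan_base closure_subset rangeI subsetD)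
    qed
  qed (simp_all add: HH0_dense')
  then have "cspan {t x y |x y. True} \<subseteq> closure (cspan (range tL))"
    by (intro cspan_minimal[OF csub_closure[OF cspan_csub]]) auto
  then have "closure (cspan {t x y |x y. True}) \<subseteq> closure (cspan (range tL))"
    by (rule closure_minimal[OF _ closed_closure])
  then show ?thesis using tensor unfolding hilbert_tensor_def by blast
qed

lemma bcl_ext_tL:
  assumes "bounded_clinear S1" "bounded_clinear S2" "\<And>p q. S1 (t (L p) (L q)) = S2 (t (L p) (L q))"
  shows "S1 = S2"
  by (rule bcl_ext[OF assms(1,2) tL_dense]) (auto simp: tL_def assms(3))

lemma bcl_ext_L:
  assumes "bounded_clinear S1" "bounded_clinear S2" "\<And>p. S1 (L p) = S2 (L p)"
  shows "S1 = S2"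
  by (rule bcl_ext[OF assms(1,2) HH0_dense']) (auto simp: HH0_def assms(3))

text \<open>\<open>tensor_op\<close> is a definite description over all vectors. Density in one
  variable at a time shows that an extension known on the algebraic tensors meets it.\<close>

lemma tensor_op_eqI:
  assumes T: "bounded_clinear T" and A: "bounded_clinear A" "bounded_clinear B"
    and eq: "\<And>p q. T (t (L p) (L q)) = t (A (L p)) (B (L q))"
  shows "tensor_op t A B = T" "T (t x y) = t (A x) (B y)"
proof -
  have 1: "(\<lambda>y. T (t (L p) y)) = (\<lambda>y. t (A (L p)) (B y))" for p
    using eq by (intro bcl_ext_L bcl_comp[OF T] bcl_comp[OF t_bcl(2)] t_bcl A)
  have 2: "(\<lambda>x. T (t x y)) = (\<lambda>x. t (A x) (B y))" for y
    using fun_cong[OF 1] by (intro bcl_ext_L bcl_comp[OF T] bcl_comp[OF t_bcl(1)] t_bcl A)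
  show 3: "T (t x y) = t (A x) (B y)" for x y using fun_cong[OF 2] .
  show "tensor_op t A B = T"
    unfolding tensor_op_def
  proof (rule the_equality)
    fix T' assume T': "bounded_clinear T' \<and> (\<forall>x y. T' (t x y) = t (A x) (B y))"
    then show "T' = T" by (intro bcl_ext_tL T) (simp_all add: 3)
  qed (use T 3 in blast)
qed

lemma isometric_tensor_op:
  assumes A: "bounded_clinear A" "bounded_clinear B"
    and iso: "\<And>x y. cinner (A x) (A y) = cinner x y" "\<And>x y. cinner (B x) (B y) = cinner x y"
  shows "bounded_clinear (tensor_op t A B)" "tensor_op t A B (t x y) = t (A x) (B y)"
    "cinner (tensor_op t A B u) (tensor_op t A B v) = cinner u v"
proof -
  obtain T where T: "bounded_clinear T" "\<And>p q. T (t (L p) (L q)) = t (A (L p)) (B (L q))"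
    "\<And>x y. cinner (T x) (T y) = cinner x y"
    using isometry_extension[OF tL_dense, of "\<lambda>(p, q). t (A (L p)) (B (L q))"]
    by (auto simp: tL_def t_inner iso)
  show "bounded_clinear (tensor_op t A B)" "tensor_op t A B (t x y) = t (A x) (B y)"
    "cinner (tensor_op t A B u) (tensor_op t A B v) = cinner u v"
    using T(1,3) tensor_op_eqI[OF T(1) A T(2)] by simp_all
qed

lemma flip_op: "bounded_clinear (flip_op t)" "flip_op t (t x y) = t y x"
    "cinner (flip_op t u) (flip_op t v) = cinner u v"
proof -
  obtain T where T: "bounded_clinear T" "\<And>p q. T (t (L p) (L q)) = t (L q) (L p)"
    "\<And>x y. cinner (T x) (T y) = cinner x y"
    using isometry_extension[OF tL_dense, of "\<lambda>(p, q). t (L q) (L p)"]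
    by (auto simp: tL_def t_inner mult.commute)
  have 1: "(\<lambda>y. T (t (L p) y)) = (\<lambda>y. t y (L p))" for p
    using T(2) by (intro bcl_ext_L bcl_comp[OF T(1)] t_bcl)
  have 2: "(\<lambda>x. T (t x y)) = (\<lambda>x. t y x)" for y
    using fun_cong[OF 1] by (intro bcl_ext_L bcl_comp[OF T(1)] t_bcl)
  note 3 = fun_cong[OF 2]
  have "flip_op t = T"
    unfolding flip_op_def
  proof (rule the_equality)
    fix T' assume T': "bounded_clinear T' \<and> (\<forall>x y. T' (t x y) = t y x)"
    then show "T' = T" by (intro bcl_ext_tL T) (simp_all add: 3)
  qed (use T 3 in blast)
  then show "bounded_clinear (flip_op t)" "flip_op t (t x y) = t y x"
    "cinner (flip_op t u) (flip_op t v) = cinner u v" using T 3 by simp_all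
qed

subsection \<open>The action of the algebra\<close>

text \<open>Boundedness of left multiplication on H and of its amplification to the tensor square.
  The second clause supplies the operator that \<open>tensor_op\<close> describes, and this
  multiplication need not be isometric.\<close>

definition acts :: "entry_alg \<Rightarrow> bool" where
  "acts p \<longleftrightarrow> (\<exists>T. bounded_clinear T \<and> (\<forall>q. T (L q) = L (p * q))) \<and>
     (\<exists>T. bounded_clinear T \<and> (\<forall>q r. T (t (L q) (L r)) = t (L (p * q)) (L r)))"

lemma acts_add: "acts p \<Longrightarrow> acts q \<Longrightarrow> acts (p + q)"
proof -
  assume "acts p" "acts q"
  then obtain A A' B B' where
    "bounded_clinear A" "\<forall>q. A (L q) = L (p * q)" "bounded_clinear A'" "\<forall>q r. A' (t (L q) (L r)) = t (L (p * q)) (L r)"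
    "bounded_clinear B" "\<forall>r. B (L r) = L (q * r)" "bounded_clinear B'" "\<forall>r s. B' (t (L r) (L s)) = t (L (q * r)) (L s)"
    unfolding acts_def by (elim conjE exE)
  then show ?thesis
    unfolding acts_def
    by (intro conjI exI[of _ "\<lambda>x. A x + B x"] exI[of _ "\<lambda>x. A' x + B' x"] bcl_plus)
      (simp_all add: distrib_right L_add t_add)
qed

lemma acts_smult: "acts p \<Longrightarrow> acts (fconst c * p)"
proof -
  assume "acts p"
  then obtain A A' where
    "bounded_clinear A" "\<forall>q. A (L q) = L (p * q)" "bounded_clinear A'" "\<forall>q r. A' (t (L q) (L r)) = t (L (p * q)) (L r)"
    unfolding acts_def by (elim conjE exE)
  then show ?thesis
    unfolding acts_def
    by (intro conjI exI[of _ "\<lambda>x. c *\<^sub>C A x"] exI[of _ "\<lambda>x. c *\<^sub>C A' x"] bcl_scale)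
      (simp_all add: mult.assoc L_smult t_scaleC)
qed

lemma acts_mult: "acts p \<Longrightarrow> acts q \<Longrightarrow> acts (p * q)"
proof -
  assume "acts p" "acts q"
  then obtain A A' B B' where
    "bounded_clinear A" "\<forall>q. A (L q) = L (p * q)" "bounded_clinear A'" "\<forall>q r. A' (t (L q) (L r)) = t (L (p * q)) (L r)"
    "bounded_clinear B" "\<forall>r. B (L r) = L (q * r)" "bounded_clinear B'" "\<forall>r s. B' (t (L r) (L s)) = t (L (q * r)) (L s)"
    unfolding acts_def by (elim conjE exE)
  then show ?thesis
    unfolding acts_def
    by (intro conjI exI[of _ "\<lambda>x. A (B x)"] exI[of _ "\<lambda>x. A' (B' x)"])
      (simp_all add: mult.assoc bcl_comp)
qed

lemma acts_cong: "acts p \<Longrightarrow> L p = L q \<Longrightarrow> acts q"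
  unfolding acts_def using L_mult[of p q] by metis

text \<open>The entries in a column of a unitary matrix are contractions.\<close>

lemma acts_lt: assumes g: "ok \<gamma>" "i < nn \<gamma>" "j < nn \<gamma>" shows "acts (lt \<gamma> i j)"
proof -
  have 1: "(\<Sum>k<nn \<gamma>. cinner (L (lt \<gamma> k j * q)) (L (lt \<gamma> k j * q'))) = cinner (L q) (L q')" for q q'
    using unitary_hh2[OF g(1,3,3), of "st q" q'] by (simp add: L_inner st_mult mult.assoc)
  have "\<exists>T. bounded_clinear T \<and> (\<forall>q\<in>UNIV. T (L q) = L (lt \<gamma> i j * q))"
    using column_extension[of L UNIV "{..<nn \<gamma>}" "\<lambda>k q. L (lt \<gamma> k j * q)" i] HH0_dense' g 1 by (simp add: HH0_def)
  moreover have "\<exists>T. bounded_clinear T \<and> (\<forall>z\<in>UNIV. T (tL z) = (\<lambda>(q, r). t (L (lt \<gamma> i j * q)) (L r)) z)"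
    by (rule column_extension[OF tL_dense, of "{..<nn \<gamma>}" "\<lambda>k (q, r). t (L (lt \<gamma> k j * q)) (L r)" i])
      (auto simp: tL_def t_inner sum_distrib_right[symmetric] 1 g)
  ultimately show ?thesis unfolding acts_def by (auto simp: tL_def)
qed

lemma acts_all: "acts p"
proof (induction p rule: pi_induct)
  case (word gs "is" js)
  then show ?case
  proof (induction gs arbitrary: "is" js)
    case Nil
    then show ?case unfolding acts_def by (auto intro: exI[of _ "\<lambda>x. x"] bcl_id)
  next
    case (Cons g gs)
    then show ?case by (auto intro!: acts_mult acts_lt)
  qed
next
  case (cong p q)
  show ?case by (rule acts_cong[OF cong(1) L_cong[OF cong(2)]])
qed (erule acts_add acts_smult, assumption?)+

definition lam :: "entry_alg \<Rightarrow> 'h \<Rightarrow> 'h" where "lam p = gns_rep S \<Lambda> (pi p)"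
definition act :: "entry_alg \<Rightarrow> 't \<Rightarrow> 't" where "act p = edge_action Fs \<Lambda> t (pi p)"

lemma lam: "bounded_clinear (lam p)" "lam p (L q) = L (p * q)"
proof -
  obtain T where T: "bounded_clinear T" "\<And>q. T (L q) = L (p * q)" using acts_all[of p] unfolding acts_def by blast
  have "lam p = T"
    unfolding lam_def gns_rep_def
  proof (rule the_equality)
    show "bounded_clinear T \<and> (\<forall>y\<in>carrier S. T (\<Lambda> y) = \<Lambda> (pi p \<otimes>\<^bsub>S\<^esub> y))"
      using T by (auto simp: carrier_S L_def pi_mult)
    fix T' assume T': "bounded_clinear T' \<and> (\<forall>y\<in>carrier S. T' (\<Lambda> y) = \<Lambda> (pi p \<otimes>\<^bsub>S\<^esub> y))"
    then have "T' (L q) = L (p * q)" for q by (simp add: carrier_S L_def pi_mult)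
    then show "T' = T" using T' T by (intro bcl_ext_L) simp_all
  qed
  then show "bounded_clinear (lam p)" "lam p (L q) = L (p * q)" using T by simp_all
qed

lemma act: "bounded_clinear (act p)" "act p (t x y) = t (lam p x) y"
proof -
  obtain T where T: "bounded_clinear T" "\<And>q r. T (t (L q) (L r)) = t (L (p * q)) (L r)"
    using acts_all[of p] unfolding acts_def by blast
  have "act p = tensor_op t (lam p) id" by (simp add: act_def edge_action_def lam_def)
  moreover have "tensor_op t (lam p) id = T" "T (t x y) = t (lam p x) (id y)" for x y
    using tensor_op_eqI[OF T(1) lam(1)[of p], of id] T(2) lam(2) bcl_id by (simp_all add: id_def)
  ultimately show "bounded_clinear (act p)" "act p (t x y) = t (lam p x) y" using T(1) by simp_all
qed

subsection \<open>The multiplicative unitary\<close>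

text \<open>The first legs combine into the coproduct of \<open>st p * p'\<close>, and left
  invariance replaces them by a Haar value.\<close>

lemma SW_inner:
  assumes ps: "SW p ps" "SW p' ps'"
  shows "cinner (\<Sum>(a, b)\<leftarrow>ps. t (L a) (L (b * q))) (\<Sum>(a, b)\<leftarrow>ps'. t (L a) (L (b * q')))
    = cinner (t (L p) (L q)) (t (L p') (L q'))"
proof -
  have "cinner (\<Sum>(a, b)\<leftarrow>ps. t (L a) (L (b * q))) (\<Sum>(a, b)\<leftarrow>ps'. t (L a) (L (b * q')))
    = (\<Sum>(a, b)\<leftarrow>ps. \<Sum>(a', b')\<leftarrow>ps'. hh (st a * a') * hh (st q * (st b * b' * q')))"
    by (simp only: case_prod_unfold cinner_sum_list_left)
      (simp only: cinner_sum_list_right t_inner L_inner st_mult mult.assoc)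
  also have "\<dots> = (\<Sum>(a, b)\<leftarrow>map (\<lambda>(a, b). (st a, st b)) ps. \<Sum>(a', b')\<leftarrow>ps'. hh (a * a') * hh (st q * (b * b' * q')))"
    by (simp add: o_def case_prod_unfold)
  also have "\<dots> = (\<Sum>(a, b)\<leftarrow>pmul (map (\<lambda>(a, b). (st a, st b)) ps) ps'. hh a * hh (st q * (b * q')))"
  proof -
    have "(\<Sum>(a, b)\<leftarrow>pmul xs ys. F a b) = (\<Sum>(a, b)\<leftarrow>xs. \<Sum>(a', b')\<leftarrow>ys. F (a * a') (b * b'))"
      for F :: "entry_alg \<Rightarrow> entry_alg \<Rightarrow> complex" and xs ys
      by (induction xs) (simp_all add: pmul_def o_def case_prod_unfold)
    then show ?thesis by (simp only: mult.assoc)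
  qed
  also have "\<dots> = hh (st q * ((\<Sum>(a, b)\<leftarrow>pmul (map (\<lambda>(a, b). (st a, st b)) ps) ps'. fconst (hh a) * b) * q'))"
  proof -
    have "hh (st q * ((\<Sum>(a, b)\<leftarrow>qs. fconst (hh a) * b) * q')) = (\<Sum>(a, b)\<leftarrow>qs. hh a * hh (st q * (b * q')))" for qs
      by (induction qs) (auto simp: distrib_left distrib_right hh_add mult.assoc hh_smult_right)
    then show ?thesis ..
  qed
  also have "\<dots> = hh (st q * (fconst (hh (st p * p')) * q'))"
    using haar_left[OF SW_mult[OF SW_st[OF ps(1)] ps(2)]]
    by (intro hh_cong pi_mult_cong_right pi_mult_cong_left)
  also have "\<dots> = cinner (t (L p) (L q)) (t (L p') (L q'))"
    by (simp add: hh_smult_right t_inner L_inner)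
  finally show ?thesis .
qed

text \<open>\<open>SW_inner\<close> gives an isometry that does not depend on the decompositions
  used. Its range contains the elementary tensors, because the antipode provides explicit preimages,
  and is therefore everything.\<close>

lemma mult_unitary: "unitary_op (mult_unitary S \<delta> \<Lambda> t)"
  "SW p ps \<Longrightarrow> mult_unitary S \<delta> \<Lambda> t (t (L p) (L q)) = (\<Sum>(a, b)\<leftarrow>ps. t (L a) (L (b * q)))"
proof -
  \<comment> \<open>The decomposition is part of the index, so the prescribed values cover all
    decompositions of the same element at once.\<close>
  let ?I = "{(p, ps, q :: entry_alg). SW p ps}"
  have "\<exists>T. bounded_clinear T \<and> (\<forall>i\<in>?I. T ((\<lambda>(p, ps, q). t (L p) (L q)) i)
      = (\<lambda>(p, ps, q). \<Sum>(a, b)\<leftarrow>ps. t (L a) (L (b * q))) i) \<and> (\<forall>x y. cinner (T x) (T y) = cinner x y)"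
  proof (rule isometry_extension)
    have "(\<lambda>(p, ps, q). t (L p) (L q)) ` ?I = range tL"
    proof (intro equalityI subsetI)
      fix x assume "x \<in> range tL"
      then obtain p q where x: "x = t (L p) (L q)" by (auto simp: tL_def)
      obtain ps where "SW p ps" using SW_exists by blast
      then show "x \<in> (\<lambda>(p, ps, q). t (L p) (L q)) ` ?I" using x by (intro image_eqI[of _ _ "(p, ps, q)"]) auto
    qed (auto simp: tL_def)
    then show "closure (cspan ((\<lambda>(p, ps, q). t (L p) (L q)) ` ?I)) = UNIV" using tL_dense by simp
    fix i j assume "i \<in> ?I" "j \<in> ?I"
    then obtain p ps q p' ps' q' where ij: "i = (p, ps, q)" "j = (p', ps', q')" "SW p ps" "SW p' ps'" by blast
    then show "cinner ((\<lambda>(p, ps, q). \<Sum>(a, b)\<leftarrow>ps. t (L a) (L (b * q))) i) ((\<lambda>(p, ps, q). \<Sum>(a, b)\<leftarrow>ps. t (L a) (L (b * q))) j)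
      = cinner ((\<lambda>(p, ps, q). t (L p) (L q)) i) ((\<lambda>(p, ps, q). t (L p) (L q)) j)"
      using SW_inner[OF ij(3,4)] by (simp only: ij(1,2) prod.case)
  qed
  then obtain V where V: "bounded_clinear V"
    "\<And>p ps q. SW p ps \<Longrightarrow> V (t (L p) (L q)) = (\<Sum>(a, b)\<leftarrow>ps. t (L a) (L (b * q)))"
    "\<And>x y. cinner (V x) (V y) = cinner x y" by auto
  have "csub (range V)"
    unfolding csub_def using bcl_zero[OF V(1)] by (auto simp: bcl_add[OF V(1), symmetric] bcl_scaleC[OF V(1), symmetric] intro: rev_image_eqI)
  have "t (L p) (L q) \<in> range V" for p q
  proof (induction p rule: pi_induct)
    case (cong p p')
    then show ?case using L_cong by metis
  next
    case (add p p')
    then show ?case using csub_add[OF \<open>csub (range V)\<close>] by (simp add: L_add t_add)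
  next
    case (scale c p)
    then show ?case using csub_scaleC[OF \<open>csub (range V)\<close>] by (simp add: L_smult t_scaleC)
  next
    case (word gs "is" js)
    let ?I = "set (Ix gs)"
    have u: "ucorep (Ix gs) (wd gs)" by (rule ucorep_wd[OF word(1)])
    \<comment> \<open>The preimage applies the antipode to the second leg of the coproduct:
      \<open>st (wd gs js k)\<close> represents the antipode of \<open>wd gs k js\<close>.\<close>
    have "V (\<Sum>k\<in>?I. t (L (wd gs is k)) (L (st (wd gs js k) * q)))
        = (\<Sum>k\<in>?I. \<Sum>l\<in>?I. t (L (wd gs is l)) (L (wd gs l k * (st (wd gs js k) * q))))"
    proof -
      have "V (t (L (wd gs is k)) (L (st (wd gs js k) * q)))
         = (\<Sum>l\<in>?I. t (L (wd gs is l)) (L (wd gs l k * (st (wd gs js k) * q))))" if "k \<in> ?I" for k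
        unfolding V(2)[OF ucorepD(2)[OF u word(2) that]] SW_sum_I[OF u word(2) that] ..
      then show ?thesis by (simp add: bcl_sum[OF V(1)])
    qed
    also have "\<dots> = (\<Sum>l\<in>?I. t (L (wd gs is l)) (L ((\<Sum>k\<in>?I. wd gs l k * st (wd gs js k)) * q)))"
      by (subst sum.swap) (simp add: sum_distrib_right L_sum t_sum mult.assoc)
    also have "\<dots> = (\<Sum>l\<in>?I. t (L (wd gs is l)) (L ((if l = js then 1 else 0) * q)))"
      using ucorepD(3)[OF u _ word(3)]
      by (intro sum.cong refl arg_cong[of _ _ "t _"] L_cong pi_mult_cong_left)
    also have "\<dots> = (\<Sum>l\<in>?I. if l = js then t (L (wd gs is l)) (L q) else 0)"
      by (intro sum.cong refl) (simp add: t_zero)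
    also have "\<dots> = t (L (wd gs is js)) (L q)" using word(3) by simp
    finally show ?case by (rule range_eqI[OF sym])
  qed
  then have "cspan (range tL) \<subseteq> range V"
    by (intro cspan_minimal \<open>csub (range V)\<close>) (auto simp: tL_def)
  then have "closure (range V) = UNIV" using tL_dense closure_mono by blast
  then have "surj V" by (intro isometry_surj V)
  then have uV: "unitary_op V" using V unfolding unitary_op_def by blast
  have "mult_unitary S \<delta> \<Lambda> t = V"
    unfolding mult_unitary_def
  proof (rule the_equality)
    have "V (t (\<Lambda> x) (\<Lambda> y)) = (\<Sum>(a, b)\<leftarrow>qs. t (\<Lambda> a) (\<Lambda> (b \<otimes>\<^bsub>S\<^esub> y)))"
      if sw: "sweedler S \<delta> x qs" and y: "y \<in> carrier S" for x qs y
    proof -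
      define f where "f a = (SOME p. pi p = a)" for a
      have f: "pi (f a) = a" if "a \<in> carrier S" for a
      proof -
        obtain p where "a = pi p" using \<open>a \<in> carrier S\<close> by (rule pi_surj)
        then show ?thesis unfolding f_def by (intro someI[of "\<lambda>p. pi p = a"]) (rule sym)
      qed
      have x: "x \<in> carrier S" and qs: "set qs \<subseteq> carrier S \<times> carrier S" using sw by (auto simp: sweedler_def)
      define ps where "ps = map (\<lambda>(a, b). (f a, f b)) qs"
      have qs': "map (\<lambda>(a, b). (pi a, pi b)) ps = qs"
        unfolding ps_def map_map using qs f by (intro map_idI) auto
      then have "SW (f x) ps" using sw x by (simp add: SW_def f)
      then have "V (t (L (f x)) (L (f y))) = (\<Sum>(a, b)\<leftarrow>ps. t (L a) (L (b * f y)))" by (rule V(2))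
      also have "\<dots> = (\<Sum>(a, b)\<leftarrow>map (\<lambda>(a, b). (pi a, pi b)) ps. t (\<Lambda> a) (\<Lambda> (b \<otimes>\<^bsub>S\<^esub> y)))"
        using f[OF y] by (simp add: L_def pi_mult o_def case_prod_unfold)
      finally show ?thesis unfolding qs' using f[OF x] f[OF y] by (simp add: L_def)
    qed
    then show "unitary_op V \<and> (\<forall>x ps. sweedler S \<delta> x ps \<longrightarrow> (\<forall>y\<in>carrier S.
        V (t (\<Lambda> x) (\<Lambda> y)) = (\<Sum>(a, b)\<leftarrow>ps. t (\<Lambda> a) (\<Lambda> (b \<otimes>\<^bsub>S\<^esub> y)))))" using uV by blast
    fix V' assume V': "unitary_op V' \<and> (\<forall>x ps. sweedler S \<delta> x ps \<longrightarrow> (\<forall>y\<in>carrier S.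
        V' (t (\<Lambda> x) (\<Lambda> y)) = (\<Sum>(a, b)\<leftarrow>ps. t (\<Lambda> a) (\<Lambda> (b \<otimes>\<^bsub>S\<^esub> y)))))"
    show "V' = V"
    proof (rule bcl_ext_tL[OF _ V(1)])
      show "bounded_clinear V'" using V' by (simp add: unitary_op_def)
      fix p q
      obtain ps where ps: "SW p ps" using SW_exists by blast
      then have "V' (t (\<Lambda> (pi p)) (\<Lambda> (pi q)))
          = (\<Sum>(a, b)\<leftarrow>map (\<lambda>(a, b). (pi a, pi b)) ps. t (\<Lambda> a) (\<Lambda> (b \<otimes>\<^bsub>S\<^esub> pi q)))"
        using V' pi_closed unfolding SW_def by blast
      then have "V' (t (L p) (L q)) = (\<Sum>(a, b)\<leftarrow>ps. t (L a) (L (b * q)))"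
        by (simp add: L_def pi_mult o_def case_prod_unfold)
      then show "V' (t (L p) (L q)) = V (t (L p) (L q))" using V(2)[OF ps] by simp
    qed
  qed
  then show "unitary_op (mult_unitary S \<delta> \<Lambda> t)"
    "SW p ps \<Longrightarrow> mult_unitary S \<delta> \<Lambda> t (t (L p) (L q)) = (\<Sum>(a, b)\<leftarrow>ps. t (L a) (L (b * q)))"
    using uV V(2) by simp_all
qed

subsection \<open>The reversing operator\<close>

definition Th :: "'t \<Rightarrow> 't" where "Th = reversing_op Fs \<delta> R \<Lambda> t"

abbreviation "KU \<equiv> kac_U S R \<Lambda>"
abbreviation "VV \<equiv> mult_unitary S \<delta> \<Lambda> t"

lemma Th_eq: "Th = (\<lambda>z. flip_op t (tensor_op t id KU (VV (tensor_op t KU KU (flip_op t z)))))"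
  by (simp add: Th_def reversing_op_def Let_def o_def)

lemma UV_ops: "bounded_clinear (tensor_op t id KU)" "tensor_op t id KU (t x y) = t x (KU y)"
    "cinner (tensor_op t id KU u) (tensor_op t id KU v) = cinner u v"
    "bounded_clinear (tensor_op t KU KU)" "tensor_op t KU KU (t x y) = t (KU x) (KU y)"
    "cinner (tensor_op t KU KU u) (tensor_op t KU KU v) = cinner u v"
    "bounded_clinear VV" "cinner (VV u) (VV v) = cinner u v"
  using isometric_tensor_op[of id KU] isometric_tensor_op[OF kac_U(1) kac_U(1) kac_U(2) kac_U(2)]
    kac_U bcl_id mult_unitary(1) by (simp_all add: id_def unitary_op_def)

lemma Th_bcl: "bounded_clinear Th"
  unfolding Th_eq by (intro bcl_comp[OF flip_op(1)] bcl_comp[OF UV_ops(1)] bcl_comp[OF UV_ops(7)] bcl_comp[OF UV_ops(4)] flip_op(1))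

lemma Th_iso: "cinner (Th u) (Th v) = cinner u v"
  by (simp add: Th_eq flip_op UV_ops)

text \<open>The first use of \<open>U\<close> spreads the entry over adjoint entries with unknown
  coefficients \<phi>. After \<open>VV\<close>, the last use of \<open>U\<close> meets the same
  linear combination and, being an antimultiplicative involution, restores the entry
  \<open>lt \<gamma> i l\<close>.\<close>

lemma Th_lt:
  assumes g: "ok \<gamma>" "i < nn \<gamma>" "j < nn \<gamma>"
  shows "Th (t (L p) (L (lt \<gamma> i j))) = (\<Sum>l<nn \<gamma>. t (L (p * lt \<gamma> i l)) (L (st (lt \<gamma> j l))))"
proof -
  let ?n = "nn \<gamma>"
  obtain \<phi> where phi: "\<And>i j. i < ?n \<Longrightarrow> j < ?n \<Longrightarrow> UU (L (lt \<gamma> i j)) = (\<Sum>k<?n. \<phi> i k *\<^sub>C L (st (lt \<gamma> j k)))"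
    using UU_lt[OF g(1)] by blast
  have V: "VV (t (L (st (lt \<gamma> j k))) (L q)) = (\<Sum>l<?n. t (L (st (lt \<gamma> j l))) (L (st (lt \<gamma> l k) * q)))" if "k < ?n" for k q
    unfolding mult_unitary(2)[OF SW_st[OF SW_lt[OF g(1,3) that]]]
    by (simp add: o_def sum_list_distinct_conv_sum_set atLeast0LessThan)
  have U: "KU (L (st (lt \<gamma> l k) * uu p)) = L (p * uu (st (lt \<gamma> l k)))" for k l
  proof -
    have "L (uu (uu p) * uu (st (lt \<gamma> l k))) = L (p * uu (st (lt \<gamma> l k)))"
      by (rule L_mult[OF _ refl]) (simp add: L_uu UU_UU)
    then show ?thesis by (simp add: kac_U(3) UU_mult)
  qed
  have "tensor_op t KU KU (flip_op t (t (L p) (L (lt \<gamma> i j)))) = (\<Sum>k<?n. \<phi> i k *\<^sub>C t (L (st (lt \<gamma> j k))) (L (uu p)))"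
    using g by (simp add: flip_op UV_ops kac_U(3) phi L_uu t_sum t_scaleC)
  then have "Th (t (L p) (L (lt \<gamma> i j)))
      = (\<Sum>k<?n. \<phi> i k *\<^sub>C (\<Sum>l<?n. t (L (p * uu (st (lt \<gamma> l k)))) (L (st (lt \<gamma> j l)))))"
    by (simp add: Th_eq bcl_sum[OF UV_ops(7)] bcl_scaleC[OF UV_ops(7)] V bcl_sum[OF UV_ops(1)] bcl_scaleC[OF UV_ops(1)]
        bcl_sum[OF flip_op(1)] bcl_scaleC[OF flip_op(1)] UV_ops(2) U flip_op(2))
  also have "\<dots> = (\<Sum>l<?n. t (\<Sum>k<?n. \<phi> i k *\<^sub>C L (p * uu (st (lt \<gamma> l k)))) (L (st (lt \<gamma> j l))))"
    unfolding scaleC_sum_right t_sum t_scaleC by (rule sum.swap)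
  also have "\<dots> = (\<Sum>l<?n. t (L (p * lt \<gamma> i l)) (L (st (lt \<gamma> j l))))"
  proof (intro sum.cong refl arg_cong[of _ _ "\<lambda>x. t x _"])
    fix l assume l: "l \<in> {..<?n}"
    have "(\<Sum>k<?n. \<phi> i k *\<^sub>C L (p * uu (st (lt \<gamma> l k)))) = lam p (\<Sum>k<?n. \<phi> i k *\<^sub>C L (uu (st (lt \<gamma> l k))))"
      by (simp add: bcl_sum[OF lam(1)] bcl_scaleC[OF lam(1)] lam(2))
    also have "(\<Sum>k<?n. \<phi> i k *\<^sub>C L (uu (st (lt \<gamma> l k)))) = KU (\<Sum>k<?n. \<phi> i k *\<^sub>C L (st (lt \<gamma> l k)))"
      by (simp add: bcl_sum[OF kac_U(1)] bcl_scaleC[OF kac_U(1)] kac_U(3) L_uu)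
    also have "\<dots> = KU (L (uu (lt \<gamma> i l)))" using phi[of i l] g l by (simp add: L_uu)
    also have "\<dots> = L (lt \<gamma> i l)" unfolding kac_U(3) unfolding L_uu UU_UU ..
    finally show "(\<Sum>k<?n. \<phi> i k *\<^sub>C L (p * uu (st (lt \<gamma> l k)))) = L (p * lt \<gamma> i l)" by (simp add: lam(2))
  qed
  finally show ?thesis .
qed

end

section \<open>The quantum Cayley graph\<close>

lemma bcl_cspan: assumes T: "bounded_clinear T" shows "T ` cspan A = cspan (T ` A)"
proof
  have "csub {x. T x \<in> cspan (T ` A)}"
    using cspan_csub[of "T ` A"] by (simp add: csub_def bcl_add[OF T] bcl_zero[OF T] bcl_scaleC[OF T])
  then have "cspan A \<subseteq> {x. T x \<in> cspan (T ` A)}"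
    by (rule cspan_minimal) (auto intro: cspan_base)
  then show "T ` cspan A \<subseteq> cspan (T ` A)" by blast
  have "csub (T ` cspan A)"
    unfolding csub_def
  proof (intro conjI ballI allI)
    show "0 \<in> T ` cspan A" using bcl_zero[OF T] csub_0[OF cspan_csub] by (metis imageI)
    fix x y assume "x \<in> T ` cspan A" "y \<in> T ` cspan A"
    then show "x + y \<in> T ` cspan A" by (auto simp: bcl_add[OF T, symmetric] intro: csub_add[OF cspan_csub])
  next
    fix c x assume "x \<in> T ` cspan A"
    then show "c *\<^sub>C x \<in> T ` cspan A" by (auto simp: bcl_scaleC[OF T, symmetric] intro: csub_scaleC[OF cspan_csub])
  qed
  then show "cspan (T ` A) \<subseteq> T ` cspan A" by (rule cspan_minimal) (auto intro: cspan_base)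
qed

lemma bcl_sum_fun: "(\<And>i. i \<in> I \<Longrightarrow> bounded_clinear (f i)) \<Longrightarrow> bounded_clinear (\<lambda>x. \<Sum>i\<in>I. f i x)"
  by (induction I rule: infinite_finite_induct) (auto intro: bcl_0 bcl_plus)

context fp_tensor
begin

definition LT :: "entry_alg set" where "LT = {lt \<gamma> i j |\<gamma> i j. ok \<gamma> \<and> i < nn \<gamma> \<and> j < nn \<gamma>}"
definition BB :: "'h set" where "BB = L ` LT"
text \<open>Turns out to be the range of \<open>p1_op\<close>; it is kept as a span of entries
  because all computations are made on those.\<close>

definition DV :: "'h set" where "DV = cspan BB"

lemma LT_I: "ok \<gamma> \<Longrightarrow> i < nn \<gamma> \<Longrightarrow> j < nn \<gamma> \<Longrightarrow> lt \<gamma> i j \<in> LT"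
  unfolding LT_def by blast

lemma finite_LT: "finite LT"
proof -
  have "LT \<subseteq> (\<Union>\<gamma>\<in>{..<length Fs} \<times> UNIV. \<Union>i<nn \<gamma>. \<Union>j<nn \<gamma>. {lt \<gamma> i j})"
    by (auto simp: LT_def ok_def)
  then show ?thesis by (rule finite_subset) (auto intro: finite_cartesian_product)
qed

lemma finite_BB: "finite BB" using finite_LT by (simp add: BB_def)

lemma DV_csub: "csub DV" and DV_closed: "closed DV"
  using finite_cspan_closed[OF finite_BB] by (simp_all add: DV_def cspan_csub)

lemma DV_eq: "DV = L ` P.span LT"
  by (simp add: DV_def BB_def L_span)

lemma L_lt_DV: "ok \<gamma> \<Longrightarrow> i < nn \<gamma> \<Longrightarrow> j < nn \<gamma> \<Longrightarrow> L (lt \<gamma> i j) \<in> DV"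
  unfolding DV_def BB_def by (intro cspan_base imageI LT_I)

lemma st_lt_span: "ok \<gamma> \<Longrightarrow> i < nn \<gamma> \<Longrightarrow> j < nn \<gamma> \<Longrightarrow> st (lt \<gamma> i j) \<in> P.span LT"
  unfolding st_lt by (intro P_span_fconst_sum P.span_base LT_I) auto

definition dB :: "direction \<Rightarrow> 'h set" where
  "dB \<gamma> = {L (lt \<gamma> i j) |i j. i < nn \<gamma> \<and> j < nn \<gamma>}"

lemma finite_dB: "finite (dB \<gamma>)"
proof -
  have "dB \<gamma> = (\<lambda>(i, j). L (lt \<gamma> i j)) ` ({..<nn \<gamma>} \<times> {..<nn \<gamma>})" by (auto simp: dB_def)
  then show ?thesis by simp
qed

lemma directions_ok: "\<gamma> \<in> directions Fs \<Longrightarrow> ok \<gamma>"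
  by (auto simp: directions_def ok_def)

lemma finite_directions: "finite (directions Fs)"
  by (rule finite_subset[of _ "{..<length Fs} \<times> UNIV"]) (auto simp: directions_def)

text \<open>Letters of an \<open>Ao\<close> factor with conjugate flag are no directions, but they
  represent the same vectors as the letters of \<open>u\<close>.\<close>

lemma BB_directions: "BB = (\<Union>\<gamma>\<in>directions Fs. dB \<gamma>)"
proof
  show "BB \<subseteq> (\<Union>\<gamma>\<in>directions Fs. dB \<gamma>)"
  proof
    fix x assume "x \<in> BB"
    then obtain \<gamma> i j where x: "x = L (lt \<gamma> i j)" "ok \<gamma>" "i < nn \<gamma>" "j < nn \<gamma>" by (auto simp: BB_def LT_def)
    show "x \<in> (\<Union>\<gamma>\<in>directions Fs. dB \<gamma>)"
    proof (cases "\<gamma> \<in> directions Fs")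
      case True
      then show ?thesis using x by (auto simp: dB_def)
    next
      case False
      obtain p where \<gamma>: "\<gamma> = (p, True)" "p < length Fs" "\<not> (\<exists>Q. Fs ! p = Au Q)"
        using False x(2) by (cases \<gamma>) (auto simp: directions_def ok_def)
      then obtain Q where Q: "Fs ! p = Ao Q" by (cases "Fs ! p") auto
      have "pi (lt (p, False) i j) = pi (lt (p, True) i j)"
        using Ao_self_conj[OF \<gamma>(2) Q] x \<gamma> by (simp add: nn_def Q)
      then have "x = L (lt (p, False) i j)" using x(1) \<gamma>(1) by (simp add: L_def)
      moreover have "(p, False) \<in> directions Fs" using \<gamma> by (simp add: directions_def)
      moreover have "i < nn (p, False)" "j < nn (p, False)" using x \<gamma>(1) by (simp_all add: nn_def)
      ultimately show ?thesis unfolding dB_def by blast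
    qed
  qed
  show "(\<Union>\<gamma>\<in>directions Fs. dB \<gamma>) \<subseteq> BB"
    using directions_ok LT_I unfolding BB_def dB_def by blast
qed

lemma dir_proj_eq: "\<gamma> \<in> directions Fs \<Longrightarrow> dir_proj Fs \<Lambda> \<gamma> = orth_proj (cspan (dB \<gamma>))"
proof -
  assume \<gamma>: "\<gamma> \<in> directions Fs"
  have "{\<Lambda> (dir_corep Fs \<gamma> i j) |i j. i < dir_dim Fs \<gamma> \<and> j < dir_dim Fs \<gamma>} = dB \<gamma>"
    using pi_dir directions_ok[OF \<gamma>] unfolding dB_def L_def dir_dim_def nn_def ok_def by metis
  then show ?thesis by (simp add: dir_proj_def)
qed

text \<open>No orthogonality between different directions is needed: on the span of all of them, the
  sum of the projections is injective and positive, hence surjective.\<close>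

lemma range_p1: "range (p1_op Fs \<Lambda>) = DV"
proof
  let ?P = "\<lambda>\<gamma>. orth_proj (cspan (dB \<gamma>))"
  have M: "csub (cspan (dB \<gamma>))" "closed (cspan (dB \<gamma>))" for \<gamma>
    by (simp_all add: cspan_csub finite_cspan_closed[OF finite_dB])
  have p1: "p1_op Fs \<Lambda> = (\<lambda>x. \<Sum>\<gamma>\<in>directions Fs. ?P \<gamma> x)"
    by (rule ext) (simp add: p1_op_def dir_proj_eq)
  have lin: "bounded_clinear (p1_op Fs \<Lambda>)" unfolding p1 by (intro bcl_sum_fun orth_proj_bcl M)
  have sub: "cspan (dB \<gamma>) \<subseteq> DV" if "\<gamma> \<in> directions Fs" for \<gamma>
    unfolding DV_def BB_directions using that by (intro cspan_mono) auto
  then show "range (p1_op Fs \<Lambda>) \<subseteq> DV"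
    unfolding p1 using orth_proj_in[OF M] by (intro image_subsetI csub_sum[OF DV_csub]) blast
  then have im: "p1_op Fs \<Lambda> ` DV \<subseteq> DV" by blast
  have N: "csub (p1_op Fs \<Lambda> ` DV)" "closed (p1_op Fs \<Lambda> ` DV)"
    unfolding DV_def bcl_cspan[OF lin] using finite_cspan_closed[OF finite_imageI[OF finite_BB]] by (simp_all add: cspan_csub)
  show "DV \<subseteq> range (p1_op Fs \<Lambda>)"
  proof
    fix x assume x: "x \<in> DV"
    define y where "y = x - orth_proj (p1_op Fs \<Lambda> ` DV) x"
    have y: "y \<in> DV" unfolding y_def using x im orth_proj_in[OF N] by (intro csub_diff[OF DV_csub]) auto
    have "cinner (p1_op Fs \<Lambda> y) y = 0"
      unfolding y_def by (rule orth_proj_orth[OF N]) (use y in \<open>simp add: y_def\<close>)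
    then have "(\<Sum>\<gamma>\<in>directions Fs. cinner (?P \<gamma> y) (?P \<gamma> y)) = 0"
      unfolding p1 cinner_sum_left orth_proj_sym[OF M, of _ y y] .
    then have "complex_of_real (\<Sum>\<gamma>\<in>directions Fs. (norm (?P \<gamma> y))\<^sup>2) = 0" by (simp add: cinner_self)
    then have "(\<Sum>\<gamma>\<in>directions Fs. (norm (?P \<gamma> y))\<^sup>2) = 0" by (simp only: of_real_eq_0_iff)
    then have Py: "?P \<gamma> y = 0" if "\<gamma> \<in> directions Fs" for \<gamma>
      using that finite_directions by (subst (asm) sum_nonneg_eq_0_iff) auto
    have "csub {z. cinner z y = 0}"
      by (simp add: csub_def cinner_add_left cinner_scaleC_left)
    moreover have "BB \<subseteq> {z. cinner z y = 0}"
    proof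
      fix z assume "z \<in> BB"
      then obtain \<gamma> where g: "\<gamma> \<in> directions Fs" "z \<in> dB \<gamma>" by (auto simp: BB_directions)
      then show "z \<in> {z. cinner z y = 0}"
        using orth_proj_orth[OF M cspan_base[OF g(2)], of y] Py[OF g(1)] by simp
    qed
    ultimately have "DV \<subseteq> {z. cinner z y = 0}" unfolding DV_def by (rule cspan_minimal)
    then have "y = 0" using y cinner_eq_zero_iff by blast
    then have "x = orth_proj (p1_op Fs \<Lambda> ` DV) x" by (simp add: y_def)
    then show "x \<in> range (p1_op Fs \<Lambda>)" using orth_proj_in[OF N, of x] by auto
  qed
qed

section \<open>The edge space and the operators acting on it\<close>

definition KB :: "'t set" where "KB = {t (L p) (L q) |p q. q \<in> LT}"
definition KK :: "'t set" where "KK = closure (cspan KB)"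

lemma KK_csub: "csub KK" and KK_closed: "closed KK" and KB_KK: "cspan KB \<subseteq> KK"
  by (simp_all add: KK_def csub_closure[OF cspan_csub] closure_subset)

lemma t_DV: assumes "\<eta> \<in> DV" shows "t (L p) \<eta> \<in> cspan KB"
proof -
  have "csub {\<eta>. t (L p) \<eta> \<in> cspan KB}" by (rule csub_vimage[OF t_bcl(2) cspan_csub])
  then have "DV \<subseteq> {\<eta>. t (L p) \<eta> \<in> cspan KB}"
    unfolding DV_def by (rule cspan_minimal) (auto simp: BB_def KB_def intro!: cspan_base)
  then show ?thesis using assms by blast
qed

lemma KB_DV: "z \<in> KB \<Longrightarrow> \<exists>p \<eta>. z = t (L p) \<eta> \<and> \<eta> \<in> DV"
  unfolding KB_def DV_eq using P.span_base by blast

lemma alg_edge_space_eq: "alg_edge_space Fs \<Lambda> t = cspan KB"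
proof -
  have eq: "{t (\<Lambda> x) \<eta> |x \<eta>. x \<in> carrier S \<and> \<eta> \<in> range (p1_op Fs \<Lambda>)} = {t (L p) \<eta> |p \<eta>. \<eta> \<in> DV}"
    unfolding range_p1 by (auto simp: carrier_S L_def)
  show ?thesis
    unfolding alg_edge_space_def eq
  proof
    show "cspan {t (L p) \<eta> |p \<eta>. \<eta> \<in> DV} \<subseteq> cspan KB"
      by (rule cspan_minimal[OF cspan_csub]) (auto intro: t_DV)
    show "cspan KB \<subseteq> cspan {t (L p) \<eta> |p \<eta>. \<eta> \<in> DV}"
      by (rule cspan_mono) (use KB_DV in blast)
  qed
qed

lemma edge_space_eq: "edge_space Fs \<Lambda> t = KK"
  unfolding edge_space_def range_p1
proof
  have "t \<xi> \<eta> \<in> KK" if "\<eta> \<in> DV" for \<xi> \<eta>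
  proof (rule t_in_closure[OF KK_csub KK_closed])
    show "t x y \<in> KK" if xy: "x \<in> HH0" "y \<in> BB" for x y
    proof -
      have "y \<in> DV" using xy(2) unfolding DV_def by (rule cspan_base)
      moreover obtain p where "x = L p" using xy(1) unfolding HH0_def by blast
      ultimately show ?thesis using t_DV KB_KK by blast
    qed
    show "\<xi> \<in> closure (cspan HH0)" by (simp add: HH0_dense')
    show "\<eta> \<in> closure (cspan BB)" using \<open>\<eta> \<in> DV\<close> closure_subset unfolding DV_def by blast
  qed
  then show "closure (cspan {t \<xi> \<eta> |\<xi> \<eta>. \<eta> \<in> DV}) \<subseteq> KK"
    by (intro closure_minimal[OF cspan_minimal[OF KK_csub]] KK_closed) auto
  show "KK \<subseteq> closure (cspan {t \<xi> \<eta> |\<xi> \<eta>. \<eta> \<in> DV})"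
    unfolding KK_def by (intro closure_mono cspan_mono) (use KB_DV in blast)
qed

lemma bcl_preserves_KK:
  assumes T: "bounded_clinear T" and KB: "T ` KB \<subseteq> cspan KB"
  shows "z \<in> cspan KB \<Longrightarrow> T z \<in> cspan KB" "z \<in> KK \<Longrightarrow> T z \<in> KK"
proof -
  have 1: "T ` cspan KB \<subseteq> cspan KB"
    unfolding bcl_cspan[OF T] by (rule cspan_minimal[OF cspan_csub KB])
  then show "z \<in> cspan KB \<Longrightarrow> T z \<in> cspan KB" by blast
  have "T ` closure (cspan KB) \<subseteq> KK"
    by (rule image_closure_subset[OF bcl_cont[OF T] KK_closed]) (use 1 KB_KK in blast)
  then show "z \<in> KK \<Longrightarrow> T z \<in> KK" unfolding KK_def by blast
qed

lemma act_KB: "act p ` KB \<subseteq> cspan KB"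
  by (force simp: KB_def act(2) lam(2) intro: cspan_base)

lemma act_KK: "z \<in> cspan KB \<Longrightarrow> act p z \<in> cspan KB" "z \<in> KK \<Longrightarrow> act p z \<in> KK"
  using bcl_preserves_KK[OF act(1) act_KB] by blast+

lemma Th_KB: "Th ` KB \<subseteq> cspan KB"
proof
  fix z assume "z \<in> Th ` KB"
  then obtain p \<gamma> i j where g: "ok \<gamma>" "i < nn \<gamma>" "j < nn \<gamma>" and z: "z = Th (t (L p) (L (lt \<gamma> i j)))"
    by (auto simp: KB_def LT_def)
  show "z \<in> cspan KB"
    unfolding z Th_lt[OF g]
  proof (intro csub_sum[OF cspan_csub] t_DV)
    fix l assume "l \<in> {..<nn \<gamma>}"
    then show "L (st (lt \<gamma> j l)) \<in> DV" using st_lt_span[of \<gamma> j l] g by (simp add: DV_eq)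
  qed
qed

lemma Th_KK: "z \<in> cspan KB \<Longrightarrow> Th z \<in> cspan KB" "z \<in> KK \<Longrightarrow> Th z \<in> KK"
  using bcl_preserves_KK[OF Th_bcl Th_KB] by blast+

lemma KK_eqI:
  assumes "bounded_clinear S1" "bounded_clinear S2"
    and "\<And>p \<gamma> i j. ok \<gamma> \<Longrightarrow> i < nn \<gamma> \<Longrightarrow> j < nn \<gamma> \<Longrightarrow> S1 (t (L p) (L (lt \<gamma> i j))) = S2 (t (L p) (L (lt \<gamma> i j)))"
    and "z \<in> KK"
  shows "S1 z = S2 z"
  by (rule bcl_eq_on[OF assms(1,2) _ assms(4)[unfolded KK_def]]) (auto simp: KB_def LT_def assms(3))

lemma Th_act: "z \<in> KK \<Longrightarrow> Th (act p z) = act p (Th z)"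
proof (rule KK_eqI[OF bcl_comp[OF Th_bcl act(1)] bcl_comp[OF act(1) Th_bcl]])
  fix q \<gamma> i j assume g: "ok \<gamma>" "i < nn \<gamma>" "j < nn \<gamma>"
  show "Th (act p (t (L q) (L (lt \<gamma> i j)))) = act p (Th (t (L q) (L (lt \<gamma> i j))))"
    by (simp add: act(2) lam(2) Th_lt[OF g] bcl_sum[OF act(1)] mult.assoc)
qed

lemma L_inner_mult: "cinner (L (p * q)) (L r) = cinner (L q) (L (st p * r))"
  by (simp add: L_inner st_mult mult.assoc)

lemma act_adj: "cinner (act p u) v = cinner u (act (st p) v)"
proof -
  have 1: "cinner (act p (tL i)) (tL j) = cinner (tL i) (act (st p) (tL j))" for i j
    by (cases i; cases j) (simp add: tL_def act(2) lam(2) t_inner L_inner_mult)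
  have 2: "cinner (act p (tL i)) v = cinner (tL i) (act (st p) v)" for i v
  proof (rule cdense_induct[OF tL_dense, where P = "\<lambda>v. cinner (act p (tL i)) v = cinner (tL i) (act (st p) v)"])
    show "closed {v. cinner (act p (tL i)) v = cinner (tL i) (act (st p) v)}"
      by (intro closed_Collect_eq continuous_on_cinner_right continuous_on_id bcl_cont[OF act(1)])
    show "csub {v. cinner (act p (tL i)) v = cinner (tL i) (act (st p) v)}"
      by (simp add: csub_def bcl_zero[OF act(1)] bcl_add[OF act(1)] bcl_scaleC[OF act(1)] cinner_add_right cinner_scaleC_right)
    show "cinner (act p (tL i)) v = cinner (tL i) (act (st p) v)" if "v \<in> range tL" for v
      using that 1 by blast
  qed
  show ?thesis
  proof (rule cdense_induct[OF tL_dense, where P = "\<lambda>u. cinner (act p u) v = cinner u (act (st p) v)"])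
    show "closed {u. cinner (act p u) v = cinner u (act (st p) v)}"
      by (intro closed_Collect_eq continuous_on_cinner_left continuous_on_id bcl_cont[OF act(1)])
    show "csub {u. cinner (act p u) v = cinner u (act (st p) v)}"
      by (simp add: csub_def bcl_zero[OF act(1)] bcl_add[OF act(1)] bcl_scaleC[OF act(1)] cinner_add_left cinner_scaleC_left)
    show "cinner (act p u) v = cinner u (act (st p) v)" if "u \<in> range tL" for u
      using that 2 by blast
  qed
qed

subsection \<open>Source and target operators\<close>

lemma ee_L: "L p = L q \<Longrightarrow> ee p = ee q"
  unfolding L_eq_iff by (rule ee_cong)

lemma ee_smult: "ee (fconst c * p) = c * ee p"
  by (simp add: ee_mult)

lemma ee_st_lt: assumes "ok \<gamma>" "i < nn \<gamma>" "j < nn \<gamma>" shows "ee (st (lt \<gamma> i j)) = (if i = j then 1 else 0)"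
proof -
  have "ee (st (lt \<gamma> i j)) = (\<Sum>k<nn \<gamma>. \<Sum>l<nn \<gamma>. dm \<gamma> i k * cnj (dm (bar \<gamma>) l j) * (if k = l then 1 else 0))"
    unfolding st_lt[OF assms] ee_sum ee_smult using assms by (intro sum.cong refl) (simp add: ee_lt)
  then show ?thesis using dm_inv[OF assms] by (simp add: if_distrib cong: if_cong)
qed

text \<open>The counit is given on the algebra only; on the finite-dimensional space
  \<open>DV\<close> it is represented by a vector, which makes the source operator bounded.\<close>

lemma counit_vector: "\<exists>e0. \<forall>q\<in>P.span LT. cinner e0 (L q) = ee q"
proof -
  define f where "f \<xi> = ee (SOME q. L q = \<xi>)" for \<xi>
  have f: "f (L q) = ee q" for q
    unfolding f_def by (rule ee_L) (rule someI[of "\<lambda>r. L r = L q"], rule refl)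
  have "\<exists>e0\<in>cspan BB. \<forall>y\<in>cspan BB. cinner e0 y = f y"
  proof (rule finite_cspan_riesz[OF finite_BB])
    have "cspan BB = L ` P.span LT" using DV_eq by (simp add: DV_def)
    then have D: "\<exists>q. x = L q" if "x \<in> cspan BB" for x using that by blast
    show "f (x + y) = f x + f y" if xy: "x \<in> cspan BB" "y \<in> cspan BB" for x y
    proof -
      obtain p q where "x = L p" "y = L q" using D xy by blast
      then show ?thesis using f[of "p + q"] by (simp add: L_add f ee_add)
    qed
    show "f (c *\<^sub>C x) = c * f x" if x: "x \<in> cspan BB" for c x
    proof -
      obtain p where "x = L p" using D x by blast
      then show ?thesis using f[of "fconst c * p"] by (simp add: L_smult f ee_smult)
    qed
  qed
  then show ?thesis using DV_eq f by (metis DV_def imageI)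
qed

definition e0 :: 'h where "e0 = (SOME e. \<forall>q\<in>P.span LT. cinner e (L q) = ee q)"

lemma e0: "q \<in> P.span LT \<Longrightarrow> cinner e0 (L q) = ee q"
  using someI_ex[OF counit_vector] unfolding e0_def by blast

text \<open>This is the adjoint of v -> v \<otimes> e: pairing the image with v amounts to pairing
  the argument with \<open>t v e\<close>, which yields the norm bound.\<close>

lemma slice: "\<exists>T. bounded_clinear T \<and> (\<forall>p q. T (t (L p) (L q)) = cinner e (L q) *\<^sub>C L p)"
proof -
  \<comment> \<open>The extension theorem is real, so complex multiples are included in the index
    family; complex linearity is recovered afterwards.\<close>
  let ?g = "\<lambda>(c, p, q). c *\<^sub>C t (L p) (L q)" and ?f = "\<lambda>(c, p, q). (c * cinner e (L q)) *\<^sub>C L p"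
  have "range ?g = {c *\<^sub>C x |c x. x \<in> range tL}"
  proof (intro equalityI subsetI)
    fix x assume "x \<in> {c *\<^sub>C x |c x. x \<in> range tL}"
    then obtain c p q where "x = ?g (c, p, q)" by (auto simp: tL_def)
    then show "x \<in> range ?g" by (rule range_eqI)
  next
    fix x assume "x \<in> range ?g"
    then obtain c p q where "x = c *\<^sub>C tL (p, q)" by (auto simp: tL_def)
    then show "x \<in> {c *\<^sub>C x |c x. x \<in> range tL}" by blast
  qed
  then have dense: "closure (span (range ?g)) = UNIV" using tL_dense by (simp only: cspan_def)
  have "\<exists>T. bounded_linear T \<and> (\<forall>i\<in>UNIV. T (?g i) = ?f i)"
  proof (rule bounded_extension[OF dense, where C = "norm e"])
    fix F :: "(complex \<times> entry_alg \<times> entry_alg) set" and r :: "_ \<Rightarrow> real"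
    let ?s = "\<Sum>i\<in>F. r i *\<^sub>R ?f i" and ?z = "\<Sum>i\<in>F. r i *\<^sub>R ?g i"
    have "inner v (?f i) = inner (t v e) (?g i)" for v i
      unfolding Re_cinner[symmetric]
      by (cases i) (simp add: t_inner cinner_scaleC_right mult.assoc mult.commute mult.left_commute)
    then have "inner ?s ?s = inner (t ?s e) ?z" unfolding inner_sum_right inner_scaleR_right by simp
    also have "\<dots> \<le> norm (t ?s e) * norm ?z" by (rule norm_cauchy_schwarz)
    finally have le: "norm ?s * norm ?s \<le> norm ?s * (norm e * norm ?z)"
      by (simp add: norm_t power2_norm_eq_inner[symmetric] power2_eq_square mult.assoc)
    show "norm ?s \<le> norm e * norm ?z"
    proof (cases "norm ?s = 0")
      case False
      then have "0 < norm ?s" by (simp only: norm_ge_zero order.not_eq_order_implies_strict)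
      with le show ?thesis by (simp only: mult_le_cancel_left_pos)
    qed (simp only: mult_nonneg_nonneg norm_ge_zero)
  qed
  then obtain T where T: "bounded_linear T" "\<And>c p q. T (c *\<^sub>C t (L p) (L q)) = (c * cinner e (L q)) *\<^sub>C L p" by auto
  interpret T: bounded_linear T by fact
  have 1: "T (t (L p) (L q)) = cinner e (L q) *\<^sub>C L p" for p q using T(2)[of 1] by simp
  have "T (c *\<^sub>C x) = c *\<^sub>C T x" for c x
  proof (rule dense_induct[OF dense])
    have T': "continuous_on UNIV T" by (rule linear_continuous_on[OF T(1)])
    show "closed {x. T (c *\<^sub>C x) = c *\<^sub>C T x}"
      by (rule closed_Collect_eq[OF continuous_on_compose2[OF T' continuous_scaleC subset_UNIV] continuous_on_scaleC[OF T']])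
    show "subspace {x. T (c *\<^sub>C x) = c *\<^sub>C T x}"
      by (rule subspaceI) (simp_all add: T.zero scaleC_add_right T.add scaleC_scaleR T.scaleR)
    show "T (c *\<^sub>C x) = c *\<^sub>C T x" if "x \<in> range ?g" for x
      using that by (auto simp: T(2) scaleC_scaleC mult.assoc)
  qed
  then show ?thesis using T(1) 1 by (auto simp: bounded_clinear_def)
qed

definition E1 :: "'t \<Rightarrow> 'h" where
  "E1 = (SOME T. bounded_clinear T \<and> (\<forall>p q. T (t (L p) (L q)) = cinner e0 (L q) *\<^sub>C L p))"

lemma E1: "bounded_clinear E1" "q \<in> P.span LT \<Longrightarrow> E1 (t (L p) (L q)) = ee q *\<^sub>C L p"
  using someI_ex[OF slice, of e0] e0 unfolding E1_def[symmetric] by simp_all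

text \<open>The target is defined as the source of the reversed edge, so its boundedness comes for
  free. The projection makes it vanish on the complement of the edge space, as
  \<open>target_op\<close> demands.\<close>

definition E2 :: "'t \<Rightarrow> 'h" where "E2 z = E1 (Th (orth_proj KK z))"

lemma E2_bcl: "bounded_clinear E2"
  unfolding E2_def[abs_def] by (intro bcl_comp[OF E1(1)] bcl_comp[OF Th_bcl] orth_proj_bcl KK_csub KK_closed)

lemma lt_span: "ok \<gamma> \<Longrightarrow> i < nn \<gamma> \<Longrightarrow> j < nn \<gamma> \<Longrightarrow> lt \<gamma> i j \<in> P.span LT"
  by (intro P.span_base LT_I)

lemma E1_Th: "z \<in> KK \<Longrightarrow> E1 (Th z) = E2 z"
  by (simp add: E2_def orth_proj_id KK_csub KK_closed)

lemma span_KK: "q \<in> P.span LT \<Longrightarrow> t (L p) (L q) \<in> KK"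
  using t_DV[of "L q" p] KB_KK by (auto simp: DV_eq)

text \<open>The counit applied to the second legs of the reversed edge keeps only the term l = j,
  which is the product.\<close>

lemma E2_span: assumes "q \<in> P.span LT" shows "E2 (t (L p) (L q)) = L (p * q)"
proof -
  have "E2 (t (L p) \<eta>) = lam p \<eta>" if "\<eta> \<in> closure (cspan BB)" for \<eta>
  proof (rule bcl_eq_on[OF bcl_comp[OF E2_bcl t_bcl(2)] lam(1) _ that])
    fix x assume "x \<in> BB"
    then obtain \<gamma> i j where x: "x = L (lt \<gamma> i j)" and g: "ok \<gamma>" "i < nn \<gamma>" "j < nn \<gamma>" by (auto simp: BB_def LT_def)
    have "E2 (t (L p) x) = (\<Sum>l<nn \<gamma>. E1 (t (L (p * lt \<gamma> i l)) (L (st (lt \<gamma> j l)))))"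
      unfolding x E1_Th[OF span_KK[OF lt_span[OF g]], symmetric] Th_lt[OF g] bcl_sum[OF E1(1)] ..
    also have "\<dots> = (\<Sum>l<nn \<gamma>. if j = l then L (p * lt \<gamma> i l) else 0)"
      using g by (intro sum.cong refl) (simp add: E1(2)[OF st_lt_span] ee_st_lt)
    finally show "E2 (t (L p) x) = lam p x" using g by (simp add: x lam(2))
  qed
  moreover have "L q \<in> closure (cspan BB)" using assms DV_eq closure_subset unfolding DV_def by blast
  ultimately show ?thesis by (simp add: lam(2))
qed

text \<open>Multiplying the legs of the reversed edge produces the unitarity sum of the direction,
  whose value is the counit of the entry.\<close>

lemma E2_Th: "z \<in> KK \<Longrightarrow> E2 (Th z) = E1 z"
proof (rule KK_eqI[OF bcl_comp[OF E2_bcl Th_bcl] E1(1)])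
  fix p \<gamma> i j assume g: "ok \<gamma>" "i < nn \<gamma>" "j < nn \<gamma>"
  have "E2 (Th (t (L p) (L (lt \<gamma> i j)))) = (\<Sum>l<nn \<gamma>. L (p * lt \<gamma> i l * st (lt \<gamma> j l)))"
    unfolding Th_lt[OF g] bcl_sum[OF E2_bcl] using g by (intro sum.cong refl E2_span st_lt_span) auto
  also have "\<dots> = L (p * (\<Sum>l<nn \<gamma>. lt \<gamma> i l * st (lt \<gamma> j l)))"
    by (simp add: sum_distrib_left L_sum mult.assoc)
  also have "\<dots> = L (p * (if i = j then 1 else 0))"
    by (intro L_cong pi_mult_cong_right unitary1 g)
  also have "\<dots> = E1 (t (L p) (L (lt \<gamma> i j)))"
    by (simp add: E1(2)[OF lt_span[OF g]] ee_lt[OF g])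
  finally show "E2 (Th (t (L p) (L (lt \<gamma> i j)))) = E1 (t (L p) (L (lt \<gamma> i j)))" .
qed

text \<open>Density settles uniqueness on the edge space, and the clause about the orthogonal
  complement settles it elsewhere.\<close>

lemma target_op_eq: "target_op Fs \<Lambda> t = E2"
  unfolding target_op_def Let_def range_p1 edge_space_eq
proof (rule the_equality)
  have "E2 (t (\<Lambda> x) (\<Lambda> y)) = \<Lambda> (x \<otimes>\<^bsub>S\<^esub> y)" if x: "x \<in> carrier S" and y: "y \<in> carrier S" "\<Lambda> y \<in> DV" for x y
  proof -
    obtain p where p: "x = pi p" using x by (rule pi_surj)
    obtain r where r: "y = pi r" using y(1) by (rule pi_surj)
    obtain q where q: "q \<in> P.span LT" "\<Lambda> y = L q" using y(2) by (auto simp: DV_eq)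
    then have "L r = L q" by (simp add: r L_def)
    then show ?thesis using E2_span[OF q(1), of p] L_mult[OF refl, of r q p]
      by (simp add: p r L_def pi_mult)
  qed
  moreover have "E2 \<zeta> = 0" if "\<forall>\<xi>\<in>KK. cinner \<xi> \<zeta> = 0" for \<zeta>
    using orth_proj_0[OF KK_csub KK_closed, of \<zeta>] that
    by (simp add: E2_def bcl_zero[OF E1(1)] bcl_zero[OF Th_bcl])
  ultimately show "bounded_clinear E2 \<and>
    (\<forall>x\<in>carrier S. \<forall>y\<in>carrier S. \<Lambda> y \<in> DV \<longrightarrow> E2 (t (\<Lambda> x) (\<Lambda> y)) = \<Lambda> (x \<otimes>\<^bsub>S\<^esub> y)) \<and>
    (\<forall>\<zeta>. (\<forall>\<xi>\<in>KK. cinner \<xi> \<zeta> = 0) \<longrightarrow> E2 \<zeta> = 0)" using E2_bcl by blast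
  fix E assume E: "bounded_clinear E \<and>
    (\<forall>x\<in>carrier S. \<forall>y\<in>carrier S. \<Lambda> y \<in> DV \<longrightarrow> E (t (\<Lambda> x) (\<Lambda> y)) = \<Lambda> (x \<otimes>\<^bsub>S\<^esub> y)) \<and>
    (\<forall>\<zeta>. (\<forall>\<xi>\<in>KK. cinner \<xi> \<zeta> = 0) \<longrightarrow> E \<zeta> = 0)"
  have 1: "E z = E2 z" if "z \<in> KK" for z
  proof (rule KK_eqI[OF _ E2_bcl _ that])
    show "bounded_clinear E" using E by blast
    fix p \<gamma> i j assume g: "ok \<gamma>" "i < nn \<gamma>" "j < nn \<gamma>"
    have "E (t (L p) (L (lt \<gamma> i j))) = L (p * lt \<gamma> i j)"
      using E L_lt_DV[OF g] pi_closed by (simp add: L_def pi_mult)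
    then show "E (t (L p) (L (lt \<gamma> i j))) = E2 (t (L p) (L (lt \<gamma> i j)))" by (simp add: E2_span[OF lt_span[OF g]])
  qed
  show "E = E2"
  proof
    fix z
    let ?y = "orth_proj KK z"
    have "E (z - ?y) = 0" using E orth_proj_orth[OF KK_csub KK_closed, of _ z] by blast
    then have "E z = E ?y" using E bcl_diff[of E z ?y] by simp
    also have "\<dots> = E2 ?y" by (rule 1[OF orth_proj_in[OF KK_csub KK_closed]])
    also have "\<dots> = E2 z" by (simp add: E2_def orth_proj_id KK_csub KK_closed orth_proj_in)
    finally show "E z = E2 z" .
  qed
qed

subsection \<open>Geometric edges\<close>

definition KG :: "'t set" where "KG = geom_edge_space Fs \<delta> R \<Lambda> t"

lemma KG_iff: "z \<in> KG \<longleftrightarrow> z \<in> KK \<and> Th z = - z"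
  by (auto simp: KG_def geom_edge_space_def edge_space_eq Th_def eq_neg_iff_add_eq_0)

lemma KG_csub: "csub KG"
  unfolding csub_def Ball_def KG_iff
  using csub_0[OF KK_csub] csub_add[OF KK_csub] csub_scaleC[OF KK_csub]
  by (simp add: bcl_zero[OF Th_bcl] bcl_add[OF Th_bcl] bcl_scaleC[OF Th_bcl] scaleC_minus_right)

lemma KG_closed: "closed KG"
proof -
  have "KG = KK \<inter> {z. Th z = - z}" using KG_iff by blast
  moreover have "closed {z. Th z = - z}"
    by (intro closed_Collect_eq bcl_cont[OF Th_bcl] continuous_intros)
  ultimately show ?thesis using KK_closed by (simp add: closed_Int)
qed

definition PG :: "'t \<Rightarrow> 't" where "PG = orth_proj KG"

lemma PG_bcl: "bounded_clinear PG" and PG_in: "PG z \<in> KG"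
  and PG_orth: "w \<in> KG \<Longrightarrow> cinner w (z - PG z) = 0"
  unfolding PG_def using orth_proj_bcl orth_proj_in orth_proj_orth KG_csub KG_closed by blast+

text \<open>A geometric edge w has \<Theta> w = -w, so isometry of \<Theta> makes its inner product
  with \<Theta> z the negative of that with z.\<close>

lemma PG_Th: assumes "z \<in> KK" shows "PG (z + Th z) = 0"
  unfolding PG_def
proof (rule orth_proj_0[OF KG_csub KG_closed])
  fix w assume "w \<in> KG"
  then have "cinner w (Th z) = - cinner (Th w) (Th z)" by (simp add: KG_iff cinner_minus_left)
  then show "cinner w (z + Th z) = 0" by (simp add: Th_iso cinner_add_right)
qed

text \<open>The action commutes with \<Theta>, so geometric edges are stable under
  \<open>act p\<close> and under its adjoint \<open>act (st p)\<close>; hence it commutes with their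
  projection.\<close>

lemma act_PG: assumes "z \<in> KK" shows "act p (PG z) = PG (act p z)"
proof -
  have actG: "act q w \<in> KG" if "w \<in> KG" for q w
    using that act_KK(2)[of w q] Th_act[of w q] by (simp add: KG_iff bcl_minus[OF act(1)])
  have "PG (act p z) = act p (PG z)"
    unfolding PG_def
  proof (rule orth_proj_eqI[OF KG_csub KG_closed])
    show "act p (orth_proj KG z) \<in> KG" using actG PG_in unfolding PG_def by blast
    fix w assume w: "w \<in> KG"
    have "cinner (act p (z - PG z)) w = cinner (z - PG z) (act (st p) w)" by (rule act_adj)
    also have "\<dots> = cnj (cinner (act (st p) w) (z - PG z))" by (rule cinner_commute)
    also have "\<dots> = 0" using PG_orth[OF actG[OF w]] by simp
    finally have "cnj (cinner w (act p (z - PG z))) = 0" by (simp only: cinner_commute[symmetric])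
    then show "cinner w (act p z - act p (orth_proj KG z)) = 0" by (simp add: bcl_diff[OF act(1)] PG_def)
  qed
  then show ?thesis ..
qed

text \<open>The difference of target and source vanishes on the range of \<open>1 + Th\<close>, whose orthogonal
  complement in the edge space is the kernel of \<open>1 + Th\<close> because \<open>Th\<close> is isometric.\<close>

lemma E2_PG: assumes z: "z \<in> KK" shows "2 *\<^sub>C E2 (PG z) = E2 z - E1 z"
proof -
  define D where "D x = E2 x - E1 x" for x
  have D: "bounded_clinear D" unfolding D_def[abs_def] by (intro bcl_minus_fun E2_bcl E1(1))
  define N where "N = closure ((\<lambda>x. x + Th x) ` KK)"
  have N: "csub N" "closed N"
  proof -
    have "csub ((\<lambda>x. x + Th x) ` KK)"
      unfolding csub_def
    proof (intro conjI ballI allI)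
      show "0 \<in> (\<lambda>x. x + Th x) ` KK"
        by (intro image_eqI[of _ _ 0]) (simp_all add: bcl_zero[OF Th_bcl] csub_0[OF KK_csub])
      fix x y assume "x \<in> (\<lambda>x. x + Th x) ` KK" "y \<in> (\<lambda>x. x + Th x) ` KK"
      then obtain u v where "x = u + Th u" "y = v + Th v" "u \<in> KK" "v \<in> KK" by blast
      then show "x + y \<in> (\<lambda>x. x + Th x) ` KK"
        by (intro image_eqI[of _ _ "u + v"]) (simp_all add: bcl_add[OF Th_bcl] csub_add[OF KK_csub])
    next
      fix c x assume "x \<in> (\<lambda>x. x + Th x) ` KK"
      then obtain u where "x = u + Th u" "u \<in> KK" by blast
      then show "c *\<^sub>C x \<in> (\<lambda>x. x + Th x) ` KK"
        by (intro image_eqI[of _ _ "c *\<^sub>C u"]) (simp_all add: bcl_scaleC[OF Th_bcl] scaleC_add_right csub_scaleC[OF KK_csub])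
    qed
    then show "csub N" "closed N" by (simp_all add: N_def csub_closure)
  qed
  have base: "x + Th x \<in> N" if "x \<in> KK" for x
    unfolding N_def using that by (intro closure_subset[THEN subsetD] imageI)
  have NK: "N \<subseteq> KK"
    unfolding N_def using Th_KK(2) csub_add[OF KK_csub] by (intro closure_minimal KK_closed) blast
  have DN: "D x = 0" if "x \<in> N" for x
  proof -
    have "N \<subseteq> {x. D x = 0}"
      unfolding N_def
    proof (rule closure_minimal)
      show "(\<lambda>x. x + Th x) ` KK \<subseteq> {x. D x = 0}"
        by (auto simp: D_def bcl_add[OF E2_bcl] bcl_add[OF E1(1)] E2_Th E1_Th)
      show "closed {x. D x = 0}" by (intro closed_Collect_eq bcl_cont[OF D] continuous_on_const)
    qed
    then show ?thesis using that by blast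
  qed
  define y where "y = z - PG z"
  have yK: "y \<in> KK" unfolding y_def using z PG_in[of z] by (auto simp: KG_iff intro: csub_diff[OF KK_csub])
  define w where "w = y - orth_proj N y"
  have wK: "w \<in> KK" unfolding w_def using yK NK orth_proj_in[OF N] by (intro csub_diff[OF KK_csub]) auto
  have wN: "cinner x w = 0" if "x \<in> N" for x unfolding w_def by (rule orth_proj_orth[OF N that])
  have "w \<in> KG"
  proof -
    have 1: "cinner w (w + Th w) = 0" using wN[OF base[OF wK]] cinner_commute[of w "w + Th w"] by simp
    have "cinner (w + Th w) (w + Th w) = cinner (w + Th w) w + (cinner w (Th w) + cinner (Th w) (Th w))"
      by (simp add: cinner_add_right cinner_add_left)
    also have "\<dots> = 0" using wN[OF base[OF wK]] 1 by (simp add: Th_iso cinner_add_right add.commute)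
    finally have "w + Th w = 0" by (simp only: cinner_eq_zero_iff)
    then show ?thesis using wK by (simp add: KG_iff eq_neg_iff_add_eq_0 add.commute)
  qed
  have "cinner w w = cinner w y - cinner w (orth_proj N y)" by (simp add: w_def cinner_diff_right)
  also have "cinner w y = 0" unfolding y_def by (rule PG_orth[OF \<open>w \<in> KG\<close>])
  also have "cinner w (orth_proj N y) = 0"
    using wN[OF orth_proj_in[OF N]] cinner_commute[of w "orth_proj N y"] by simp
  finally have "w = 0" by (simp add: cinner_eq_zero_iff)
  then have "y \<in> N" using orth_proj_in[OF N, of y] by (simp add: w_def)
  then have "D z = D (PG z)" using DN[of y] by (simp add: y_def bcl_diff[OF D])
  \<comment> \<open>On a geometric edge \<Theta> is -1, so source and target are opposite there and
    their difference is twice the target.\<close>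
  moreover have "D (PG z) = 2 *\<^sub>C E2 (PG z)"
  proof -
    have g: "PG z \<in> KK" "Th (PG z) = - PG z" using PG_in[of z] by (simp_all add: KG_iff)
    have "E1 (PG z) = - E2 (PG z)" using E2_Th[OF g(1)] by (simp add: g(2) bcl_minus[OF E2_bcl])
    then have "D (PG z) = E2 (PG z) + E2 (PG z)" by (simp add: D_def)
    also have "\<dots> = (1 + 1) *\<^sub>C E2 (PG z)" unfolding scaleC_add_left by simp
    finally show ?thesis by simp
  qed
  ultimately show ?thesis by (simp add: D_def)
qed

end

section \<open>Path cocycles\<close>

context fp_tensor
begin

lemma act_cong: "pi p = pi q \<Longrightarrow> act p z = act q z"
  by (simp add: act_def)

lemma act_eqI: "(\<And>q r. t (L (p * q)) (L r) = T (t (L q) (L r))) \<Longrightarrow> bounded_clinear T \<Longrightarrow> act p z = T z"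
  using bcl_ext_tL[OF act(1), of T p] by (simp add: act(2) lam(2))

lemma act_add: "act (p + q) z = act p z + act q z"
  by (rule act_eqI) (simp_all add: distrib_right L_add t_add act(2) lam(2) bcl_plus act(1))

lemma act_mult: "act (p * q) z = act p (act q z)"
  by (rule act_eqI) (simp_all add: mult.assoc act(2) lam(2) bcl_comp act(1))

lemma act_fconst: "act (fconst c) z = c *\<^sub>C z"
  by (rule act_eqI) (simp_all add: L_smult t_scaleC bcl_scale bcl_id)

text \<open>The factor 2 compensates for \<open>E2_PG\<close>: for q in the span of the entries, the
  target of \<open>ew q\<close> is then the vector of q minus its counit.\<close>

definition ew :: "entry_alg \<Rightarrow> 't" where
  "ew q = 2 *\<^sub>C PG (t (L 1) (L q))"

lemma ew_add: "ew (p + q) = ew p + ew q" and ew_smult: "ew (fconst c * p) = c *\<^sub>C ew p"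
  by (simp_all add: ew_def L_add L_smult t_add t_scaleC bcl_add[OF PG_bcl] bcl_scaleC[OF PG_bcl] scaleC_add_right
      scaleC_scaleC mult.commute)

definition wsc :: "complex \<Rightarrow> 't \<times> complex \<Rightarrow> 't \<times> complex" where
  "wsc c z = (c *\<^sub>C fst z, c * snd z)"

text \<open>The triangular action on \<open>'t \<times> complex\<close> whose off-diagonal part is the cocycle.\<close>

definition wop :: "(nat \<times> nat \<times> nat) \<times> bool \<Rightarrow> 't \<times> complex \<Rightarrow> 't \<times> complex" where
  "wop l z = (act (sgl [l] 1) (fst z) + snd z *\<^sub>C ew (sgl [l] 1), ee (sgl [l] 1) * snd z)"

lemma wops: "letter_ops wsc wop"
proof -
  have "vector_space wsc"
    by (rule vector_space.intro)
      (simp_all add: wsc_def prod_eq_iff scaleC_add_right scaleC_add_left scaleC_scaleC distrib_left distrib_right)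
  moreover have "letter_ops_axioms wsc wop"
    by (rule letter_ops_axioms.intro)
      (simp_all add: wop_def wsc_def prod_eq_iff bcl_add[OF act(1)] bcl_scaleC[OF act(1)] scaleC_add_left scaleC_add_right
        scaleC_scaleC distrib_left mult.left_commute)
  ultimately show ?thesis by (rule letter_ops.intro)
qed

definition cc :: "entry_alg \<Rightarrow> 't" where
  "cc p = fst (ev_op wsc wop p (0, 1))"

lemma ev_wop: "ev_op wsc wop p z = (act p (fst z) + snd z *\<^sub>C cc p, ee p * snd z)"
proof -
  interpret W: letter_ops wsc wop by (rule wops)
  \<comment> \<open>The triangular shape is first proved with an unspecified off-diagonal entry;
    evaluation at (0, 1) identifies it as \<open>cc p\<close>.\<close>
  have "(\<exists>x. \<forall>z. ev_op wsc wop p z = (act p (fst z) + snd z *\<^sub>C x, ee p * snd z))"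
  proof (induction p rule: free_alg_induct')
    case (const c)
    show ?case
      by (intro exI[of _ 0] allI, simp only: ev_op_fconst[OF wops]) (simp add: wsc_def act_fconst)
  next
    case (letter l)
    show ?case
      by (intro exI[of _ "ew (sgl [l] 1)"] allI, simp only: ev_op_letter[OF wops]) (simp add: wop_def)
  next
    case (add p q)
    then obtain x y where pq: "\<And>z. ev_op wsc wop p z = (act p (fst z) + snd z *\<^sub>C x, ee p * snd z)"
      "\<And>z. ev_op wsc wop q z = (act q (fst z) + snd z *\<^sub>C y, ee q * snd z)" by blast
    then show ?case
      by (intro exI[of _ "x + y"] allI) (simp add: W.ev_add pq act_add scaleC_add_right ee_add distrib_right)
  next
    case (mult p q)
    then obtain x y where pq: "\<And>z. ev_op wsc wop p z = (act p (fst z) + snd z *\<^sub>C x, ee p * snd z)"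
      "\<And>z. ev_op wsc wop q z = (act q (fst z) + snd z *\<^sub>C y, ee q * snd z)" by blast
    then show ?case
      by (intro exI[of _ "act p y + ee q *\<^sub>C x"] allI)
        (simp add: W.ev_mult pq act_mult ee_mult bcl_add[OF act(1)] bcl_scaleC[OF act(1)] scaleC_add_right scaleC_scaleC
          mult.assoc mult.commute)
  qed
  then obtain x where x: "\<And>z. ev_op wsc wop p z = (act p (fst z) + snd z *\<^sub>C x, ee p * snd z)" by blast
  have "cc p = x" by (simp add: cc_def x bcl_zero[OF act(1)])
  then show ?thesis using x by simp
qed

lemma cc_add: "cc (p + q) = cc p + cc q" and cc_mult: "cc (p * q) = act p (cc q) + ee q *\<^sub>C cc p"
  and cc_fconst: "cc (fconst c) = 0" and cc_letter: "cc (sgl [l] 1) = ew (sgl [l] 1)"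
proof -
  interpret W: letter_ops wsc wop by (rule wops)
  show "cc (p + q) = cc p + cc q"
    unfolding cc_def by (simp add: W.ev_add)
  show "cc (p * q) = act p (cc q) + ee q *\<^sub>C cc p"
    unfolding cc_def[of "p * q"] W.ev_mult by (simp add: ev_wop bcl_zero[OF act(1)])
  show "cc (fconst c) = 0" "cc (sgl [l] 1) = ew (sgl [l] 1)"
    unfolding cc_def ev_op_fconst[OF wops] ev_op_letter[OF wops]
    by (simp_all add: wsc_def wop_def bcl_zero[OF act(1)])
qed

lemma cc_zero: "cc 0 = 0"
  using cc_fconst[of 0] by simp

lemma cc_smult: "cc (fconst c * p) = c *\<^sub>C cc p"
  by (simp add: cc_mult cc_fconst act_fconst)

lemma cc_sum: "cc (\<Sum>i\<in>I. f i) = (\<Sum>i\<in>I. cc (f i))"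
  by (induction I rule: infinite_finite_induct) (simp_all add: cc_zero cc_add)

lemma cc_span: assumes "q \<in> P.span LT" shows "cc q = ew q"
  using assms
proof (induction rule: P.span_induct_alt)
  case base
  show ?case using ew_smult[of 0 0] by (simp add: cc_zero)
next
  case (step c x y)
  then have "cc x = ew x" by (auto simp: LT_def lt_def cc_letter)
  then show ?case using step by (simp add: cc_add cc_smult ew_add ew_smult)
qed

lemma act_ew: assumes "q \<in> P.span LT" shows "act p (ew q) = 2 *\<^sub>C PG (t (L p) (L q))"
  unfolding ew_def bcl_scaleC[OF act(1)] act_PG[OF span_KK[OF assms]] by (simp add: act(2) lam(2))

text \<open>Both unitarity relations hold because \<open>PG\<close> annihilates the range of \<open>1 + Th\<close>.\<close>

lemma cc_unitary1: assumes g: "ok \<gamma>" "i < nn \<gamma>" "j < nn \<gamma>"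
  shows "cc (\<Sum>k<nn \<gamma>. lt \<gamma> i k * st (lt \<gamma> j k)) = 0"
proof -
  have "cc (\<Sum>k<nn \<gamma>. lt \<gamma> i k * st (lt \<gamma> j k))
      = (\<Sum>k<nn \<gamma>. 2 *\<^sub>C PG (t (L (lt \<gamma> i k)) (L (st (lt \<gamma> j k)))) + (if j = k then ew (lt \<gamma> i k) else 0))"
    unfolding cc_sum cc_mult using g
    by (intro sum.cong refl) (simp add: cc_span[OF st_lt_span] act_ew[OF st_lt_span] cc_span[OF lt_span] ee_st_lt)
  also have "\<dots> = 2 *\<^sub>C PG (t (L 1) (L (lt \<gamma> i j)) + Th (t (L 1) (L (lt \<gamma> i j))))"
    using g by (simp add: sum.distrib scaleC_sum_right[symmetric] bcl_sum[OF PG_bcl] bcl_add[OF PG_bcl] Th_lt ew_def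
        scaleC_add_right)
  also have "\<dots> = 0" using PG_Th[OF span_KK[OF lt_span[OF g]]] by simp
  finally show ?thesis .
qed

lemma cc_unitary2: assumes g: "ok \<gamma>" "i < nn \<gamma>" "j < nn \<gamma>"
  shows "cc (\<Sum>k<nn \<gamma>. st (lt \<gamma> k i) * lt \<gamma> k j) = 0"
proof -
  let ?z = "\<Sum>k<nn \<gamma>. t (L (st (lt \<gamma> k i))) (L (lt \<gamma> k j))"
  \<comment> \<open>Unitarity collapses the first legs, so the reversed edge starts at 1 and is
    exactly the one whose projection gives \<open>ew (st (lt \<gamma> j i))\<close>.\<close>
  have "Th ?z = (\<Sum>k<nn \<gamma>. \<Sum>l<nn \<gamma>. t (L (st (lt \<gamma> k i) * lt \<gamma> k l)) (L (st (lt \<gamma> j l))))"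
    unfolding bcl_sum[OF Th_bcl] using g by (intro sum.cong refl Th_lt) auto
  also have "\<dots> = (\<Sum>l<nn \<gamma>. t (L (\<Sum>k<nn \<gamma>. st (lt \<gamma> k i) * lt \<gamma> k l)) (L (st (lt \<gamma> j l))))"
    unfolding L_sum t_sum by (rule sum.swap)
  also have "\<dots> = (\<Sum>l<nn \<gamma>. t (L (if i = l then 1 else 0)) (L (st (lt \<gamma> j l))))"
    using g by (intro sum.cong refl arg_cong[of _ _ "\<lambda>x. t x _"] L_cong unitary2) auto
  also have "\<dots> = (\<Sum>l<nn \<gamma>. if i = l then t (L 1) (L (st (lt \<gamma> j l))) else 0)"
    by (intro sum.cong refl) (simp add: t_zero)
  finally have Th: "Th ?z = t (L 1) (L (st (lt \<gamma> j i)))" using g by simp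
  have z: "?z \<in> KK" using g by (intro csub_sum[OF KK_csub] span_KK lt_span) auto
  have "cc (\<Sum>k<nn \<gamma>. st (lt \<gamma> k i) * lt \<gamma> k j)
      = (\<Sum>k<nn \<gamma>. 2 *\<^sub>C PG (t (L (st (lt \<gamma> k i))) (L (lt \<gamma> k j))) + (if k = j then ew (st (lt \<gamma> k i)) else 0))"
    unfolding cc_sum cc_mult using g
    by (intro sum.cong refl) (simp add: cc_span[OF st_lt_span] act_ew[OF lt_span] cc_span[OF lt_span] ee_lt)
  also have "\<dots> = 2 *\<^sub>C PG (?z + Th ?z)"
    unfolding Th using g by (simp add: sum.distrib scaleC_sum_right[symmetric] bcl_sum[OF PG_bcl] bcl_add[OF PG_bcl] ew_def
        scaleC_add_right)
  also have "\<dots> = 0" using PG_Th[OF z] by simp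
  finally show ?thesis .
qed

text \<open>\<open>lift\<close> is applied to the triangular operators. Their diagonal parts, the
  action and the counit, respect \<open>pi\<close> already, so only the off-diagonal values on the
  relations remain to be checked.\<close>

lemma cc_cong: assumes "pi p = pi q" shows "cc p = cc q"
proof -
  have inv: "wop l z = 0" if l: "\<not> vl l" for l z
  proof -
    obtain a i j b where x: "l = ((a, i, j), b)" by (metis prod.exhaust)
    then have lt: "sgl [l] 1 = lt (a, b) i j" by (simp add: lt_def)
    have "\<not> (ok (a, b) \<and> i < nn (a, b) \<and> j < nn (a, b))"
      using l vl_iff[of "(a, b)" i j] unfolding x fst_conv snd_conv by blast
    then have p: "pi (sgl [l] 1) = pi 0" and e: "ee (sgl [l] 1) = 0"
      unfolding lt by (rule pi_lt_invalid, rule ee_lt_invalid)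
    have "act (sgl [l] 1) (fst z) = 0"
      using act_cong[OF p, of "fst z"] act_fconst[of 0 "fst z"] by simp
    moreover have "ew (sgl [l] 1) = 0" using L_cong[OF p] by (simp add: ew_def t_zero bcl_zero[OF PG_bcl])
    ultimately show ?thesis by (simp add: wop_def e zero_prod_def)
  qed
  have u: "ev_op wsc wop x z = (if i = j then z else 0)" if "pi x = pi (if i = j then 1 else 0)" "cc x = 0" for x z and i j :: nat
  proof -
    have "act x (fst z) = (if i = j then fst z else 0)" "ee x = (if i = j then 1 else 0)"
      using act_cong[OF that(1), of "fst z"] act_fconst[of 0 "fst z"] act_fconst[of 1 "fst z"] ee_cong[OF that(1)] by simp_all
    then show ?thesis by (simp add: ev_wop that(2) prod_eq_iff)
  qed
  \<comment> \<open>For self-conjugate factors nothing beyond linearity is required: on the span of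
    the entries the off-diagonal value depends on the vector alone.\<close>
  have ao: "ev_op wsc wop x z = ev_op wsc wop y z" if "pi x = pi y" "x \<in> P.span LT" "y \<in> P.span LT" for x y z
    using act_cong[OF that(1)] ee_cong[OF that(1)] L_cong[OF that(1)] by (simp add: ev_wop cc_span that(2,3) ew_def)
  have "ev_op wsc wop p (0, 1) = ev_op wsc wop q (0, 1)"
  proof (rule lift[OF wops inv _ _ _ _ assms])
    fix \<gamma> i j z assume g: "ok \<gamma>" "i < nn \<gamma>" "j < nn \<gamma>"
    show "ev_op wsc wop (\<Sum>k<nn \<gamma>. lt \<gamma> i k * st (lt \<gamma> j k)) z = (if i = j then z else 0)"
      by (rule u[OF unitary1[OF g] cc_unitary1[OF g]])
    show "ev_op wsc wop (\<Sum>k<nn \<gamma>. st (lt \<gamma> k i) * lt \<gamma> k j) z = (if i = j then z else 0)"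
      by (rule u[OF unitary2[OF g] cc_unitary2[OF g]])
  next
    fix p Q i j z assume p: "p < length Fs" "Fs ! p = Ao Q" "i < dim_row Q" "j < dim_row Q"
    have e: "pi (lt (p, False) i j) = pi (lt (p, True) i j)" by (rule Ao_self_conj[OF p])
    have g: "ok (p, b)" "i < nn (p, b)" "j < nn (p, b)" for b using p by (simp_all add: ok_def nn_def)
    show "ev_op wsc wop (lt (p, False) i j) z = ev_op wsc wop (lt (p, True) i j) z"
      by (rule ao[OF e lt_span[OF g] lt_span[OF g]])
    show "ev_op wsc wop (st (lt (p, False) i j)) z = ev_op wsc wop (st (lt (p, True) i j)) z"
      by (rule ao[OF pi_st_cong[OF e] st_lt_span[OF g] st_lt_span[OF g]])
  qed
  then show ?thesis by (simp add: cc_def)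
qed

section \<open>Range and target of the cocycle, and uniqueness\<close>

definition core :: "'t set" where "core = PG ` cspan KB"

lemma core_eq: "geom_edge_core Fs \<delta> R \<Lambda> t = core"
  by (simp add: geom_edge_core_def core_def alg_edge_space_eq PG_def KG_def)

lemma core_csub: "csub core"
  unfolding core_def bcl_cspan[OF PG_bcl] by (rule cspan_csub)

lemma letter_cases:
  obtains (valid) "sgl [l] 1 \<in> P.span LT" | (invalid) "pi (sgl [l] 1) = pi 0" "ee (sgl [l] 1) = 0"
proof -
  obtain a i j b where x: "l = ((a, i, j), b)" by (metis prod.exhaust)
  then have lt: "sgl [l] 1 = lt (a, b) i j" by (simp add: lt_def)
  show thesis
  proof (cases "ok (a, b) \<and> i < nn (a, b) \<and> j < nn (a, b)")
    case True
    then show ?thesis using valid lt_span lt by simp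
  next
    case False
    then show ?thesis using invalid pi_lt_invalid ee_lt_invalid lt by simp
  qed
qed

lemma cc_core: "cc p \<in> core"
proof (induction p rule: free_alg_induct')
  case (const c)
  show ?case by (simp add: cc_fconst csub_0[OF core_csub])
next
  case (letter l)
  show ?case
  proof (cases l rule: letter_cases)
    case valid
    then have "t (L 1) (L (sgl [l] 1)) \<in> cspan KB" by (intro t_DV) (simp add: DV_eq)
    then show ?thesis
      unfolding cc_letter ew_def by (intro csub_scaleC[OF core_csub]) (simp add: core_def)
  next
    case invalid
    then show ?thesis using cc_cong[OF invalid(1)] by (simp add: cc_zero csub_0[OF core_csub])
  qed
next
  case (mult p q)
  then obtain z where z: "z \<in> cspan KB" "cc q = PG z" by (auto simp: core_def)
  have "act p (cc q) = PG (act p z)" unfolding z(2) by (rule act_PG[OF subsetD[OF KB_KK z(1)]])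
  then have "act p (cc q) \<in> core" using act_KK(1)[OF z(1)] by (auto simp: core_def)
  then show ?case unfolding cc_mult by (intro csub_add[OF core_csub] csub_scaleC[OF core_csub] mult)
qed (simp add: cc_add csub_add[OF core_csub])

lemma E2_act: assumes "z \<in> KK" shows "E2 (act p z) = lam p (E2 z)"
proof (rule KK_eqI[OF bcl_comp[OF E2_bcl act(1)] bcl_comp[OF lam(1) E2_bcl] _ assms])
  fix q \<gamma> i j assume g: "ok \<gamma>" "i < nn \<gamma>" "j < nn \<gamma>"
  show "E2 (act p (t (L q) (L (lt \<gamma> i j)))) = lam p (E2 (t (L q) (L (lt \<gamma> i j))))"
    by (simp add: act(2) lam(2) E2_span[OF lt_span[OF g]] mult.assoc)
qed

lemma core_KK: "core \<subseteq> KK"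
  using PG_in by (auto simp: core_def KG_iff)

text \<open>Since \<open>E2\<close> intertwines the actions, both sides obey the same product rule;
  on letters the equality is \<open>E2_PG\<close>.\<close>

lemma E2_cc: "E2 (cc p) = L p - ee p *\<^sub>C L 1"
proof (induction p rule: free_alg_induct')
  case (const c)
  show ?case using L_smult[of c 1] by (simp add: cc_fconst bcl_zero[OF E2_bcl])
next
  case (letter l)
  show ?case
  proof (cases l rule: letter_cases)
    case valid
    have "E2 (cc (sgl [l] 1)) = E2 (t (L 1) (L (sgl [l] 1))) - E1 (t (L 1) (L (sgl [l] 1)))"
      unfolding cc_letter ew_def bcl_scaleC[OF E2_bcl] by (rule E2_PG[OF span_KK[OF valid]])
    then show ?thesis by (simp add: E2_span[OF valid] E1(2)[OF valid])
  next
    case invalid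
    then show ?thesis using cc_cong[OF invalid(1)] L_cong[OF invalid(1)] by (simp add: cc_zero bcl_zero[OF E2_bcl])
  qed
next
  case (add p q)
  then show ?case by (simp add: cc_add bcl_add[OF E2_bcl] L_add ee_add scaleC_add_left)
next
  case (mult p q)
  have "E2 (act p (cc q)) = lam p (E2 (cc q))" using cc_core core_KK by (intro E2_act) blast
  then show ?case using mult
    by (simp add: cc_mult bcl_add[OF E2_bcl] bcl_scaleC[OF E2_bcl] bcl_diff[OF lam(1)] bcl_scaleC[OF lam(1)] lam(2)
        scaleC_diff_right scaleC_scaleC ee_mult mult.commute)
qed

text \<open>The cocycle recovers a geometric edge from its target.\<close>

lemma edge_path: assumes "z \<in> cspan KB" shows "\<exists>r. cc r = 2 *\<^sub>C PG z \<and> L r = 2 *\<^sub>C E2 (PG z)"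
  using assms
proof (induction rule: cspan_induct)
  case zero
  show ?case by (intro exI[of _ 0]) (simp add: cc_zero bcl_zero[OF PG_bcl] bcl_zero[OF E2_bcl])
next
  case (add x y)
  then obtain r s where "cc r = 2 *\<^sub>C PG x" "L r = 2 *\<^sub>C E2 (PG x)" "cc s = 2 *\<^sub>C PG y" "L s = 2 *\<^sub>C E2 (PG y)" by blast
  then show ?case
    by (intro exI[of _ "r + s"]) (simp add: cc_add L_add bcl_add[OF PG_bcl] bcl_add[OF E2_bcl] scaleC_add_right)
next
  case (scale c x)
  then obtain r where "cc r = 2 *\<^sub>C PG x" "L r = 2 *\<^sub>C E2 (PG x)" by blast
  then show ?case
    by (intro exI[of _ "fconst c * r"])
      (simp add: cc_smult L_smult bcl_scaleC[OF PG_bcl] bcl_scaleC[OF E2_bcl] scaleC_scaleC mult.commute)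
next
  case (base x)
  then obtain p q where x: "x = t (L p) (L q)" and q: "q \<in> P.span LT"
    using P.span_base by (auto simp: KB_def)
  let ?r = "p * (q + fconst (- ee q))"
  have "cc ?r = 2 *\<^sub>C PG x"
    by (simp add: cc_mult cc_add cc_fconst ee_add x cc_span[OF q] act_ew[OF q])
  moreover have "L ?r = 2 *\<^sub>C E2 (PG x)"
  proof -
    have "L (p * fconst (- ee q)) = - ee q *\<^sub>C L p"
      using L_smult[of "- ee q" p] fconst_commute[of p "- ee q"] by simp
    then have "L ?r = L (p * q) - ee q *\<^sub>C L p" by (simp add: distrib_left L_add scaleC_minus_left)
    then show ?thesis unfolding x E2_PG[OF span_KK[OF q]] by (simp add: E2_span[OF q] E1(2)[OF q])
  qed
  ultimately show ?case by blast
qed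

lemma E2_inj: assumes "x \<in> core" "E2 x = 0" shows "x = 0"
proof -
  obtain z where z: "z \<in> cspan KB" "x = PG z" using assms by (auto simp: core_def)
  obtain r where r: "cc r = 2 *\<^sub>C PG z" "L r = 2 *\<^sub>C E2 (PG z)" using edge_path[OF z(1)] by blast
  have "L r = L 0" using r(2) assms(2) z(2) by simp
  then have "cc r = cc 0" unfolding L_eq_iff by (rule cc_cong)
  then have "2 *\<^sub>C x = 0" using r(1) z(2) by (simp add: cc_zero)
  then show ?thesis by (simp add: scaleC_eq_0)
qed

theorem path_cocycle_ex1: "\<exists>!c. path_cocycle Fs \<delta> \<epsilon> R \<Lambda> t c"
proof (rule ex1I)
  define c where "c = restrict (\<lambda>x. cc (SOME p. pi p = x)) (carrier S)"
  have c: "c (pi p) = cc p" for p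
  proof -
    have "pi (SOME q. pi q = pi p) = pi p" by (rule someI[of "\<lambda>q. pi q = pi p"]) (rule refl)
    from cc_cong[OF this] show ?thesis by (simp add: c_def)
  qed
  show "path_cocycle Fs \<delta> \<epsilon> R \<Lambda> t c"
    unfolding path_cocycle_def Let_def core_eq target_op_eq linear_to_hilbert_def
  proof (intro conjI ballI allI)
    have "c x \<in> core" if "x \<in> carrier S" for x
    proof -
      obtain p where "x = pi p" using \<open>x \<in> carrier S\<close> by (rule pi_surj)
      then show ?thesis by (simp add: c cc_core)
    qed
    then show "c \<in> carrier S \<rightarrow>\<^sub>E core" by (auto simp: c_def)
  next
    fix x y assume "x \<in> carrier S" "y \<in> carrier S"
    obtain p where p: "x = pi p" using \<open>x \<in> carrier S\<close> by (rule pi_surj)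
    obtain q where q: "y = pi q" using \<open>y \<in> carrier S\<close> by (rule pi_surj)
    show "c (x \<oplus>\<^bsub>S\<^esub> y) = c x + c y"
      by (simp only: p q pi_add[symmetric] c cc_add)
    show "c (x \<otimes>\<^bsub>S\<^esub> y) = edge_action Fs \<Lambda> t x (c y) + \<epsilon> y *\<^sub>C c x"
      by (simp only: p q pi_mult[symmetric] c cc_mult act_def eps_pi)
  next
    fix x d assume "x \<in> carrier S"
    obtain p where p: "x = pi p" using \<open>x \<in> carrier S\<close> by (rule pi_surj)
    show "c (d \<odot>\<^bsub>S\<^esub> x) = d *\<^sub>C c x"
      by (simp only: p pi_smult[symmetric] c cc_smult)
  next
    fix x assume "x \<in> carrier S"
    obtain p where p: "x = pi p" using \<open>x \<in> carrier S\<close> by (rule pi_surj)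
    show "E2 (c x) = \<Lambda> x - \<epsilon> x *\<^sub>C \<Lambda> \<one>\<^bsub>S\<^esub>"
      using E2_cc[of p] by (simp only: p c L_def eps_pi pi_one)
  qed
  fix c' assume "path_cocycle Fs \<delta> \<epsilon> R \<Lambda> t c'"
  then have c': "c' \<in> carrier S \<rightarrow>\<^sub>E core" "\<And>x. x \<in> carrier S \<Longrightarrow> E2 (c' x) = \<Lambda> x - \<epsilon> x *\<^sub>C \<Lambda> \<one>\<^bsub>S\<^esub>"
    unfolding path_cocycle_def Let_def core_eq target_op_eq by blast+
  show "c' = c"
  proof (rule extensionalityI[of _ "carrier S"])
    show "c' \<in> extensional (carrier S)" using c'(1) by (simp add: PiE_def)
    show "c \<in> extensional (carrier S)" by (simp add: c_def)
    fix x assume x: "x \<in> carrier S"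
    obtain p where p: "x = pi p" using x by (rule pi_surj)
    have "c' x - c x \<in> core"
      using c'(1) x cc_core by (intro csub_diff[OF core_csub]) (auto simp: p c)
    moreover have "E2 (c' x - c x) = 0"
      using c'(2)[OF x] E2_cc[of p] by (simp add: bcl_diff[OF E2_bcl] p c L_def eps_pi pi_one)
    ultimately have "c' x - c x = 0" by (rule E2_inj)
    then show "c' x = c x" by simp
  qed
qed

end

theorem corollary4p2:
  fixes Fs :: "factor list"
    and \<delta> :: "fp_elem comult"
    and \<epsilon> :: "fp_elem \<Rightarrow> complex"
    and \<kappa> R :: "fp_elem \<Rightarrow> fp_elem"
    and h :: "fp_elem \<Rightarrow> complex"
    and \<Lambda> :: "fp_elem \<Rightarrow> 'h::complex_hilbert_space"
    and t :: "'h \<Rightarrow> 'h \<Rightarrow> 't::complex_hilbert_space"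
  assumes "Fs \<noteq> []" and "\<forall>F\<in>set Fs. valid_factor F"
    and "fp_coproduct Fs \<delta>"
    and "counit (fp_alg Fs) \<delta> \<epsilon>"
    and "antipode (fp_alg Fs) \<delta> \<epsilon> \<kappa>"
    and "haar_state (fp_alg Fs) \<delta> h"
    and "unitary_antipode (fp_alg Fs) \<kappa> h R"
    and "gns_map (fp_alg Fs) h \<Lambda>"
    and "hilbert_tensor t"
    and "\<forall>\<gamma>\<in>directions Fs. qdim Fs \<kappa> \<gamma> \<noteq> 2"
  shows "\<exists>!c. path_cocycle Fs \<delta> \<epsilon> R \<Lambda> t c"
proof -
  interpret fp_tensor Fs \<delta> \<epsilon> \<kappa> h \<Lambda> R t
    by unfold_locales (use assms in auto)
  show ?thesis by (rule path_cocycle_ex1)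
qed

end
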